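(* Let $\mathfrak{e}(t)$, $0\le t\le1$, be the normalized Brownian excursion. Let $\psi:[0,1]\to\mathbb{R}$ be positive and twice continuously differentiable on $[0,1]$, and let $\vartheta=\int_0^1\sqrt{\psi(t)}\,dt$. Then, as $\varepsilon\to0+$, $$ \mathsf{P}\{\|\mathfrak{e}\|_\psi\leq\varepsilon\}\sim \frac{2\sqrt{6\vartheta}\,\psi^{3/8}(0)\,\psi^{3/8}(1)}{\sqrt\pi}\, \varepsilon^{-2} \exp\left(-\frac{9\vartheta^2}{8}\varepsilon^{-2}\right). $$
   Context: For a process $X(t)$, $0\le t\le 1$, and a non-negative weight $\psi$ on $[0,1]$, $\|X\|_\psi=\left(\int_0^1X^2(t)\psi(t)\,dt\right)^{1/2}$. The normalized Brownian excursion $\mathfrak{e}$ is, informally, the Brownian bridge on $[0,1]$ from $0$ to $0$ conditioned to be positive on $(0,1)$; rigorously, if $W$ is a standard Brownian motion, $g=\sup\{t\le1:W(t)=0\}$ and $d=\inf\{t\ge 1:W(t)=0\}$, then $\mathfrak{e}(t)=|W(g+t(d-g))|/\sqrt{d-g}$, $0\le t\le 1$. The notation $f(\varepsilon)\sim g(\varepsilon)$ means $f(\varepsilon)/g(\varepsilon)\to1$. $\psi^{a}(t)$ means $(\psi(t))^{a}$. *)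

theory Defs
  imports "HOL-Probability.Probability" "HOL-Library.Landau_Symbols"
begin

(* Paths are only required to be continuous and to start at 0 almost surely; the process is indexed
   by all reals for typing reasons, and its values at negative times are irrelevant. *)
locale standard_brownian_motion = prob_space M
  for M :: "'a measure" and W :: "real \<Rightarrow> 'a \<Rightarrow> real" +
  assumes rv: "\<And>t. 0 \<le> t \<Longrightarrow> random_variable borel (W t)"
    and start_zero: "AE \<omega> in M. W 0 \<omega> = 0"
    and indep_increments: "\<And>(n::nat) (t::nat \<Rightarrow> real).
      0 \<le> t 0 \<Longrightarrow> (\<And>i. i < n \<Longrightarrow> t i < t (Suc i)) \<Longrightarrow>
      indep_vars (\<lambda>_. borel) (\<lambda>i \<omega>. W (t (Suc i)) \<omega> - W (t i) \<omega>) {..<n}"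
    and normal_increments: "\<And>s t. 0 \<le> s \<Longrightarrow> s < t \<Longrightarrow>
      distributed M lborel (\<lambda>\<omega>. W t \<omega> - W s \<omega>) (normal_density 0 (sqrt (t - s)))"
    and continuous_paths: "AE \<omega> in M. continuous_on {0..} (\<lambda>t. W t \<omega>)"

definition last_zero_before_1 :: "(real \<Rightarrow> real) \<Rightarrow> real" where
  "last_zero_before_1 w = Sup {t. 0 \<le> t \<and> t \<le> 1 \<and> w t = 0}"

definition first_zero_after_1 :: "(real \<Rightarrow> real) \<Rightarrow> real" where
  "first_zero_after_1 w = Inf {t. 1 \<le> t \<and> w t = 0}"

(* Meaningful for almost every Brownian path: there both sets of zeros above are nonempty and
   g < 1 < d.  On the exceptional null set the value is arbitrary. *)
definition normalized_excursion :: "(real \<Rightarrow> 'a \<Rightarrow> real) \<Rightarrow> real \<Rightarrow> 'a \<Rightarrow> real" where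
  "normalized_excursion W t \<omega> =
    (let g = last_zero_before_1 (\<lambda>s. W s \<omega>);
         d = first_zero_after_1 (\<lambda>s. W s \<omega>)
     in \<bar>W (g + t * (d - g)) \<omega>\<bar> / sqrt (d - g))"

definition weighted_norm :: "(real \<Rightarrow> real) \<Rightarrow> (real \<Rightarrow> real) \<Rightarrow> real" where
  "weighted_norm \<psi> x = sqrt (LINT t:{0..1}|lborel. (x t)\<^sup>2 * \<psi> t)"

(* Derivatives at the end points of S are one-sided. *)
definition twice_continuously_differentiable_on :: "(real \<Rightarrow> real) \<Rightarrow> real set \<Rightarrow> bool" where
  "twice_continuously_differentiable_on f S \<longleftrightarrow>
    (\<exists>f' f''. (\<forall>t\<in>S. (f has_real_derivative f' t) (at t within S)) \<and>
             (\<forall>t\<in>S. (f' has_real_derivative f'' t) (at t within S)) \<and>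
             continuous_on S f'')"

end

theory Submission
  imports Defs "HOL-Complex_Analysis.Complex_Analysis" "HOL-Real_Asymp.Real_Asymp"
begin

text \<open>Let \<open>Z\<close> be the squared weighted norm of the excursion. Its Laplace transform at \<open>s > 0\<close> is \<open>u 1 powr (-3/2)\<close>,
  where \<open>u'' = 2 * s * \<psi> * u\<close>, \<open>u 0 = 0\<close> and \<open>u' 0 = 1\<close>. To see this, fix dyadic cells for the last zero before 1
  and the first zero after 1, and let \<open>p < q\<close> be the inner endpoints of these cells. On functionals that are even
  in the path, the reflection principle replaces the indicator of having no zero in an interval by the product
  of the signs of the path at its ends. The expectation then becomes a chain of Gaussian integrals against odd
  functions, and if the weights of the chain are read off from \<open>u\<close> on a grid, it can be evaluated in closed form.
  Restricted to paths that are small at \<open>p\<close> and \<open>q\<close> (which is no restriction as the cells shrink), the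
  weighted chain is the unweighted one times a factor that tends to \<open>u 1 powr (-3/2)\<close>, the same for all cells.

  As a function of complex \<open>s\<close>, \<open>u 1\<close> is entire, so the identity extends to the right half-plane, where the
  Liouville-Green approximation gives \<open>u 1 \<sim> exp (\<theta> * sqrt (2 * s)) / (2 * sqrt (2 * s) * (\<psi> 0 * \<psi> 1) powr (1/4))\<close>
  as the real part of \<open>s\<close> grows. Fourier inversion along the vertical line through the saddle point turns this
  into the asymptotics of the distribution function of \<open>Z\<close> at 0.\<close>

section \<open>Laplace inversion and small deviations\<close>

text \<open>The last zero before 1 is not a stopping time, so the strong Markov property does not
  isolate the excursion. Cells make both ends of it deterministic, and because the limiting factor
  is common to all cells, the law of the excursion interval is never computed: the cell
  probabilities only have to add up to nearly 1. The power -3/2 is that of the three-dimensional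
  Bessel bridge, which has the law of the excursion; here it appears as follows. An odd function
  sees a Gaussian kernel with coupling \<open>1 / U\<close> only through
  \<open>sinh (x * y / U)\<close>, which near 0 contributes \<open>1 / U\<close> in addition to the
  normalization \<open>1 / sqrt U\<close>. Nothing is known about a density of \<open>Z\<close>, so
  the distribution function is inverted, whose transform is that of the law divided by
  \<open>s\<close>. With \<open>a = 3 * \<theta> / 2\<close> the exponent
  \<open>s * r - a * sqrt (2 * s)\<close> is stationary at \<open>s = a^2 / (2 * r^2)\<close> with
  value \<open>- a^2 / (2 * r) = - 9 * \<theta>^2 / (8 * r)\<close>, to be read at
  \<open>r = \<epsilon>^2\<close>.\<close>

lemma
  fixes z :: complex and y :: real
  assumes z: "Re z > 0"
  shows integrable_exp_atLeast: "integrable lborel (\<lambda>x. indicator {y..} x *\<^sub>R exp (- z * of_real x))" (is ?A)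
    and integral_exp_atLeast:
      "(LINT x|lborel. indicator {y..} x *\<^sub>R exp (- z * of_real x)) = exp (- z * of_real y) / z" (is ?B)
proof -
  let ?s = "Re z"
  let ?r = "\<lambda>x. indicator {y..} x *\<^sub>R exp (- ?s * x)"
  have nn: "(\<integral>\<^sup>+x. ennreal (exp (- ?s * x)) * indicator {y ..} x \<partial>lborel) = 0 - (- exp (- ?s * y) / ?s)"
  proof (rule nn_integral_FTC_atLeast)
    show "DERIV (\<lambda>x. - exp (- ?s * x) / ?s) x :> exp (- ?s * x)" for x
      using z by (auto intro!: derivative_eq_intros simp: field_simps)
    show "((\<lambda>x. - exp (- ?s * x) / ?s) \<longlongrightarrow> 0) at_top"
      using z by real_asymp
  qed auto
  have ir: "integrable lborel ?r"
  proof (rule integrableI_nonneg)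
    have "(\<integral>\<^sup>+x. ennreal (?r x) \<partial>lborel) = (\<integral>\<^sup>+x. ennreal (exp (- ?s * x)) * indicator {y ..} x \<partial>lborel)"
      by (intro nn_integral_cong) (auto simp: indicator_def)
    then show "(\<integral>\<^sup>+x. ennreal (?r x) \<partial>lborel) < \<infinity>"
      unfolding nn by simp
  qed auto
  show ?A
    by (rule Bochner_Integration.integrable_bound[OF ir]) (auto simp: indicator_def)
  have lim: "(\<lambda>n. LINT x|lborel. indicator {y..y + real n} x *\<^sub>R exp (- z * of_real x)) \<longlonglongrightarrow>
      (LINT x|lborel. indicator {y..} x *\<^sub>R exp (- z * of_real x))"
  proof (rule integral_dominated_convergence[OF _ _ ir])
    show "AE x in lborel. (\<lambda>n. indicat_real {y..y + real n} x *\<^sub>R exp (- z * complex_of_real x))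
        \<longlonglongrightarrow> indicat_real {y..} x *\<^sub>R exp (- z * complex_of_real x)"
    proof (intro AE_I2)
      fix x
      have "eventually (\<lambda>n. x \<le> y + real n) sequentially"
        by real_asymp
      then have "eventually (\<lambda>n. indicat_real {y..y + real n} x *\<^sub>R exp (- z * complex_of_real x) =
         indicat_real {y..} x *\<^sub>R exp (- z * complex_of_real x)) sequentially"
        by eventually_elim (auto simp: indicator_def)
      then show "(\<lambda>n. indicat_real {y..y + real n} x *\<^sub>R exp (- z * complex_of_real x))
        \<longlonglongrightarrow> indicat_real {y..} x *\<^sub>R exp (- z * complex_of_real x)"
        by (rule tendsto_eventually)
    qed
  qed (auto simp: indicator_def)
  have fin: "(LINT x|lborel. indicator {y..y + real n} x *\<^sub>R exp (- z * of_real x)) =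
     - exp (- z * of_real (y + real n)) / z - (- exp (- z * of_real y) / z)" for n
  proof (rule integral_FTC_atLeastAtMost)
    have "((\<lambda>w. - exp (- z * w) / z) has_field_derivative exp (- z * of_real x)) (at (of_real x) within S)" for x :: real and S
      using z by (auto intro!: derivative_eq_intros simp: field_simps)
    from has_vector_derivative_real_field[OF this[of _ UNIV]]
    show "((\<lambda>x. - exp (- z * of_real x) / z) has_vector_derivative exp (- z * of_real x)) (at x within {y..y + real n})" for x
      by (simp add: o_def has_vector_derivative_at_within)
  qed (auto intro!: continuous_intros)
  have "(\<lambda>n. - exp (- z * of_real (y + real n)) / z) \<longlonglongrightarrow> 0"
  proof (rule tendsto_norm_zero_cancel)
    have "(\<lambda>n. exp (- ?s * (y + real n)) / norm z) \<longlonglongrightarrow> 0"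
    proof -
      have "(\<lambda>n. exp (- ?s * (y + real n))) \<longlonglongrightarrow> 0"
        using z by real_asymp
      then show ?thesis by (rule tendsto_divide_zero)
    qed
    then show "(\<lambda>n. norm (- exp (- z * of_real (y + real n)) / z)) \<longlonglongrightarrow> 0"
      by (simp add: norm_divide)
  qed
  then have "(\<lambda>n. - exp (- z * of_real (y + real n)) / z - (- exp (- z * of_real y) / z)) \<longlonglongrightarrow> 0 - (- exp (- z * of_real y) / z)"
    by (intro tendsto_intros) auto
  then show ?B
    using LIMSEQ_unique[OF lim[unfolded fin]] by simp
qed

text \<open>Levy inversion gives the mass of \<open>{r<..b}\<close>. Dividing by
  \<open>b - r\<close> and letting \<open>b\<close> decrease to \<open>r\<close> turns the mass into
  \<open>h r\<close> and the kernel into \<open>iexp (- (t * r))\<close>, with the integrable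
  characteristic function as dominating function. Continuity from the right is the natural
  condition, because the density to be inserted is a damped distribution function.\<close>

lemma density_eq_inverse_Fourier_integral:
  fixes h :: "real \<Rightarrow> real"
  assumes h[measurable]: "h \<in> borel_measurable borel" and h0: "\<And>x. 0 \<le> h x"
    and prob: "prob_space (density lborel h)"
    and ch[measurable]: "integrable lborel (char (density lborel h))"
    and cont: "continuous (at_right r) h"
  shows "of_real (h r) = 1 / (2 * pi) * (CLINT t|lborel. iexp (- (t * r)) * char (density lborel h) t)"
proof -
  define \<nu> where "\<nu> = density lborel h"
  define \<phi> where "\<phi> = char \<nu>"
  interpret real_distribution \<nu>
    using prob unfolding \<nu>_def real_distribution_def real_distribution_axioms_def by auto
  have phi: "integrable lborel \<phi>" using ch by (simp add: \<phi>_def \<nu>_def)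
  then have [measurable]: "\<phi> \<in> borel_measurable borel" by auto
  have hi: "integrable lborel h"
  proof (rule integrableI_nonneg)
    show "(\<integral>\<^sup>+ x. ennreal (h x) \<partial>lborel) < \<infinity>"
      using emeasure_space_1 by (auto simp: \<nu>_def emeasure_density)
  qed (auto simp: h0)
  have meas: "measure \<nu> A = (LINT x|lborel. indicator A x * h x)" if "A \<in> sets borel" for A
  proof -
    have "emeasure \<nu> A = (\<integral>\<^sup>+x. ennreal (indicator A x * h x) \<partial>lborel)"
      using that unfolding \<nu>_def by (subst emeasure_density) (auto intro!: nn_integral_cong simp: indicator_def)
    also have "\<dots> = ennreal (LINT x|lborel. indicator A x * h x)"
      using that hi h0 by (intro nn_integral_eq_integral integrable_real_mult_indicator)
         (auto simp: mult.commute integrable_real_mult_indicator)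
    finally show ?thesis
      by (auto simp: measure_def h0 intro!: enn2real_ennreal Bochner_Integration.integral_nonneg)
  qed
  \<comment> \<open>\<open>Levy_Inversion\<close> asks for end points without mass.\<close>
  have pt: "measure \<nu> {x} = 0" for x
  proof -
    have "AE y in lborel. indicator {x} y * h y = 0"
      using AE_lborel_singleton[of x] by eventually_elim auto
    then show ?thesis
      by (subst meas) (auto intro!: integral_eq_zero_AE)
  qed
  let ?F = "\<lambda>b t. (iexp (-(t * r)) - iexp (-(t * b))) / (\<i> * t)"
  have F_le: "norm (?F b t) \<le> b - r" if "r \<le> b" for b t
  proof (cases "t = 0")
    case False
    then show ?thesis using Levy_Inversion_aux2[of "-b" "-r" t] that
      by simp
  qed (use that in auto)
  have inv: "1 / (2 * pi) * (CLINT t|lborel. ?F b t * \<phi> t) = measure \<nu> {r<..b}" if rb: "r \<le> b" for b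
  proof -
    \<comment> \<open>\<open>Levy_Inversion\<close> only yields a limit over symmetric intervals; as
      \<open>\<phi>\<close> is integrable and the kernel is bounded by \<open>b - r\<close>, that
      limit is the full integral.\<close>
    have *: "(\<lambda>T. (CLBINT t=-real T..real T. ?F b t * \<phi> t)) \<longlonglongrightarrow> (CLINT t|lborel. ?F b t * \<phi> t)"
    proof -
      have "(CLBINT t=-real T..real T. ?F b t * \<phi> t) = (CLINT t|lborel. indicator {-real T<..<real T} t *\<^sub>R (?F b t * \<phi> t))" for T :: nat
        by (simp add: interval_lebesgue_integral_def set_lebesgue_integral_def)
      moreover have "(\<lambda>T. (CLINT t|lborel. indicator {-real T<..<real T} t *\<^sub>R (?F b t * \<phi> t))) \<longlonglongrightarrow> (CLINT t|lborel. ?F b t * \<phi> t)"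
      proof (rule integral_dominated_convergence)
        show "integrable lborel (\<lambda>t. (b - r) * norm (\<phi> t))"
          using phi by auto
        show "AE x in lborel. norm (indicat_real {- real i<..<real i} x *\<^sub>R (?F b x * \<phi> x)) \<le> (b - r) * cmod (\<phi> x)" for i
          using F_le[OF rb] rb by (intro AE_I2)
            (auto simp: norm_mult indicator_def simp del: times_divide_eq_left intro!: mult_right_mono)
        show "AE x in lborel. (\<lambda>i. indicat_real {- real i<..<real i} x *\<^sub>R (?F b x * \<phi> x)) \<longlonglongrightarrow> ?F b x * \<phi> x"
        proof (intro AE_I2)
          fix x :: real
          have "eventually (\<lambda>n. \<bar>x\<bar> < real n) sequentially" by real_asymp
          then have "eventually (\<lambda>i. indicat_real {- real i<..<real i} x *\<^sub>R (?F b x * \<phi> x) = ?F b x * \<phi> x) sequentially"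
            by eventually_elim (auto simp: indicator_def abs_less_iff)
          then show "(\<lambda>i. indicat_real {- real i<..<real i} x *\<^sub>R (?F b x * \<phi> x)) \<longlonglongrightarrow> ?F b x * \<phi> x"
            by (rule tendsto_eventually)
        qed
      qed (simp_all add: \<nu>_def)
      ultimately show ?thesis by simp
    qed
    have "(\<lambda>T. 1 / (2 * pi) * (CLBINT t=-real T..real T. ?F b t * \<phi> t)) \<longlonglongrightarrow> measure \<nu> {r<..b}"
      using Levy_Inversion[OF rb pt pt] unfolding \<phi>_def by simp
    moreover have "(\<lambda>T. 1 / (2 * pi) * (CLBINT t=-real T..real T. ?F b t * \<phi> t)) \<longlonglongrightarrow> 1 / (2 * pi) * (CLINT t|lborel. ?F b t * \<phi> t)"
      by (intro tendsto_mult_left *)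
    ultimately show ?thesis by (rule LIMSEQ_unique[symmetric])
  qed
  define b where "b n = r + 1 / real (Suc n)" for n
  have b: "r < b n" for n by (auto simp: b_def)
  have blim: "b \<longlonglongrightarrow> r" unfolding b_def by real_asymp
  have L: "(\<lambda>n. measure \<nu> {r<..b n} / (b n - r)) \<longlonglongrightarrow> h r"
  proof (rule LIMSEQ_I)
    fix e :: real assume e: "0 < e"
    have "eventually (\<lambda>x. \<bar>h x - h r\<bar> < e / 2) (at_right r)"
      using cont e unfolding continuous_within tendsto_iff by (auto simp: dist_real_def dest: spec[of _ "e/2"])
    then obtain c where c: "c > r" "\<And>x. r < x \<Longrightarrow> x < c \<Longrightarrow> \<bar>h x - h r\<bar> < e / 2"
      unfolding eventually_at_right_field by auto
    have "eventually (\<lambda>n. b n < c) sequentially"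
      using blim c(1) by (rule order_tendstoD)
    then obtain N where N: "\<And>n. n \<ge> N \<Longrightarrow> b n < c"
      by (auto simp: eventually_sequentially)
    show "\<exists>no. \<forall>n\<ge>no. norm (measure \<nu> {r<..b n} / (b n - r) - h r) < e"
    proof (intro exI allI impI)
      fix n assume n: "n \<ge> N"
      have i1: "integrable lborel (\<lambda>x. indicator {r<..b n} x * h x)"
        using hi by (simp add: integrable_real_mult_indicator mult.commute)
      have i2: "integrable lborel (\<lambda>x. indicator {r<..b n} x * c)" for c :: real
      proof -
        have "integrable lborel (indicat_real {r<..b n})"
          by (rule integrable_real_indicator) (simp_all add: less_imp_le[OF b])
        then show ?thesis by (rule integrable_mult_left)
      qed
      have Lc: "(LINT x|lborel. indicator {r<..b n} x * c) = (b n - r) * c" for c :: real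
        using b[of n] by simp
      have hb: "h x \<le> h r + e / 2" "h r - e / 2 \<le> h x" if "r < x" "x \<le> b n" for x
        using c(2)[of x] that N[OF n] by linarith+
      have up: "measure \<nu> {r<..b n} \<le> (LINT x|lborel. indicator {r<..b n} x * (h r + e / 2))"
        unfolding meas[of "{r<..b n}", simplified]
        by (intro integral_mono i1 i2) (auto simp: indicator_def hb)
      have lo: "(LINT x|lborel. indicator {r<..b n} x * (h r - e / 2)) \<le> measure \<nu> {r<..b n}"
        unfolding meas[of "{r<..b n}", simplified]
        by (intro integral_mono i1 i2) (auto simp: indicator_def hb)
      have "\<bar>measure \<nu> {r<..b n} - (b n - r) * h r\<bar> \<le> (b n - r) * (e / 2)"
        using up[unfolded Lc, unfolded distrib_left] lo[unfolded Lc, unfolded right_diff_distrib] unfolding abs_le_iff right_diff_distrib by linarith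
      then have "\<bar>measure \<nu> {r<..b n} / (b n - r) - h r\<bar> \<le> e / 2"
      proof -
        have "\<bar>measure \<nu> {r<..b n} / (b n - r) - h r\<bar> = \<bar>measure \<nu> {r<..b n} - (b n - r) * h r\<bar> / (b n - r)"
          using b[of n] by (subst abs_div_pos) (auto simp: diff_divide_distrib)
        then show "\<bar>measure \<nu> {r<..b n} - (b n - r) * h r\<bar> \<le> (b n - r) * (e / 2) \<Longrightarrow> ?thesis"
          using b[of n] by (simp add: pos_divide_le_eq mult.commute)
      qed
      then show "norm (measure \<nu> {r<..b n} / (b n - r) - h r) < e"
        using e by simp
    qed
  qed
  have R: "(\<lambda>n. CLINT t|lborel. ?F (b n) t / (b n - r) * \<phi> t) \<longlonglongrightarrow> (CLINT t|lborel. iexp (- (t * r)) * \<phi> t)"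
  proof (rule integral_dominated_convergence)
    show "integrable lborel (\<lambda>t. norm (\<phi> t))" using phi by simp
    show "AE x in lborel. norm (?F (b n) x / (b n - r) * \<phi> x) \<le> norm (\<phi> x)" for n
    proof (intro AE_I2)
      fix x
      have "norm (?F (b n) x / (b n - r)) \<le> 1"
      proof -
        have "norm (?F (b n) x / (b n - r)) = norm (?F (b n) x) / (b n - r)"
          using b[of n] by (subst norm_divide, subst norm_of_real) simp
        also have "\<dots> \<le> 1"
          using F_le[of "b n" x] b[of n] by (subst pos_divide_le_eq) auto
        finally show ?thesis .
      qed
      then show "norm (?F (b n) x / (b n - r) * \<phi> x) \<le> norm (\<phi> x)"
        by (metis mult_left_le_one_le norm_ge_zero norm_mult)
    qed
    \<comment> \<open>Divided by \<open>b n - r\<close>, the kernel is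
      \<open>-1 / (\<i> * t)\<close> times a difference quotient of \<open>?g\<close> at
      \<open>r\<close>; hence the exclusion of the null set \<open>t = 0\<close>.\<close>
    show "AE x in lborel. (\<lambda>n. ?F (b n) x / (b n - r) * \<phi> x) \<longlonglongrightarrow> iexp (- (x * r)) * \<phi> x"
      using AE_lborel_singleton[of 0]
    proof eventually_elim
      fix t :: real assume t: "t \<noteq> 0"
      let ?g = "\<lambda>w. exp (- (\<i> * of_real t * w))"
      have "(?g has_field_derivative - \<i> * t * ?g r) (at (of_real r))"
        by (auto intro!: derivative_eq_intros)
      then have *: "((\<lambda>w. (?g w - ?g r) / (w - r)) \<longlongrightarrow> - \<i> * t * ?g r) (at (of_real r))"
        by (simp add: has_field_derivative_iff)
      have "filterlim (\<lambda>n. complex_of_real (b n)) (at (of_real r)) sequentially"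
        using b blim by (auto simp: filterlim_at intro!: tendsto_of_real always_eventually)
      from filterlim_compose[OF * this]
      have "(\<lambda>n. (?g (b n) - ?g r) / (b n - r) * (-1 / (\<i> * t)) * \<phi> t) \<longlonglongrightarrow> - \<i> * t * ?g r * (-1 / (\<i> * t)) * \<phi> t"
        by (intro tendsto_intros) auto
      moreover have "(?g (b n) - ?g r) / (b n - r) * (-1 / (\<i> * t)) * \<phi> t = ?F (b n) t / (b n - r) * \<phi> t" for n
        using b[of n] t by (simp add: field_simps flip: of_real_diff)
      ultimately show "(\<lambda>n. ?F (b n) t / (b n - r) * \<phi> t) \<longlonglongrightarrow> iexp (- (t * r)) * \<phi> t"
        using t by (simp add: field_simps)
    qed
  qed (auto simp: \<nu>_def)
  have "(CLINT t|lborel. ?F (b n) t / (b n - r) * \<phi> t) = 2 * pi * complex_of_real (measure \<nu> {r<..b n} / (b n - r))" for n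
  proof -
    have "(CLINT t|lborel. ?F (b n) t / (b n - r) * \<phi> t) = (CLINT t|lborel. (1 / (b n - r)) * (?F (b n) t * \<phi> t))"
      by (intro Bochner_Integration.integral_cong) (auto simp: field_simps)
    also have "\<dots> = (1 / (b n - r)) * (CLINT t|lborel. ?F (b n) t * \<phi> t)"
      by (rule integral_mult_right_zero)
    also have "\<dots> = (1 / (b n - r)) * (2 * pi * measure \<nu> {r<..b n})"
    proof -
      have "w = 2 * pi * v" if "1 / (2 * pi) * w = v" for v w :: complex
        using that by auto
      from this[OF inv[OF less_imp_le[OF b]]] show ?thesis by (simp only: of_real_mult)
    qed
    finally show ?thesis by (simp add: field_simps)
  qed
  with R have "(\<lambda>n. 2 * pi * complex_of_real (measure \<nu> {r<..b n} / (b n - r))) \<longlonglongrightarrow> (CLINT t|lborel. iexp (- (t * r)) * \<phi> t)"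
    by simp
  moreover have "(\<lambda>n. 2 * pi * complex_of_real (measure \<nu> {r<..b n} / (b n - r))) \<longlonglongrightarrow> 2 * pi * complex_of_real (h r)"
    by (intro tendsto_intros L)
  ultimately have "(CLINT t|lborel. iexp (- (t * r)) * \<phi> t) = 2 * pi * complex_of_real (h r)"
    by (rule LIMSEQ_unique)
  then show ?thesis by (simp add: \<phi>_def \<nu>_def)
qed

lemma csqrt_of_real_mult: "0 \<le> p \<Longrightarrow> csqrt (of_real p * z) = of_real (sqrt p) * csqrt z"
proof (cases "z = 0")
  case False
  assume p: "0 \<le> p"
  have "csqrt ((of_real (sqrt p) * csqrt z)\<^sup>2) = of_real (sqrt p) * csqrt z" if "0 < p"
  proof (rule csqrt_square)
    show "0 < Re (of_real (sqrt p) * csqrt z) \<or> Re (of_real (sqrt p) * csqrt z) = 0 \<and> 0 \<le> Im (of_real (sqrt p) * csqrt z)"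
      using csqrt_principal[of z] that by auto
  qed
  then show ?thesis using p by (cases "p = 0") (auto simp: power_mult_distrib simp flip: of_real_power)
qed auto

definition laplace :: "real measure \<Rightarrow> complex \<Rightarrow> complex" where
  "laplace \<mu> z = (CLINT x|\<mu>. exp (- z * of_real x))"

context real_distribution
begin

lemma integrable_laplace:
  assumes "AE x in M. 0 \<le> x" "0 \<le> Re z"
  shows "integrable M (\<lambda>x. exp (- z * of_real x))"
  using assms(1) by (intro integrable_const_bound[of _ 1]) (auto simp: assms(2))

text \<open>\<open>exp (- z * y) / z\<close> is the integral of \<open>exp (- z * x)\<close> over
  \<open>x \<ge> y\<close>. Integrating it over \<open>y\<close> under \<open>M\<close> and
  exchanging the integrals collects the mass of \<open>y \<le> x\<close>, which is
  \<open>cdf M x\<close>.\<close>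

lemma
  assumes nn: "AE x in M. 0 \<le> x" and z: "Re z > 0"
  shows integrable_exp_cdf: "integrable lborel (\<lambda>x. exp (- z * of_real x) * of_real (cdf M x))"
    and integral_exp_cdf: "(CLINT x|lborel. exp (- z * of_real x) * of_real (cdf M x)) = laplace M z / z"
proof -
  interpret P: pair_sigma_finite M lborel ..
  let ?f = "\<lambda>y x. indicator {y..} x *\<^sub>R exp (- z * of_real x)"
  have f_eq: "(\<lambda>(y, x). ?f y x) = (\<lambda>p. if fst p \<le> snd p then exp (- z * of_real (snd p)) else 0)"
    by (auto simp: indicator_def fun_eq_iff)
  have f_meas: "(\<lambda>(y, x). ?f y x) \<in> borel_measurable (M \<Otimes>\<^sub>M lborel)"
    unfolding f_eq by measurable
  have int: "integrable (M \<Otimes>\<^sub>M lborel) (\<lambda>(y, x). ?f y x)"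
  proof (rule P.Fubini_integrable)
    have "(LINT x|lborel. norm (?f y x)) = exp (- Re z * y) / Re z" for y
    proof -
      have "complex_of_real (LINT x|lborel. norm (?f y x)) = (CLINT x|lborel. indicator {y..} x *\<^sub>R exp (- of_real (Re z) * of_real x))"
        unfolding integral_complex_of_real[symmetric]
        by (intro Bochner_Integration.integral_cong) (auto simp: indicator_def exp_of_real simp flip: of_real_mult of_real_minus)
      also have "\<dots> = exp (- of_real (Re z) * of_real y) / of_real (Re z)"
        using z by (intro integral_exp_atLeast) auto
      also have "\<dots> = of_real (exp (- Re z * y) / Re z)"
        by (simp flip: exp_of_real)
      finally show ?thesis unfolding of_real_eq_iff .
    qed
    moreover have "integrable M (\<lambda>y. exp (- Re z * y) / Re z)"
      using nn z by (intro integrable_const_bound[of _ "1 / Re z"]) (auto simp: divide_right_mono)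
    ultimately show "integrable M (\<lambda>y. LINT x|lborel. norm (case (y, x) of (y, x) \<Rightarrow> ?f y x))"
      by simp
    show "AE x in M. complex_integrable lborel (\<lambda>y. case (x, y) of (y, x) \<Rightarrow> ?f y x)"
      using integrable_exp_atLeast[OF z] by simp
  qed (rule f_meas)
  have inner: "(CLINT y|M. ?f y x) = exp (- z * of_real x) * of_real (cdf M x)" for x
  proof -
    have "(CLINT y|M. ?f y x) = (CLINT y|M. indicator {..x} y *\<^sub>R exp (- z * of_real x))"
      by (intro Bochner_Integration.integral_cong) (auto simp: indicator_def)
    also have "\<dots> = measure M {..x} *\<^sub>R exp (- z * of_real x)"
      by (subst integral_scaleR_left) (auto simp: less_top[symmetric])
    finally show ?thesis by (simp add: cdf_def scaleR_conv_of_real mult.commute)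
  qed
  from P.integrable_snd[OF int]
  show "integrable lborel (\<lambda>x. exp (- z * of_real x) * of_real (cdf M x))"
    unfolding inner .
  have "(CLINT x|lborel. CLINT y|M. ?f y x) = (CLINT y|M. CLINT x|lborel. ?f y x)"
    by (rule P.Fubini_integral[OF int])
  then show "(CLINT x|lborel. exp (- z * of_real x) * of_real (cdf M x)) = laplace M z / z"
    unfolding inner integral_exp_atLeast[OF z] laplace_def by simp
qed

lemma laplace_of_real: 
  "laplace M (of_real s) = of_real (LINT x|M. exp (- s * x))"
  unfolding laplace_def integral_complex_of_real[symmetric]
  by (intro Bochner_Integration.integral_cong) (auto simp flip: exp_of_real)

lemma laplace_real_pos:
  assumes nn: "AE x in M. 0 \<le> x" and "0 < s"
  shows "0 < (LINT x|M. exp (- s * x))"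
proof -
  have i: "integrable M (\<lambda>x. exp (- s * x))"
    using nn \<open>0 < s\<close> by (intro integrable_const_bound[of _ 1]) auto
  have "(LINT x|M. exp (- s * x)) \<noteq> 0"
    using integral_nonneg_eq_0_iff_AE[OF i] by auto
  moreover have "0 \<le> (LINT x|M. exp (- s * x))" by simp
  ultimately show ?thesis by linarith
qed

text \<open>A distribution function is not integrable, but \<open>exp (- s * x) * cdf M x\<close>
  is. Normalized by \<open>s / l\<close> it becomes a probability density whose characteristic
  function is, up to that factor, \<open>laplace M z / z\<close> on the vertical line
  \<open>Re z = s\<close>. Fourier inversion at \<open>r\<close> followed by removal of the damping
  gives the formula.\<close>

lemma cdf_eq_inverse_laplace:
  assumes nn: "AE x in M. 0 \<le> x" and s: "0 < s"
    and int: "integrable lborel (\<lambda>t. laplace M (of_real s - \<i> * of_real t) / (of_real s - \<i> * of_real t))"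
  shows "of_real (cdf M r) = exp (of_real (s * r)) / (2 * pi) *
    (CLINT t|lborel. iexp (- (t * r)) * (laplace M (of_real s - \<i> * of_real t) / (of_real s - \<i> * of_real t)))"
proof -
  define l where "l = (LINT x|M. exp (- s * x))"
  have l: "0 < l" unfolding l_def by (rule laplace_real_pos[OF nn s])
  have lap: "laplace M (of_real s) = of_real l" by (simp add: laplace_of_real l_def)
  define h where "h x = s / l * (exp (- s * x) * cdf M x)" for x
  have [measurable]: "cdf M \<in> borel_measurable borel"
    by (intro borel_measurable_mono) (auto simp: mono_def cdf_nondecreasing)
  have [measurable]: "h \<in> borel_measurable borel" unfolding h_def by measurable
  have h0: "0 \<le> h x" for x using s l by (auto simp: h_def cdf_nonneg)
  have hi: "integrable lborel (\<lambda>x. exp (- s * x) * cdf M x)"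
    using integrable_Re[OF integrable_exp_cdf[OF nn, of "of_real s"]] s
    by (simp add: exp_of_real flip: of_real_mult of_real_minus)
  have "complex_of_real (LINT x|lborel. exp (- s * x) * cdf M x) = laplace M (of_real s) / of_real s"
    using integral_exp_cdf[OF nn, of "of_real s"] s unfolding integral_complex_of_real[symmetric]
    by (simp flip: exp_of_real)
  then have "(LINT x|lborel. exp (- s * x) * cdf M x) = l / s"
    unfolding lap by (metis of_real_divide of_real_eq_iff)
  then have h1: "(LINT x|lborel. h x) = 1"
    using s l by (simp add: h_def)
  have hint: "integrable lborel h" unfolding h_def using hi by simp
  have prob: "prob_space (density lborel h)"
  proof
    have "emeasure (density lborel h) (space (density lborel h)) = (\<integral>\<^sup>+x. h x \<partial>lborel)"
      by (simp add: emeasure_density)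
    also have "\<dots> = ennreal (LINT x|lborel. h x)"
      by (intro nn_integral_eq_integral hint) (auto simp: h0)
    finally show "emeasure (density lborel h) (space (density lborel h)) = 1"
      using h1 by simp
  qed
  have ch: "char (density lborel h) t = of_real (s / l) * (laplace M (of_real s - \<i> * of_real t) / (of_real s - \<i> * of_real t))" for t
  proof -
    have "char (density lborel h) t = (CLINT x|lborel. h x *\<^sub>R iexp (t * x))"
      unfolding char_def by (rule integral_density) (auto simp: h0)
    also have "\<dots> = (CLINT x|lborel. of_real (s / l) * (exp (- (of_real s - \<i> * of_real t) * of_real x) * of_real (cdf M x)))"
    proof (intro Bochner_Integration.integral_cong refl)
      fix x
      have "exp (- (of_real s - \<i> * of_real t) * of_real x) = of_real (exp (- s * x)) * iexp (t * x)"
        by (simp add: algebra_simps flip: exp_of_real exp_add)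
      then show "h x *\<^sub>R iexp (t * x) = of_real (s / l) * (exp (- (of_real s - \<i> * of_real t) * of_real x) * of_real (cdf M x))"
        by (simp add: h_def scaleR_conv_of_real)
    qed
    also have "\<dots> = of_real (s / l) * (laplace M (of_real s - \<i> * of_real t) / (of_real s - \<i> * of_real t))"
      using s by (subst integral_mult_right_zero, subst integral_exp_cdf[OF nn]) auto
    finally show ?thesis .
  qed
  have "complex_of_real (h r) = 1 / (2 * pi) * (CLINT t|lborel. iexp (- (t * r)) * char (density lborel h) t)"
  proof (rule density_eq_inverse_Fourier_integral)
    show "complex_integrable lborel (char (density lborel h))"
      unfolding ch[abs_def] using int by (rule integrable_mult_right)
    show "continuous (at_right r) h"
      unfolding h_def using cdf_is_right_cont[of r] by (intro continuous_intros) auto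
  qed (auto simp: h0 prob)
  also have "\<dots> = 1 / (2 * pi) * (CLINT t|lborel. of_real (s / l) * (iexp (- (t * r)) * (laplace M (of_real s - \<i> * of_real t) / (of_real s - \<i> * of_real t))))"
    unfolding ch by (simp add: algebra_simps)
  also have "\<dots> = 1 / (2 * pi) * (of_real (s / l) * (CLINT t|lborel. (iexp (- (t * r)) * (laplace M (of_real s - \<i> * of_real t) / (of_real s - \<i> * of_real t)))))"
    by (subst integral_mult_right_zero) auto
  finally have "complex_of_real (h r) * of_real (l / s * exp (s * r)) = of_real (exp (s * r)) / (2 * pi) * (CLINT t|lborel. (iexp (- (t * r)) * (laplace M (of_real s - \<i> * of_real t) / (of_real s - \<i> * of_real t))))"
    using l s by (simp add: field_simps)
  moreover have "h r * (l / s * exp (s * r)) = cdf M r"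
    using l s by (simp add: h_def field_simps flip: exp_add)
  ultimately show ?thesis
    by (metis (no_types, lifting) exp_of_real of_real_mult)
qed

end

section \<open>The saddle-point estimate\<close>

text \<open>With \<open>y = Re c\<close> one has
  \<open>(y - 1) * (2 * (y + 1) * (q + 1)) = x\<^sup>2\<close>, while
  \<open>y + 1 \<le> 2 * sqrt q\<close> and \<open>q + 1 \<le> 2 * q\<close>. The resulting lower
  bound is quadratic near 0 and of order \<open>sqrt \<bar>x\<bar>\<close> at infinity; it is the
  damping of the integrand away from the saddle point.\<close>

lemma csqrt_one_minus_ix:
  fixes x :: real
  defines "c \<equiv> csqrt (1 - \<i> * of_real x)" and "q \<equiv> sqrt (1 + x\<^sup>2)"
  shows "x\<^sup>2 / (8 * (1 + x\<^sup>2) powr (3/4)) \<le> Re c - 1" and "norm c ^ 2 = q" and "1 \<le> Re c"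
proof -
  have q: "cmod (1 - \<i> * of_real x) = q" by (simp add: cmod_def q_def)
  have q1: "1 \<le> q" by (simp add: q_def)
  have q2: "q\<^sup>2 = 1 + x\<^sup>2" by (simp add: q_def)
  define y where "y = Re c"
  have y: "y = sqrt ((q + 1) / 2)" unfolding y_def c_def using q by simp
  show y1: "1 \<le> Re c" unfolding y_def[symmetric] y using q1 by simp
  show "norm c ^ 2 = q" unfolding c_def by (metis norm_power power2_csqrt q)
  have y2: "y\<^sup>2 = (q + 1) / 2" using q1 by (simp add: y)
  have yq: "y \<le> sqrt q" unfolding y using q1 by simp
  have "(y - 1) * (y + 1) = (q - 1) / 2" using y2 by (simp add: algebra_simps power2_eq_square)
  moreover have "(q - 1) * (q + 1) = x\<^sup>2" using q2 by (simp add: algebra_simps power2_eq_square)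
  ultimately have "(y - 1) * (2 * (y + 1) * (q + 1)) = x\<^sup>2" by algebra
  then have e: "y - 1 = x\<^sup>2 / (2 * (y + 1) * (q + 1))"
    using y1 q1 by (subst eq_divide_eq) (auto simp: y_def)
  have q34: "(1 + x\<^sup>2) powr (3/4) = sqrt q * q"
  proof -
    have "sqrt q * q = q powr (1/2) * q powr 1" using q1 by (simp add: powr_half_sqrt)
    also have "\<dots> = ((1 + x\<^sup>2) powr (1/2)) powr (3/2)"
      using q1 unfolding powr_add[symmetric] by (simp add: q_def powr_half_sqrt)
    finally show ?thesis by (simp add: powr_powr)
  qed
  have "2 * (y + 1) * (q + 1) \<le> 2 * (2 * sqrt q) * (2 * q)"
    using yq y1 q1 by (intro mult_mono) (auto simp: y_def)
  also have "\<dots> = 8 * (1 + x\<^sup>2) powr (3/4)" unfolding q34 by simp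
  finally have le: "2 * (y + 1) * (q + 1) \<le> 8 * (1 + x\<^sup>2) powr (3/4)" .
  show "x\<^sup>2 / (8 * (1 + x\<^sup>2) powr (3/4)) \<le> Re c - 1"
  proof -
    have "0 < 2 * (y + 1) * (q + 1)" using y1 q1 by (simp add: y_def)
    then show ?thesis
      unfolding y_def[symmetric] e using le q1 y1[folded y_def] by (intro divide_left_mono mult_pos_pos) (auto simp: q34)
  qed
qed

lemma integrable_lborel_inverse_1_plus_square: "integrable lborel (\<lambda>v::real. inverse (1 + v\<^sup>2))"
  using integrable_inverse_1_plus_square
  by (simp add: set_integrable_def interval_lebesgue_integrable_def)

text \<open>The constant 4 comes from inserting \<open>x = 2 * v / sqrt \<Lambda>\<close> with
  \<open>\<Lambda> \<ge> 1\<close> into the bound for \<open>Re (csqrt (1 - \<i> * x))\<close>. The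
  exponent grows only like \<open>sqrt \<bar>v\<bar>\<close>, but its exponential still beats
  \<open>1 + v\<^sup>2\<close>, so a multiple of the Cauchy density dominates.\<close>

lemma integrable_saddle_dominator:
  "integrable lborel (\<lambda>v::real. exp (- (v\<^sup>2 / (2 * (1 + 4 * v\<^sup>2) powr (3/4)))))"
proof -
  let ?f = "\<lambda>v::real. exp (- (v\<^sup>2 / (2 * (1 + 4 * v\<^sup>2) powr (3/4)))) * (1 + v\<^sup>2)"
  have lim: "(?f \<longlongrightarrow> 0) at_top" by real_asymp
  then have "eventually (\<lambda>v. ?f v < 1) at_top"
    by (rule order_tendstoD) simp
  then obtain N where N: "\<And>v. v \<ge> N \<Longrightarrow> ?f v < 1" by (auto simp: eventually_at_top_linorder)
  have pos: "1 + 4 * v\<^sup>2 \<noteq> 0" "0 \<le> 1 + 4 * v\<^sup>2" for v :: real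
    using zero_le_power2[of v] by linarith+
  have cont: "continuous_on {-\<bar>N\<bar>..\<bar>N\<bar>} ?f"
    using pos by (intro continuous_intros) auto
  have "bounded (?f ` {-\<bar>N\<bar>..\<bar>N\<bar>})"
    using compact_continuous_image[OF cont] by (auto intro: compact_imp_bounded)
  then obtain B where B': "\<forall>y\<in>?f ` {-\<bar>N\<bar>..\<bar>N\<bar>}. norm y \<le> B"
    unfolding bounded_iff by blast
  have B: "norm (?f v) \<le> B" if "v \<in> {-\<bar>N\<bar>..\<bar>N\<bar>}" for v
    using B' that by blast
  define K where "K = max 1 B"
  have K: "?f v \<le> K" for v
  proof (cases "\<bar>v\<bar> \<le> \<bar>N\<bar>")
    case True
    then show ?thesis using B[of v] by (auto simp: K_def abs_le_iff)
  next
    case False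
    then have "N \<le> \<bar>v\<bar>" by auto
    from N[OF this] show ?thesis by (simp add: K_def)
  qed
  show ?thesis
  proof (rule Bochner_Integration.integrable_bound)
    show "integrable lborel (\<lambda>v::real. K * inverse (1 + v\<^sup>2))"
      using integrable_lborel_inverse_1_plus_square by simp
    have "exp (- (v\<^sup>2 / (2 * (1 + 4 * v\<^sup>2) powr (3/4)))) \<le> K * inverse (1 + v\<^sup>2)" for v
      using K[of v] by (simp add: pos_le_divide_eq add_pos_nonneg flip: divide_inverse)
    then show "AE x in lborel. norm (exp (- (x\<^sup>2 / (2 * (1 + 4 * x\<^sup>2) powr (3/4))))) \<le> norm (K * inverse (1 + x\<^sup>2))"
      by (auto intro: order_trans[OF _ abs_ge_self])
  qed measurable
qed

lemma gaussian_integral: "integrable lborel (\<lambda>v::real. exp (- v\<^sup>2 / 2))" "(LINT v|lborel. exp (- v\<^sup>2 / 2)) = sqrt (2 * pi)"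
proof -
  have eq: "exp (- v\<^sup>2 / 2) = sqrt (2 * pi) * normal_density 0 1 v" for v :: real
    by (simp add: std_normal_density_def)
  show "integrable lborel (\<lambda>v::real. exp (- v\<^sup>2 / 2))"
    unfolding eq by (intro integrable_mult_right integrable_normal_density) simp
  show "(LINT v|lborel. exp (- v\<^sup>2 / 2)) = sqrt (2 * pi)"
    unfolding eq by (subst integral_mult_right_zero, subst integral_normal_density) simp_all
qed

text \<open>This is the power 3/4 of \<open>2 * z\<close> times
  \<open>exp (- a * sqrt (2 * z))\<close> on the principal branch; nested square roots avoid the
  complex logarithm. For \<open>a > 0\<close> the exponential alone is the transform of the
  one-sided stable law of index 1/2, the law of the hitting time of \<open>a\<close> by Brownian
  motion.\<close>

definition stable_laplace :: "real \<Rightarrow> complex \<Rightarrow> complex" where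
  "stable_laplace a z = csqrt (csqrt (2 * z)) ^ 3 * exp (- of_real a * csqrt (2 * z))"

text \<open>\<open>s\<close> is the saddle point: the derivative of
  \<open>s * r - a * sqrt (2 * s)\<close> vanishes where \<open>sqrt (2 * s) = a / r\<close>.
  Positive scaling commutes with the principal square root, so on the vertical line through
  \<open>s\<close> only \<open>csqrt w\<close> remains.\<close>

lemma stable_laplace_line:
  fixes a r x :: real
  assumes "a > 0" "r > 0"
  defines "s \<equiv> a\<^sup>2 / (2 * r\<^sup>2)" and "w \<equiv> 1 - \<i> * of_real x"
  shows "stable_laplace a (of_real s * w) =
    of_real (sqrt (a / r) ^ 3) * csqrt (csqrt w) ^ 3 * exp (- of_real (a\<^sup>2 / r) * csqrt w)"
proof -
  have "csqrt (2 * (of_real s * w)) = csqrt (of_real ((a / r)\<^sup>2) * w)"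
    by (simp add: s_def power_divide)
  also have "\<dots> = of_real (a / r) * csqrt w"
    using assms(1,2) by (subst csqrt_of_real_mult) auto
  finally have *: "csqrt (2 * (of_real s * w)) = of_real (a / r) * csqrt w" .
  show ?thesis
    unfolding stable_laplace_def * using assms(1,2)
    by (subst csqrt_of_real_mult) (simp_all add: power_mult_distrib power2_eq_square mult.assoc)
qed

lemma (in real_distribution) borel_measurable_laplace: "laplace M \<in> borel_measurable borel"
  unfolding laplace_def[abs_def] by measurable

text \<open>Laplace's method on the vertical line through the saddle point. Since
  \<open>(csqrt w - 1)\<^sup>2 = w - 2 * csqrt w + 1\<close>, the exponent is exactly a constant
  plus \<open>\<Lambda> * (csqrt w - 1)\<^sup>2 / 2\<close>, and no Taylor remainder has to be
  controlled. In the variable \<open>v\<close> the integrand tends to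
  \<open>exp (- v\<^sup>2 / 2)\<close> and is dominated uniformly in \<open>n\<close>; the
  correction \<open>\<rho>\<close> is close to 1 on the whole line because its hypothesis depends on
  the real part only.\<close>

lemma (in real_distribution) small_deviation_of_laplace_asymptotics:
  fixes a c :: real
  assumes nn: "AE x in M. 0 \<le> x" and a: "0 < a" and c: "0 < c"
    and lap: "\<And>z. Re z > 0 \<Longrightarrow> laplace M z = of_real c * stable_laplace a z * \<rho> z"
    and \<rho>: "\<And>e. e > 0 \<Longrightarrow> \<exists>R. \<forall>z. R \<le> Re z \<longrightarrow> norm (\<rho> z - 1) \<le> e"
  shows "((\<lambda>r. cdf M r / (c * sqrt (2 * a / pi) / r * exp (- a\<^sup>2 / (2 * r)))) \<longlongrightarrow> 1) (at_right 0)"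
proof (rule tendsto_at_right_sequentially[of 0 1])
  fix r :: "nat \<Rightarrow> real"
  assume r: "\<And>n. 0 < r n" and rlim: "r \<longlonglongrightarrow> 0"
  define s where "s n = a\<^sup>2 / (2 * (r n)\<^sup>2)" for n
  define \<Lambda> where "\<Lambda> n = a\<^sup>2 / r n" for n
  have s: "0 < s n" for n using a r[of n] by (simp add: s_def)
  have \<Lambda>: "0 < \<Lambda> n" for n using a r[of n] by (simp add: \<Lambda>_def)
  have rinv: "filterlim (\<lambda>n. inverse (r n)) at_top sequentially"
    using rlim r by (intro filterlim_inverse_at_top) auto
  have \<Lambda>_lim: "filterlim \<Lambda> at_top sequentially"
    unfolding \<Lambda>_def divide_inverse using a by (intro filterlim_tendsto_pos_mult_at_top[OF tendsto_const _ rinv]) auto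
  have s_lim: "filterlim s at_top sequentially"
  proof -
    have "s = (\<lambda>n. a\<^sup>2 / 2 * (inverse (r n))\<^sup>2)"
      by (auto simp: s_def fun_eq_iff field_simps)
    then show ?thesis
      using a by (simp only:) (intro filterlim_tendsto_pos_mult_at_top[OF tendsto_const] filterlim_pow_at_top rinv; simp)
  qed
  define w where "w x = 1 - \<i> * complex_of_real x" for x
  \<comment> \<open>\<open>k n v\<close> measures the distance from the saddle point relative to
    \<open>s n\<close>; the width \<open>2 / sqrt \<Lambda>\<close> is what makes the limiting
    exponent \<open>- v\<^sup>2 / 2\<close>.\<close>
  define k where "k n v = 2 * v / sqrt (\<Lambda> n)" for n v
  define g where "g n v = exp (- \<i> * of_real (k n v * \<Lambda> n / 2)) / w (k n v) *
     (laplace M (of_real (s n) * w (k n v)))" for n v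
  \<comment> \<open>The value of \<open>c * stable_laplace a\<close> at the saddle point.\<close>
  define l where "l n = c * sqrt (a / r n) ^ 3 * exp (- \<Lambda> n)" for n
  define G where "G n v = csqrt (csqrt (w (k n v))) ^ 3 / w (k n v) * exp (of_real (\<Lambda> n) * (csqrt (w (k n v)) - 1)\<^sup>2 / 2) * \<rho> (of_real (s n) * w (k n v))" for n v
  have w0: "w x \<noteq> 0" "Re (w x) = 1" for x by (auto simp: w_def complex_eq_iff)
  have g_eq: "g n v = of_real (l n) * G n v" for n v
  proof -
    let ?x = "k n v"
    have "laplace M (of_real (s n) * w ?x) = of_real c * (of_real (sqrt (a / r n) ^ 3) * csqrt (csqrt (w ?x)) ^ 3 * exp (- of_real (\<Lambda> n) * csqrt (w ?x))) * \<rho> (of_real (s n) * w ?x)"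
      using stable_laplace_line[OF a r[of n], of ?x] lap[of "of_real (s n) * w ?x"] s[of n] w0
      by (simp add: s_def \<Lambda>_def w_def)
    moreover have "exp (- \<i> * of_real (?x * \<Lambda> n / 2)) * exp (- of_real (\<Lambda> n) * csqrt (w ?x)) = of_real (exp (- \<Lambda> n)) * exp (of_real (\<Lambda> n) * (csqrt (w ?x) - 1)\<^sup>2 / 2)"
    proof -
      have "(csqrt (w ?x) - 1)\<^sup>2 = w ?x - 2 * csqrt (w ?x) + 1"
        unfolding power2_diff by simp
      then have "- \<i> * of_real (?x * \<Lambda> n / 2) + - of_real (\<Lambda> n) * csqrt (w ?x) = of_real (- \<Lambda> n) + of_real (\<Lambda> n) * (csqrt (w ?x) - 1)\<^sup>2 / 2"
      proof -
        have *: "- \<i> * (x * L / 2) + - L * C = - L + L * (W - 2 * C + 1) / 2" if "W = 1 - \<i> * x" for x L C W :: complex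
          unfolding that by (simp add: field_simps)
        from *[of "w ?x" "of_real ?x" "of_real (\<Lambda> n)" "csqrt (w ?x)"] show "(csqrt (w ?x) - 1)\<^sup>2 = w ?x - 2 * csqrt (w ?x) + 1 \<Longrightarrow> ?thesis"
          by (simp add: w_def)
      qed
      then show ?thesis by (simp only: exp_add[symmetric] exp_of_real[symmetric])
    qed
    ultimately show ?thesis
      by (simp add: g_def G_def l_def field_simps)
  qed
  obtain R where R: "\<And>z. R \<le> Re z \<Longrightarrow> norm (\<rho> z - 1) \<le> 1"
    using \<rho>[of 1] by auto
  let ?D = "\<lambda>v::real. exp (- (v\<^sup>2 / (2 * (1 + 4 * v\<^sup>2) powr (3/4))))"
  \<comment> \<open>\<open>\<Lambda> n \<ge> 1\<close> keeps \<open>\<bar>k n v\<bar>\<close> below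
    \<open>2 * \<bar>v\<bar>\<close>, so that one dominating function serves all large
    \<open>n\<close>.\<close>
  have big: "eventually (\<lambda>n. 1 \<le> \<Lambda> n \<and> R \<le> s n) sequentially"
    using \<Lambda>_lim s_lim by (auto simp: filterlim_at_top eventually_conj)
  then obtain N where N: "\<And>n. n \<ge> N \<Longrightarrow> 1 \<le> \<Lambda> n \<and> R \<le> s n" by (auto simp: eventually_sequentially)
  have norm_w: "1 \<le> norm (w x)" for x
    using complex_Re_le_cmod[of "w x"] w0[of x] by simp
  have G_le: "norm (G n v) \<le> 2 * ?D v" if n: "n \<ge> N" for n v
  proof -
    let ?x = "k n v"
    \<comment> \<open>The modulus is \<open>norm w\<close> to the power 3/4 - 1, and
      \<open>norm w \<ge> 1\<close> on the line.\<close>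
    have 1: "norm (csqrt (csqrt (w ?x)) ^ 3 / w ?x) \<le> 1"
    proof -
      let ?b = "norm (csqrt (csqrt (w ?x)))"
      have b4: "?b ^ 4 = norm (w ?x)"
        by (metis norm_power power2_csqrt power_mult numeral_times_numeral semiring_norm(12,13))
      have "1 \<le> ?b"
        using norm_w[of ?x] unfolding b4[symmetric] by (metis not_le norm_ge_zero power_less_one_iff zero_less_numeral)
      then have "?b ^ 3 \<le> ?b ^ 4" by (intro power_increasing) auto
      then have "?b ^ 3 \<le> norm (w ?x)" unfolding b4 .
      then show ?thesis using norm_w[of ?x] by (simp add: norm_divide norm_power divide_le_eq)
    qed
    have 2: "norm (exp (of_real (\<Lambda> n) * (csqrt (w ?x) - 1)\<^sup>2 / 2)) \<le> ?D v"
    proof -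
      have "(csqrt (w ?x) - 1)\<^sup>2 = w ?x - 2 * csqrt (w ?x) + 1"
        unfolding power2_diff by simp
      then have "Re ((csqrt (w ?x) - 1)\<^sup>2) = - 2 * (Re (csqrt (w ?x)) - 1)" by (simp add: w0)
      moreover have "Re (of_real L * Z / 2) = - L * (y - 1)" if "Re Z = - 2 * (y - 1)" for L y Z
      proof -
        have "Re (of_real L * Z / 2) = L * Re Z / 2" by simp
        also have "\<dots> = - L * (y - 1)" unfolding that by algebra
        finally show ?thesis .
      qed
      ultimately have "Re (of_real (\<Lambda> n) * (csqrt (w ?x) - 1)\<^sup>2 / 2) = - \<Lambda> n * (Re (csqrt (w ?x)) - 1)"
        by blast
      also have "\<dots> \<le> - \<Lambda> n * (?x\<^sup>2 / (8 * (1 + ?x\<^sup>2) powr (3/4)))"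
        unfolding mult_minus_left neg_le_iff_le w_def using \<Lambda>[of n]
        by (intro mult_left_mono csqrt_one_minus_ix(1)) simp
      also have "\<Lambda> n * (?x\<^sup>2 / (8 * (1 + ?x\<^sup>2) powr (3/4))) = v\<^sup>2 / (2 * (1 + ?x\<^sup>2) powr (3/4))"
        using \<Lambda>[of n] by (simp add: k_def power_divide power_mult_distrib field_simps)
      then have "- \<Lambda> n * (?x\<^sup>2 / (8 * (1 + ?x\<^sup>2) powr (3/4))) = - (v\<^sup>2 / (2 * (1 + ?x\<^sup>2) powr (3/4)))" by simp
      also have "\<dots> \<le> - (v\<^sup>2 / (2 * (1 + 4 * v\<^sup>2) powr (3/4)))"
      proof -
        have "?x\<^sup>2 \<le> 4 * v\<^sup>2"
        proof -
          have "?x\<^sup>2 * 1 \<le> ?x\<^sup>2 * \<Lambda> n"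
            using N[OF n] by (intro mult_left_mono) auto
          also have "\<dots> = 4 * v\<^sup>2" using \<Lambda>[of n] by (simp add: k_def power_divide power_mult_distrib)
          finally show ?thesis by simp
        qed
        then have "(1 + ?x\<^sup>2) powr (3/4) \<le> (1 + 4 * v\<^sup>2) powr (3/4)"
          by (intro powr_mono2) auto
        then show ?thesis
        proof -
          have "1 + c \<noteq> 0" if "0 \<le> c" for c :: real using that by linarith
          from this[of "?x\<^sup>2"] this[of "4 * v\<^sup>2"]
          show "(1 + ?x\<^sup>2) powr (3/4) \<le> (1 + 4 * v\<^sup>2) powr (3/4) \<Longrightarrow> ?thesis"
            by (auto intro!: divide_left_mono mult_pos_pos)
        qed
      qed
      finally show ?thesis by simp
    qed
    have 3: "norm (\<rho> (of_real (s n) * w ?x)) \<le> 2"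
    proof -
      have "norm (\<rho> (of_real (s n) * w ?x) - 1) \<le> 1"
        using N[OF n] by (intro R) (simp add: w0)
      then show ?thesis using norm_triangle_sub[of "\<rho> (of_real (s n) * w ?x)" 1] by simp
    qed
    have "norm (G n v) \<le> 1 * ?D v * 2"
      unfolding G_def norm_mult[of _ "\<rho> _"] norm_mult[of "_ / _"] using 1 2 3
      by (intro mult_mono) auto
    then show ?thesis by simp
  qed
  have meas_g: "g n \<in> borel_measurable lborel" for n
    unfolding g_def w_def k_def using borel_measurable_laplace by measurable
  have l: "0 < l n" for n using c a r[of n] by (simp add: l_def)
  have G_g: "G n = (\<lambda>v. g n v / of_real (l n))" for n
    using l[of n] by (auto simp: g_eq fun_eq_iff)
  have meas_G: "G n \<in> borel_measurable lborel" for n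
    unfolding G_g using meas_g by measurable
  have D: "integrable lborel (\<lambda>v. 2 * ?D v)"
    using integrable_saddle_dominator by simp
  have G_int: "integrable lborel (G n)" if "n \<ge> N" for n
    by (rule Bochner_Integration.integrable_bound[OF D meas_G]) (use G_le[OF that] in auto)
  have G_lim: "(\<lambda>n. G n v) \<longlonglongrightarrow> of_real (exp (- v\<^sup>2 / 2))" for v
  proof -
    have k: "(\<lambda>n. k n v) \<longlonglongrightarrow> 0"
      unfolding k_def by (intro tendsto_divide_0[OF tendsto_const] filterlim_at_top_imp_at_infinity
        filterlim_compose[OF sqrt_at_top \<Lambda>_lim])
    then have wl: "(\<lambda>n. w (k n v)) \<longlonglongrightarrow> 1"
      unfolding w_def by (auto intro!: tendsto_eq_intros)
    have cw: "(\<lambda>n. csqrt (w (k n v))) \<longlonglongrightarrow> 1"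
      using isCont_tendsto_compose[OF continuous_at_csqrt wl] by simp
    have ccw: "(\<lambda>n. csqrt (csqrt (w (k n v)))) \<longlonglongrightarrow> 1"
      using isCont_tendsto_compose[OF continuous_at_csqrt cw] by simp
    \<comment> \<open>From \<open>(csqrt w - 1) * (1 + csqrt w) = w - 1\<close> the factor
      \<open>\<Lambda>\<close> cancels against the scale of \<open>k\<close>, and the limit can be
      read off as \<open>csqrt w\<close> tends to 1.\<close>
    have "of_real (\<Lambda> n) * (csqrt (w (k n v)) - 1)\<^sup>2 / 2 = - (2 * (of_real v)\<^sup>2) / (1 + csqrt (w (k n v)))\<^sup>2" for n
    proof -
      let ?c = "csqrt (w (k n v))"
      have "0 < Re (1 + ?c)"
        using csqrt_one_minus_ix(3)[of "k n v"] unfolding w_def plus_complex.sel one_complex.sel by linarith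
      then have c1: "1 + ?c \<noteq> 0" by (metis less_irrefl zero_complex.sel(1))
      have "(?c - 1) * (1 + ?c) = ?c\<^sup>2 - 1" by (simp only: algebra_simps power2_eq_square) simp
      also have "\<dots> = - \<i> * of_real (k n v)" unfolding power2_csqrt by (simp add: w_def)
      finally have "(?c - 1) * (1 + ?c) = - \<i> * of_real (k n v)" .
      then have "(?c - 1)\<^sup>2 * (1 + ?c)\<^sup>2 = - (of_real (k n v))\<^sup>2"
        unfolding power_mult_distrib[symmetric] by (simp add: power_mult_distrib)
      moreover have "of_real (\<Lambda> n) * (complex_of_real (k n v))\<^sup>2 = 4 * (of_real v)\<^sup>2"
      proof -
        have "\<Lambda> n * (k n v)\<^sup>2 = 4 * v\<^sup>2" using \<Lambda>[of n] by (simp add: k_def power_divide power_mult_distrib)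
        then show ?thesis unfolding of_real_power[symmetric] of_real_mult[symmetric] by simp
      qed
      ultimately have "of_real (\<Lambda> n) * (?c - 1)\<^sup>2 * (1 + ?c)\<^sup>2 = - (4 * (of_real v)\<^sup>2)"
        by (simp only: mult.assoc mult_minus_right)
      moreover have "p / 2 = - (2 * V) / B" if "p * B = - (4 * V)" "B \<noteq> 0" for p B V :: complex
        using that by (simp add: field_simps)
      ultimately show ?thesis using c1 by simp
    qed
    moreover have "(\<lambda>n. - (2 * (complex_of_real v)\<^sup>2) / (1 + csqrt (w (k n v)))\<^sup>2) \<longlonglongrightarrow> - (2 * (of_real v)\<^sup>2) / (1 + 1)\<^sup>2"
      by (intro tendsto_intros cw) auto
    ultimately have "(\<lambda>n. exp (of_real (\<Lambda> n) * (csqrt (w (k n v)) - 1)\<^sup>2 / 2)) \<longlonglongrightarrow> exp (- (2 * (of_real v)\<^sup>2) / (1 + 1)\<^sup>2)"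
      by (auto intro!: tendsto_intros)
    moreover have "(\<lambda>n. \<rho> (of_real (s n) * w (k n v))) \<longlonglongrightarrow> 1"
    proof (rule LIMSEQ_I)
      fix e :: real assume "0 < e"
      with \<rho>[of "e/2"] obtain R where R: "\<And>z. R \<le> Re z \<Longrightarrow> norm (\<rho> z - 1) \<le> e / 2" by auto
      from s_lim obtain N where N: "\<And>n. n \<ge> N \<Longrightarrow> R \<le> s n" by (auto simp: filterlim_at_top eventually_sequentially)
      have "norm (\<rho> (of_real (s n) * w (k n v)) - 1) < e" if "n \<ge> N" for n
      proof -
        have "norm (\<rho> (of_real (s n) * w (k n v)) - 1) \<le> e / 2"
          using N[OF that] by (intro R) (simp add: w0)
        then show ?thesis using \<open>0 < e\<close> by linarith
      qed
      then show "\<exists>no. \<forall>n\<ge>no. norm (\<rho> (of_real (s n) * w (k n v)) - 1) < e" by blast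
    qed
    ultimately have "(\<lambda>n. G n v) \<longlonglongrightarrow> 1 ^ 3 / 1 * exp (- (2 * (of_real v)\<^sup>2) / (1 + 1)\<^sup>2) * 1"
      unfolding G_def by (intro tendsto_mult tendsto_divide[OF tendsto_power[OF ccw] wl]) auto
    moreover have "exp (- (2 * (complex_of_real v)\<^sup>2) / (1 + 1)\<^sup>2) = of_real (exp (- v\<^sup>2 / 2))"
      by (simp add: power2_eq_square flip: exp_of_real)
    ultimately show ?thesis by simp
  qed
  have GI: "(\<lambda>n. CLINT v|lborel. G n v) \<longlonglongrightarrow> of_real (sqrt (2 * pi))"
  proof -
    have "(\<lambda>n. CLINT v|lborel. G (n + N) v) \<longlonglongrightarrow> (CLINT v|lborel. of_real (exp (- v\<^sup>2 / 2)))"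
      using G_le G_lim[THEN LIMSEQ_ignore_initial_segment, of N] meas_G
      by (intro integral_dominated_convergence[OF _ _ D]) auto
    then show ?thesis
      unfolding integral_complex_of_real gaussian_integral(2) by (rule LIMSEQ_offset)
  qed
  have main: "complex_of_real (cdf M (r n) / (c * sqrt (2 * a / pi) / r n * exp (- a\<^sup>2 / (2 * r n)))) =
     (CLINT v|lborel. G n v) / of_real (sqrt (2 * pi))" if n: "n \<ge> N" for n
  proof -
    \<comment> \<open>The substitution \<open>t = \<beta> * v\<close> brings the line parameter to
      the scale of the saddle point: \<open>s n - \<i> * t = s n * w (k n v)\<close>.\<close>
    define \<beta> where "\<beta> = 2 * s n / sqrt (\<Lambda> n)"
    have \<beta>: "0 < \<beta>" using s[of n] \<Lambda>[of n] by (simp add: \<beta>_def)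
    let ?L = "\<lambda>t. laplace M (of_real (s n) - \<i> * of_real t) / (of_real (s n) - \<i> * of_real t)"
    have sw: "of_real (s n) - \<i> * of_real (0 + \<beta> * v) = of_real (s n) * w (k n v)" for v
      by (simp add: w_def k_def \<beta>_def field_simps)
    have Hg: "iexp (- ((0 + \<beta> * v) * r n)) * ?L (0 + \<beta> * v) = of_real (l n / s n) * G n v" for v
    proof -
      have "\<beta> * v * r n = k n v * \<Lambda> n / 2"
        using r[of n] by (simp add: \<beta>_def k_def s_def \<Lambda>_def field_simps power2_eq_square)
      then have "iexp (- ((0 + \<beta> * v) * r n)) = exp (- \<i> * of_real (k n v * \<Lambda> n / 2))"
        by (simp only: add_0_left of_real_minus mult_minus_left mult_minus_right)
      then show ?thesis unfolding sw using g_eq[of n v] w0[of "k n v"] s[of n]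
        by (simp add: g_def field_simps)
    qed
    have int: "integrable lborel (\<lambda>t. iexp (- (t * r n)) * ?L t)"
      using integrable_mult_right[OF G_int[OF n], of "of_real (l n / s n)"] \<beta>
      unfolding Hg[symmetric] by (subst (asm) lborel_integrable_real_affine_iff) auto
    have intL: "integrable lborel ?L"
    proof (rule Bochner_Integration.integrable_bound[OF int])
      show "?L \<in> borel_measurable lborel"
        using borel_measurable_laplace by measurable
      show "AE t in lborel. norm (?L t) \<le> norm (iexp (- (t * r n)) * ?L t)"
        by (simp only: norm_mult norm_exp_i_times mult_1_left order_refl AE_I2)
    qed
    have "complex_of_real (cdf M (r n)) = exp (of_real (s n * r n)) / (2 * pi) * (CLINT t|lborel. iexp (- (t * r n)) * ?L t)"
      by (rule cdf_eq_inverse_laplace[OF nn s intL])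
    also have "(CLINT t|lborel. iexp (- (t * r n)) * ?L t) = of_real \<beta> * (CLINT v|lborel. of_real (l n / s n) * G n v)"
      using lborel_integral_real_affine[of \<beta> "\<lambda>t. iexp (- (t * r n)) * ?L t" 0] \<beta>
      unfolding Hg by (simp add: scaleR_conv_of_real)
    also have "\<dots> = of_real (\<beta> * l n / s n) * (CLINT v|lborel. G n v)"
      by (subst integral_mult_right_zero) simp
    finally have cdf: "complex_of_real (cdf M (r n)) = of_real (exp (s n * r n) / (2 * pi) * (\<beta> * l n / s n)) * (CLINT v|lborel. G n v)"
      unfolding exp_of_real by simp
    \<comment> \<open>Since \<open>s * r = \<Lambda> / 2\<close>, the exponents combine to
      \<open>- \<Lambda> / 2 = - a\<^sup>2 / (2 * r)\<close>; the powers of \<open>r\<close> leave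
      \<open>1 / r\<close>, and \<open>sqrt (2 * pi)\<close> is the mass of the limiting
      Gaussian.\<close>
    have "exp (s n * r n) / (2 * pi) * (\<beta> * l n / s n) = c * sqrt (2 * a / pi) / r n * exp (- a\<^sup>2 / (2 * r n)) / sqrt (2 * pi)"
    proof -
      have sr: "s n * r n = \<Lambda> n / 2" using r[of n] by (simp add: s_def \<Lambda>_def power2_eq_square)
      have e: "exp (s n * r n) * exp (- \<Lambda> n) = exp (- a\<^sup>2 / (2 * r n))"
        unfolding exp_add[symmetric] sr by (simp add: \<Lambda>_def)
      have *: "P / L = S / r" if "P = (a / r) * q" "L = a / b" "q * b = S" "0 < r" "0 < b" for P L S q b r :: real
        unfolding that(1,2) that(3)[symmetric] using that(4,5) a by (simp add: field_simps)
      have f1: "sqrt (a / r n) ^ 3 / sqrt (\<Lambda> n) = sqrt a / r n"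
      proof (rule *)
        show "sqrt (a / r n) ^ 3 = (a / r n) * sqrt (a / r n)"
          using a r[of n] by (simp add: power3_eq_cube)
        show "sqrt (\<Lambda> n) = a / sqrt (r n)"
          using a by (simp add: \<Lambda>_def real_sqrt_divide)
        show "sqrt (a / r n) * sqrt (r n) = sqrt a"
          using r[of n] a by (simp add: real_sqrt_divide)
      qed (use r[of n] in auto)
      have f2: "sqrt (2 * a / pi) / sqrt (2 * pi) = sqrt a / pi"
        by (simp add: real_sqrt_divide real_sqrt_mult)
      have "exp (s n * r n) / (2 * pi) * (\<beta> * l n / s n) = c / pi * (exp (s n * r n) * exp (- \<Lambda> n)) * (sqrt (a / r n) ^ 3 / sqrt (\<Lambda> n))"
        using s[of n] by (simp add: \<beta>_def l_def)
      also have "\<dots> = c / r n * exp (- a\<^sup>2 / (2 * r n)) * (sqrt (2 * a / pi) / sqrt (2 * pi))"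
        unfolding e f1 f2 by simp
      finally show ?thesis by simp
    qed
    moreover have "complex_of_real (x / D) = I / of_real S" if "K = D / S" "complex_of_real x = of_real K * I" "D \<noteq> 0" for x D I S K
      unfolding of_real_divide that(2) unfolding that(1) using that(3) by simp
    ultimately show ?thesis
      using cdf a c r[of n] by simp
  qed
  have "(\<lambda>n. complex_of_real (cdf M (r n) / (c * sqrt (2 * a / pi) / r n * exp (- a\<^sup>2 / (2 * r n))))) \<longlonglongrightarrow> of_real 1"
  proof (rule Lim_transform_eventually)
    show "(\<lambda>n. (CLINT v|lborel. G n v) / of_real (sqrt (2 * pi))) \<longlonglongrightarrow> of_real 1"
      using tendsto_divide[OF GI tendsto_const[of "of_real (sqrt (2 * pi))"]] by simp
    show "\<forall>\<^sub>F n in sequentially. (CLINT v|lborel. G n v) / of_real (sqrt (2 * pi)) = complex_of_real (cdf M (r n) / (c * sqrt (2 * a / pi) / r n * exp (- a\<^sup>2 / (2 * r n))))"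
      using main unfolding eventually_sequentially by metis
  qed
  then show "(\<lambda>n. cdf M (r n) / (c * sqrt (2 * a / pi) / r n * exp (- a\<^sup>2 / (2 * r n)))) \<longlonglongrightarrow> 1"
    unfolding tendsto_of_real_iff .
qed simp

section \<open>The Sturm-Liouville initial value problem\<close>

text \<open>The coefficients of the power series in \<open>z\<close> of the solution of \<open>u'' = z p u\<close>, \<open>u 0 = 0\<close>, \<open>u' 0 = 1\<close>,
  and of its derivative.\<close>

fun sl_coeff :: "(real \<Rightarrow> real) \<Rightarrow> nat \<Rightarrow> real \<Rightarrow> real" where
  "sl_coeff p 0 t = t"
| "sl_coeff p (Suc n) t = integral {0..t} (\<lambda>r. integral {0..r} (\<lambda>q. p q * sl_coeff p n q))"

fun sl_deriv :: "(real \<Rightarrow> real) \<Rightarrow> nat \<Rightarrow> real \<Rightarrow> real" where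
  "sl_deriv p 0 t = 1"
| "sl_deriv p (Suc n) t = integral {0..t} (\<lambda>q. p q * sl_coeff p n q)"

text \<open>The field is generic so that one series serves both the real solution, where
  monotonicity is available, and the complex one, where analyticity in \<open>z\<close> is.\<close>

definition sl_sol :: "(real \<Rightarrow> real) \<Rightarrow> 'a::{real_normed_field,banach} \<Rightarrow> real \<Rightarrow> 'a" where
  "sl_sol p z t = (\<Sum>n. of_real (sl_coeff p n t) * z ^ n)"

definition sl_sol' :: "(real \<Rightarrow> real) \<Rightarrow> 'a::{real_normed_field,banach} \<Rightarrow> real \<Rightarrow> 'a" where
  "sl_sol' p z t = (\<Sum>n. of_real (sl_deriv p n t) * z ^ n)"

lemma has_vector_derivative_series:
  fixes f :: "nat \<Rightarrow> real \<Rightarrow> 'a::banach"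
  assumes "convex S"
    and der: "\<And>n x. x \<in> S \<Longrightarrow> (f n has_vector_derivative f' n x) (at x within S)"
    and bound: "\<And>n x. x \<in> S \<Longrightarrow> norm (f' n x) \<le> B n" "summable B"
    and sm: "\<And>x. x \<in> S \<Longrightarrow> summable (\<lambda>n. f n x)"
    and x: "x \<in> S"
  shows "((\<lambda>x. \<Sum>n. f n x) has_vector_derivative (\<Sum>n. f' n x)) (at x within S)"
proof -
  have ul: "uniform_limit S (\<lambda>n x. \<Sum>i<n. f' i x) (\<lambda>x. \<Sum>n. f' n x) sequentially"
    by (rule Weierstrass_m_test) (use bound in auto)
  have "\<exists>g. \<forall>x\<in>S. (\<lambda>n. f n x) sums (g x) \<and> (g has_derivative (\<lambda>h. h *\<^sub>R (\<Sum>n. f' n x))) (at x within S)"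
  proof (rule has_derivative_series[where f=f and f'="\<lambda>n x h. h *\<^sub>R f' n x" and x=x])
    show "convex S" "x \<in> S" "(\<lambda>n. f n x) sums (\<Sum>n. f n x)"
      using assms(1) x summable_sums[OF sm[OF x]] by auto
    show "\<And>n x. x \<in> S \<Longrightarrow> (f n has_derivative (\<lambda>h. h *\<^sub>R f' n x)) (at x within S)"
      using der by (simp add: has_vector_derivative_def)
    fix e :: real assume "e > 0"
    from ul[unfolded uniform_limit_iff, rule_format, OF this]
    show "\<forall>\<^sub>F n in sequentially. \<forall>x\<in>S. \<forall>h. norm (sum (\<lambda>i. h *\<^sub>R f' i x) {..<n} - h *\<^sub>R (\<Sum>n. f' n x)) \<le> e * norm h"
    proof eventually_elim
      case (elim n)
      show ?case
      proof (intro ballI allI)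
        fix x h assume "x \<in> S"
        then have "norm ((\<Sum>i<n. f' i x) - (\<Sum>n. f' n x)) \<le> e" using elim by (auto simp: dist_norm less_imp_le)
        then have "\<bar>h\<bar> * norm ((\<Sum>i<n. f' i x) - (\<Sum>n. f' n x)) \<le> \<bar>h\<bar> * e" by (intro mult_left_mono) auto
        then show "norm (sum (\<lambda>i. h *\<^sub>R f' i x) {..<n} - h *\<^sub>R (\<Sum>n. f' n x)) \<le> e * norm h"
          by (simp flip: scaleR_right.sum scaleR_right_diff_distrib add: mult.commute)
      qed
    qed
  qed
  then obtain g where g: "\<And>y. y \<in> S \<Longrightarrow> (\<lambda>n. f n y) sums (g y)"
      "(g has_derivative (\<lambda>h. h *\<^sub>R (\<Sum>n. f' n x))) (at x within S)"
    using x by blast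
  have *: "(\<Sum>n. f n y) = g y" if "y \<in> S" for y using g(1)[OF that] by (simp add: sums_iff)
  show ?thesis
    unfolding has_vector_derivative_def by (rule has_derivative_transform[OF x * g(2)])
qed

locale sturm_liouville =
  fixes p :: "real \<Rightarrow> real" and C :: real
  assumes cont_p: "continuous_on {0..1} p"
    and p_nonneg: "\<And>t. t \<in> {0..1} \<Longrightarrow> 0 \<le> p t"
    and p_le: "\<And>t. t \<in> {0..1} \<Longrightarrow> p t \<le> C"
begin

lemma C_nonneg: "0 \<le> C"
  using p_nonneg[of 0] p_le[of 0] by simp

lemma continuous_sl: "continuous_on {0..1} (sl_coeff p n) \<and> continuous_on {0..1} (sl_deriv p n)"
proof (induction n)
  case (Suc n)
  have "continuous_on {0..1} (\<lambda>q. p q * sl_coeff p n q)"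
    using Suc by (intro continuous_intros cont_p) auto
  then have i: "(\<lambda>q. p q * sl_coeff p n q) integrable_on {0..1}" by (rule integrable_continuous_real)
  from indefinite_integral_continuous_1[OF i]
  have c: "continuous_on {0..1} (\<lambda>t. integral {0..t} (\<lambda>q. p q * sl_coeff p n q))" .
  moreover have "sl_deriv p (Suc n) = (\<lambda>t. integral {0..t} (\<lambda>q. p q * sl_coeff p n q))" by (rule ext) simp
  moreover have "sl_coeff p (Suc n) = (\<lambda>t. integral {0..t} (\<lambda>r. integral {0..r} (\<lambda>q. p q * sl_coeff p n q)))" by (rule ext) simp
  ultimately show ?case using indefinite_integral_continuous_1[OF integrable_continuous_real[OF c]] by (simp del: sl_coeff.simps sl_deriv.simps)
next
  case 0
  have "sl_coeff p 0 = (\<lambda>t. t)" "sl_deriv p 0 = (\<lambda>t. 1)" by (rule ext, simp)+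
  then show ?case by (simp del: sl_coeff.simps sl_deriv.simps)
qed

lemmas continuous_sl_coeff = continuous_sl[THEN conjunct1]
lemmas continuous_sl_deriv = continuous_sl[THEN conjunct2]

lemma sl_deriv_Suc_eq: "sl_deriv p (Suc n) = (\<lambda>t. integral {0..t} (\<lambda>q. p q * sl_coeff p n q))"
  by (rule ext) simp

lemma sl_coeff_Suc_eq: "sl_coeff p (Suc n) = (\<lambda>t. integral {0..t} (sl_deriv p (Suc n)))"
  by (rule ext) (simp add: sl_deriv_Suc_eq)

lemma continuous_p_sl_coeff: "continuous_on {0..1} (\<lambda>q. p q * sl_coeff p n q)"
  by (intro continuous_intros cont_p continuous_sl_coeff)

lemma sl_coeff_deriv: "t \<in> {0..1} \<Longrightarrow> (sl_coeff p n has_real_derivative sl_deriv p n t) (at t within {0..1})"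
proof (cases n)
  case (Suc m)
  moreover assume "t \<in> {0..1}"
  ultimately show ?thesis
    using integral_has_real_derivative[OF continuous_sl_deriv[of n]] by (simp only: sl_coeff_Suc_eq)
next
  case 0
  have "sl_coeff p 0 = (\<lambda>t. t)" by (rule ext) simp
  then show ?thesis using 0 by (simp del: sl_coeff.simps)
qed

lemma sl_deriv_deriv: "t \<in> {0..1} \<Longrightarrow> (sl_deriv p (Suc n) has_real_derivative p t * sl_coeff p n t) (at t within {0..1})"
  using integral_has_real_derivative[OF continuous_p_sl_coeff[of n]] by (simp only: sl_deriv_Suc_eq)

text \<open>Each stage multiplies by \<open>p \<le> C\<close> and integrates twice. Of the
  denominators that arise, only a factor \<open>n + 1\<close> from the first integration is kept,
  which suffices for an exponential majorant. The power of \<open>t\<close> is retained because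
  bounds on \<open>u t / t\<close> near 0 depend on it.\<close>

lemma sl_bounds:
  assumes "t \<in> {0..1}"
  shows "0 \<le> sl_coeff p n t" "sl_coeff p n t \<le> C ^ n * t ^ (2 * n + 1) / fact n"
    "0 \<le> sl_deriv p n t" "sl_deriv p n t \<le> C ^ n * t ^ (2 * n) / fact n"
proof -
  have "0 \<le> sl_coeff p n t \<and> sl_coeff p n t \<le> C ^ n * t ^ (2 * n + 1) / fact n \<and>
     0 \<le> sl_deriv p n t \<and> sl_deriv p n t \<le> C ^ n * t ^ (2 * n) / fact n" if "t \<in> {0..1}" for t
    using that
  proof (induction n arbitrary: t)
    case (Suc n)
    let ?K = "C ^ Suc n / fact (Suc n)"
    have K: "0 \<le> ?K" using C_nonneg by simp
    have d: "0 \<le> sl_deriv p (Suc n) r \<and> sl_deriv p (Suc n) r \<le> ?K * r ^ (2 * Suc n)" if r: "r \<in> {0..1}" for r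
    proof
      have i: "(\<lambda>q. p q * sl_coeff p n q) integrable_on {0..r}"
        using r by (intro integrable_continuous_real continuous_on_subset[OF continuous_p_sl_coeff]) auto
      show "0 \<le> sl_deriv p (Suc n) r"
        unfolding sl_deriv.simps
      proof (rule Henstock_Kurzweil_Integration.integral_nonneg[OF i])
        fix q assume "q \<in> {0..r}"
        then have q: "q \<in> {0..1}" using r by auto
        from Suc.IH[OF q] p_nonneg[OF q] show "0 \<le> p q * sl_coeff p n q" by simp
      qed
      have hi: "((\<lambda>q. C ^ Suc n / fact n * q ^ (2 * n + 1)) has_integral
          (C ^ Suc n / fact n * (r ^ (2 * n + 2) / real (2 * n + 2)) - C ^ Suc n / fact n * (0 ^ (2 * n + 2) / real (2 * n + 2)))) {0..r}"
      proof (rule fundamental_theorem_of_calculus)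
        have "((\<lambda>q. C ^ Suc n / fact n * (q ^ (2 * n + 2) / real (2 * n + 2))) has_real_derivative C ^ Suc n / fact n * q ^ (2 * n + 1)) (at q within {0..r})" for q
        proof -
          have "((\<lambda>q. q ^ (2 * n + 2)) has_real_derivative real (2 * n + 2) * q ^ (2 * n + 1)) (at q within {0..r})"
            using DERIV_power[OF DERIV_ident, where n="2 * n + 2"] by simp
          from DERIV_cmult[OF DERIV_cdivide[OF this, of "real (2 * n + 2)"], of "C ^ Suc n / fact n"]
          show ?thesis by simp
        qed
        then show "\<And>x. x \<in> {0..r} \<Longrightarrow> ((\<lambda>q. C ^ Suc n / fact n * (q ^ (2 * n + 2) / real (2 * n + 2))) has_vector_derivative C ^ Suc n / fact n * x ^ (2 * n + 1)) (at x within {0..r})"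
          by (simp only: has_real_derivative_iff_has_vector_derivative)
      qed (use r in auto)
      have "sl_deriv p (Suc n) r \<le> integral {0..r} (\<lambda>q. C ^ Suc n / fact n * q ^ (2 * n + 1))"
      proof (simp only: sl_deriv.simps, rule integral_le[OF i])
        fix q assume q: "q \<in> {0..r}"
        then have q1: "q \<in> {0..1}" using r by auto
        have "p q * sl_coeff p n q \<le> C * (C ^ n * q ^ (2 * n + 1) / fact n)"
          using Suc.IH[OF q1] p_le[OF q1] p_nonneg[OF q1] C_nonneg by (intro mult_mono) auto
        then show "p q * sl_coeff p n q \<le> C ^ Suc n / fact n * q ^ (2 * n + 1)" by simp
      qed (use hi in \<open>auto simp: integrable_on_def\<close>)
      also have "\<dots> = C ^ Suc n / fact n * (r ^ (2 * n + 2) / real (2 * n + 2))"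
        unfolding integral_unique[OF hi] by simp
      also have "\<dots> \<le> C ^ Suc n / fact n * (r ^ (2 * n + 2) / (real n + 1))"
      proof (rule mult_left_mono)
        show "r ^ (2 * n + 2) / real (2 * n + 2) \<le> r ^ (2 * n + 2) / (real n + 1)"
          by (rule divide_left_mono) (use r in \<open>auto intro!: mult_pos_pos add_pos_nonneg\<close>)
      qed (use C_nonneg in auto)
      also have "\<dots> = ?K * r ^ (2 * Suc n)"
        by (simp add: field_simps)
      finally show "sl_deriv p (Suc n) r \<le> ?K * r ^ (2 * Suc n)" .
    qed
    have t: "0 \<le> t" "t \<le> 1" using Suc.prems by auto
    have i: "sl_deriv p (Suc n) integrable_on {0..t}"
      using t by (intro integrable_continuous_real continuous_on_subset[OF continuous_sl_deriv]) auto
    have eq: "sl_coeff p (Suc n) t = integral {0..t} (sl_deriv p (Suc n))" by (simp only: sl_coeff_Suc_eq)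
    have "0 \<le> sl_coeff p (Suc n) t"
      unfolding eq using d t by (intro Henstock_Kurzweil_Integration.integral_nonneg[OF i]) auto
    moreover have "sl_coeff p (Suc n) t \<le> integral {0..t} (\<lambda>_. ?K * t ^ (2 * Suc n))"
      unfolding eq
    proof (rule integral_le[OF i])
      fix x assume x: "x \<in> {0..t}"
      then have "sl_deriv p (Suc n) x \<le> ?K * x ^ (2 * Suc n)" using d t by auto
      also have "\<dots> \<le> ?K * t ^ (2 * Suc n)" using x K by (intro mult_left_mono power_mono) auto
      finally show "sl_deriv p (Suc n) x \<le> ?K * t ^ (2 * Suc n)" .
    qed auto
    moreover have "integral {0..t} (\<lambda>_. ?K * t ^ (2 * Suc n)) = ?K * t ^ (2 * Suc n + 1)"
      using t by simp
    ultimately show ?case using d[of t] Suc.prems by (auto simp: field_simps)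
  qed auto
  from this[OF assms] show "0 \<le> sl_coeff p n t" "sl_coeff p n t \<le> C ^ n * t ^ (2 * n + 1) / fact n"
    "0 \<le> sl_deriv p n t" "sl_deriv p n t \<le> C ^ n * t ^ (2 * n) / fact n" by auto
qed

lemma sl_norm_bounds:
  fixes z :: "'a::{real_normed_field,banach}"
  assumes "t \<in> {0..1}"
  shows "norm (of_real (sl_coeff p n t) * z ^ n) \<le> (C * norm z) ^ n /\<^sub>R fact n"
    "norm (of_real (sl_deriv p n t) * z ^ n) \<le> (C * norm z) ^ n /\<^sub>R fact n"
proof -
  have t: "t ^ k \<le> 1" for k using assms by (intro power_le_one) auto
  have "sl_coeff p n t \<le> C ^ n / fact n" "sl_deriv p n t \<le> C ^ n / fact n"
    using sl_bounds[OF assms, of n] mult_left_mono[OF t, of "C ^ n" "2*n+1"] mult_left_mono[OF t, of "C ^ n" "2*n"] C_nonneg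
    by (auto simp: divide_simps intro: order_trans)
  then have "\<bar>sl_coeff p n t\<bar> * norm z ^ n \<le> C ^ n / fact n * norm z ^ n" "\<bar>sl_deriv p n t\<bar> * norm z ^ n \<le> C ^ n / fact n * norm z ^ n"
    using sl_bounds(1,3)[OF assms, of n] by (intro mult_right_mono; simp)+
  then show "norm (of_real (sl_coeff p n t) * z ^ n) \<le> (C * norm z) ^ n /\<^sub>R fact n"
    "norm (of_real (sl_deriv p n t) * z ^ n) \<le> (C * norm z) ^ n /\<^sub>R fact n"
    unfolding norm_mult norm_power norm_of_real power_mult_distrib real_scaleR_def
    by (simp_all only: divide_inverse mult_ac)
qed

lemma summable_sl:
  fixes z :: "'a::{real_normed_field,banach}"
  assumes "t \<in> {0..1}"
  shows "summable (\<lambda>n. of_real (sl_coeff p n t) * z ^ n)" "summable (\<lambda>n. of_real (sl_deriv p n t) * z ^ n)"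
  by (rule summable_comparison_test'[OF summable_exp_generic sl_norm_bounds(1)[OF assms]],
      rule summable_comparison_test'[OF summable_exp_generic sl_norm_bounds(2)[OF assms]])

lemma sl_sol_0 [simp]: "sl_sol p z 0 = 0"
proof -
  have "sl_coeff p n 0 = 0" for n by (cases n) auto
  then show ?thesis by (simp add: sl_sol_def)
qed

lemma sl_sol'_0 [simp]: "sl_sol' p (z :: 'a::{real_normed_field,banach}) 0 = 1"
proof -
  have "of_real (sl_deriv p n 0) * z ^ n = (if n = 0 then 1 else 0)" for n by (cases n) auto
  then show ?thesis
    using sums_unique[OF sums_single[of 0 "\<lambda>_. 1 :: 'a"]] by (simp add: sl_sol'_def)
qed

lemma sl_sol_deriv:
  fixes z :: "'a::{real_normed_field,banach}"
  assumes "t \<in> {0..1}"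
  shows "(sl_sol p z has_vector_derivative sl_sol' p z t) (at t within {0..1})"
  unfolding sl_sol_def[abs_def] sl_sol'_def
proof (rule has_vector_derivative_series[where B="\<lambda>n. (C * norm z) ^ n /\<^sub>R fact n"])
  fix n t assume "t \<in> {0..1::real}"
  from sl_coeff_deriv[OF this, of n]
  show "((\<lambda>t. of_real (sl_coeff p n t) * z ^ n) has_vector_derivative of_real (sl_deriv p n t) * z ^ n) (at t within {0..1})"
    by (intro has_vector_derivative_mult_left has_vector_derivative_of_real)
       (simp add: has_real_derivative_iff_has_vector_derivative)
next
  show "summable (\<lambda>n. (C * norm z) ^ n /\<^sub>R fact n)" by (rule summable_exp_generic)
qed (use assms sl_norm_bounds(2) summable_sl(1) in \<open>simp_all only: convex_real_interval\<close>)

text \<open>The zeroth term of the series of the derivative is the constant 1. In the others,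
  differentiation lowers the index by one and leaves the factor \<open>p t * z\<close>, which
  reproduces the series of the solution.\<close>

lemma sl_sol'_deriv:
  fixes z :: "'a::{real_normed_field,banach}"
  assumes "t \<in> {0..1}"
  shows "(sl_sol' p z has_vector_derivative of_real (p t) * z * sl_sol p z t) (at t within {0..1})"
proof -
  let ?f = "\<lambda>n t. of_real (sl_deriv p (Suc n) t) * z ^ Suc n"
  let ?f' = "\<lambda>n t. of_real (p t) * z * (of_real (sl_coeff p n t) * z ^ n)"
  have "((\<lambda>t. \<Sum>n. ?f n t) has_vector_derivative (\<Sum>n. ?f' n t)) (at t within {0..1})"
  proof (rule has_vector_derivative_series[where B="\<lambda>n. C * norm z * ((C * norm z) ^ n /\<^sub>R fact n)"])
    fix n t assume t: "t \<in> {0..1::real}"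
    have "((\<lambda>t. ?f n t) has_vector_derivative of_real (p t * sl_coeff p n t) * z ^ Suc n) (at t within {0..1})"
      by (intro has_vector_derivative_mult_left has_vector_derivative_of_real)
         (use sl_deriv_deriv[OF t, of n] in \<open>simp add: has_real_derivative_iff_has_vector_derivative del: sl_deriv.simps\<close>)
    then show "((\<lambda>t. ?f n t) has_vector_derivative ?f' n t) (at t within {0..1})"
      by (simp add: mult_ac)
    show "norm (?f' n t) \<le> C * norm z * ((C * norm z) ^ n /\<^sub>R fact n)"
      unfolding norm_mult[of "_ * z"] norm_mult[of _ z] using p_le[OF t] p_nonneg[OF t] C_nonneg
      by (intro mult_mono sl_norm_bounds(1)[OF t]) (auto simp: mult_right_mono)
    show "summable (\<lambda>n. ?f n t)"
      using summable_sl(2)[OF t, of z] by (subst summable_Suc_iff)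
  next
    show "summable (\<lambda>n. C * norm z * ((C * norm z) ^ n /\<^sub>R fact n))"
      by (intro summable_mult summable_exp_generic)
  qed (use assms in \<open>simp_all only: convex_real_interval\<close>)
  also have "(\<Sum>n. ?f' n t) = of_real (p t) * z * sl_sol p z t"
    unfolding sl_sol_def by (rule suminf_mult[OF summable_sl(1)[OF assms]])
  finally have "((\<lambda>t. 1 + (\<Sum>n. ?f n t)) has_vector_derivative of_real (p t) * z * sl_sol p z t) (at t within {0..1})"
    by (auto intro!: derivative_eq_intros)
  then show ?thesis
  proof (rule has_vector_derivative_transform[OF assms, rotated])
    fix x assume "x \<in> {0..1::real}"
    then show "sl_sol' p z x = 1 + (\<Sum>n. ?f n x)"
      using suminf_split_head[OF summable_sl(2)[of x z]] by (simp add: sl_sol'_def del: sl_deriv.simps(2))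
  qed
qed

lemma sl_sol_of_real:
  "t \<in> {0..1} \<Longrightarrow> sl_sol p (of_real s :: complex) t = of_real (sl_sol p s t)"
  using suminf_of_real[OF summable_sl(1)[of t s], where 'a=complex] by (simp add: sl_sol_def)

lemma holomorphic_sl_sol: "t \<in> {0..1} \<Longrightarrow> (\<lambda>z::complex. sl_sol p z t) holomorphic_on UNIV"
proof -
  assume t: "t \<in> {0..1}"
  have "((\<lambda>z::complex. sl_sol p z t) has_field_derivative (\<Sum>n. diffs (\<lambda>n. of_real (sl_coeff p n t)) n * z ^ n)) (at z)" for z
    unfolding sl_sol_def
    by (rule termdiffs_strong'[where K="norm z + 1"]) (use summable_sl(1)[OF t] in auto)
  then show ?thesis
    by (auto simp: holomorphic_on_def field_differentiable_def)
qed

text \<open>For \<open>s \<ge> 0\<close> all terms are nonnegative: the first one alone gives the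
  lower bound, and the coefficient bounds sum to an exponential. Both bounds are linear in
  \<open>t\<close> at 0, which keeps quotients such as \<open>u t / t\<close> under control
  there.\<close>

lemma sl_sol_ge:
  assumes "t \<in> {0..1}" "0 \<le> s"
  shows "t \<le> sl_sol p s t" "sl_sol p s t \<le> t * exp (s * C * t\<^sup>2)"
proof -
  have "(\<Sum>n<1. of_real (sl_coeff p n t) * s ^ n) \<le> sl_sol p s t"
    unfolding sl_sol_def using sl_bounds(1)[OF assms(1)] assms(2)
    by (intro sum_le_suminf summable_sl(1)[OF assms(1)]) auto
  then show "t \<le> sl_sol p s t" by simp
  have "(\<lambda>n. (s * C * t\<^sup>2) ^ n /\<^sub>R fact n) sums exp (s * C * t\<^sup>2)"
    by (rule exp_converges)
  then have e: "(\<lambda>n. t * ((s * C * t\<^sup>2) ^ n /\<^sub>R fact n)) sums (t * exp (s * C * t\<^sup>2))"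
    by (rule sums_mult)
  have "sl_sol p s t \<le> (\<Sum>n. t * ((s * C * t\<^sup>2) ^ n /\<^sub>R fact n))"
    unfolding sl_sol_def
  proof (rule suminf_le)
    fix n
    have "sl_coeff p n t * s ^ n \<le> C ^ n * t ^ (2 * n + 1) / fact n * s ^ n"
      using sl_bounds(2)[OF assms(1), of n] assms(2) by (intro mult_right_mono) auto
    also have "\<dots> = t * ((s * C * t\<^sup>2) ^ n /\<^sub>R fact n)"
      by (simp add: power_mult_distrib power_mult divide_inverse mult_ac flip: power_mult)
    finally show "of_real (sl_coeff p n t) * s ^ n \<le> t * ((s * C * t\<^sup>2) ^ n /\<^sub>R fact n)" by simp
  qed (use sums_summable[OF e] summable_sl(1)[OF assms(1), of s] in auto)
  then show "sl_sol p s t \<le> t * exp (s * C * t\<^sup>2)"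
    using e by (simp add: sums_iff)
qed

end

section \<open>Liouville-Green approximation\<close>

lemma vector_derivative_bound_01:
  fixes f :: "real \<Rightarrow> complex"
  assumes t: "t \<in> {0..1}"
    and der: "\<And>x. x \<in> {0..1} \<Longrightarrow> (f has_vector_derivative f' x) (at x within {0..1})"
    and B: "\<And>x. x \<in> {0..t} \<Longrightarrow> norm (f' x) \<le> B"
  shows "norm (f t - f 0) \<le> B"
proof -
  have "norm (f t - f 0) \<le> B * norm (t - 0)"
  proof (rule differentiable_bound[where S="{0..t}" and f'="\<lambda>x h. h *\<^sub>R f' x"])
    show "(f has_derivative (\<lambda>h. h *\<^sub>R f' x)) (at x within {0..t})" if "x \<in> {0..t}" for x
      using der[of x] that t has_derivative_subset[of f _ x "{0..1}" "{0..t}"]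
      by (auto simp: has_vector_derivative_def)
    show "onorm (\<lambda>h. h *\<^sub>R f' x) \<le> B" if "x \<in> {0..t}" for x
      using onorm_scaleR_left[OF bounded_linear_ident, of "f' x"] B[OF that] by (simp add: onorm_id)
  qed (use t in auto)
  also have "\<dots> \<le> B * 1"
    using t order_trans[OF norm_ge_zero B[of 0]] by (intro mult_left_mono) auto
  finally show ?thesis by simp
qed

text \<open>The approximate solutions of \<open>u'' = \<kappa>\<^sup>2 * g ^ 4 * u\<close> are
  \<open>f * exp (\<kappa> * S)\<close> and \<open>f * exp (- \<kappa> * S)\<close>. Variation of
  constants with respect to them leaves only \<open>f''\<close> as a source. Bounding the source by
  the maximum \<open>X\<close> of \<open>norm (exp (- \<kappa> * S) * u)\<close> gives an inequality
  for \<open>X\<close> that closes when \<open>norm \<kappa>\<close> is large; inserting the bound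
  on \<open>X\<close> once more yields the error at 1.\<close>

lemma liouville_green_estimate:
  fixes f g f1 f2 S :: "real \<Rightarrow> real" and u u1 :: "real \<Rightarrow> complex" and \<kappa> :: complex
  assumes df: "\<And>t. t \<in> {0..1} \<Longrightarrow> (f has_real_derivative f1 t) (at t within {0..1})"
    and df1: "\<And>t. t \<in> {0..1} \<Longrightarrow> (f1 has_real_derivative f2 t) (at t within {0..1})"
    and dg: "\<And>t. t \<in> {0..1} \<Longrightarrow> (g has_real_derivative - (f1 t * (g t)\<^sup>2)) (at t within {0..1})"
    and dS: "\<And>t. t \<in> {0..1} \<Longrightarrow> (S has_real_derivative (g t)\<^sup>2) (at t within {0..1})"
    and S0: "S 0 = 0" and S_mono: "\<And>r t. 0 \<le> r \<Longrightarrow> r \<le> t \<Longrightarrow> t \<le> 1 \<Longrightarrow> S r \<le> S t"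
    and fg: "\<And>t. t \<in> {0..1} \<Longrightarrow> f t * g t = 1"
    and gm: "0 < gm" "\<And>t. t \<in> {0..1} \<Longrightarrow> gm \<le> g t"
    and F: "\<And>t. t \<in> {0..1} \<Longrightarrow> \<bar>f2 t\<bar> \<le> F" and f0: "0 < f 0"
    and du: "\<And>t. t \<in> {0..1} \<Longrightarrow> (u has_vector_derivative u1 t) (at t within {0..1})"
    and du1: "\<And>t. t \<in> {0..1} \<Longrightarrow> (u1 has_vector_derivative of_real (g t ^ 4) * \<kappa>\<^sup>2 * u t) (at t within {0..1})"
    and u0: "u 0 = 0" "u1 0 = 1" and \<kappa>: "0 < Re \<kappa>" "2 * F \<le> norm \<kappa> * gm"
  shows "norm (2 * \<kappa> * of_real (g 1) * exp (- \<kappa> * of_real (S 1)) * u 1 / of_real (f 0) - 1)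
     \<le> 4 * F / (norm \<kappa> * gm) + exp (- 2 * Re \<kappa> * S 1)"
proof -
  define E where "E t = exp (- \<kappa> * of_real (S t))" for t
  define E' where "E' t = exp (\<kappa> * of_real (S t))" for t
  have EE': "E t * E' t = 1" for t by (simp add: E_def E'_def flip: exp_add)
  \<comment> \<open>Up to the factors \<open>2 * \<kappa>\<close> and \<open>- 2 * \<kappa>\<close>,
    \<open>A\<close> and \<open>B\<close> are the coefficients of \<open>u\<close> along the growing
    and the decaying approximate solution. Both start at \<open>f 0\<close>.\<close>
  define A where "A t = E t * (of_real (f t) * u1 t - of_real (f1 t) * u t + \<kappa> * of_real (g t) * u t)" for t
  define B where "B t = E' t * (of_real (f t) * u1 t - of_real (f1 t) * u t - \<kappa> * of_real (g t) * u t)" for t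
  have vec: "\<And>h h' t. (h has_real_derivative h') (at t within {0..1}) \<Longrightarrow>
      ((\<lambda>t. complex_of_real (h t)) has_vector_derivative of_real h') (at t within {0..1})"
    by (intro has_vector_derivative_of_real) (simp add: has_real_derivative_iff_has_vector_derivative)
  have dE: "(E has_vector_derivative (- \<kappa> * of_real ((g t)\<^sup>2)) * E t) (at t within {0..1})"
    and dE': "(E' has_vector_derivative (\<kappa> * of_real ((g t)\<^sup>2)) * E' t) (at t within {0..1})"
    if "t \<in> {0..1}" for t
  proof -
    have "((exp \<circ> (\<lambda>t. c * of_real (S t))) has_vector_derivative (c * of_real ((g t)\<^sup>2)) * exp (c * of_real (S t))) (at t within {0..1})" for c :: complex
      by (rule field_vector_diff_chain_within[OF has_vector_derivative_mult_right[OF vec[OF dS[OF that]]]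
            has_field_derivative_at_within[OF DERIV_exp]])
    from this[of "-\<kappa>"] this[of \<kappa>] show
      "(E has_vector_derivative (- \<kappa> * of_real ((g t)\<^sup>2)) * E t) (at t within {0..1})"
      "(E' has_vector_derivative (\<kappa> * of_real ((g t)\<^sup>2)) * E' t) (at t within {0..1})"
      by (simp_all add: E_def[abs_def] E'_def[abs_def] o_def)
  qed
  have key: "of_real (f t) * of_real (g t) = (1::complex)" if "t \<in> {0..1}" for t
    using fg[OF that] by (simp flip: of_real_mult)
  have dA: "(A has_vector_derivative - (E t * of_real (f2 t) * u t)) (at t within {0..1})" if t: "t \<in> {0..1}" for t
  proof -
    note d = vec[OF df[OF t]] vec[OF df1[OF t]] vec[OF dg[OF t]] du[OF t] du1[OF t] dE[OF t]
    have "(A has_vector_derivative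
       (E t * ((of_real (f t) * (of_real (g t ^ 4) * \<kappa>\<^sup>2 * u t) + of_real (f1 t) * u1 t)
             - (of_real (f1 t) * u1 t + of_real (f2 t) * u t)
             + ((\<kappa> * of_real (g t)) * u1 t + (\<kappa> * of_real (- (f1 t * (g t)\<^sup>2))) * u t))
        + ((- \<kappa> * of_real ((g t)\<^sup>2)) * E t) * (of_real (f t) * u1 t - of_real (f1 t) * u t + \<kappa> * of_real (g t) * u t))) (at t within {0..1})"
      unfolding A_def[abs_def]
      by (intro has_vector_derivative_mult has_vector_derivative_add has_vector_derivative_diff has_vector_derivative_mult_right d)
    also have "(E t * ((of_real (f t) * (of_real (g t ^ 4) * \<kappa>\<^sup>2 * u t) + of_real (f1 t) * u1 t)
             - (of_real (f1 t) * u1 t + of_real (f2 t) * u t)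
             + ((\<kappa> * of_real (g t)) * u1 t + (\<kappa> * of_real (- (f1 t * (g t)\<^sup>2))) * u t))
        + ((- \<kappa> * of_real ((g t)\<^sup>2)) * E t) * (of_real (f t) * u1 t - of_real (f1 t) * u t + \<kappa> * of_real (g t) * u t))
       = - (E t * of_real (f2 t) * u t)"
      using key[OF t] unfolding of_real_minus of_real_mult of_real_power by algebra
    finally show ?thesis .
  qed
  have dB: "(B has_vector_derivative - (E' t * of_real (f2 t) * u t)) (at t within {0..1})" if t: "t \<in> {0..1}" for t
  proof -
    note d = vec[OF df[OF t]] vec[OF df1[OF t]] vec[OF dg[OF t]] du[OF t] du1[OF t] dE'[OF t]
    have "(B has_vector_derivative
       (E' t * ((of_real (f t) * (of_real (g t ^ 4) * \<kappa>\<^sup>2 * u t) + of_real (f1 t) * u1 t)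
             - (of_real (f1 t) * u1 t + of_real (f2 t) * u t)
             - ((\<kappa> * of_real (g t)) * u1 t + (\<kappa> * of_real (- (f1 t * (g t)\<^sup>2))) * u t))
        + ((\<kappa> * of_real ((g t)\<^sup>2)) * E' t) * (of_real (f t) * u1 t - of_real (f1 t) * u t - \<kappa> * of_real (g t) * u t))) (at t within {0..1})"
      unfolding B_def[abs_def]
      by (intro has_vector_derivative_mult has_vector_derivative_add has_vector_derivative_diff has_vector_derivative_mult_right d)
    also have "(E' t * ((of_real (f t) * (of_real (g t ^ 4) * \<kappa>\<^sup>2 * u t) + of_real (f1 t) * u1 t)
             - (of_real (f1 t) * u1 t + of_real (f2 t) * u t)
             - ((\<kappa> * of_real (g t)) * u1 t + (\<kappa> * of_real (- (f1 t * (g t)\<^sup>2))) * u t))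
        + ((\<kappa> * of_real ((g t)\<^sup>2)) * E' t) * (of_real (f t) * u1 t - of_real (f1 t) * u t - \<kappa> * of_real (g t) * u t))
       = - (E' t * of_real (f2 t) * u t)"
      using key[OF t] unfolding of_real_minus of_real_mult of_real_power by algebra
    finally show ?thesis .
  qed
  have Eu: "2 * \<kappa> * of_real (g t) * (E t * u t) = A t - B t * (E t)\<^sup>2" for t
  proof -
    have "B t * (E t)\<^sup>2 = E t * (of_real (f t) * u1 t - of_real (f1 t) * u t - \<kappa> * of_real (g t) * u t)"
      using EE'[of t] unfolding B_def by algebra
    then show ?thesis unfolding A_def by algebra
  qed
  have F0: "0 \<le> F" using F[of 0] by simp
  have \<kappa>0: "0 < norm \<kappa>" using \<kappa>(1) by auto
  \<comment> \<open>The expected growth of \<open>u\<close> is divided out before the maximum is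
    taken, so that the same maximum bounds the error terms at every time.\<close>
  define m where "m t = norm (E t * u t)" for t
  have "continuous_on {0..1} m"
    unfolding m_def continuous_on_eq_continuous_within
    by (intro ballI continuous_intros has_vector_derivative_continuous[OF dE] has_vector_derivative_continuous[OF du])
  then obtain t0 where t0: "t0 \<in> {0..1}" "\<And>t. t \<in> {0..1} \<Longrightarrow> m t \<le> m t0"
    using continuous_attains_sup[of "{0..1::real}" m] by auto
  define X where "X = m t0"
  have X0: "0 \<le> X" by (simp add: X_def m_def)
  have A0: "A 0 = of_real (f 0)" "B 0 = of_real (f 0)" by (simp_all add: A_def B_def E_def E'_def u0 S0)
  have nE: "norm (E t) = exp (- Re \<kappa> * S t)" "norm (E' t) = exp (Re \<kappa> * S t)" for t by (simp_all add: E_def E'_def)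
  have bA: "norm (A t - of_real (f 0)) \<le> F * X" if t: "t \<in> {0..1}" for t
    unfolding A0(1)[symmetric]
  proof (rule vector_derivative_bound_01[OF t dA])
    fix x assume "x \<in> {0..t}"
    then have x: "x \<in> {0..1}" using t by auto
    have "norm (- (E x * of_real (f2 x) * u x)) = \<bar>f2 x\<bar> * m x" by (simp add: m_def norm_mult)
    also have "\<dots> \<le> F * X" using F[OF x] t0(2)[OF x] F0 by (intro mult_mono) (auto simp: X_def m_def)
    finally show "norm (- (E x * of_real (f2 x) * u x)) \<le> F * X" .
  qed
  \<comment> \<open>\<open>B\<close> may grow like \<open>exp (2 * \<kappa> * S)\<close>, but only
    its product with \<open>(E t)\<^sup>2\<close> enters. As \<open>S\<close> is monotone, the
    exponential in the derivative at \<open>x\<close> is bounded by the one at \<open>t\<close>,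
    which \<open>(E t)\<^sup>2\<close> cancels.\<close>
  have bB: "norm ((E t)\<^sup>2 * (B t - of_real (f 0))) \<le> F * X" if t: "t \<in> {0..1}" for t
  proof -
    have "norm (B t - B 0) \<le> exp (Re \<kappa> * S t) ^ 2 * (F * X)"
    proof (rule vector_derivative_bound_01[OF t dB])
      fix x assume xt: "x \<in> {0..t}"
      then have x: "x \<in> {0..1}" using t by auto
      have "norm (- (E' x * of_real (f2 x) * u x)) = norm (E' x * E' x * E x) * \<bar>f2 x\<bar> * norm (u x)"
      proof -
        have "- (E' x * of_real (f2 x) * u x) = - ((E' x * E' x * E x) * of_real (f2 x) * u x)"
          using EE'[of x] by algebra
        then show ?thesis by (simp only: norm_minus_cancel norm_mult norm_of_real)
      qed
      also have "\<dots> = exp (Re \<kappa> * S x) ^ 2 * (\<bar>f2 x\<bar> * m x)"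
        by (simp add: m_def norm_mult nE(2) power2_eq_square)
      also have "\<dots> \<le> exp (Re \<kappa> * S t) ^ 2 * (F * X)"
        using F[OF x] t0(2)[OF x] F0 xt t \<kappa>(1)
        by (intro mult_mono power_mono) (auto simp: X_def m_def intro!: S_mono mult_nonneg_nonneg)
      finally show "norm (- (E' x * of_real (f2 x) * u x)) \<le> exp (Re \<kappa> * S t) ^ 2 * (F * X)" .
    qed
    then have "norm (E t) ^ 2 * norm (B t - B 0) \<le> norm (E t) ^ 2 * (exp (Re \<kappa> * S t) ^ 2 * (F * X))"
      by (intro mult_left_mono) auto
    also have "\<dots> = (norm (E t) * exp (Re \<kappa> * S t)) ^ 2 * (F * X)" by (simp add: power_mult_distrib)
    also have "norm (E t) * exp (Re \<kappa> * S t) = 1" by (simp add: nE flip: exp_add)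
    finally show ?thesis by (simp add: A0 norm_mult norm_power)
  qed
  have St: "0 \<le> S t" if "t \<in> {0..1}" for t using S_mono[of 0 t] that S0 by auto
  have E1: "norm ((E t)\<^sup>2) \<le> 1" if "t \<in> {0..1}" for t
    using St[OF that] \<kappa>(1) by (auto simp: norm_power nE intro!: power_le_one)
  have "norm (2 * \<kappa> * of_real (g t0) * (E t0 * u t0)) \<le> 2 * f 0 + 2 * (F * X)"
  proof -
    have "A t0 - B t0 * (E t0)\<^sup>2 = (A t0 - of_real (f 0)) - (E t0)\<^sup>2 * (B t0 - of_real (f 0)) + of_real (f 0) * (1 - (E t0)\<^sup>2)"
      by (simp add: algebra_simps)
    also have "norm \<dots> \<le> F * X + F * X + f 0 * 2"
    proof (rule order_trans[OF norm_triangle_ineq add_mono[OF order_trans[OF norm_triangle_ineq4 add_mono[OF bA[OF t0(1)] bB[OF t0(1)]]]]])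
      have "norm (1 - (E t0)\<^sup>2) \<le> 1 + 1"
        using E1[OF t0(1)] by (intro order_trans[OF norm_triangle_ineq4]) auto
      then show "norm (of_real (f 0) * (1 - (E t0)\<^sup>2)) \<le> f 0 * 2"
        using f0 unfolding norm_mult by (intro mult_mono) auto
    qed
    finally show ?thesis unfolding Eu by simp
  qed
  also have "norm (2 * \<kappa> * of_real (g t0) * (E t0 * u t0)) = 2 * norm \<kappa> * \<bar>g t0\<bar> * X"
    unfolding X_def m_def by (simp add: norm_mult)
  finally have "2 * norm \<kappa> * \<bar>g t0\<bar> * X \<le> 2 * f 0 + 2 * (F * X)" .
  moreover have "2 * norm \<kappa> * gm * X \<le> 2 * norm \<kappa> * \<bar>g t0\<bar> * X"
    using gm(2)[OF t0(1)] X0 by (intro mult_right_mono mult_left_mono) auto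
  \<comment> \<open>The lower bound on \<open>norm \<kappa>\<close> lets the source term be absorbed
    into the left-hand side and leaves a bound on \<open>X\<close> of order
    \<open>1 / norm \<kappa>\<close>.\<close>
  moreover have "2 * F * X \<le> norm \<kappa> * gm * X" using \<kappa>(2) X0 by (rule mult_right_mono)
  ultimately have "norm \<kappa> * gm * X \<le> 2 * f 0" by linarith
  then have X: "X \<le> 2 * f 0 / (norm \<kappa> * gm)"
    using \<kappa>0 gm by (simp add: pos_le_divide_eq mult.commute)
  have one: "1 \<in> {0..1::real}" by simp
  have "2 * \<kappa> * of_real (g 1) * exp (- \<kappa> * of_real (S 1)) * u 1 / of_real (f 0) - 1 =
      ((A 1 - of_real (f 0)) - (E 1)\<^sup>2 * (B 1 - of_real (f 0)) - of_real (f 0) * (E 1)\<^sup>2) / of_real (f 0)"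
    using Eu[of 1] f0 unfolding E_def[symmetric] by (simp add: field_simps)
  also have "norm \<dots> \<le> (F * X + F * X + f 0 * exp (- 2 * Re \<kappa> * S 1)) / f 0"
  proof -
    have "norm ((E 1)\<^sup>2) = exp (- 2 * Re \<kappa> * S 1)"
      by (simp add: norm_power nE flip: exp_of_nat_mult)
    then have "norm (of_real (f 0) * (E 1)\<^sup>2) \<le> f 0 * exp (- 2 * Re \<kappa> * S 1)"
      using f0 unfolding norm_mult by simp
    then have "norm ((A 1 - of_real (f 0)) - (E 1)\<^sup>2 * (B 1 - of_real (f 0)) - of_real (f 0) * (E 1)\<^sup>2) \<le> F * X + F * X + f 0 * exp (- 2 * Re \<kappa> * S 1)"
      by (rule order_trans[OF norm_triangle_ineq4 add_mono[OF order_trans[OF norm_triangle_ineq4 add_mono[OF bA[OF one] bB[OF one]]]]])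
    then show ?thesis using f0 unfolding norm_divide by (auto intro!: divide_right_mono)
  qed
  also have "\<dots> = 2 * F * X / f 0 + exp (- 2 * Re \<kappa> * S 1)" using f0 by (simp add: field_simps)
  also have "2 * F * X / f 0 \<le> 2 * F * (2 * f 0 / (norm \<kappa> * gm)) / f 0"
    using X F0 f0 by (intro divide_right_mono mult_left_mono) auto
  also have "\<dots> = 4 * F / (norm \<kappa> * gm)" using f0 by simp
  finally show ?thesis by simp
qed

section \<open>Analytic continuation of the transform identity\<close>

text \<open>Differentiation under the integral by dominated convergence: on the half-plane
  \<open>Re w \<ge> s\<close> the derivative \<open>x * exp (- w * x)\<close> is at most
  \<open>1 / s\<close> in modulus because \<open>y * exp (- y) \<le> 1\<close>, so the difference
  quotients are bounded by a constant.\<close>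

lemma (in real_distribution) holomorphic_laplace:
  assumes nn: "AE x in M. 0 \<le> x"
  shows "laplace M holomorphic_on {z. 0 < Re z}"
proof -
  have "(laplace M has_field_derivative (CLINT x|M. - of_real x * exp (- z * of_real x))) (at z)" if z: "0 < Re z" for z
    unfolding has_field_derivative_iff tendsto_at_iff_sequentially
  proof (intro allI impI)
    fix X :: "nat \<Rightarrow> complex"
    assume X: "\<forall>i. X i \<in> UNIV - {z}" "X \<longlonglongrightarrow> z"
    define s where "s = Re z / 2"
    have s: "0 < s" using z by (simp add: s_def)
    have bnd: "norm (exp (- w * of_real x) - exp (- z * of_real x)) \<le> (1 / s) * norm (w - z)" if "0 \<le> x" "s \<le> Re w" for w x
    proof (rule field_differentiable_bound[where S="{w. s \<le> Re w}" and f'="\<lambda>w. - of_real x * exp (- w * of_real x)"])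
      show "((\<lambda>w. exp (- w * of_real x)) has_field_derivative - of_real x * exp (- v * of_real x)) (at v within {w. s \<le> Re w})" for v
        by (auto intro!: derivative_eq_intros)
    next
      fix v :: complex assume "v \<in> {w. s \<le> Re w}"
      then have "exp (- Re v * x) \<le> exp (- (s * x))" using that by (auto intro: mult_right_mono)
      moreover have "s * x \<le> exp (s * x)" using exp_ge_add_one_self[of "s * x"] by linarith
      then have "s * x * exp (- (s * x)) \<le> 1" by (simp add: exp_minus field_simps)
      moreover have "s * x * exp (- Re v * x) \<le> s * x * exp (- (s * x))"
        using calculation(1) that s by (intro mult_left_mono) auto
      ultimately have "s * (x * exp (- Re v * x)) \<le> 1" by simp
      then show "norm (- of_real x * exp (- v * of_real x)) \<le> 1 / s"
        using s that by (simp add: norm_mult field_simps)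
    next
      show "convex {w. s \<le> Re w}" by (rule convex_halfspace_Re_ge)
    qed (use that z in \<open>auto simp: s_def\<close>)
    have "eventually (\<lambda>n. s < Re (X n)) sequentially"
      using X(2) z by (intro order_tendstoD[OF tendsto_Re]) (auto simp: s_def)
    then obtain N where N: "\<And>n. n \<ge> N \<Longrightarrow> s < Re (X n)" by (auto simp: eventually_sequentially)
    have lim: "(\<lambda>n. CLINT x|M. (exp (- X (n + N) * of_real x) - exp (- z * of_real x)) / (X (n + N) - z))
        \<longlonglongrightarrow> (CLINT x|M. - of_real x * exp (- z * of_real x))"
    proof (rule integral_dominated_convergence[where w="\<lambda>_. 1 / s"])
      show "AE x in M. norm ((exp (- X (i + N) * of_real x) - exp (- z * of_real x)) / (X (i + N) - z)) \<le> 1 / s" for i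
        using nn
      proof eventually_elim
        fix x :: real assume "0 \<le> x"
        have "0 < norm (X (i + N) - z)" using X(1) by auto
        then show "norm ((exp (- X (i + N) * of_real x) - exp (- z * of_real x)) / (X (i + N) - z)) \<le> 1 / s"
          unfolding norm_divide using bnd[OF \<open>0 \<le> x\<close> less_imp_le[OF N[of "i + N"]]]
          by (subst pos_divide_le_eq) auto
      qed
      show "AE x in M. (\<lambda>i. (exp (- X (i + N) * of_real x) - exp (- z * of_real x)) / (X (i + N) - z)) \<longlonglongrightarrow> - of_real x * exp (- z * of_real x)"
      proof (intro AE_I2)
        fix x :: real
        have "((\<lambda>w. exp (- w * of_real x)) has_field_derivative - of_real x * exp (- z * of_real x)) (at z)"
          by (auto intro!: derivative_eq_intros)
        then have "(\<lambda>i. (exp (- X i * of_real x) - exp (- z * of_real x)) / (X i - z)) \<longlonglongrightarrow> - of_real x * exp (- z * of_real x)"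
          unfolding has_field_derivative_iff tendsto_at_iff_sequentially using X by (auto simp: o_def)
        then show "(\<lambda>i. (exp (- X (i + N) * of_real x) - exp (- z * of_real x)) / (X (i + N) - z)) \<longlonglongrightarrow> - of_real x * exp (- z * of_real x)"
          by (rule LIMSEQ_ignore_initial_segment)
      qed
    qed auto
    have eq: "(laplace M (X (n + N)) - laplace M z) / (X (n + N) - z) =
       (CLINT x|M. (exp (- X (n + N) * of_real x) - exp (- z * of_real x)) / (X (n + N) - z))" for n
    proof -
      have "integrable M (\<lambda>x. exp (- X (n + N) * of_real x))" "integrable M (\<lambda>x. exp (- z * of_real x))"
        using N[of "n + N"] s z by (intro integrable_laplace[OF nn]; simp)+
      then show ?thesis
        unfolding laplace_def by (subst integral_divide_zero, subst Bochner_Integration.integral_diff) auto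
    qed
    show "((\<lambda>y. (laplace M y - laplace M z) / (y - z)) \<circ> X) \<longlonglongrightarrow> (CLINT x|M. - of_real x * exp (- z * of_real x))"
      by (rule LIMSEQ_offset[where k=N]) (use lim in \<open>simp add: o_def eq\<close>)
  qed
  then show ?thesis
    by (auto simp: holomorphic_on_def field_differentiable_def intro: has_field_derivative_at_within)
qed

lemma open_connected_right_half_plane: "open {z. 0 < Re z}" "connected {z. 0 < Re z}"
  by (auto intro!: open_halfspace_Re_gt convex_connected convex_halfspace_Re_gt)

lemma one_islimpt_positive_reals: "1 islimpt (complex_of_real ` {0<..})"
  unfolding islimpt_sequential
proof (intro exI conjI allI)
  have "(\<lambda>n. complex_of_real (1 + 1 / real (Suc n))) \<longlonglongrightarrow> of_real 1"
    by (intro tendsto_of_real) real_asymp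
  then show "(\<lambda>n. complex_of_real (1 + 1 / real (Suc n))) \<longlonglongrightarrow> 1" by simp
  fix n 
  show "complex_of_real (1 + 1 / real (Suc n)) \<in> complex_of_real ` {0<..} - {1}"
    by (auto intro!: imageI add_pos_pos simp: of_real_eq_1_iff simp del: of_real_add of_real_divide)
qed

text \<open>Near infinity \<open>\<rho>\<close> is close to \<open>1\<close> or to \<open>- 1\<close>; the half-plane is connected and \<open>\<rho>\<close> has positive real part
  on the real axis, which fixes the sign.\<close>

lemma root_of_limit_one:
  fixes D \<rho> :: "complex \<Rightarrow> complex"
  assumes D: "\<And>e. e > 0 \<Longrightarrow> \<exists>R. \<forall>z. R \<le> Re z \<longrightarrow> norm (D z - 1) \<le> e"
    and cont: "continuous_on {z. 0 < Re z} \<rho>"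
    and eq: "\<And>z. 0 < Re z \<Longrightarrow> (\<rho> z)\<^sup>2 * D z ^ 3 = 1"
    and pos: "\<And>s. 0 < s \<Longrightarrow> 0 < Re (\<rho> (of_real s))"
    and e: "e > 0"
  shows "\<exists>R. \<forall>z. R \<le> Re z \<longrightarrow> norm (\<rho> z - 1) \<le> e"
proof -
  have "((\<lambda>w. inverse (w ^ 3)) \<longlongrightarrow> inverse (1 ^ 3)) (at (1::complex))"
    by (intro tendsto_intros) auto
  then have "isCont (\<lambda>w. inverse (w ^ 3)) (1::complex)" by (simp add: isCont_def)
  then obtain d where d: "d > 0" "\<And>w::complex. dist w 1 < d \<Longrightarrow> dist (inverse (w ^ 3)) (inverse (1 ^ 3)) < min e (1/2)"
    unfolding continuous_at_eps_delta using e by (auto dest!: spec[of _ "min e (1/2)"])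
  obtain R0 where R0: "\<And>z. R0 \<le> Re z \<Longrightarrow> norm (D z - 1) \<le> d / 2"
    using D[of "d/2"] d(1) by auto
  define R where "R = max R0 1"
  have sq: "norm ((\<rho> z)\<^sup>2 - 1) \<le> min e (1/2)" if "R \<le> Re z" for z
  proof -
    have "(\<rho> z)\<^sup>2 = inverse (D z ^ 3)"
      using eq[of z] that by (metis R_def inverse_unique less_le_trans max.boundedE mult.commute zero_less_one)
    moreover have "dist (D z) 1 < d" using R0[of z] that d(1) by (auto simp: R_def dist_norm)
    ultimately show ?thesis using d(2)[of "D z"] by (simp add: dist_norm less_imp_le)
  qed
  have ne: "Re (\<rho> z) \<noteq> 0" if "R \<le> Re z" for z
  proof
    assume 0: "Re (\<rho> z) = 0"
    have "(\<rho> z)\<^sup>2 = of_real (- (Im (\<rho> z))\<^sup>2)" using 0 by (simp add: complex_eq_iff power2_eq_square)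
    then have "(\<rho> z)\<^sup>2 - 1 = of_real (- (Im (\<rho> z))\<^sup>2 - 1)" by simp
    then have "norm ((\<rho> z)\<^sup>2 - 1) = \<bar>- (Im (\<rho> z))\<^sup>2 - 1\<bar>" by (simp only: norm_of_real)
    moreover have "1 \<le> \<bar>- (Im (\<rho> z))\<^sup>2 - 1\<bar>" using zero_le_power2[of "Im (\<rho> z)"] by linarith
    ultimately show False using sq[OF that] by linarith
  qed
  have "0 < Re (\<rho> z)" if z: "R \<le> Re z" for z
  proof (rule ccontr)
    assume n: "\<not> 0 < Re (\<rho> z)"
    let ?S = "(\<lambda>z. Re (\<rho> z)) ` {z. R \<le> Re z}"
    have "connected ?S"
      by (intro connected_continuous_image continuous_on_Re continuous_on_subset[OF cont]
           convex_connected convex_halfspace_Re_ge) (auto simp: R_def)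
    moreover have "Re (\<rho> z) \<in> ?S" "Re (\<rho> (of_real R)) \<in> ?S" using z by auto
    moreover have "0 < Re (\<rho> (of_real R))" by (rule pos) (simp add: R_def)
    ultimately have "0 \<in> ?S" using n unfolding connected_iff_interval by (meson less_imp_le not_less)
    then show False using ne by auto
  qed
  then have "norm (\<rho> z - 1) \<le> e" if "R \<le> Re z" for z
  proof -
    have "1 \<le> Re (\<rho> z + 1)" using \<open>\<And>z. R \<le> Re z \<Longrightarrow> 0 < Re (\<rho> z)\<close>[OF that] by simp
    then have "1 \<le> norm (\<rho> z + 1)" using complex_Re_le_cmod order_trans by blast
    then have "norm (\<rho> z - 1) * 1 \<le> norm (\<rho> z - 1) * norm (\<rho> z + 1)" by (intro mult_left_mono) auto
    also have "\<dots> = norm ((\<rho> z)\<^sup>2 - 1)" by (simp add: power2_eq_square algebra_simps flip: norm_mult)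
    finally show ?thesis using sq[OF that] by simp
  qed
  then show ?thesis by blast
qed

lemma has_real_derivative_powr_const:
  assumes "(h has_real_derivative h') (at t within A)" "0 < h t"
  shows "((\<lambda>t. h t powr c) has_real_derivative (c * h t powr (c - 1)) * h') (at t within A)"
  by (rule DERIV_chain2[OF has_real_derivative_powr[OF assms(2)] assms(1)])

text \<open>The Liouville-Green error depends on \<open>z\<close> only through lower bounds for
  \<open>Re (csqrt (2 * z))\<close>, whose square is at least \<open>Re z\<close>. Hence the
  approximation is uniform in the imaginary part, as integration along a vertical line requires. The
  two derivatives of \<open>\<psi>\<close> enter through \<open>f2\<close>, the second derivative of
  \<open>\<psi> powr (-1/4)\<close>.\<close>

lemma sl_sol_asymptotics:
  fixes \<psi> :: "real \<Rightarrow> real"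
  assumes pos: "\<And>t. t \<in> {0..1} \<Longrightarrow> \<psi> t > 0"
    and C2: "twice_continuously_differentiable_on \<psi> {0..1}"
    and \<theta>: "\<theta> = integral {0..1} (\<lambda>t. sqrt (\<psi> t))"
    and e: "e > 0"
  shows "\<exists>R. \<forall>z. R \<le> Re z \<longrightarrow>
    norm (2 * csqrt (2 * z) * of_real (\<psi> 0 powr (1/4) * \<psi> 1 powr (1/4)) * exp (- csqrt (2 * z) * of_real \<theta>) * sl_sol (\<lambda>t. 2 * \<psi> t) z 1 - 1) \<le> e"
proof -
  obtain \<psi>1 \<psi>2 where d1: "\<And>t. t \<in> {0..1} \<Longrightarrow> (\<psi> has_real_derivative \<psi>1 t) (at t within {0..1})"
    and d2: "\<And>t. t \<in> {0..1} \<Longrightarrow> (\<psi>1 has_real_derivative \<psi>2 t) (at t within {0..1})"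
    and c2: "continuous_on {0..1} \<psi>2"
    using C2 unfolding twice_continuously_differentiable_on_def by metis
  have c0: "continuous_on {0..1} \<psi>" and c1: "continuous_on {0..1} \<psi>1"
    using DERIV_continuous_on[OF d1] DERIV_continuous_on[OF d2] by blast+
  have "continuous_on {0..1} (\<lambda>t. 2 * \<psi> t)" by (intro continuous_intros c0)
  then have "\<exists>x\<in>{0..1}. \<forall>y\<in>{0..1}. 2 * \<psi> y \<le> 2 * \<psi> x"
    by (intro continuous_attains_sup) auto
  then obtain C where C: "\<And>t. t \<in> {0..1} \<Longrightarrow> 2 * \<psi> t \<le> C" by blast
  interpret sturm_liouville "\<lambda>t. 2 * \<psi> t" C
    by standard (auto intro!: continuous_intros c0 simp: C pos less_imp_le)
  define g where "g t = \<psi> t powr (1/4)" for t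
  define f where "f t = \<psi> t powr (-1/4)" for t
  define f1 where "f1 t = -1/4 * \<psi> t powr (-5/4) * \<psi>1 t" for t
  define f2 where "f2 t = -1/4 * (-5/4 * \<psi> t powr (-9/4) * \<psi>1 t) * \<psi>1 t + -1/4 * \<psi> t powr (-5/4) * \<psi>2 t" for t
  define S where "S t = integral {0..t} (\<lambda>r. (g r)\<^sup>2)" for t
  have gpos: "0 < g t" if "t \<in> {0..1}" for t using pos[OF that] by (simp add: g_def)
  have cg: "continuous_on {0..1} g" unfolding g_def using c0 pos by (intro continuous_intros) (auto simp: less_imp_neq[THEN not_sym])
  have g2: "(g t)\<^sup>2 = sqrt (\<psi> t)" if "t \<in> {0..1}" for t
    using pos[OF that] by (simp add: g_def powr_half_sqrt[symmetric] power2_eq_square flip: powr_add)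
  have S1: "S 1 = \<theta>" unfolding S_def \<theta> by (intro integral_cong) (auto simp: g2)
  have df: "(f has_real_derivative f1 t) (at t within {0..1})" if "t \<in> {0..1}" for t
    using has_real_derivative_powr_const[OF d1[OF that] pos[OF that], of "-1/4"]
    by (simp add: f_def[abs_def] f1_def)
  have df1: "(f1 has_real_derivative f2 t) (at t within {0..1})" if "t \<in> {0..1}" for t
  proof -
    have "((\<lambda>t. -1/4 * \<psi> t powr (-5/4) * \<psi>1 t) has_real_derivative
       (-1/4 * ((-5/4 * \<psi> t powr (-5/4 - 1)) * \<psi>1 t)) * \<psi>1 t + \<psi>2 t * (-1/4 * \<psi> t powr (-5/4))) (at t within {0..1})"
      by (intro DERIV_mult DERIV_cmult has_real_derivative_powr_const d1 d2 that pos)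
    then show ?thesis by (simp add: f1_def[abs_def] f2_def mult_ac)
  qed
  have dg: "(g has_real_derivative - (f1 t * (g t)\<^sup>2)) (at t within {0..1})" if "t \<in> {0..1}" for t
  proof -
    have "\<psi> t powr (-5/4) * (\<psi> t powr (1/4))\<^sup>2 = \<psi> t powr (1/4 - 1)"
      using pos[OF that] by (simp add: power2_eq_square flip: powr_add)
    then have "- (f1 t * (g t)\<^sup>2) = (1/4 * \<psi> t powr (1/4 - 1)) * \<psi>1 t"
      by (simp add: f1_def g_def)
    then show ?thesis
      using has_real_derivative_powr_const[OF d1[OF that] pos[OF that], of "1/4"]
      by (simp only: g_def[abs_def])
  qed
  have fg: "f t * g t = 1" if "t \<in> {0..1}" for t
    using pos[OF that] by (simp add: f_def g_def flip: powr_add)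
  have "\<exists>x\<in>{0..1}. \<forall>y\<in>{0..1}. g x \<le> g y"
    using cg by (intro continuous_attains_inf) auto
  then obtain tm where tm: "tm \<in> {0..1}" "\<And>t. t \<in> {0..1} \<Longrightarrow> g tm \<le> g t" by blast
  define gm where "gm = g tm"
  have gm: "0 < gm" "\<And>t. t \<in> {0..1} \<Longrightarrow> gm \<le> g t" using tm gpos by (auto simp: gm_def)
  have "continuous_on {0..1} f2"
    unfolding f2_def using c0 c1 c2 pos by (intro continuous_intros) (auto simp: less_imp_neq[THEN not_sym])
  then have "continuous_on {0..1} (\<lambda>t. \<bar>f2 t\<bar>)" by (intro continuous_intros)
  then have "\<exists>x\<in>{0..1}. \<forall>y\<in>{0..1}. \<bar>f2 y\<bar> \<le> \<bar>f2 x\<bar>"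
    by (intro continuous_attains_sup) auto
  then obtain F where F: "\<And>t. t \<in> {0..1} \<Longrightarrow> \<bar>f2 t\<bar> \<le> F" by blast
  have g2c: "continuous_on {0..1} (\<lambda>r. (g r)\<^sup>2)" by (intro continuous_intros cg)
  have dS: "(S has_real_derivative (g t)\<^sup>2) (at t within {0..1})" if "t \<in> {0..1}" for t
    unfolding S_def[abs_def] by (rule integral_has_real_derivative[OF g2c that])
  have S_mono: "S r \<le> S t" if "0 \<le> r" "r \<le> t" "t \<le> 1" for r t
    unfolding S_def using that
    by (intro integral_subset_le integrable_continuous_real continuous_on_subset[OF g2c]) auto
  have \<theta>0: "0 < \<theta>"
  proof -
    have "integral {0..1::real} (\<lambda>_. gm\<^sup>2) \<le> integral {0..1::real} (\<lambda>r. (g r)\<^sup>2)"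
    proof (rule Henstock_Kurzweil_Integration.integral_le)
      show "gm\<^sup>2 \<le> (g x)\<^sup>2" if "x \<in> {0..1}" for x
        using gm(1) gm(2)[OF that] by (intro power_mono) auto
    qed (auto intro!: integrable_continuous_real g2c)
    then have "gm\<^sup>2 \<le> \<theta>" unfolding S1[symmetric] S_def by simp
    moreover have "0 < gm\<^sup>2" using gm(1) by (rule zero_less_power)
    ultimately show ?thesis by (rule less_le_trans[rotated])
  qed
  have "((\<lambda>K. 4 * F / (K * gm) + exp (- 2 * K * \<theta>)) \<longlongrightarrow> 0) at_top" using \<theta>0 gm(1) by real_asymp
  then have ev1: "eventually (\<lambda>K. 4 * F / (K * gm) + exp (- 2 * K * \<theta>) < e) at_top" using e by (rule order_tendstoD)
  have ev2: "eventually (\<lambda>K. 2 * F \<le> K * gm \<and> 0 < K) at_top"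
    using eventually_ge_at_top[of "2 * F / gm"] eventually_gt_at_top[of 0]
    by eventually_elim (use gm(1) in \<open>simp add: pos_divide_le_eq\<close>)
  from eventually_conj[OF ev1 ev2] obtain K0 where K0: "\<And>K. K \<ge> K0 \<Longrightarrow> 4 * F / (K * gm) + exp (- 2 * K * \<theta>) < e \<and> 2 * F \<le> K * gm \<and> 0 < K"
    unfolding eventually_at_top_linorder by auto
  have F0: "0 \<le> F" using F[of 0] by simp
  show ?thesis
  proof (intro exI allI impI)
    fix z :: complex assume z: "max 1 (K0\<^sup>2) \<le> Re z"
    define \<kappa> where "\<kappa> = csqrt (2 * z)"
    have "Re z \<le> (Re \<kappa>)\<^sup>2"
      using complex_Re_le_cmod[of "2 * z"] z by (simp add: \<kappa>_def)
    then have "K0\<^sup>2 \<le> (Re \<kappa>)\<^sup>2" using z by simp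
    moreover have "0 \<le> Re \<kappa>" unfolding \<kappa>_def by (rule Re_csqrt)
    ultimately have "K0 \<le> Re \<kappa>" by (rule power2_le_imp_le)
    note K = K0[OF this]
    have k: "Re \<kappa> \<le> norm \<kappa>" by (rule complex_Re_le_cmod)
    have "norm (2 * \<kappa> * of_real (g 1) * exp (- \<kappa> * of_real (S 1)) * sl_sol (\<lambda>t. 2 * \<psi> t) z 1 / of_real (f 0) - 1)
       \<le> 4 * F / (norm \<kappa> * gm) + exp (- 2 * Re \<kappa> * S 1)"
    proof (rule liouville_green_estimate[OF df df1 dg dS _ S_mono fg gm F _ sl_sol_deriv])
      show "S 0 = 0" by (simp add: S_def)
      show "0 < f 0" using pos[of 0] by (simp add: f_def)
      show "2 * F \<le> norm \<kappa> * gm" using K k gm(1) mult_right_mono[OF k, of gm] by linarith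
      show "(sl_sol' (\<lambda>t. 2 * \<psi> t) z has_vector_derivative of_real (g t ^ 4) * \<kappa>\<^sup>2 * sl_sol (\<lambda>t. 2 * \<psi> t) z t) (at t within {0..1})"
        if t: "t \<in> {0..1}" for t
      proof -
        have "g t ^ 4 = (sqrt (\<psi> t))\<^sup>2" unfolding g2[OF t, symmetric] by simp
        then have "g t ^ 4 = \<psi> t" using pos[OF t] by simp
        then show ?thesis using sl_sol'_deriv[OF t, of z] unfolding \<kappa>_def power2_csqrt by (simp add: mult_ac)
      qed
    qed (use K in \<open>simp_all\<close>)
    also have "\<dots> \<le> 4 * F / (Re \<kappa> * gm) + exp (- 2 * Re \<kappa> * \<theta>)"
      unfolding S1 using K k gm(1) F0
      by (intro add_mono divide_left_mono mult_right_mono mult_pos_pos) auto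
    also have "\<dots> \<le> e" using K by simp
    also have "2 * \<kappa> * of_real (g 1) * exp (- \<kappa> * of_real (S 1)) * sl_sol (\<lambda>t. 2 * \<psi> t) z 1 / of_real (f 0)
       = 2 * csqrt (2 * z) * of_real (\<psi> 0 powr (1/4) * \<psi> 1 powr (1/4)) * exp (- csqrt (2 * z) * of_real \<theta>) * sl_sol (\<lambda>t. 2 * \<psi> t) z 1"
    proof -
      have f0: "f 0 \<noteq> 0" using pos[of 0] by (simp add: f_def)
      have "f 0 * g 0 = 1" by (rule fg) simp
      then have "inverse (f 0) = g 0" by (rule inverse_unique)
      then have "inverse (complex_of_real (f 0)) = of_real (g 0)" by (metis of_real_inverse)
      then show ?thesis unfolding divide_inverse S1 \<kappa>_def[symmetric] by (simp add: g_def mult_ac)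
    qed
    finally show "norm (2 * csqrt (2 * z) * of_real (\<psi> 0 powr (1/4) * \<psi> 1 powr (1/4)) * exp (- csqrt (2 * z) * of_real \<theta>) * sl_sol (\<lambda>t. 2 * \<psi> t) z 1 - 1) \<le> e" .
  qed
qed

lemma Re_csqrt_pos: "0 < Re z \<Longrightarrow> 0 < Re (csqrt z)"
  using complex_Re_le_cmod[of z] by simp

lemma continuous_on_stable_laplace: "continuous_on {z. 0 < Re z} (stable_laplace a)"
proof -
  have "z \<notin> \<real>\<^sub>\<le>\<^sub>0" if "0 < Re z" for z
    using that complex_nonpos_Reals_iff by auto
  then have c: "continuous_on {z. 0 < Re z} csqrt"
    by (intro continuous_on_subset[OF continuous_on_csqrt]) auto
  have c1: "continuous_on {z. 0 < Re z} (\<lambda>z. csqrt (2 * z))"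
    by (rule continuous_on_compose2[OF c]) (auto intro!: continuous_intros)
  have c2: "continuous_on {z. 0 < Re z} (\<lambda>z. csqrt (csqrt (2 * z)))"
    by (rule continuous_on_compose2[OF c c1]) (auto intro!: Re_csqrt_pos simp del: csqrt.simps)
  show ?thesis
    unfolding stable_laplace_def[abs_def] by (intro continuous_intros c1 c2)
qed

lemma stable_laplace_nonzero: "z \<noteq> 0 \<Longrightarrow> stable_laplace a z \<noteq> 0"
  by (simp add: stable_laplace_def)

lemma stable_laplace_of_real:
  assumes "0 < s"
  shows "stable_laplace a (of_real s) = of_real (sqrt (sqrt (2 * s)) ^ 3 * exp (- a * sqrt (2 * s)))"
proof -
  have "csqrt (2 * of_real s) = of_real (sqrt (2 * s))"
    using csqrt_of_real_nonneg[of "of_real (2 * s)"] assms by simp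
  then show ?thesis
    using assms unfolding stable_laplace_def by (simp add: csqrt_of_real_nonneg flip: exp_of_real)
qed

text \<open>A power -3/2 of the complex \<open>u\<close> would require a branch, so the identity is
  continued in the polynomial form \<open>L\<^sup>2 * u ^ 3 = 1\<close>. The comparison function
  satisfies \<open>T\<^sup>2 * u ^ 3 = D ^ 3\<close> with \<open>D\<close> tending to 1, so the
  square of \<open>\<rho> = L / T\<close> is \<open>1 / D ^ 3\<close>, and positivity of
  \<open>\<rho>\<close> on the real axis selects the root.\<close>

lemma (in real_distribution) cdf_asymptotics_of_sl_laplace:
  fixes \<psi> :: "real \<Rightarrow> real"
  assumes nn: "AE x in M. 0 \<le> x"
    and pos: "\<And>t. t \<in> {0..1} \<Longrightarrow> \<psi> t > 0"
    and C2: "twice_continuously_differentiable_on \<psi> {0..1}"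
    and \<theta>: "\<theta> = integral {0..1} (\<lambda>t. sqrt (\<psi> t))" and \<theta>0: "0 < \<theta>"
    and lap: "\<And>s. 0 < s \<Longrightarrow> (LINT x|M. exp (- s * x)) = sl_sol (\<lambda>t. 2 * \<psi> t) s 1 powr (-3/2)"
  shows "((\<lambda>r. cdf M r / (2 * sqrt (6 * \<theta>) * \<psi> 0 powr (3/8) * \<psi> 1 powr (3/8) / sqrt pi / r * exp (- (9 * \<theta>\<^sup>2 / 8) / r))) \<longlongrightarrow> 1) (at_right 0)"
proof -
  have "continuous_on {0..1} \<psi>"
    using C2 unfolding twice_continuously_differentiable_on_def by (metis DERIV_continuous_on)
  then have c: "continuous_on {0..1} (\<lambda>t. 2 * \<psi> t)" by (intro continuous_intros)
  then have "\<exists>x\<in>{0..1}. \<forall>y\<in>{0..1}. 2 * \<psi> y \<le> 2 * \<psi> x"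
    by (intro continuous_attains_sup) auto
  then obtain C where C: "\<And>t. t \<in> {0..1} \<Longrightarrow> 2 * \<psi> t \<le> C" by blast
  interpret sturm_liouville "\<lambda>t. 2 * \<psi> t" C
    by standard (auto intro!: c simp: C pos less_imp_le)
  have one: "1 \<in> {0..1::real}" by simp
  let ?u = "\<lambda>z::complex. sl_sol (\<lambda>t. 2 * \<psi> t) z 1"
  let ?L = "laplace M"
  have real_id: "?L (of_real s) ^ 2 * ?u (of_real s) ^ 3 = 1" if s: "0 < s" for s
  proof -
    define x where "x = sl_sol (\<lambda>t. 2 * \<psi> t) s 1"
    have x: "1 \<le> x" unfolding x_def using sl_sol_ge(1)[OF one, of s] s by simp
    have "x ^ 3 = x powr 3" using x by simp
    then have "(x powr (-3/2))\<^sup>2 * x ^ 3 = x powr (-3/2) * x powr (-3/2) * x powr 3" by (simp only: power2_eq_square)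
    also have "\<dots> = 1" unfolding powr_add[symmetric] using x by simp
    finally have "complex_of_real ((x powr (-3/2))\<^sup>2 * x ^ 3) = 1" by simp
    then show ?thesis
      using sl_sol_of_real[OF one, of s] lap[OF s] by (simp add: laplace_of_real x_def)
  qed
  \<comment> \<open>Both factors are holomorphic in the right half-plane, and the positive reals
    accumulate inside it.\<close>
  have id: "?L z ^ 2 * ?u z ^ 3 = 1" if z: "0 < Re z" for z
  proof -
    have "?L z ^ 2 * ?u z ^ 3 - 1 = 0"
    proof (rule analytic_continuation[of "\<lambda>z. ?L z ^ 2 * ?u z ^ 3 - 1" "{z. 0 < Re z}" "complex_of_real ` {0<..}" 1])
      show "(\<lambda>z. ?L z ^ 2 * ?u z ^ 3 - 1) holomorphic_on {z. 0 < Re z}"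
        by (intro holomorphic_intros holomorphic_laplace[OF nn] holomorphic_on_subset[OF holomorphic_sl_sol[OF one]]) auto
    qed (use z real_id one_islimpt_positive_reals open_connected_right_half_plane in auto)
    then show ?thesis by simp
  qed
  define P where "P = \<psi> 0 powr (3/8) * \<psi> 1 powr (3/8)"
  define G where "G = \<psi> 0 powr (1/4) * \<psi> 1 powr (1/4)"
  have psi: "0 < \<psi> 0" "0 < \<psi> 1" using pos by auto
  have P: "0 < P" using psi by (simp add: P_def)
  have PG: "P\<^sup>2 = G ^ 3"
  proof -
    have "(y powr (3/8))\<^sup>2 = (y powr (1/4)) ^ 3" if "0 < y" for y :: real
      using that by (simp add: power2_eq_square power3_eq_cube flip: powr_add)
    then show ?thesis using psi by (simp add: P_def G_def power_mult_distrib)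
  qed
  \<comment> \<open>Raising \<open>exp (\<theta> * k) / (2 * k * G)\<close>,
    \<open>k = csqrt (2 * z)\<close>, to the power -3/2 gives
    \<open>exp (- 3 * \<theta> / 2 * k)\<close> times the power 3/2 of \<open>2 * k * G\<close>.
    This yields \<open>a\<close>; and \<open>2 * sqrt 2\<close> and \<open>P\<close> are the powers
    3/2 of 2 and of \<open>G\<close>.\<close>
  define a where "a = 3 * \<theta> / 2"
  define c where "c = 2 * sqrt 2 * P"
  have a: "0 < a" and c: "0 < c" using \<theta>0 P by (auto simp: a_def c_def)
  define T where "T z = of_real c * stable_laplace a z" for z
  define D where "D z = 2 * csqrt (2 * z) * of_real G * exp (- csqrt (2 * z) * of_real \<theta>) * ?u z" for z
  define \<rho> where "\<rho> z = ?L z / T z" for z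
  have T0: "T z \<noteq> 0" if "0 < Re z" for z
  proof -
    have "z \<noteq> 0" using that by auto
    then show ?thesis using c stable_laplace_nonzero[of z a] by (simp add: T_def)
  qed
  have TD: "(T z)\<^sup>2 * ?u z ^ 3 = D z ^ 3" for z
  proof -
    let ?k = "csqrt (2 * z)"
    have 1: "(stable_laplace a z)\<^sup>2 = ?k ^ 3 * exp (- ?k * of_real \<theta>) ^ 3"
    proof -
      have "(csqrt ?k ^ 3)\<^sup>2 = ((csqrt ?k)\<^sup>2) ^ 3" unfolding power_mult[symmetric] by simp
      moreover have "exp (- of_real a * ?k) ^ 2 = exp (- ?k * of_real \<theta>) ^ 3"
        unfolding exp_of_nat_mult[symmetric] by (simp add: a_def field_simps)
      ultimately show ?thesis unfolding stable_laplace_def power_mult_distrib power2_csqrt by simp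
    qed
    have "c\<^sup>2 = 8 * G ^ 3" unfolding PG[symmetric] by (simp add: c_def power_mult_distrib)
    then have "complex_of_real c ^ 2 = 8 * of_real G ^ 3" unfolding of_real_power[symmetric] by simp
    then show ?thesis unfolding T_def D_def power_mult_distrib 1 by simp
  qed
  have "((\<lambda>r. cdf M r / (c * sqrt (2 * a / pi) / r * exp (- a\<^sup>2 / (2 * r)))) \<longlongrightarrow> 1) (at_right 0)"
  proof (rule small_deviation_of_laplace_asymptotics[OF nn a c])
    show "?L z = of_real c * stable_laplace a z * \<rho> z" if "0 < Re z" for z
      using T0[OF that] by (simp add: \<rho>_def T_def[symmetric])
    show "\<exists>R. \<forall>z. R \<le> Re z \<longrightarrow> norm (\<rho> z - 1) \<le> e" if "0 < e" for e
    proof (rule root_of_limit_one[OF _ _ _ _ that])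
      show "\<exists>R. \<forall>z. R \<le> Re z \<longrightarrow> norm (D z - 1) \<le> e" if "0 < e" for e
        unfolding D_def G_def by (rule sl_sol_asymptotics[OF pos C2 \<theta> that])
      show "continuous_on {z. 0 < Re z} \<rho>"
        unfolding \<rho>_def T_def using T0
        by (intro continuous_intros continuous_on_stable_laplace holomorphic_on_imp_continuous_on holomorphic_laplace nn)
           (auto simp: T_def)
      show "(\<rho> z)\<^sup>2 * D z ^ 3 = 1" if "0 < Re z" for z
        unfolding TD[symmetric] using id[OF that] T0[OF that] by (simp add: \<rho>_def power_divide)
      show "0 < Re (\<rho> (of_real s))" if "0 < s" for s
      proof -
        have "\<rho> (of_real s) = of_real ((LINT x|M. exp (- s * x)) / (c * (sqrt (sqrt (2 * s)) ^ 3 * exp (- a * sqrt (2 * s)))))"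
          unfolding \<rho>_def T_def stable_laplace_of_real[OF that] laplace_of_real by simp
        moreover have "0 < (LINT x|M. exp (- s * x)) / (c * (sqrt (sqrt (2 * s)) ^ 3 * exp (- a * sqrt (2 * s))))"
          using laplace_real_pos[OF nn that] c that by (intro divide_pos_pos mult_pos_pos) auto
        ultimately show ?thesis by simp
      qed
    qed
  qed
  moreover have "c * sqrt (2 * a / pi) / r * exp (- a\<^sup>2 / (2 * r)) =
     2 * sqrt (6 * \<theta>) * \<psi> 0 powr (3/8) * \<psi> 1 powr (3/8) / sqrt pi / r * exp (- (9 * \<theta>\<^sup>2 / 8) / r)" for r
  proof -
    have "sqrt 2 * sqrt (2 * a / pi) = sqrt (6 * \<theta>) / sqrt pi"
      unfolding real_sqrt_mult[symmetric] real_sqrt_divide[symmetric] by (simp add: a_def)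
    then have "c * sqrt (2 * a / pi) = 2 * sqrt (6 * \<theta>) * \<psi> 0 powr (3/8) * \<psi> 1 powr (3/8) / sqrt pi"
    proof -
      assume *: "sqrt 2 * sqrt (2 * a / pi) = sqrt (6 * \<theta>) / sqrt pi"
      have "c * sqrt (2 * a / pi) = 2 * P * (sqrt 2 * sqrt (2 * a / pi))" by (simp only: c_def mult_ac)
      then show ?thesis unfolding * P_def by (simp add: mult_ac)
    qed
    moreover have "- a\<^sup>2 / (2 * r) = - (9 * \<theta>\<^sup>2 / 8) / r"
      by (simp add: a_def power_divide power_mult_distrib)
    ultimately show ?thesis by simp
  qed
  ultimately show ?thesis by (simp only:)
qed

section \<open>Gaussian kernels\<close>

text \<open>A two-point Gaussian kernel whose coupling \<open>1 / U\<close> and diagonal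
  coefficients \<open>A\<close>, \<open>B\<close> are independent parameters: multiplication by
  \<open>exp (- r * y\<^sup>2)\<close> followed by a heat step stays in this family. The heat kernel
  of time \<open>h\<close> is the member \<open>U = h\<close>, \<open>A = B = 1 / h\<close>.\<close>

definition gauss_kernel :: "real \<Rightarrow> real \<Rightarrow> real \<Rightarrow> real \<Rightarrow> real \<Rightarrow> real" where
  "gauss_kernel U A B x y = exp (x * y / U - (A * x\<^sup>2 + B * y\<^sup>2) / 2) / sqrt (2 * pi * U)"

lemma gauss_kernel_nonneg: "0 \<le> U \<Longrightarrow> 0 \<le> gauss_kernel U A B x y"
  by (simp add: gauss_kernel_def)

lemma measurable_gauss_kernel [measurable]:
  "(\<lambda>p. gauss_kernel U A B (f p) (g p)) \<in> borel_measurable N" if "f \<in> borel_measurable N" "g \<in> borel_measurable N"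
  using that unfolding gauss_kernel_def by measurable

lemma normal_density_eq_gauss_kernel:
  "0 < h \<Longrightarrow> normal_density 0 (sqrt h) (y - x) = gauss_kernel h (1 / h) (1 / h) x y"
  by (simp add: normal_density_def gauss_kernel_def power2_diff diff_divide_distrib add_divide_distrib algebra_simps)

lemma
  fixes D b :: real
  assumes D: "0 < D"
  shows integrable_exp_quadratic: "integrable lborel (\<lambda>y. exp (b * y - D * y\<^sup>2 / 2))"
    and integral_exp_quadratic: "(LINT y|lborel. exp (b * y - D * y\<^sup>2 / 2)) = sqrt (2 * pi / D) * exp (b\<^sup>2 / (2 * D))"
proof -
  have eq: "exp (b * y - D * y\<^sup>2 / 2) = sqrt (2 * pi / D) * exp (b\<^sup>2 / (2 * D)) * normal_density (b / D) (1 / sqrt D) y" for y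
  proof -
    have "normal_density (b / D) (1 / sqrt D) y = exp (- (D * (y - b / D)\<^sup>2 / 2)) / sqrt (2 * pi / D)"
      using D by (simp add: normal_density_def power_divide)
    moreover have "b * y - D * y\<^sup>2 / 2 = b\<^sup>2 / (2 * D) + - (D * (y - b / D)\<^sup>2 / 2)"
      using D by (simp add: power2_eq_square field_simps)
    then have "exp (b * y - D * y\<^sup>2 / 2) = exp (b\<^sup>2 / (2 * D)) * exp (- (D * (y - b / D)\<^sup>2 / 2))"
      by (simp only: exp_add)
    ultimately show ?thesis using D by (simp only: mult.assoc) simp
  qed
  have "0 < 1 / sqrt D" using D by simp
  note n = integrable_normal_density[OF this, of "b / D"] integral_normal_density[OF this, of "b / D"]
  show "integrable lborel (\<lambda>y. exp (b * y - D * y\<^sup>2 / 2))"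
    unfolding eq by (intro integrable_mult_right n)
  show "(LINT y|lborel. exp (b * y - D * y\<^sup>2 / 2)) = sqrt (2 * pi / D) * exp (b\<^sup>2 / (2 * D))"
    unfolding eq by (subst integral_mult_right_zero, subst n) simp
qed

lemma integrable_gauss_kernel:
  assumes "0 < B"
  shows "integrable lborel (gauss_kernel U A B x)"
proof -
  have "gauss_kernel U A B x = (\<lambda>y. exp (- A * x\<^sup>2 / 2) / sqrt (2 * pi * U) * exp (x / U * y - B * y\<^sup>2 / 2))"
    by (rule ext) (simp add: gauss_kernel_def diff_divide_distrib add_divide_distrib flip: exp_add)
  then show ?thesis by (simp only:) (intro integrable_mult_right integrable_exp_quadratic assms)
qed

text \<open>Completing the square in \<open>y\<close>: \<open>D\<close> is the total coefficient of
  \<open>y\<^sup>2\<close>. The square of \<open>x / U + z / h\<close>, divided by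
  \<open>2 * D\<close>, supplies the new coupling through its cross term and lowers the diagonal
  coefficients through its squares.\<close>

lemma integral_gauss_kernel_normal_density:
  fixes U A B h r x z :: real
  assumes U: "0 < U" and h: "0 < h" and D: "D = B + 1 / h + 2 * r" "0 < D"
  shows "(LINT y|lborel. gauss_kernel U A B x y * exp (- r * y\<^sup>2) * normal_density 0 (sqrt h) (z - y))
     = gauss_kernel (U * h * D) (A - 1 / (U\<^sup>2 * D)) (1 / h - 1 / (h\<^sup>2 * D)) x z"
proof -
  let ?c = "exp (- A * x\<^sup>2 / 2 - z\<^sup>2 / (2 * h)) / (sqrt (2 * pi * U) * sqrt (2 * pi * h))"
  let ?b = "x / U + z / h"
  have gen: "exp a / s1 * exp b * (exp c / s2) = exp d / (s1 * s2) * exp e" if "a + b + c = d + e" for a b c d e s1 s2 :: real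
  proof -
    have "exp a * exp b * exp c = exp d * exp e" using that by (simp flip: exp_add)
    then show ?thesis by simp
  qed
  have "gauss_kernel U A B x y * exp (- r * y\<^sup>2) * normal_density 0 (sqrt h) (z - y) = ?c * exp (?b * y - D * y\<^sup>2 / 2)" for y
  proof -
    have "x * y / U - (A * x\<^sup>2 + B * y\<^sup>2) / 2 + - r * y\<^sup>2 + (y * z / h - (1 / h * y\<^sup>2 + 1 / h * z\<^sup>2) / 2)
      = (- A * x\<^sup>2 / 2 - z\<^sup>2 / (2 * h)) + (?b * y - D * y\<^sup>2 / 2)"
      unfolding D(1) using U h by (simp add: field_simps)
    then show ?thesis
      unfolding normal_density_eq_gauss_kernel[OF h] gauss_kernel_def
      by (rule gen)
  qed
  then have "(LINT y|lborel. gauss_kernel U A B x y * exp (- r * y\<^sup>2) * normal_density 0 (sqrt h) (z - y))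
     = ?c * (sqrt (2 * pi / D) * exp (?b\<^sup>2 / (2 * D)))"
    by (simp add: integral_exp_quadratic[OF D(2)])
  also have "\<dots> = (exp (- A * x\<^sup>2 / 2 - z\<^sup>2 / (2 * h)) * exp (?b\<^sup>2 / (2 * D))) * (sqrt (2 * pi / D) / (sqrt (2 * pi * U) * sqrt (2 * pi * h)))"
    by simp
  also have "sqrt (2 * pi / D) / (sqrt (2 * pi * U) * sqrt (2 * pi * h)) = 1 / sqrt (2 * pi * (U * h * D))"
  proof -
    have "(2 * pi / D) / ((2 * pi * U) * (2 * pi * h)) = 1 / (2 * pi * (U * h * D))"
      using U h D(2) by (simp add: field_simps)
    then show ?thesis by (metis real_sqrt_divide real_sqrt_mult real_sqrt_one)
  qed
  also have "exp (- A * x\<^sup>2 / 2 - z\<^sup>2 / (2 * h)) * exp (?b\<^sup>2 / (2 * D)) =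
     exp (x * z / (U * h * D) - ((A - 1 / (U\<^sup>2 * D)) * x\<^sup>2 + (1 / h - 1 / (h\<^sup>2 * D)) * z\<^sup>2) / 2)"
    unfolding exp_add[symmetric] using U h D(2) by (simp add: field_simps power2_eq_square)
  finally show ?thesis by (simp add: gauss_kernel_def)
qed

text \<open>This absorbs one weighted time step of a Gaussian chain into the kernel. The bound on
  \<open>f\<close> and the decay from \<open>B > 0\<close> justify the exchange of the
  integrals.\<close>

lemma integral_gauss_kernel_step:
  fixes f :: "real \<Rightarrow> real"
  assumes U: "0 < U" and h: "0 < h" and B: "0 < B" and r: "0 \<le> r" and D: "D = B + 1 / h + 2 * r"
    and f[measurable]: "f \<in> borel_measurable borel" and fb: "\<And>z. \<bar>f z\<bar> \<le> b"
  shows "(LINT y|lborel. gauss_kernel U A B x y * (exp (- r * y\<^sup>2) * (LINT z|lborel. normal_density 0 (sqrt h) (z - y) * f z)))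
     = (LINT z|lborel. gauss_kernel (U * h * D) (A - 1 / (U\<^sup>2 * D)) (1 / h - 1 / (h\<^sup>2 * D)) x z * f z)"
proof -
  have D0: "0 < D" using B h r D by (simp add: add_pos_nonneg)
  have b0: "0 \<le> b" using fb[of 0] by simp
  let ?n = "normal_density 0 (sqrt h)"
  have n1: "integrable lborel (\<lambda>z. ?n (z - y))" "(LINT z|lborel. ?n (z - y)) = 1" for y
  proof -
    have *: "?n (z - y) = normal_density y (sqrt h) z" for z by (simp add: normal_density_def)
    show "integrable lborel (\<lambda>z. ?n (z - y))" "(LINT z|lborel. ?n (z - y)) = 1"
      unfolding * using h by simp_all
  qed
  let ?F = "\<lambda>y z. gauss_kernel U A B x y * exp (- r * y\<^sup>2) * ?n (z - y) * f z"
  have int: "integrable (lborel \<Otimes>\<^sub>M lborel) (\<lambda>(y, z). ?F y z)"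
  proof (rule lborel_pair.Fubini_integrable)
    show "AE y in lborel. integrable lborel (\<lambda>z. case (y, z) of (y, z) \<Rightarrow> ?F y z)"
    proof (intro AE_I2)
      fix y
      show "integrable lborel (\<lambda>z. case (y, z) of (y, z) \<Rightarrow> ?F y z)"
        unfolding prod.case
      proof (rule Bochner_Integration.integrable_bound[OF integrable_mult_right[OF n1(1)[of y], of "gauss_kernel U A B x y * exp (- r * y\<^sup>2) * b"]])
        show "AE z in lborel. norm (?F y z) \<le> norm (gauss_kernel U A B x y * exp (- r * y\<^sup>2) * b * ?n (z - y))"
        proof (intro AE_I2)
          fix z
          have "norm (?F y z) = \<bar>gauss_kernel U A B x y * exp (- r * y\<^sup>2) * ?n (z - y)\<bar> * \<bar>f z\<bar>"
            by (simp add: abs_mult)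
          also have "\<dots> \<le> \<bar>gauss_kernel U A B x y * exp (- r * y\<^sup>2) * ?n (z - y)\<bar> * b"
            by (intro mult_left_mono fb) auto
          also have "\<dots> = norm (gauss_kernel U A B x y * exp (- r * y\<^sup>2) * b * ?n (z - y))"
            using b0 by (simp add: abs_mult)
          finally show "norm (?F y z) \<le> norm (gauss_kernel U A B x y * exp (- r * y\<^sup>2) * b * ?n (z - y))" .
        qed
      qed measurable
    qed
    show "integrable lborel (\<lambda>y. LINT z|lborel. norm (case (y, z) of (y, z) \<Rightarrow> ?F y z))"
      unfolding prod.case
    proof (rule Bochner_Integration.integrable_bound[OF integrable_mult_right[OF integrable_gauss_kernel[OF B, of U A x], of b]])
      show "AE y in lborel. norm (LINT z|lborel. norm (?F y z)) \<le> norm (b * gauss_kernel U A B x y)"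
      proof (intro AE_I2)
        fix y
        have g0: "0 \<le> gauss_kernel U A B x y" using U by (simp add: gauss_kernel_nonneg)
        have "(LINT z|lborel. norm (?F y z)) \<le> (LINT z|lborel. b * gauss_kernel U A B x y * ?n (z - y))"
        proof (rule integral_mono')
          fix z
          have "norm (?F y z) = gauss_kernel U A B x y * exp (- r * y\<^sup>2) * ?n (z - y) * \<bar>f z\<bar>"
            using g0 by (simp add: abs_mult)
          also have "\<dots> \<le> gauss_kernel U A B x y * 1 * ?n (z - y) * b"
            using g0 r fb b0 by (intro mult_mono) auto
          finally show "norm (?F y z) \<le> b * gauss_kernel U A B x y * ?n (z - y)" by (simp add: mult_ac)
        qed (use n1 g0 b0 in auto)
        also have "\<dots> = b * gauss_kernel U A B x y" using n1 by simp
        finally show "norm (LINT z|lborel. norm (?F y z)) \<le> norm (b * gauss_kernel U A B x y)"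
          using g0 b0 by simp
      qed
    qed measurable
  qed measurable
  have "(LINT y|lborel. gauss_kernel U A B x y * (exp (- r * y\<^sup>2) * (LINT z|lborel. ?n (z - y) * f z))) = (LINT y|lborel. LINT z|lborel. ?F y z)"
    by (simp add: mult.assoc)
  also have "\<dots> = (LINT z|lborel. LINT y|lborel. ?F y z)"
    by (rule lborel_pair.Fubini_integral[OF int, symmetric])
  also have "\<dots> = (LINT z|lborel. gauss_kernel (U * h * D) (A - 1 / (U\<^sup>2 * D)) (1 / h - 1 / (h\<^sup>2 * D)) x z * f z)"
    by (simp only: integral_mult_left_zero integral_gauss_kernel_normal_density[OF U h D D0])
  finally show ?thesis .
qed

text \<open>The upper bound is convexity of \<open>sinh\<close> on the half-line. The lower one
  combines \<open>x \<le> sinh x\<close> with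
  \<open>exp (- w) * sinh w = (1 - exp (- 2 * w)) / 2 \<le> w\<close>. Together they allow
  \<open>sinh (l * w)\<close> to be replaced by \<open>l * sinh w\<close> at the cost of a factor
  that is close to 1 for small \<open>w\<close>.\<close>

lemma sinh_scale_bounds:
  fixes w l :: real
  assumes w: "0 \<le> w" and l: "0 \<le> l" "l \<le> 1"
  shows "sinh (l * w) \<le> l * sinh w" "l * (exp (- w) * sinh w) \<le> sinh (l * w)"
proof -
  have "convex_on {0..} (sinh :: real \<Rightarrow> real)"
    by (rule f''_ge0_imp_convex[where f'=cosh and f''=sinh]) (auto intro!: derivative_eq_intros)
  from convex_onD[OF this, of l 0 w] w l show "sinh (l * w) \<le> l * sinh w" by simp
  have x: "x \<le> sinh x" if "0 \<le> x" for x :: real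
  proof -
    have "sinh 0 - 0 \<le> sinh x - x"
      by (rule DERIV_nonneg_imp_nondecreasing[OF that, where f="\<lambda>x. sinh x - x"])
         (auto intro!: exI derivative_eq_intros cosh_real_ge_1)
    then show ?thesis by simp
  qed
  have "exp (- w) * sinh w = (1 - exp (- 2 * w)) / 2"
    by (simp add: sinh_def algebra_simps flip: exp_add)
  also have "\<dots> \<le> w" using exp_ge_add_one_self[of "- 2 * w"] by simp
  finally have "l * (exp (- w) * sinh w) \<le> l * w" using l by (intro mult_left_mono)
  also have "\<dots> \<le> sinh (l * w)" using w l by (intro x) auto
  finally show "l * (exp (- w) * sinh w) \<le> sinh (l * w)" .
qed

lemma gauss_kernel_diff:
  "gauss_kernel U A B x y - gauss_kernel U A B x (- y) = 2 / sqrt (2 * pi * U) * exp (- (A * x\<^sup>2 + B * y\<^sup>2) / 2) * sinh (x * y / U)"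
proof -
  have "gauss_kernel U A B x z = exp (x * z / U) * exp (- (A * x\<^sup>2 + B * z\<^sup>2) / 2) / sqrt (2 * pi * U)" for z
  proof -
    have "x * z / U - (A * x\<^sup>2 + B * z\<^sup>2) / 2 = x * z / U + - (A * x\<^sup>2 + B * z\<^sup>2) / 2"
      by (simp only: diff_conv_add_uminus minus_divide_left)
    then show ?thesis unfolding gauss_kernel_def by (simp only: exp_add)
  qed
  note eq = this
  have gen: "e1 * q / s - e2 * q / s = 2 / s * q * ((e1 - e2) / 2)" for e1 e2 q s :: real
  proof -
    have "e1 * q / s - e2 * q / s = (e1 - e2) * q / s" by (simp only: left_diff_distrib diff_divide_distrib)
    then show ?thesis by simp
  qed
  show ?thesis
  proof -
    have "x * - y / U = - (x * y / U)" by simp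
    then have "gauss_kernel U A B x (- y) = exp (- (x * y / U)) * exp (- (A * x\<^sup>2 + B * y\<^sup>2) / 2) / sqrt (2 * pi * U)"
      by (simp only: eq[of "- y"] power2_minus)
    then show ?thesis by (simp only: eq[of y] gen sinh_field_def)
  qed
qed

text \<open>For the heat kernel the difference at \<open>y\<close> and \<open>- y\<close> is the
  kernel of Brownian motion absorbed at 0. Passing from the coupling \<open>1 / T\<close> to
  \<open>1 / U\<close> costs \<open>(T / U) powr (1/2)\<close> in the normalization and
  \<open>T / U\<close> in \<open>sinh\<close>. The exponent \<open>e\<close> collects the excess of
  the diagonal coefficients over \<open>1 / T\<close> and the error of linearizing
  \<open>sinh\<close>.\<close>

lemma gauss_kernel_diff_bounds:
  assumes T: "0 < T" "T \<le> U" and A: "1 / T \<le> A" and B: "1 / T \<le> B" and xy: "0 \<le> x" "0 \<le> y"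
    and e: "(A - 1 / T) * x\<^sup>2 / 2 + (B - 1 / T) * y\<^sup>2 / 2 + x * y / T \<le> e"
  defines "d \<equiv> gauss_kernel U A B x y - gauss_kernel U A B x (- y)"
    and "d0 \<equiv> gauss_kernel T (1 / T) (1 / T) x y - gauss_kernel T (1 / T) (1 / T) x (- y)"
  shows "d \<le> (T / U) powr (3/2) * d0" "exp (- e) * ((T / U) powr (3/2) * d0) \<le> d" "0 \<le> d0"
proof -
  define w where "w = x * y / T"
  have w: "0 \<le> w" using T xy by (simp add: w_def)
  define l where "l = T / U"
  have l: "0 < l" "l \<le> 1" using T by (auto simp: l_def)
  define E0 where "E0 = exp (- (1 / T * x\<^sup>2 + 1 / T * y\<^sup>2) / 2)"
  define E where "E = exp (- ((A - 1 / T) * x\<^sup>2 / 2 + (B - 1 / T) * y\<^sup>2 / 2))"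
  have "exp (- (A * x\<^sup>2 + B * y\<^sup>2) / 2) = E0 * E"
    unfolding E0_def E_def exp_add[symmetric] by (simp add: algebra_simps add_divide_distrib diff_divide_distrib)
  moreover have "x * y / U = l * w" using T by (simp add: l_def w_def)
  moreover have "2 / sqrt (2 * pi * U) = 2 / sqrt (2 * pi * T) * sqrt l"
    using T by (simp add: l_def real_sqrt_mult real_sqrt_divide)
  ultimately have d: "d = 2 / sqrt (2 * pi * T) * sqrt l * (E0 * E) * sinh (l * w)"
    unfolding d_def gauss_kernel_diff by simp
  have d0: "d0 = 2 / sqrt (2 * pi * T) * E0 * sinh w"
    unfolding d0_def gauss_kernel_diff E0_def w_def by simp
  show d00: "0 \<le> d0" unfolding d0 using T w by (simp add: E0_def)
  have "0 \<le> (A - 1 / T) * x\<^sup>2 / 2 + (B - 1 / T) * y\<^sup>2 / 2"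
    using A B by (intro add_nonneg_nonneg divide_nonneg_nonneg mult_nonneg_nonneg) auto
  then have E1: "E \<le> 1" unfolding E_def exp_le_one_iff by linarith
  have E2: "exp (- e) \<le> E * exp (- w)" using e by (simp add: E_def w_def flip: exp_add)
  have l32: "l powr (3/2) = sqrt l * l"
  proof -
    have "l powr (1/2 + 1) = sqrt l * l" unfolding powr_add using l by (simp add: powr_half_sqrt)
    then show ?thesis by simp
  qed
  have c0: "0 \<le> 2 / sqrt (2 * pi * T) * sqrt l * E0" using T l by (simp add: E0_def)
  have "d = 2 / sqrt (2 * pi * T) * sqrt l * E0 * (E * sinh (l * w))" unfolding d by simp
  also have "\<dots> \<le> 2 / sqrt (2 * pi * T) * sqrt l * E0 * (1 * (l * sinh w))"
    using sinh_scale_bounds(1)[OF w, of l] l w E1 by (intro mult_left_mono[OF _ c0] mult_mono) auto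
  also have "\<dots> = (T / U) powr (3/2) * d0" unfolding l_def[symmetric] l32 d0 by simp
  finally show "d \<le> (T / U) powr (3/2) * d0" .
  have "exp (- e) * ((T / U) powr (3/2) * d0) = 2 / sqrt (2 * pi * T) * sqrt l * E0 * (exp (- e) * (l * sinh w))"
    unfolding l_def[symmetric] l32 d0 by simp
  also have "\<dots> \<le> 2 / sqrt (2 * pi * T) * sqrt l * E0 * ((E * exp (- w)) * (l * sinh w))"
    using E2 l w by (intro mult_left_mono[OF _ c0] mult_right_mono) auto
  also have "\<dots> = 2 / sqrt (2 * pi * T) * sqrt l * E0 * (E * (l * (exp (- w) * sinh w)))" by simp
  also have "\<dots> \<le> 2 / sqrt (2 * pi * T) * sqrt l * E0 * (E * sinh (l * w))"
    using sinh_scale_bounds(2)[OF w, of l] l by (intro mult_left_mono[OF _ c0] mult_left_mono) (auto simp: E_def)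
  also have "\<dots> = d" unfolding d by simp
  finally show "exp (- e) * ((T / U) powr (3/2) * d0) \<le> d" .
qed

text \<open>On odd functions the kernel acts as \<open>sinh (x * y / U)\<close>, which for small arguments is proportional to \<open>1 / U\<close>;
  together with the normalization \<open>1 / sqrt U\<close> this yields the exponent 3/2.\<close>

lemma integral_odd_kernel_bounds:
  fixes \<phi> :: "real \<Rightarrow> real"
  assumes T: "0 < T" "T \<le> U" and A: "1 / T \<le> A" and B: "1 / T \<le> B"
    and \<phi>[measurable]: "\<phi> \<in> borel_measurable borel" and odd: "\<And>y. \<phi> (- y) = - \<phi> y" and pos: "\<And>y. 0 \<le> y \<Longrightarrow> 0 \<le> \<phi> y"
    and bnd: "\<And>y. \<phi> y \<le> b" and supp: "\<And>y. \<rho> < \<bar>y\<bar> \<Longrightarrow> \<phi> y = 0"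
    and x: "\<bar>x\<bar> \<le> \<rho>"
    and e: "(A - 1 / T) * \<rho>\<^sup>2 / 2 + (B - 1 / T) * \<rho>\<^sup>2 / 2 + \<rho>\<^sup>2 / T \<le> e"
  defines "I \<equiv> (LINT y|lborel. gauss_kernel U A B x y * \<phi> y)"
    and "I0 \<equiv> (LINT y|lborel. gauss_kernel T (1 / T) (1 / T) x y * \<phi> y)"
  shows "sgn x * I \<le> (T / U) powr (3/2) * (sgn x * I0)" "exp (- e) * ((T / U) powr (3/2) * (sgn x * I0)) \<le> sgn x * I" "0 \<le> sgn x * I0"
proof -
  have b: "\<bar>\<phi> y\<bar> \<le> b" for y
    using bnd[of y] bnd[of "- y"] odd[of y] by linarith
  \<comment> \<open>Against an odd \<open>\<phi>\<close> only the odd part of the kernel counts.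
    Folding onto \<open>y \<ge> 0\<close> and \<open>\<bar>x\<bar>\<close> makes all factors
    nonnegative, so that the pointwise bounds can be integrated.\<close>
  have fold: "(LINT y|lborel. gauss_kernel U A B x y * \<phi> y) = sgn x *
      (LINT y|lborel. indicator {0..} y * ((gauss_kernel U A B \<bar>x\<bar> y - gauss_kernel U A B \<bar>x\<bar> (- y)) * \<phi> y))"
    and fint: "integrable lborel (\<lambda>y. indicator {0..} y * ((gauss_kernel U A B \<bar>x\<bar> y - gauss_kernel U A B \<bar>x\<bar> (- y)) * \<phi> y))"
    if "0 < B" for U A B
  proof -
    have i: "integrable lborel (\<lambda>y. gauss_kernel U A B v y * \<phi> y)" for v
      by (rule Bochner_Integration.integrable_bound[OF integrable_mult_right[OF integrable_gauss_kernel[OF that, of U A v], of b]])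
         (use b in \<open>auto simp: abs_mult mult.commute[of b] intro!: mult_left_mono AE_I2 order_trans[OF b abs_ge_self]\<close>)
    have i': "integrable lborel (\<lambda>y. gauss_kernel U A B v (- y) * \<phi> y)" for v
      using lborel_integrable_real_affine[OF i[of v], of "-1" 0] odd by simp
    have ii: "integrable lborel (\<lambda>y. (gauss_kernel U A B v y - gauss_kernel U A B v (- y)) * \<phi> y)" for v
      using Bochner_Integration.integrable_diff[OF i i'] by (simp add: left_diff_distrib)
    show "integrable lborel (\<lambda>y. indicator {0..} y * ((gauss_kernel U A B \<bar>x\<bar> y - gauss_kernel U A B \<bar>x\<bar> (- y)) * \<phi> y))"
      using integrable_mult_indicator[of "{0..}" lborel, OF _ ii[of "\<bar>x\<bar>"]] by simp
    have g: "gauss_kernel U A B (- v) y = gauss_kernel U A B v (- y)" for v y by (simp add: gauss_kernel_def)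
    have half: "(LINT y|lborel. gauss_kernel U A B v y * \<phi> y) =
       (LINT y|lborel. indicator {0..} y * ((gauss_kernel U A B v y - gauss_kernel U A B v (- y)) * \<phi> y))" for v
    proof -
      have "(LINT y|lborel. gauss_kernel U A B v y * \<phi> y) =
         (LINT y|lborel. indicator {0..} y * (gauss_kernel U A B v y * \<phi> y) + indicator {..<0} y * (gauss_kernel U A B v y * \<phi> y))"
        by (intro Bochner_Integration.integral_cong) (auto simp: indicator_def)
      also have "\<dots> = (LINT y|lborel. indicator {0..} y * (gauss_kernel U A B v y * \<phi> y)) + (LINT y|lborel. indicator {..<0} y * (gauss_kernel U A B v y * \<phi> y))"
        using integrable_mult_indicator[of "{0..}" lborel, OF _ i[of v]] integrable_mult_indicator[of "{..<0}" lborel, OF _ i[of v]]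
        by (intro Bochner_Integration.integral_add) simp_all
      also have "(LINT y|lborel. indicator {..<0} y * (gauss_kernel U A B v y * \<phi> y)) =
          (LINT y|lborel. - (indicator {0<..} y * (gauss_kernel U A B v (- y) * \<phi> y)))"
        by (subst lborel_integral_real_affine[where c="-1" and t=0])
           (auto intro!: Bochner_Integration.integral_cong simp: indicator_def odd)
      also have "\<dots> = (LINT y|lborel. - (indicator {0..} y * (gauss_kernel U A B v (- y) * \<phi> y)))"
        using AE_lborel_singleton[of 0]
        by (intro integral_cong_AE) (auto simp: indicator_def elim!: eventually_mono)
      also have "(LINT y|lborel. indicator {0..} y * (gauss_kernel U A B v y * \<phi> y)) + \<dots> =
         (LINT y|lborel. indicator {0..} y * (gauss_kernel U A B v y * \<phi> y) + - (indicator {0..} y * (gauss_kernel U A B v (- y) * \<phi> y)))"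
        using integrable_mult_indicator[of "{0..}" lborel, OF _ i[of v]] integrable_mult_indicator[of "{0..}" lborel, OF _ i'[of v]]
        by (intro Bochner_Integration.integral_add[symmetric]) simp_all
      finally show ?thesis by (simp add: algebra_simps)
    qed
    show "(LINT y|lborel. gauss_kernel U A B x y * \<phi> y) = sgn x *
      (LINT y|lborel. indicator {0..} y * ((gauss_kernel U A B \<bar>x\<bar> y - gauss_kernel U A B \<bar>x\<bar> (- y)) * \<phi> y))"
    proof (cases "0 < x" "x = 0" rule: bool.exhaust[case_product bool.exhaust])
      case True_True then show ?thesis using half[of x] by simp
    next
      case True_False then show ?thesis using half[of x] by simp
    next
      case False_True then show ?thesis using half[of x] by (simp add: gauss_kernel_def)
    next
      case False_False
      then have "x < 0" by simp
      then show ?thesis using half[of x] g[of "- x"] by (simp flip: Bochner_Integration.integral_minus add: algebra_simps)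
    qed
  qed
  have T': "0 < 1 / T" using T by simp
  have B0: "0 < B" using B T' by linarith
  define J where "J = (LINT y|lborel. indicator {0..} y * ((gauss_kernel U A B \<bar>x\<bar> y - gauss_kernel U A B \<bar>x\<bar> (- y)) * \<phi> y))"
  define J0 where "J0 = (LINT y|lborel. indicator {0..} y * ((gauss_kernel T (1/T) (1/T) \<bar>x\<bar> y - gauss_kernel T (1/T) (1/T) \<bar>x\<bar> (- y)) * \<phi> y))"
  note fi = fint[OF B0, of U A] fint[OF T', of T "1/T"]
  have pt: "(gauss_kernel U A B \<bar>x\<bar> y - gauss_kernel U A B \<bar>x\<bar> (- y)) * \<phi> y \<le> (T / U) powr (3/2) * ((gauss_kernel T (1/T) (1/T) \<bar>x\<bar> y - gauss_kernel T (1/T) (1/T) \<bar>x\<bar> (- y)) * \<phi> y)"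
       "exp (- e) * ((T / U) powr (3/2) * ((gauss_kernel T (1/T) (1/T) \<bar>x\<bar> y - gauss_kernel T (1/T) (1/T) \<bar>x\<bar> (- y)) * \<phi> y)) \<le> (gauss_kernel U A B \<bar>x\<bar> y - gauss_kernel U A B \<bar>x\<bar> (- y)) * \<phi> y"
       "0 \<le> (gauss_kernel T (1/T) (1/T) \<bar>x\<bar> y - gauss_kernel T (1/T) (1/T) \<bar>x\<bar> (- y)) * \<phi> y" if y: "0 \<le> y" for y
  proof -
    have "(gauss_kernel U A B \<bar>x\<bar> y - gauss_kernel U A B \<bar>x\<bar> (- y)) * \<phi> y \<le> (T / U) powr (3/2) * ((gauss_kernel T (1/T) (1/T) \<bar>x\<bar> y - gauss_kernel T (1/T) (1/T) \<bar>x\<bar> (- y)) * \<phi> y)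
       \<and> exp (- e) * ((T / U) powr (3/2) * ((gauss_kernel T (1/T) (1/T) \<bar>x\<bar> y - gauss_kernel T (1/T) (1/T) \<bar>x\<bar> (- y)) * \<phi> y)) \<le> (gauss_kernel U A B \<bar>x\<bar> y - gauss_kernel U A B \<bar>x\<bar> (- y)) * \<phi> y
       \<and> 0 \<le> (gauss_kernel T (1/T) (1/T) \<bar>x\<bar> y - gauss_kernel T (1/T) (1/T) \<bar>x\<bar> (- y)) * \<phi> y"
    proof (cases "y \<le> \<rho>")
      case True
      have "\<bar>x\<bar>\<^sup>2 \<le> \<rho>\<^sup>2" using x by (intro power_mono) auto
      moreover have "y\<^sup>2 \<le> \<rho>\<^sup>2" using True y by (intro power_mono) auto
      moreover have "\<bar>x\<bar> * y \<le> \<rho>\<^sup>2" unfolding power2_eq_square using x y True by (intro mult_mono) auto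
      ultimately have "(A - 1 / T) * \<bar>x\<bar>\<^sup>2 / 2 + (B - 1 / T) * y\<^sup>2 / 2 + \<bar>x\<bar> * y / T \<le>
          (A - 1 / T) * \<rho>\<^sup>2 / 2 + (B - 1 / T) * \<rho>\<^sup>2 / 2 + \<rho>\<^sup>2 / T"
        using A B T(1) by (intro add_mono divide_right_mono mult_left_mono) auto
      also note e
      finally have e': "(A - 1 / T) * \<bar>x\<bar>\<^sup>2 / 2 + (B - 1 / T) * y\<^sup>2 / 2 + \<bar>x\<bar> * y / T \<le> e" .
      note bb = gauss_kernel_diff_bounds[OF T A B abs_ge_zero y e']
      show ?thesis
        using mult_right_mono[OF bb(1) pos[OF y]] mult_right_mono[OF bb(2) pos[OF y]] mult_nonneg_nonneg[OF bb(3) pos[OF y]]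
        by (simp add: mult.assoc)
    next
      case False
      then have "\<phi> y = 0" using y by (intro supp) auto
      then show ?thesis by simp
    qed
    then show "(gauss_kernel U A B \<bar>x\<bar> y - gauss_kernel U A B \<bar>x\<bar> (- y)) * \<phi> y \<le> (T / U) powr (3/2) * ((gauss_kernel T (1/T) (1/T) \<bar>x\<bar> y - gauss_kernel T (1/T) (1/T) \<bar>x\<bar> (- y)) * \<phi> y)"
       "exp (- e) * ((T / U) powr (3/2) * ((gauss_kernel T (1/T) (1/T) \<bar>x\<bar> y - gauss_kernel T (1/T) (1/T) \<bar>x\<bar> (- y)) * \<phi> y)) \<le> (gauss_kernel U A B \<bar>x\<bar> y - gauss_kernel U A B \<bar>x\<bar> (- y)) * \<phi> y"
       "0 \<le> (gauss_kernel T (1/T) (1/T) \<bar>x\<bar> y - gauss_kernel T (1/T) (1/T) \<bar>x\<bar> (- y)) * \<phi> y"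
      by blast+
  qed
  have J1: "J \<le> (T / U) powr (3/2) * J0"
  proof -
    have "J \<le> (LINT y|lborel. (T / U) powr (3/2) * (indicator {0..} y * ((gauss_kernel T (1/T) (1/T) \<bar>x\<bar> y - gauss_kernel T (1/T) (1/T) \<bar>x\<bar> (- y)) * \<phi> y)))"
      unfolding J_def by (intro integral_mono fi integrable_mult_right) (use pt(1) in \<open>auto simp: indicator_def\<close>)
    then show ?thesis by (simp add: J0_def)
  qed
  have J2: "exp (- e) * ((T / U) powr (3/2) * J0) \<le> J"
  proof -
    have "(LINT y|lborel. exp (- e) * ((T / U) powr (3/2) * (indicator {0..} y * ((gauss_kernel T (1/T) (1/T) \<bar>x\<bar> y - gauss_kernel T (1/T) (1/T) \<bar>x\<bar> (- y)) * \<phi> y)))) \<le> J"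
      unfolding J_def by (intro integral_mono fi integrable_mult_right) (use pt(2) in \<open>auto simp: indicator_def\<close>)
    then show ?thesis by (simp add: J0_def)
  qed
  have J3: "0 \<le> J0" unfolding J0_def using pt(3) by (intro Bochner_Integration.integral_nonneg) (auto simp: indicator_def)
  have s: "sgn x * I = \<bar>sgn x\<bar> * J" "sgn x * I0 = \<bar>sgn x\<bar> * J0"
    unfolding I_def I0_def fold[OF B0] fold[OF T'] J_def J0_def by (auto simp: sgn_if)
  show "sgn x * I \<le> (T / U) powr (3/2) * (sgn x * I0)" "exp (- e) * ((T / U) powr (3/2) * (sgn x * I0)) \<le> sgn x * I" "0 \<le> sgn x * I0"
    unfolding s using J1 J2 J3 by (auto simp: sgn_if)
qed

section \<open>Brownian motion and reflection\<close>

abbreviation path_space :: "(nat \<Rightarrow> real) measure" where "path_space \<equiv> PiM UNIV (\<lambda>_. borel)"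

definition gaussian :: "real \<Rightarrow> real measure" where
  "gaussian u = density lborel (\<lambda>x. ennreal (normal_density 0 (sqrt u) x))"

definition depends_upto :: "nat \<Rightarrow> ((nat \<Rightarrow> real) \<Rightarrow> real) \<Rightarrow> bool" where
  "depends_upto K G \<longleftrightarrow> (\<forall>x y. (\<forall>k\<le>K. x k = y k) \<longrightarrow> G x = G y)"

text \<open>\<open>min\<close> freezes the walk at time \<open>K\<close>, which makes the result a
  total sequence in \<open>path_space\<close> although only the increments below \<open>K\<close>
  are given.\<close>

definition partial_sums :: "nat \<Rightarrow> (nat \<Rightarrow> real) \<Rightarrow> nat \<Rightarrow> real" where
  "partial_sums K x k = (\<Sum>l<min k K. x l)"

definition reflect_after :: "nat \<Rightarrow> (nat \<Rightarrow> real) \<Rightarrow> nat \<Rightarrow> real" where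
  "reflect_after m x k = (if k \<le> m then x k else 2 * x m - x k)"

definition heat :: "real \<Rightarrow> (real \<Rightarrow> real) \<Rightarrow> real \<Rightarrow> real" where
  "heat h f x = (LINT z|lborel. normal_density 0 (sqrt h) (z - x) * f z)"

lemma depends_uptoD: "depends_upto K G \<Longrightarrow> (\<And>k. k \<le> K \<Longrightarrow> x k = y k) \<Longrightarrow> G x = G y"
  by (auto simp: depends_upto_def)

lemma prob_space_gaussian: "0 < u \<Longrightarrow> prob_space (gaussian u)"
  unfolding gaussian_def by (rule prob_space_normal_density) simp

lemma sets_gaussian [simp, measurable_cong]: "sets (gaussian u) = sets borel"
  and space_gaussian [simp]: "space (gaussian u) = UNIV"
  by (simp_all add: gaussian_def)

lemma uminus_vimage_borel: "A \<in> sets borel \<Longrightarrow> (\<lambda>x::real. - x) -` A \<in> sets borel"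
  using measurable_sets_borel[of "\<lambda>x::real. - x" borel A] by simp

lemma distr_uminus_gaussian: "distr (gaussian u) borel (\<lambda>x. - x) = gaussian u"
proof (rule measure_eqI)
  fix A assume "A \<in> sets (distr (gaussian u) borel (\<lambda>x. - x))"
  then have A[measurable]: "A \<in> sets borel" by simp
  note A'[measurable] = uminus_vimage_borel[OF A]
  have "emeasure (distr (gaussian u) borel (\<lambda>x. - x)) A = emeasure (gaussian u) ((\<lambda>x. - x) -` A)"
    by (subst emeasure_distr) auto
  also have "\<dots> = (\<integral>\<^sup>+x. ennreal (normal_density 0 (sqrt u) x) * indicator ((\<lambda>x. - x) -` A) x \<partial>lborel)"
    unfolding gaussian_def by (rule emeasure_density) auto
  also have "\<dots> = (\<integral>\<^sup>+x. ennreal (normal_density 0 (sqrt u) (0 + (-1) * x)) * indicator ((\<lambda>x. - x) -` A) (0 + (-1) * x) \<partial>lborel)"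
    by (subst nn_integral_real_affine[where c="-1" and t=0]) auto
  also have "\<dots> = (\<integral>\<^sup>+x. ennreal (normal_density 0 (sqrt u) x) * indicator A x \<partial>lborel)"
    by (intro nn_integral_cong) (auto simp: normal_density_def indicator_def)
  also have "\<dots> = emeasure (gaussian u) A"
    unfolding gaussian_def by (rule emeasure_density[symmetric]) auto
  finally show "emeasure (distr (gaussian u) borel (\<lambda>x. - x)) A = emeasure (gaussian u) A" .
qed simp

lemma heat_measurable [measurable]:
  assumes [measurable]: "f \<in> borel_measurable borel"
  shows "heat h f \<in> borel_measurable borel"
  unfolding heat_def[abs_def] by measurable

lemma heat_bound:
  assumes h: "0 < h" and f[measurable]: "f \<in> borel_measurable borel" and b: "\<And>x. \<bar>f x\<bar> \<le> b"
  shows "\<bar>heat h f x\<bar> \<le> b"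
proof -
  let ?n = "normal_density 0 (sqrt h)"
  have *: "?n (z - x) = normal_density x (sqrt h) z" for z by (simp add: normal_density_def)
  have n1: "integrable lborel (\<lambda>z. ?n (z - x))" "(LINT z|lborel. ?n (z - x)) = 1"
    unfolding * using h by simp_all
  have "\<bar>heat h f x\<bar> \<le> (LINT z|lborel. \<bar>?n (z - x) * f z\<bar>)"
    unfolding heat_def by (rule integral_abs_bound)
  also have "\<dots> \<le> (LINT z|lborel. ?n (z - x) * b)"
    by (rule integral_mono') (use n1 b order_trans[OF abs_ge_zero b[of 0]] in \<open>auto simp: abs_mult intro!: mult_left_mono\<close>)
  also have "\<dots> = b" using n1 by simp
  finally show ?thesis .
qed

lemma integral_gaussian_shift:
  assumes "0 < h" and [measurable]: "f \<in> borel_measurable borel"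
  shows "(LINT y|gaussian h. f (x + y)) = heat h f x"
proof -
  have "(LINT y|gaussian h. f (x + y)) = (LINT y|lborel. normal_density 0 (sqrt h) y * f (x + y))"
    unfolding gaussian_def by (subst integral_density) auto
  also have "\<dots> = heat h f x"
    unfolding heat_def by (subst lborel_integral_real_affine[where c=1 and t="-x"]) auto
  finally show ?thesis .
qed

lemma measurable_partial_sums [measurable]:
  "partial_sums K \<in> measurable (PiM {..<K} (\<lambda>_. borel)) path_space"
  unfolding partial_sums_def[abs_def] by (intro measurable_PiM_single') (auto intro!: borel_measurable_sum)

lemma measurable_reflect_after [measurable]: "reflect_after m \<in> measurable path_space path_space"
  unfolding reflect_after_def[abs_def] by (intro measurable_PiM_single') auto

lemma reflect_partial_sums:
  assumes "m \<le> K" "k \<le> K"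
  shows "partial_sums K (\<lambda>l\<in>{..<K}. if l < m then x l else - x l) k = reflect_after m (partial_sums K x) k"
proof (cases "k \<le> m")
  case True
  then show ?thesis using assms by (auto simp: partial_sums_def reflect_after_def intro!: sum.cong)
next
  case False
  have split: "{..<k} = {..<m} \<union> {m..<k}" using False by auto
  have "(\<Sum>l<k. (\<lambda>l\<in>{..<K}. if l < m then x l else - x l) l) = (\<Sum>l<m. x l) - (\<Sum>l=m..<k. x l)"
    unfolding split using assms
    by (subst sum.union_disjoint) (auto simp: sum_negf[symmetric] intro!: arg_cong2[where f="(+)"] sum.cong)
  moreover have "(\<Sum>l<k. x l) = (\<Sum>l<m. x l) + (\<Sum>l=m..<k. x l)"
    unfolding split by (subst sum.union_disjoint) auto
  ultimately show ?thesis
    using False assms by (simp add: partial_sums_def reflect_after_def min_absorb1)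
qed

text \<open>Flipping the increments from index \<open>m\<close> on is reflection of the path after
  time \<open>m\<close>. On rectangles the invariance reduces to the symmetry of each Gaussian
  factor.\<close>

lemma distr_flip_PiM_gaussian:
  fixes K m :: nat
  assumes u: "0 < u"
  shows "distr (PiM {..<K} (\<lambda>_. gaussian u)) (PiM {..<K} (\<lambda>_. borel)) (\<lambda>x. \<lambda>l\<in>{..<K}. if l < m then x l else - x l)
     = PiM {..<K} (\<lambda>_. gaussian u)"
proof -
  interpret N: prob_space "gaussian u" by (rule prob_space_gaussian[OF u])
  interpret S: product_sigma_finite "\<lambda>_::nat. gaussian u"
    unfolding product_sigma_finite_def by (intro allI N.sigma_finite_measure_axioms)
  let ?T = "\<lambda>x. \<lambda>l\<in>{..<K}. if l < m then x l else - x l :: real"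
  have T[measurable]: "?T \<in> measurable (PiM {..<K} (\<lambda>_. gaussian u)) (PiM {..<K} (\<lambda>_. borel))"
    by (intro measurable_restrict) measurable
  show ?thesis
  proof (rule S.PiM_eqI)
    fix A assume A: "\<And>i. i \<in> {..<K} \<Longrightarrow> A i \<in> sets (gaussian u)"
    let ?A = "\<lambda>l. if l < m then A l else (\<lambda>x. - x) -` A l"
    have A': "?A i \<in> sets (gaussian u)" if "i \<in> {..<K}" for i
      using A[OF that] by (auto intro: uminus_vimage_borel)
    have "emeasure (distr (PiM {..<K} (\<lambda>_. gaussian u)) (PiM {..<K} (\<lambda>_. borel)) ?T) (Pi\<^sub>E {..<K} A)
       = emeasure (PiM {..<K} (\<lambda>_. gaussian u)) (?T -` (Pi\<^sub>E {..<K} A) \<inter> space (PiM {..<K} (\<lambda>_. gaussian u)))"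
      using A by (intro emeasure_distr) (auto intro!: sets_PiM_I_finite)
    also have "?T -` (Pi\<^sub>E {..<K} A) \<inter> space (PiM {..<K} (\<lambda>_. gaussian u)) = Pi\<^sub>E {..<K} ?A"
    proof -
      have "(if l < m then x l else - x l) \<in> A l \<longleftrightarrow> x l \<in> ?A l" for l and x :: "nat \<Rightarrow> real"
        by (cases "l < m") (simp_all only: if_True if_False vimage_eq)
      then have "?T x \<in> Pi\<^sub>E {..<K} A \<and> x \<in> Pi\<^sub>E {..<K} (\<lambda>_. UNIV) \<longleftrightarrow> x \<in> Pi\<^sub>E {..<K} ?A" for x
        unfolding PiE_iff by (simp only: restrict_apply restrict_extensional UNIV_I simp_thms if_True cong: ball_cong) blast
      then show ?thesis unfolding space_PiM space_gaussian by (intro set_eqI) (simp only: Int_iff vimage_eq)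
    qed
    also have "emeasure (PiM {..<K} (\<lambda>_. gaussian u)) (Pi\<^sub>E {..<K} ?A) = (\<Prod>i<K. emeasure (gaussian u) (?A i))"
      using A' by (intro S.emeasure_PiM) auto
    also have "\<dots> = (\<Prod>i<K. emeasure (gaussian u) (A i))"
    proof (intro prod.cong refl)
      fix i assume i: "i \<in> {..<K}"
      have "emeasure (gaussian u) ((\<lambda>x. - x) -` A i) = emeasure (distr (gaussian u) borel (\<lambda>x. - x)) (A i)"
        using A[OF i] by (subst emeasure_distr) auto
      then show "emeasure (gaussian u) (?A i) = emeasure (gaussian u) (A i)"
        by (simp add: distr_uminus_gaussian)
    qed
    finally show "emeasure (distr (PiM {..<K} (\<lambda>_. gaussian u)) (PiM {..<K} (\<lambda>_. borel)) ?T) (Pi\<^sub>E {..<K} A)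
       = (\<Prod>i\<in>{..<K}. emeasure (gaussian u) (A i))" .
  qed (auto intro!: sets_PiM_cong)
qed

section \<open>Equidistant grids and Gaussian chains\<close>

text \<open>The start at 0 and continuity hold at every point, so that pathwise arguments carry no
  exceptional set. The law is recorded through increments on equidistant grids, as every expectation
  is evaluated on such a grid.\<close>

locale continuous_brownian_motion = prob_space M for M :: "'a measure" +
  fixes X :: "real \<Rightarrow> 'a \<Rightarrow> real"
  assumes X_measurable: "\<And>t. 0 \<le> t \<Longrightarrow> X t \<in> borel_measurable M"
    and X_0 [simp]: "\<And>\<omega>. X 0 \<omega> = 0"
    and X_continuous: "\<And>\<omega>. continuous_on {0..} (\<lambda>t. X t \<omega>)"
    and X_increments: "\<And>u K. 0 < u \<Longrightarrow> 0 < K \<Longrightarrow>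
      distr M (PiM {..<K} (\<lambda>_. borel)) (\<lambda>\<omega>. \<lambda>l\<in>{..<K}. X (real (Suc l) * u) \<omega> - X (real l * u) \<omega>)
        = PiM {..<K} (\<lambda>_. gaussian u)"
begin

definition grid :: "real \<Rightarrow> 'a \<Rightarrow> nat \<Rightarrow> real" where
  "grid u \<omega> k = X (real k * u) \<omega>"

lemma measurable_grid: "0 < u \<Longrightarrow> grid u \<in> measurable M path_space"
  unfolding grid_def[abs_def] by (intro measurable_PiM_single') (auto intro: X_measurable)

lemma borel_measurable_grid: "0 < u \<Longrightarrow> (\<lambda>\<omega>. grid u \<omega> k) \<in> borel_measurable M"
  unfolding grid_def by (auto intro: X_measurable)

lemma partial_sums_increments:
  assumes "k \<le> K"
  shows "partial_sums K (\<lambda>l\<in>{..<K}. X (real (Suc l) * u) \<omega> - X (real l * u) \<omega>) k = grid u \<omega> k"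
proof -
  have "partial_sums K (\<lambda>l\<in>{..<K}. X (real (Suc l) * u) \<omega> - X (real l * u) \<omega>) k =
      (\<Sum>l<k. X (real (Suc l) * u) \<omega> - X (real l * u) \<omega>)"
    using assms unfolding partial_sums_def by (intro sum.cong) (auto simp: min_absorb1)
  also have "\<dots> = X (real k * u) \<omega>"
    by (subst sum_lessThan_telescope[where f="\<lambda>l. X (real l * u) \<omega>"]) simp
  finally show ?thesis by (simp add: grid_def)
qed

lemma expectation_grid:
  assumes u: "0 < u" and K: "0 < K" and [measurable]: "G \<in> borel_measurable path_space" and dep: "depends_upto K G"
  shows "expectation (\<lambda>\<omega>. G (grid u \<omega>)) = (LINT x|PiM {..<K} (\<lambda>_. gaussian u). G (partial_sums K x))"
proof -
  let ?I = "\<lambda>\<omega>. \<lambda>l\<in>{..<K}. X (real (Suc l) * u) \<omega> - X (real l * u) \<omega>"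
  have I: "?I \<in> measurable M (PiM {..<K} (\<lambda>_. borel))"
    using u by (intro measurable_restrict borel_measurable_diff X_measurable) auto
  have "expectation (\<lambda>\<omega>. G (grid u \<omega>)) = expectation (\<lambda>\<omega>. G (partial_sums K (?I \<omega>)))"
    by (intro Bochner_Integration.integral_cong refl depends_uptoD[OF dep] partial_sums_increments[symmetric])
  also have "\<dots> = (LINT x|distr M (PiM {..<K} (\<lambda>_. borel)) ?I. G (partial_sums K x))"
    by (rule integral_distr[OF I, symmetric]) measurable
  finally show ?thesis unfolding X_increments[OF u K] .
qed

text \<open>The reflection index is deterministic; a random first hitting index is later treated by
  summing over its values, which takes the place of the strong Markov property.\<close>

lemma expectation_reflect:
  assumes u: "0 < u" and K: "0 < K" and G[measurable]: "G \<in> borel_measurable path_space" and dep: "depends_upto K G" and m: "m \<le> K"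
  shows "expectation (\<lambda>\<omega>. G (reflect_after m (grid u \<omega>))) = expectation (\<lambda>\<omega>. G (grid u \<omega>))"
proof -
  let ?P = "PiM {..<K} (\<lambda>_. gaussian u)"
  let ?T = "\<lambda>x. \<lambda>l\<in>{..<K}. if l < m then x l else - x l :: real"
  have T: "?T \<in> measurable ?P (PiM {..<K} (\<lambda>_. borel))"
    by (intro measurable_restrict) measurable
  have "depends_upto K (\<lambda>x. G (reflect_after m x))"
    unfolding depends_upto_def using m by (auto intro!: depends_uptoD[OF dep] simp: reflect_after_def)
  then have "expectation (\<lambda>\<omega>. G (reflect_after m (grid u \<omega>))) = (LINT x|?P. G (reflect_after m (partial_sums K x)))"
    by (intro expectation_grid[OF u K]) auto
  also have "\<dots> = (LINT x|?P. G (partial_sums K (?T x)))"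
    by (intro Bochner_Integration.integral_cong refl depends_uptoD[OF dep] reflect_partial_sums[OF m, symmetric])
  also have "\<dots> = (LINT x|distr ?P (PiM {..<K} (\<lambda>_. borel)) ?T. G (partial_sums K x))"
    by (rule integral_distr[OF T, symmetric]) measurable
  also have "\<dots> = expectation (\<lambda>\<omega>. G (grid u \<omega>))"
    unfolding distr_flip_PiM_gaussian[OF u] by (rule expectation_grid[OF u K G dep, symmetric])
  finally show ?thesis .
qed

text \<open>Fubini over the last increment: the functional \<open>G\<close> of the past does not see
  it, and integrating it out is one application of \<open>heat u\<close>.\<close>

lemma markov_step:
  assumes u: "0 < u" and G[measurable]: "G \<in> borel_measurable path_space" and dep: "depends_upto k G"
    and Gb: "\<And>x. \<bar>G x\<bar> \<le> b" and f[measurable]: "f \<in> borel_measurable borel" and fb: "\<And>x. \<bar>f x\<bar> \<le> c"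
  shows "expectation (\<lambda>\<omega>. G (grid u \<omega>) * f (grid u \<omega> (Suc k))) = expectation (\<lambda>\<omega>. G (grid u \<omega>) * heat u f (grid u \<omega> k))"
proof -
  let ?P = "PiM (insert k {..<k}) (\<lambda>_. gaussian u)"
  interpret N: prob_space "gaussian u" by (rule prob_space_gaussian[OF u])
  interpret S: product_sigma_finite "\<lambda>_::nat. gaussian u"
    unfolding product_sigma_finite_def by (intro allI N.sigma_finite_measure_axioms)
  interpret P: prob_space ?P by (rule prob_space_PiM) (rule prob_space_gaussian[OF u])
  have ins: "{..<Suc k} = insert k {..<k}" by auto
  have c0: "0 \<le> c" and b0: "0 \<le> b" using fb[of 0] Gb[of "\<lambda>_. 0"] by auto
  have ps[measurable]: "partial_sums (Suc k) \<in> measurable ?P path_space"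
    using measurable_partial_sums[of "Suc k"] unfolding ins
    by (simp cong: measurable_cong_sets sets_PiM_cong add: measurable_cong_sets[OF sets_PiM_cong[OF refl sets_gaussian] refl])
  have key: "(LINT x|?P. G (partial_sums (Suc k) x) * g (partial_sums (Suc k) x)) =
     (LINT x|PiM {..<k} (\<lambda>_. gaussian u). G (partial_sums k x) * (LINT y|gaussian u. g (partial_sums (Suc k) (x(k := y)))))"
    if [measurable]: "g \<in> borel_measurable path_space" and gc: "\<And>x. \<bar>g x\<bar> \<le> c" for g
  proof -
    have "(LINT x|?P. G (partial_sums (Suc k) x) * g (partial_sums (Suc k) x)) =
      (LINT x|PiM {..<k} (\<lambda>_. gaussian u). LINT y|gaussian u. G (partial_sums (Suc k) (x(k := y))) * g (partial_sums (Suc k) (x(k := y))))"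
    proof (rule S.product_integral_insert)
      show "integrable ?P (\<lambda>x. G (partial_sums (Suc k) x) * g (partial_sums (Suc k) x))"
        by (rule P.integrable_const_bound[where B="b * c"])
           (use Gb gc c0 b0 in \<open>auto simp: abs_mult intro!: mult_mono\<close>)
    qed auto
    moreover have "G (partial_sums (Suc k) (x(k := y))) = G (partial_sums k x)" for x y
      by (rule depends_uptoD[OF dep]) (auto simp: partial_sums_def intro!: sum.cong)
    ultimately show ?thesis by simp
  qed
  have Sk: "partial_sums (Suc k) (x(k := y)) (Suc k) = partial_sums k x k + y"
       "partial_sums (Suc k) (x(k := y)) k = partial_sums k x k" for x y
    by (auto simp: partial_sums_def intro!: sum.cong)
  have d1: "depends_upto (Suc k) (\<lambda>x. G x * f (x (Suc k)))" "depends_upto (Suc k) (\<lambda>x. G x * heat u f (x k))"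
    using dep unfolding depends_upto_def by (metis le_Suc_eq order_refl)+
  have "expectation (\<lambda>\<omega>. G (grid u \<omega>) * f (grid u \<omega> (Suc k))) = (LINT x|?P. G (partial_sums (Suc k) x) * f (partial_sums (Suc k) x (Suc k)))"
    using expectation_grid[OF u _ _ d1(1)] unfolding ins by simp
  also have "\<dots> = (LINT x|PiM {..<k} (\<lambda>_. gaussian u). G (partial_sums k x) * heat u f (partial_sums k x k))"
    by (subst key[of "\<lambda>x. f (x (Suc k))"]) (use fb in \<open>auto simp: Sk integral_gaussian_shift[OF u]\<close>)
  also have "\<dots> = (LINT x|?P. G (partial_sums (Suc k) x) * heat u f (partial_sums (Suc k) x k))"
    by (subst key[of "\<lambda>x. heat u f (x k)"]) (use heat_bound[OF u f fb] in \<open>auto simp: Sk N.prob_space[unfolded space_gaussian]\<close>)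
  also have "\<dots> = expectation (\<lambda>\<omega>. G (grid u \<omega>) * heat u f (grid u \<omega> k))"
    using expectation_grid[OF u _ _ d1(2)] unfolding ins by simp
  finally show ?thesis .
qed

text \<open>With \<open>B = (1 - U (k - 1) / U k) / u\<close> the update of the coupling becomes the
  linear recursion \<open>U (k + 1) - 2 * U k + U (k - 1) = 2 * u * r k * U k\<close>, a discrete
  Sturm-Liouville equation with \<open>U 0 = 0\<close>. Prescribing \<open>U\<close> and reading off
  the weights therefore evaluates the chain exactly. The two end points \<open>a\<close> and
  \<open>a + n\<close> carry no weight.\<close>

lemma chain_kernel:
  fixes U :: "nat \<Rightarrow> real"
  assumes u: "0 < u" and U0: "U 0 = 0" and U1: "U 1 = u" and Upos: "\<And>k. 1 \<le> k \<Longrightarrow> k \<le> n \<Longrightarrow> 0 < U k"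
    and r: "\<And>k. 1 \<le> k \<Longrightarrow> k < n \<Longrightarrow> r k = (U (Suc k) - 2 * U k + U (k - 1)) / (2 * u * U k)" "\<And>k. 1 \<le> k \<Longrightarrow> k < n \<Longrightarrow> 0 \<le> r k"
    and Uless: "\<And>k. 1 \<le> k \<Longrightarrow> k \<le> n \<Longrightarrow> U (k - 1) < U k"
    and G[measurable]: "G \<in> borel_measurable path_space" and dep: "depends_upto a G" and Gb: "\<And>x. \<bar>G x\<bar> \<le> b"
    and n: "1 \<le> n" and f[measurable]: "f \<in> borel_measurable borel" and fb: "\<And>x. \<bar>f x\<bar> \<le> c"
  shows "expectation (\<lambda>\<omega>. G (grid u \<omega>) * (\<Prod>k=1..<n. exp (- r k * (grid u \<omega> (a + k))\<^sup>2)) * f (grid u \<omega> (a + n)))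
    = expectation (\<lambda>\<omega>. G (grid u \<omega>) *
        (LINT z|lborel. gauss_kernel (U n) (1 / u - (\<Sum>k=1..<n. u / (U k * U (Suc k)))) ((1 - U (n - 1) / U n) / u) (grid u \<omega> a) z * f z))"
  using n Upos r Uless f fb
proof (induction n arbitrary: f c rule: nat_induct_at_least)
  case base
  note [measurable] = base.prems(5)
  have "expectation (\<lambda>\<omega>. G (grid u \<omega>) * f (grid u \<omega> (Suc a))) = expectation (\<lambda>\<omega>. G (grid u \<omega>) * heat u f (grid u \<omega> a))"
    by (rule markov_step[OF u G dep Gb]) (use base in auto)
  then show ?case
    unfolding heat_def normal_density_eq_gauss_kernel[OF u] by (simp add: U0 U1[unfolded One_nat_def])
next
  case (Suc n)
  note [measurable] = Suc.prems(5)
  let ?A = "1 / u - (\<Sum>k=1..<n. u / (U k * U (Suc k)))"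
  let ?B = "(1 - U (n - 1) / U n) / u"
  let ?G = "\<lambda>x. G x * (\<Prod>k=1..<Suc n. exp (- r k * (x (a + k))\<^sup>2))"
  let ?f = "\<lambda>y. exp (- r n * y\<^sup>2) * heat u f y"
  have n1: "1 \<le> n" using Suc.hyps .
  have Un: "0 < U n" "0 < U (Suc n)" "U (n - 1) < U n" using Suc.prems(1,4) n1 by auto
  have rn: "0 \<le> r n" "r n = (U (Suc n) - 2 * U n + U (n - 1)) / (2 * u * U n)" using Suc.prems(2,3) n1 by auto
  have fc: "\<bar>heat u f y\<bar> \<le> c" for y using heat_bound[OF u Suc.prems(5,6)] .
  have e1: "exp (- r k * y\<^sup>2) \<le> 1" if "1 \<le> k" "k < Suc n" for k y using Suc.prems(3)[OF that] by simp
  have "expectation (\<lambda>\<omega>. ?G (grid u \<omega>) * f (grid u \<omega> (Suc (a + n)))) = expectation (\<lambda>\<omega>. ?G (grid u \<omega>) * heat u f (grid u \<omega> (a + n)))"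
  proof (rule markov_step[OF u _ _ _ Suc.prems(5,6)])
    show "depends_upto (a + n) ?G"
      unfolding depends_upto_def
    proof (intro allI impI)
      fix x y :: "nat \<Rightarrow> real" assume xy: "\<forall>k\<le>a + n. x k = y k"
      then have "G x = G y" by (intro depends_uptoD[OF dep]) auto
      moreover have "(\<Prod>k=1..<Suc n. exp (- r k * (x (a + k))\<^sup>2)) = (\<Prod>k=1..<Suc n. exp (- r k * (y (a + k))\<^sup>2))"
        using xy by (intro prod.cong) auto
      ultimately show "?G x = ?G y" by simp
    qed
    fix x :: "nat \<Rightarrow> real"
    have "(\<Prod>k=1..<Suc n. exp (- r k * (x (a + k))\<^sup>2)) \<le> 1"
      using e1 by (intro prod_le_1) auto
    moreover have "0 \<le> (\<Prod>k=1..<Suc n. exp (- r k * (x (a + k))\<^sup>2))" by (intro prod_nonneg) auto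
    ultimately have "\<bar>?G x\<bar> \<le> \<bar>G x\<bar> * 1" unfolding abs_mult by (intro mult_left_mono) auto
    then show "\<bar>?G x\<bar> \<le> b" using Gb[of x] by simp
  qed measurable
  also have "\<dots> = expectation (\<lambda>\<omega>. G (grid u \<omega>) * (\<Prod>k=1..<n. exp (- r k * (grid u \<omega> (a + k))\<^sup>2)) * ?f (grid u \<omega> (a + n)))"
    using n1 by (simp add: prod.atLeastLessThan_Suc mult.assoc)
  also have "\<dots> = expectation (\<lambda>\<omega>. G (grid u \<omega>) * (LINT z|lborel. gauss_kernel (U n) ?A ?B (grid u \<omega> a) z * ?f z))"
  proof (rule Suc.IH)
    show "\<bar>?f y\<bar> \<le> c" for y
      using mult_mono[OF e1[of n y] fc[of y]] n1 by (simp add: abs_mult)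
  qed (use Suc.prems in \<open>auto intro!: borel_measurable_times heat_measurable\<close>)
  also have "(\<lambda>\<omega>. G (grid u \<omega>) * (LINT z|lborel. gauss_kernel (U n) ?A ?B (grid u \<omega> a) z * ?f z)) =
    (\<lambda>\<omega>. G (grid u \<omega>) * (LINT z|lborel. gauss_kernel (U (Suc n)) (1 / u - (\<Sum>k=1..<Suc n. u / (U k * U (Suc k)))) ((1 - U (Suc n - 1) / U (Suc n)) / u) (grid u \<omega> a) z * f z))"
  proof (rule ext)
    fix \<omega>
    \<comment> \<open>By the formula for \<open>r n\<close>, \<open>D\<close> collapses to
      \<open>U (Suc n) / (u * U n)\<close>, and the three updated parameters follow from it.\<close>
    define D where "D = ?B + 1 / u + 2 * r n"
    have D: "D = U (Suc n) / (u * U n)"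
      unfolding D_def rn(2) using u Un by (simp add: field_simps)
    have B: "0 < ?B" using Un u by simp
    have 1: "U n * u * D = U (Suc n)" using u Un by (simp add: D)
    have 2: "?A - 1 / ((U n)\<^sup>2 * D) = 1 / u - (\<Sum>k=1..<Suc n. u / (U k * U (Suc k)))"
      using n1 u Un by (simp add: D power2_eq_square)
    have 3: "1 / u - 1 / (u\<^sup>2 * D) = (1 - U (Suc n - 1) / U (Suc n)) / u"
      using u Un by (simp add: D power2_eq_square diff_divide_distrib)
    show "G (grid u \<omega>) * (LINT z|lborel. gauss_kernel (U n) ?A ?B (grid u \<omega> a) z * ?f z) =
      G (grid u \<omega>) * (LINT z|lborel. gauss_kernel (U (Suc n)) (1 / u - (\<Sum>k=1..<Suc n. u / (U k * U (Suc k)))) ((1 - U (Suc n - 1) / U (Suc n)) / u) (grid u \<omega> a) z * f z)"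
      unfolding heat_def
      by (subst integral_gauss_kernel_step[OF Un(1) u B rn(1) D_def Suc.prems(5,6)]) (simp only: 1 2 3)
  qed
  finally show ?case by simp
qed

end

context continuous_brownian_motion
begin

text \<open>The weightless chain \<open>U k = k * u\<close>, whose second differences vanish; its
  diagonal coefficients telescope to those of the heat kernel. In effect this is the semigroup
  property of \<open>heat\<close> under the expectation.\<close>

lemma chain_heat:
  assumes u: "0 < u" and G[measurable]: "G \<in> borel_measurable path_space" and dep: "depends_upto a G" and Gb: "\<And>x. \<bar>G x\<bar> \<le> b"
    and n: "1 \<le> n" and f[measurable]: "f \<in> borel_measurable borel" and fb: "\<And>x. \<bar>f x\<bar> \<le> c"
  shows "expectation (\<lambda>\<omega>. G (grid u \<omega>) * f (grid u \<omega> (a + n))) = expectation (\<lambda>\<omega>. G (grid u \<omega>) * heat (real n * u) f (grid u \<omega> a))"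
proof -
  have A: "1 / u - (\<Sum>k=1..<n. u / (real k * u * (real (Suc k) * u))) = 1 / (real n * u)" using n
  proof (induction n rule: nat_induct_at_least)
    case (Suc m)
    then have "1 / u - (\<Sum>k=1..<Suc m. u / (real k * u * (real (Suc k) * u))) = 1 / (real m * u) - u / (real m * u * (real (Suc m) * u))"
      by simp
    also have "\<dots> = 1 / (real (Suc m) * u)"
    proof -
      have "1 / (a * u) - u / (a * u * ((a + 1) * u)) = 1 / ((a + 1) * u)" if "0 < a" for a
      proof -
        have "1 / (a * u) - u / (a * u * ((a + 1) * u)) = (a + 1) / (a * (a + 1) * u) - 1 / (a * (a + 1) * u)"
          using that u by simp
        also have "\<dots> = a / (a * (a + 1) * u)" unfolding diff_divide_distrib[symmetric] by simp
        finally show ?thesis using that by simp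
      qed
      from this[of "real m"] show ?thesis using Suc.hyps by (simp add: add.commute)
    qed
    finally show ?case .
  qed simp
  have B: "(1 - real (n - 1) * u / (real n * u)) / u = 1 / (real n * u)"
    using u n by (simp add: field_simps of_nat_diff)
  have "expectation (\<lambda>\<omega>. G (grid u \<omega>) * (\<Prod>k=1..<n. exp (- 0 * (grid u \<omega> (a + k))\<^sup>2)) * f (grid u \<omega> (a + n)))
    = expectation (\<lambda>\<omega>. G (grid u \<omega>) *
        (LINT z|lborel. gauss_kernel (real n * u) (1 / u - (\<Sum>k=1..<n. u / (real k * u * (real (Suc k) * u)))) ((1 - real (n - 1) * u / (real n * u)) / u) (grid u \<omega> a) z * f z))"
  proof (rule chain_kernel[OF u _ _ _ _ _ _ G dep Gb n f fb])
    fix k :: nat assume k: "1 \<le> k" "k < n"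
    then show "0 = (real (Suc k) * u - 2 * (real k * u) + real (k - 1) * u) / (2 * u * (real k * u))"
      by (simp add: of_nat_diff algebra_simps)
  qed (use u in auto)
  then show ?thesis
    using n u unfolding A B heat_def by (simp add: normal_density_eq_gauss_kernel)
qed

lemma X_nonzero_AE:
  assumes t: "0 < t"
  shows "AE \<omega> in M. X t \<omega> \<noteq> 0"
proof -
  have "expectation (\<lambda>\<omega>. 1 * indicator {0} (grid t \<omega> (Suc 0))) = expectation (\<lambda>\<omega>. 1 * heat t (indicator {0}) (grid t \<omega> 0))"
    by (rule markov_step[OF t, where b=1 and c=1]) (auto simp: depends_upto_def indicator_def)
  also have "heat t (indicator {0}) x = 0" for x
  proof -
    have "AE z in lborel. normal_density 0 (sqrt t) (z - x) * indicator {0} z = 0"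
      using AE_lborel_singleton[of 0] by eventually_elim auto
    then show ?thesis unfolding heat_def by (rule integral_eq_zero_AE)
  qed
  then have "expectation (\<lambda>\<omega>. 1 * heat t (indicator {0}) (grid t \<omega> 0)) = 0" by simp
  finally have e: "expectation (\<lambda>\<omega>. indicat_real {0} (X t \<omega>)) = 0" by (simp add: grid_def)
  have [measurable]: "X t \<in> borel_measurable M" using t by (intro X_measurable) simp
  have "integrable M (\<lambda>\<omega>. indicator {0} (X t \<omega>) :: real)"
    by (intro integrable_const_bound[where B=1]) auto
  from integral_nonneg_eq_0_iff_AE[OF this] e have "AE \<omega> in M. indicator {0} (X t \<omega>) = (0::real)" by auto
  then show ?thesis by eventually_elim (auto simp: indicator_def split: if_splits)
qed

section \<open>Zeros of the path and the reflection principle\<close>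

definition no_zero :: "real \<Rightarrow> real \<Rightarrow> 'a \<Rightarrow> bool" where
  "no_zero a b \<omega> \<longleftrightarrow> (\<forall>t\<in>{a..b}. X t \<omega> \<noteq> 0)"

text \<open>A discretized zero between \<open>p * u\<close> and \<open>q * u\<close>: each grid
  interval is divided into \<open>m\<close> parts, and 0 is replaced by an
  \<open>\<epsilon>\<close>-neighbourhood, which a given continuous path cannot jump over once the
  mesh is fine.\<close>

definition hit :: "real \<Rightarrow> nat \<Rightarrow> nat \<Rightarrow> nat \<Rightarrow> real \<Rightarrow> 'a \<Rightarrow> bool" where
  "hit u p q m \<epsilon> \<omega> \<longleftrightarrow> (\<exists>k\<in>{p * m..q * m}. \<bar>grid (u / real m) \<omega> k\<bar> \<le> \<epsilon>)"

lemma no_zero_sgn: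
  assumes nz: "no_zero a b \<omega>" and ab: "0 \<le> a" "a \<le> b"
  shows "sgn (X a \<omega>) * sgn (X b \<omega>) = 1"
proof -
  have c: "continuous_on {a..b} (\<lambda>t. X t \<omega>)"
    using ab by (intro continuous_on_subset[OF X_continuous]) auto
  have ne: "X t \<omega> \<noteq> 0" if "a \<le> t" "t \<le> b" for t using nz that by (auto simp: no_zero_def)
  have "\<not> (X a \<omega> \<le> 0 \<and> 0 \<le> X b \<omega>)" using IVT'[OF _ _ ab(2) c, of 0] ne by auto
  moreover have "\<not> (0 \<le> X a \<omega> \<and> X b \<omega> \<le> 0)" using IVT2'[OF _ _ ab(2) c, of 0] ne by auto
  ultimately show ?thesis by (auto simp: sgn_if not_le)
qed

lemma eventually_hit:
  assumes u: "0 < u" and nz: "\<not> no_zero (real p * u) (real q * u) \<omega>" and \<epsilon>: "0 < \<epsilon>"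
  shows "eventually (\<lambda>m. hit u p q m \<epsilon> \<omega>) sequentially"
proof -
  obtain t where t: "real p * u \<le> t" "t \<le> real q * u" "X t \<omega> = 0" using nz by (auto simp: no_zero_def)
  have t0: "0 \<le> t" using t(1) u by (meson mult_nonneg_nonneg of_nat_0_le_iff less_imp_le order_trans)
  have "continuous (at t within {0..}) (\<lambda>t. X t \<omega>)" using X_continuous t0 by (auto simp: continuous_on_eq_continuous_within)
  then obtain d where d: "0 < d" "\<And>s. 0 \<le> s \<Longrightarrow> dist s t < d \<Longrightarrow> dist (X s \<omega>) (X t \<omega>) < \<epsilon>"
    unfolding continuous_within_eps_delta using \<epsilon> by (metis atLeast_iff)
  have "eventually (\<lambda>m. u / d < real m) sequentially" using filterlim_real_sequentially unfolding filterlim_at_top_dense by blast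
  with eventually_gt_at_top[of 0] show ?thesis
  proof eventually_elim
    case (elim m)
    let ?h = "u / real m"
    have h: "0 < ?h" "?h < d" using elim u d(1) by (auto simp: field_simps)
    \<comment> \<open>The last fine grid point not after the zero \<open>t\<close>. It is at least
      \<open>p * m\<close> because \<open>p * u\<close> is itself a fine grid point.\<close>
    define k where "k = nat \<lfloor>t / ?h\<rfloor>"
    have "0 \<le> t / ?h" using t0 h(1) by (rule divide_nonneg_pos)
    then have rk: "real k = of_int \<lfloor>t / ?h\<rfloor>" unfolding k_def by (intro of_nat_nat) (simp only: zero_le_floor)
    have k: "real k \<le> t / ?h" "t / ?h < real k + 1" unfolding rk using floor_correct[of "t / ?h"] by auto
    have kt: "real k * ?h \<le> t" using k(1) h(1) by (simp only: pos_le_divide_eq)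
    have "t < (real k + 1) * ?h" using k(2) h(1) by (simp only: pos_divide_less_eq)
    then have kt2: "t < real k * ?h + ?h" by (simp only: distrib_right mult_1_left)
    have "p * m \<le> k"
    proof -
      have "real (p * m) * ?h \<le> t" using t(1) elim by simp
      then have "real (p * m) \<le> t / ?h" using h by (simp only: pos_le_divide_eq)
      then have "real (p * m) < real k + 1" using k(2) by linarith
      then show ?thesis by linarith
    qed
    moreover have "k \<le> q * m"
    proof -
      have "t \<le> real (q * m) * ?h" using t(2) elim by simp
      then have "real k * ?h \<le> real (q * m) * ?h" using kt by linarith
      then show ?thesis using h by (simp only: mult_le_cancel_right_pos of_nat_le_iff)
    qed
    moreover have "\<bar>grid ?h \<omega> k\<bar> \<le> \<epsilon>"
    proof -
      have "0 \<le> real k * ?h" using h(1) by (intro mult_nonneg_nonneg) auto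
      moreover have "dist (real k * ?h) t < d" using kt kt2 h(2) by (simp add: dist_real_def)
      ultimately show ?thesis using d(2)[of "real k * ?h"] t(3) by (simp add: grid_def dist_real_def)
    qed
    ultimately show ?case unfolding hit_def by auto
  qed
qed

text \<open>The minimum of \<open>\<bar>X\<bar>\<close> over the compact interval is the threshold;
  it serves all meshes at once.\<close>

lemma no_zero_not_hit:
  assumes u: "0 < u" and pq: "p \<le> q" and nz: "no_zero (real p * u) (real q * u) \<omega>"
  obtains \<epsilon> where "0 < \<epsilon>" "\<And>m e. 0 < m \<Longrightarrow> e < \<epsilon> \<Longrightarrow> \<not> hit u p q m e \<omega>"
proof -
  have c: "continuous_on {real p * u..real q * u} (\<lambda>t. \<bar>X t \<omega>\<bar>)"
    using u by (intro continuous_intros continuous_on_subset[OF X_continuous]) auto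
  have ne: "{real p * u..real q * u} \<noteq> {}" using u pq by (auto intro: mult_right_mono)
  from continuous_attains_inf[OF compact_Icc ne c] obtain t where
    t: "t \<in> {real p * u..real q * u}" "\<And>s. s \<in> {real p * u..real q * u} \<Longrightarrow> \<bar>X t \<omega>\<bar> \<le> \<bar>X s \<omega>\<bar>" by blast
  show ?thesis
  proof
    show "0 < \<bar>X t \<omega>\<bar>" using nz t(1) by (auto simp: no_zero_def)
    fix m :: nat and e assume m: "0 < m" and e: "e < \<bar>X t \<omega>\<bar>"
    show "\<not> hit u p q m e \<omega>"
    proof
      assume "hit u p q m e \<omega>"
      then obtain k where k: "p * m \<le> k" "k \<le> q * m" "\<bar>grid (u / real m) \<omega> k\<bar> \<le> e" by (auto simp: hit_def)
      have "real p * u \<le> real k * (u / real m)" "real k * (u / real m) \<le> real q * u"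
      proof -
        have "real (p * m) * (u / real m) \<le> real k * (u / real m)" "real k * (u / real m) \<le> real (q * m) * (u / real m)"
          using k u m by (intro mult_right_mono of_nat_mono; simp)+
        then show "real p * u \<le> real k * (u / real m)" "real k * (u / real m) \<le> real q * u" using m by simp_all
      qed
      then have "\<bar>X t \<omega>\<bar> \<le> \<bar>X (real k * (u / real m)) \<omega>\<bar>" by (intro t(2)) auto
      then show False using e k(3) by (simp add: grid_def)
    qed
  qed
qed

lemma measurable_hit:
  assumes "0 < u" "0 < m"
  shows "Measurable.pred M (hit u p q m \<epsilon>)"
proof -
  have [measurable]: "(\<lambda>\<omega>. grid (u / real m) \<omega> k) \<in> borel_measurable M" for k
    using assms by (intro borel_measurable_grid) auto
  show ?thesis unfolding hit_def[abs_def] by measurable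
qed

text \<open>A condition at uncountably many times becomes countable: there is no zero exactly when,
  for some threshold, no mesh produces a hit.\<close>

lemma measurable_no_zero:
  assumes "0 < u" "p \<le> q"
  shows "Measurable.pred M (no_zero (real p * u) (real q * u))"
proof -
  have eq: "no_zero (real p * u) (real q * u) \<omega> \<longleftrightarrow> (\<exists>j::nat. \<forall>m::nat. \<not> hit u p q (Suc m) (1 / real (Suc j)) \<omega>)" for \<omega>
  proof
    assume "no_zero (real p * u) (real q * u) \<omega>"
    from no_zero_not_hit[OF assms this] obtain \<epsilon> where e: "0 < \<epsilon>" "\<And>m e. 0 < m \<Longrightarrow> e < \<epsilon> \<Longrightarrow> \<not> hit u p q m e \<omega>" by blast
    obtain j where "1 / real (Suc j) < \<epsilon>" using reals_Archimedean[OF e(1)] by (auto simp: inverse_eq_divide)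
    then show "\<exists>j::nat. \<forall>m::nat. \<not> hit u p q (Suc m) (1 / real (Suc j)) \<omega>" using e(2) by blast
  next
    assume "\<exists>j::nat. \<forall>m::nat. \<not> hit u p q (Suc m) (1 / real (Suc j)) \<omega>"
    then obtain j where j: "\<And>m. \<not> hit u p q (Suc m) (1 / real (Suc j)) \<omega>" by blast
    show "no_zero (real p * u) (real q * u) \<omega>"
    proof (rule ccontr)
      assume "\<not> no_zero (real p * u) (real q * u) \<omega>"
      from eventually_hit[OF assms(1) this, of "1 / real (Suc j)"]
      obtain N where "\<And>m. N \<le> m \<Longrightarrow> hit u p q m (1 / real (Suc j)) \<omega>" by (auto simp: eventually_sequentially)
      from this[of "Suc N"] j[of N] show False by simp
    qed
  qed
  have [measurable]: "Measurable.pred M (hit u p q (Suc m) e)" for m e by (rule measurable_hit) (use assms in auto)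
  show ?thesis unfolding eq[abs_def] by measurable
qed

text \<open>Reflecting the path after its first grid time within \<open>\<epsilon>\<close> of 0 flips the sign at \<open>q\<close> and moves the
  absolute values by at most \<open>2 * \<epsilon>\<close>. So paths that come close to 0 contribute almost nothing.\<close>

lemma hit_reflection:
  assumes u: "0 < u" and pq: "1 \<le> p" "p \<le> q" "q \<le> K" and m: "0 < m"
    and G[measurable]: "G \<in> borel_measurable path_space" and dep: "depends_upto K G" and Gb: "\<And>x. \<bar>G x\<bar> \<le> B"
  defines "A \<equiv> (\<lambda>\<omega>. G (\<lambda>k. \<bar>grid u \<omega> k\<bar>) * (sgn (grid u \<omega> p) * sgn (grid u \<omega> q)))"
  shows "\<exists>R. R \<in> borel_measurable M \<and> (\<forall>\<omega>. \<bar>R \<omega>\<bar> \<le> 2 * B) \<and>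
     expectation (\<lambda>\<omega>. if hit u p q m \<epsilon> \<omega> then A \<omega> else 0) = expectation R / 2 \<and>
     (\<forall>\<omega>. 2 * \<epsilon> < \<bar>grid u \<omega> q\<bar> \<longrightarrow> 0 \<le> \<epsilon> \<longrightarrow> (\<exists>y. (\<forall>k\<le>K. \<bar>y k - \<bar>grid u \<omega> k\<bar>\<bar> \<le> 2 * \<epsilon>) \<and> \<bar>R \<omega>\<bar> \<le> \<bar>G (\<lambda>k. \<bar>grid u \<omega> k\<bar>) - G y\<bar>))"
proof -
  define h where "h = u / real m"
  have h: "0 < h" using u m by (simp add: h_def)
  have gh: "grid h \<omega> (k * m) = grid u \<omega> k" for k \<omega> using m by (simp add: grid_def h_def)
  have mg: "grid h \<in> measurable M path_space" by (rule measurable_grid[OF h])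
  define S where "S x = G (\<lambda>k. \<bar>x (k * m)\<bar>) * (sgn (x (p * m)) * sgn (x (q * m)))" for x :: "nat \<Rightarrow> real"
  define fst_hit where "fst_hit k x \<longleftrightarrow> \<bar>x k\<bar> \<le> \<epsilon> \<and> (\<forall>l\<in>{p * m..<k}. \<epsilon> < \<bar>x l\<bar>)" for k and x :: "nat \<Rightarrow> real"
  let ?I = "{p * m..q * m}"
  define F where "F k x = (if fst_hit k x then S x else 0)" for k x
  have [measurable]: "(\<lambda>x k. \<bar>x (k * m)\<bar>) \<in> measurable path_space path_space"
    by (intro measurable_PiM_single') auto
  have S[measurable]: "S \<in> borel_measurable path_space" unfolding S_def by measurable
  have F[measurable]: "F k \<in> borel_measurable path_space" for k unfolding F_def fst_hit_def by measurable
  have B0: "0 \<le> B" using order_trans[OF abs_ge_zero Gb] .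
  have Sb: "\<bar>S x\<bar> \<le> B" for x
  proof -
    have "\<bar>sgn (x (p * m)) * sgn (x (q * m))\<bar> \<le> 1" by (auto simp: sgn_if abs_mult)
    then have "\<bar>S x\<bar> \<le> B * 1" unfolding S_def abs_mult[of "G _"] using Gb B0 by (intro mult_mono) auto
    then show ?thesis by simp
  qed
  have uniq: "k = k'" if "k \<in> ?I" "k' \<in> ?I" "fst_hit k x" "fst_hit k' x" for k k' x
  proof (rule ccontr)
    assume "k \<noteq> k'"
    then consider "k < k'" | "k' < k" by linarith
    then show False
      by cases (use that in \<open>auto simp: fst_hit_def dest!: bspec\<close>)
  qed
  have refl_hit: "fst_hit k (reflect_after k x) = fst_hit k x" for k x
    unfolding fst_hit_def reflect_after_def by auto
  have hit_iff: "hit u p q m \<epsilon> \<omega> \<longleftrightarrow> (\<exists>k\<in>?I. fst_hit k (grid h \<omega>))" for \<omega>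
  proof
    assume "hit u p q m \<epsilon> \<omega>"
    then have ex: "\<exists>k. k \<in> ?I \<and> \<bar>grid h \<omega> k\<bar> \<le> \<epsilon>" by (auto simp: hit_def h_def)
    define k where "k = (LEAST k. k \<in> ?I \<and> \<bar>grid h \<omega> k\<bar> \<le> \<epsilon>)"
    have k: "k \<in> ?I \<and> \<bar>grid h \<omega> k\<bar> \<le> \<epsilon>" unfolding k_def by (rule LeastI_ex[OF ex])
    have "\<epsilon> < \<bar>grid h \<omega> l\<bar>" if "l \<in> {p * m..<k}" for l
      using not_less_Least[of l "\<lambda>k. k \<in> ?I \<and> \<bar>grid h \<omega> k\<bar> \<le> \<epsilon>", folded k_def] that k by auto
    then show "\<exists>k\<in>?I. fst_hit k (grid h \<omega>)" using k by (auto simp: fst_hit_def)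
  qed (auto simp: hit_def h_def fst_hit_def)
  have sumF: "(\<Sum>k\<in>?I. if fst_hit k x then c k else 0) = (if k \<in> ?I then c k else 0)"
    if "k \<in> ?I" "fst_hit k x" for k x and c :: "nat \<Rightarrow> real"
  proof -
    have "(\<Sum>j\<in>?I. if fst_hit j x then c j else 0) = (\<Sum>j\<in>?I. if j = k then c j else 0)"
    proof (intro sum.cong refl)
      fix j assume j: "j \<in> ?I"
      have "fst_hit j x \<longleftrightarrow> j = k" using uniq[OF j that(1) _ that(2)] that(2) by blast
      then show "(if fst_hit j x then c j else 0) = (if j = k then c j else 0)" by simp
    qed
    then show ?thesis by simp
  qed
  \<comment> \<open>Each first hitting index contributes the functional together with its
    reflection. The two have equal expectations, so \<open>expectation R\<close> is twice the
    quantity sought, while pointwise they nearly cancel.\<close>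
  define R where "R \<omega> = (\<Sum>k\<in>?I. F k (grid h \<omega>) + F k (reflect_after k (grid h \<omega>)))" for \<omega>
  have R_eq: "R \<omega> = (\<Sum>k\<in>?I. if fst_hit k (grid h \<omega>) then S (grid h \<omega>) + S (reflect_after k (grid h \<omega>)) else 0)" for \<omega>
    unfolding R_def F_def refl_hit by (intro sum.cong refl) auto
  have R_hit: "R \<omega> = S (grid h \<omega>) + S (reflect_after k (grid h \<omega>))" if "k \<in> ?I" "fst_hit k (grid h \<omega>)" for k \<omega>
    unfolding R_eq using sumF[OF that] that(1) by simp
  have R_nohit: "R \<omega> = 0" if "\<not> hit u p q m \<epsilon> \<omega>" for \<omega>
    unfolding R_eq using that by (intro sum.neutral) (auto simp: hit_iff)
  have Rm: "R \<in> borel_measurable M" unfolding R_def using mg by measurable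
  have Rb: "\<bar>R \<omega>\<bar> \<le> 2 * B" for \<omega>
  proof (cases "hit u p q m \<epsilon> \<omega>")
    case True
    then obtain k where "k \<in> ?I" "fst_hit k (grid h \<omega>)" by (auto simp: hit_iff)
    from R_hit[OF this] show ?thesis
      using Sb[of "grid h \<omega>"] Sb[of "reflect_after k (grid h \<omega>)"] by linarith
  qed (use R_nohit B0 in auto)
  have K0: "0 < K * m" using pq m by simp
  have depF: "depends_upto (K * m) (F k)" if "k \<in> ?I" for k
    unfolding depends_upto_def
  proof (intro allI impI)
    fix x y :: "nat \<Rightarrow> real" assume xy: "\<forall>k\<le>K * m. x k = y k"
    have qK: "q * m \<le> K * m" "p * m \<le> K * m" using pq by auto
    have "G (\<lambda>k. \<bar>x (k * m)\<bar>) = G (\<lambda>k. \<bar>y (k * m)\<bar>)"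
      using xy by (intro depends_uptoD[OF dep]) auto
    then have "S x = S y" using xy qK by (simp add: S_def)
    moreover have "fst_hit k x = fst_hit k y"
    proof -
      have "x l = y l" if "l \<le> k" for l
      proof -
        have "l \<le> K * m" using that \<open>k \<in> ?I\<close> qK(1) by (auto intro: order_trans)
        then show ?thesis using xy by blast
      qed
      then show ?thesis unfolding fst_hit_def by auto
    qed
    ultimately show "F k x = F k y" by (simp add: F_def)
  qed
  have int: "integrable M (\<lambda>\<omega>. F k (grid h \<omega>))" "integrable M (\<lambda>\<omega>. F k (reflect_after k (grid h \<omega>)))" for k
  proof -
    have "\<bar>F k x\<bar> \<le> B" for x using Sb[of x] B0 by (simp add: F_def)
    then show "integrable M (\<lambda>\<omega>. F k (grid h \<omega>))" "integrable M (\<lambda>\<omega>. F k (reflect_after k (grid h \<omega>)))"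
      by (auto intro!: integrable_const_bound[where B=B] measurable_compose[OF mg F]
          measurable_compose[OF measurable_compose[OF mg measurable_reflect_after] F])
  qed
  have "expectation R = (\<Sum>k\<in>?I. expectation (\<lambda>\<omega>. F k (grid h \<omega>)) + expectation (\<lambda>\<omega>. F k (reflect_after k (grid h \<omega>))))"
    unfolding R_def using int by simp
  also have "\<dots> = (\<Sum>k\<in>?I. 2 * expectation (\<lambda>\<omega>. F k (grid h \<omega>)))"
  proof (intro sum.cong refl)
    fix k assume k: "k \<in> ?I"
    have "k \<le> K * m" using k pq by (auto intro: order_trans[OF _ mult_right_mono])
    from expectation_reflect[OF h K0 F depF[OF k] this]
    show "expectation (\<lambda>\<omega>. F k (grid h \<omega>)) + expectation (\<lambda>\<omega>. F k (reflect_after k (grid h \<omega>))) = 2 * expectation (\<lambda>\<omega>. F k (grid h \<omega>))"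
      by simp
  qed
  also have "\<dots> = 2 * expectation (\<lambda>\<omega>. \<Sum>k\<in>?I. F k (grid h \<omega>))"
    using int by (simp add: sum_distrib_left)
  also have "(\<lambda>\<omega>. \<Sum>k\<in>?I. F k (grid h \<omega>)) = (\<lambda>\<omega>. if hit u p q m \<epsilon> \<omega> then A \<omega> else 0)"
  proof (rule ext)
    fix \<omega>
    have SA: "S (grid h \<omega>) = A \<omega>" unfolding S_def A_def gh ..
    show "(\<Sum>k\<in>?I. F k (grid h \<omega>)) = (if hit u p q m \<epsilon> \<omega> then A \<omega> else 0)"
    proof (cases "hit u p q m \<epsilon> \<omega>")
      case True
      then obtain k where "k \<in> ?I" "fst_hit k (grid h \<omega>)" by (auto simp: hit_iff)
      then show ?thesis using sumF[of k "grid h \<omega>" "\<lambda>_. S (grid h \<omega>)"] True by (simp add: F_def SA)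
    next
      case False
      then show ?thesis by (auto simp: hit_iff F_def intro!: sum.neutral)
    qed
  qed
  finally have ER: "expectation (\<lambda>\<omega>. if hit u p q m \<epsilon> \<omega> then A \<omega> else 0) = expectation R / 2" by simp
  have last: "\<exists>y. (\<forall>k\<le>K. \<bar>y k - \<bar>grid u \<omega> k\<bar>\<bar> \<le> 2 * \<epsilon>) \<and> \<bar>R \<omega>\<bar> \<le> \<bar>G (\<lambda>k. \<bar>grid u \<omega> k\<bar>) - G y\<bar>"
    if big: "2 * \<epsilon> < \<bar>grid u \<omega> q\<bar>" and e0: "0 \<le> \<epsilon>" for \<omega>
  proof (cases "hit u p q m \<epsilon> \<omega>")
    case True
    then obtain k where k: "k \<in> ?I" "fst_hit k (grid h \<omega>)" by (auto simp: hit_iff)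
    let ?x = "grid h \<omega>"
    let ?y = "\<lambda>j. \<bar>reflect_after k ?x (j * m)\<bar>"
    have xk: "\<bar>?x k\<bar> \<le> \<epsilon>" using k(2) by (simp add: fst_hit_def)
    have "\<bar>?y j - \<bar>grid u \<omega> j\<bar>\<bar> \<le> 2 * \<epsilon>" for j
      using xk e0 unfolding gh[symmetric] reflect_after_def by auto
    moreover have "\<bar>R \<omega>\<bar> \<le> \<bar>G (\<lambda>k. \<bar>grid u \<omega> k\<bar>) - G ?y\<bar>"
    proof -
      \<comment> \<open>At time \<open>q\<close> the path is farther than
        \<open>2 * \<epsilon>\<close> from 0, so the hit occurs strictly earlier, and the shift by
        \<open>2 * ?x k\<close> is too small to undo the change of sign.\<close>
      have "k \<noteq> q * m" using xk big e0 unfolding gh[symmetric] by auto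
      then have "k < q * m" using k(1) by auto
      then have rq: "reflect_after k ?x (q * m) = 2 * ?x k - ?x (q * m)" by (simp add: reflect_after_def)
      have rp: "reflect_after k ?x (p * m) = ?x (p * m)" using k(1) by (simp add: reflect_after_def)
      have "sgn (2 * ?x k - ?x (q * m)) = - sgn (?x (q * m))"
        using xk big unfolding gh[symmetric] by (auto simp: sgn_if)
      then have "R \<omega> = (G (\<lambda>k. \<bar>grid u \<omega> k\<bar>) - G ?y) * (sgn (?x (p * m)) * sgn (?x (q * m)))"
        unfolding R_hit[OF k] S_def rp rq gh by (simp add: algebra_simps)
      then have "\<bar>R \<omega>\<bar> = \<bar>G (\<lambda>k. \<bar>grid u \<omega> k\<bar>) - G ?y\<bar> * \<bar>sgn (?x (p * m)) * sgn (?x (q * m))\<bar>"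
        by (simp only: abs_mult)
      also have "\<dots> \<le> \<bar>G (\<lambda>k. \<bar>grid u \<omega> k\<bar>) - G ?y\<bar> * 1"
        by (intro mult_left_mono) (auto simp: sgn_if abs_mult)
      finally show ?thesis by simp
    qed
    ultimately show ?thesis by (intro exI[of _ ?y]) simp
  next
    case False
    then show ?thesis using R_nohit e0 by (intro exI[of _ "\<lambda>k. \<bar>grid u \<omega> k\<bar>"]) auto
  qed
  show ?thesis
    using Rm Rb ER last by (intro exI[of _ R]) blast
qed

text \<open>Without a zero in between, the two signs agree by the intermediate value theorem, so
  paths with a zero have to contribute 0 in total. Those that hit the
  \<open>\<epsilon>\<close>-neighbourhood on the fine grid cancel in the limit by reflection and the
  continuity of \<open>G\<close>; those that are missed by the grid have small probability. For
  \<open>p = 0\<close> both sides vanish since the path starts at 0.\<close>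

lemma no_zero_reflection:
  assumes u: "0 < u" and pq: "p \<le> q" "q \<le> K"
    and G[measurable]: "G \<in> borel_measurable path_space" and Gb: "\<And>x. \<bar>G x\<bar> \<le> B"
    and Gc: "\<And>y x. (\<And>k. k \<le> K \<Longrightarrow> (\<lambda>n. y n k) \<longlonglongrightarrow> x k) \<Longrightarrow> (\<lambda>n. G (y n)) \<longlonglongrightarrow> G x"
  shows "expectation (\<lambda>\<omega>. G (\<lambda>k. \<bar>grid u \<omega> k\<bar>) * (sgn (grid u \<omega> p) * sgn (grid u \<omega> q))) =
     expectation (\<lambda>\<omega>. G (\<lambda>k. \<bar>grid u \<omega> k\<bar>) * of_bool (no_zero (real p * u) (real q * u) \<omega>))"
proof (cases "p = 0")
  case True
  have "grid u \<omega> p = 0" "\<not> no_zero (real p * u) (real q * u) \<omega>" for \<omega>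
    using True u by (auto simp: grid_def no_zero_def intro!: bexI[of _ 0])
  then show ?thesis by simp
next
  case False
  then have p1: "1 \<le> p" by simp
  have dep: "depends_upto K G"
    unfolding depends_upto_def
  proof (intro allI impI)
    fix x y :: "nat \<Rightarrow> real" assume xy: "\<forall>k\<le>K. x k = y k"
    have "(\<lambda>n::nat. G x) \<longlonglongrightarrow> G y" by (rule Gc) (use xy in auto)
    then show "G x = G y" by (simp add: LIMSEQ_const_iff)
  qed
  have B0: "0 \<le> B" using order_trans[OF abs_ge_zero Gb] .
  have mg: "grid u \<in> measurable M path_space" by (rule measurable_grid[OF u])
  have [measurable]: "(\<lambda>\<omega>. grid u \<omega> k) \<in> borel_measurable M" for k by (rule borel_measurable_grid[OF u])
  have "(\<lambda>\<omega> k. \<bar>grid u \<omega> k\<bar>) \<in> measurable M path_space"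
    by (intro measurable_PiM_single') auto
  note Gm[measurable] = measurable_compose[OF this G]
  define g where "g \<omega> = G (\<lambda>k. \<bar>grid u \<omega> k\<bar>)" for \<omega>
  define A where "A \<omega> = g \<omega> * (sgn (grid u \<omega> p) * sgn (grid u \<omega> q))" for \<omega>
  let ?nz = "no_zero (real p * u) (real q * u)"
  have nzm[measurable]: "Measurable.pred M ?nz" by (rule measurable_no_zero[OF u pq(1)])
  have Am[measurable]: "A \<in> borel_measurable M" and gm[measurable]: "g \<in> borel_measurable M"
    unfolding A_def g_def by measurable
  have gb: "\<bar>g \<omega>\<bar> \<le> B" for \<omega> by (simp add: g_def Gb)
  have Ab: "\<bar>A \<omega>\<bar> \<le> B" for \<omega>
  proof -
    have "\<bar>sgn (grid u \<omega> p) * sgn (grid u \<omega> q)\<bar> \<le> 1" by (auto simp: sgn_if abs_mult)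
    then have "\<bar>A \<omega>\<bar> \<le> B * 1" unfolding A_def abs_mult[of "g _"] using gb B0 by (intro mult_mono) auto
    then show ?thesis by simp
  qed
  have A_nz: "A \<omega> = g \<omega>" if "?nz \<omega>" for \<omega>
    using no_zero_sgn[OF that] u pq(1) by (simp add: A_def grid_def mult_right_mono)
  define \<epsilon> where "\<epsilon> j = 1 / real (Suc j)" for j
  have \<epsilon>: "0 < \<epsilon> j" for j by (simp add: \<epsilon>_def)
  have \<epsilon>0: "\<epsilon> \<longlonglongrightarrow> 0" unfolding \<epsilon>_def by real_asymp
  have hm: "Measurable.pred M (hit u p q m e)" if "0 < m" for m e by (rule measurable_hit[OF u that])
  \<comment> \<open>The mesh is chosen after the threshold: for fixed \<open>\<epsilon> j\<close>
    every zero is hit eventually, so some \<open>m\<close> makes the missed paths rare.\<close>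
  have "\<exists>m>0. expectation (\<lambda>\<omega>. of_bool (\<not> ?nz \<omega> \<and> \<not> hit u p q m (\<epsilon> j) \<omega>)) \<le> \<epsilon> j" for j
  proof -
    have [measurable]: "Measurable.pred M (hit u p q (Suc m) (\<epsilon> j))" for m by (rule hm) simp
    have "(\<lambda>m. expectation (\<lambda>\<omega>. of_bool (\<not> ?nz \<omega> \<and> \<not> hit u p q (Suc m) (\<epsilon> j) \<omega>))) \<longlonglongrightarrow> expectation (\<lambda>\<omega>. 0 :: real)"
    proof (rule integral_dominated_convergence[where w="\<lambda>_. 1"])
      show "AE \<omega> in M. (\<lambda>m. of_bool (\<not> ?nz \<omega> \<and> \<not> hit u p q (Suc m) (\<epsilon> j) \<omega>)) \<longlonglongrightarrow> (0::real)"
      proof (intro AE_I2)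
        fix \<omega>
        show "(\<lambda>m. of_bool (\<not> ?nz \<omega> \<and> \<not> hit u p q (Suc m) (\<epsilon> j) \<omega>)) \<longlonglongrightarrow> (0::real)"
        proof (cases "?nz \<omega>")
          case False
          from eventually_hit[OF u this \<epsilon>[of j]] have "eventually (\<lambda>m. hit u p q (Suc m) (\<epsilon> j) \<omega>) sequentially"
            by (subst eventually_sequentially_Suc)
          then show ?thesis by (intro tendsto_eventually) (auto elim: eventually_mono)
        qed simp
      qed
    qed auto
    then have "eventually (\<lambda>m. expectation (\<lambda>\<omega>. of_bool (\<not> ?nz \<omega> \<and> \<not> hit u p q (Suc m) (\<epsilon> j) \<omega>)) < \<epsilon> j) sequentially"
      using \<epsilon>[of j] by (intro order_tendstoD) auto
    then obtain m where "expectation (\<lambda>\<omega>. of_bool (\<not> ?nz \<omega> \<and> \<not> hit u p q (Suc m) (\<epsilon> j) \<omega>)) < \<epsilon> j"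
      by (auto simp: eventually_sequentially)
    then show ?thesis by (intro exI[of _ "Suc m"]) auto
  qed
  then obtain m where m: "\<And>j. 0 < m j" "\<And>j. expectation (\<lambda>\<omega>. of_bool (\<not> ?nz \<omega> \<and> \<not> hit u p q (m j) (\<epsilon> j) \<omega>)) \<le> \<epsilon> j"
    by metis
  define H where "H j = hit u p q (m j) (\<epsilon> j)" for j
  have [measurable]: "Measurable.pred M (H j)" for j unfolding H_def by (rule hm[OF m(1)])
  define Q where "Q j R \<longleftrightarrow> R \<in> borel_measurable M \<and> (\<forall>\<omega>. \<bar>R \<omega>\<bar> \<le> 2 * B) \<and>
     expectation (\<lambda>\<omega>. if H j \<omega> then A \<omega> else 0) = expectation R / 2 \<and>
     (\<forall>\<omega>. 2 * \<epsilon> j < \<bar>grid u \<omega> q\<bar> \<longrightarrow> 0 \<le> \<epsilon> j \<longrightarrow> (\<exists>y. (\<forall>k\<le>K. \<bar>y k - \<bar>grid u \<omega> k\<bar>\<bar> \<le> 2 * \<epsilon> j) \<and> \<bar>R \<omega>\<bar> \<le> \<bar>g \<omega> - G y\<bar>))" for j R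
  have "\<exists>R. Q j R" for j
    unfolding Q_def H_def A_def g_def by (rule hit_reflection[OF u p1 pq m(1) G dep Gb])
  then have "\<exists>R. \<forall>j. Q j (R j)" by (intro choice allI)
  then obtain R where Q: "\<And>j. Q j (R j)" by blast
  have R: "R j \<in> borel_measurable M" "\<bar>R j \<omega>\<bar> \<le> 2 * B"
      "expectation (\<lambda>\<omega>. if H j \<omega> then A \<omega> else 0) = expectation (R j) / 2" for j \<omega>
    using Q[of j] unfolding Q_def by blast+
  have R4: "\<exists>y. (\<forall>k\<le>K. \<bar>y k - \<bar>grid u \<omega> k\<bar>\<bar> \<le> 2 * \<epsilon> j) \<and> \<bar>R j \<omega>\<bar> \<le> \<bar>g \<omega> - G y\<bar>"
    if "2 * \<epsilon> j < \<bar>grid u \<omega> q\<bar>" for j \<omega>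
    using Q[of j] that less_imp_le[OF \<epsilon>[of j]] unfolding Q_def by blast
  have "(\<lambda>j. expectation (R j)) \<longlonglongrightarrow> expectation (\<lambda>\<omega>. 0 :: real)"
  proof (rule integral_dominated_convergence[where w="\<lambda>_. 2 * B"])
    have q0: "0 < real q * u" using p1 pq u by simp
    show "AE \<omega> in M. (\<lambda>j. R j \<omega>) \<longlonglongrightarrow> 0"
      using X_nonzero_AE[OF q0]
    proof eventually_elim
      case (elim \<omega>)
      then have "0 < \<bar>grid u \<omega> q\<bar>" by (simp add: grid_def)
      moreover have "(\<lambda>j. 2 * \<epsilon> j) \<longlonglongrightarrow> 2 * 0" by (intro tendsto_intros \<epsilon>0)
      ultimately have "eventually (\<lambda>j. 2 * \<epsilon> j < \<bar>grid u \<omega> q\<bar>) sequentially"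
        using order_tendstoD(2)[of "\<lambda>j. 2 * \<epsilon> j" 0] by simp
      then obtain J where J: "\<And>j. j \<ge> J \<Longrightarrow> 2 * \<epsilon> j < \<bar>grid u \<omega> q\<bar>" by (auto simp: eventually_sequentially)
      \<comment> \<open>Dropping the first \<open>J\<close> indices guarantees that the path at
        \<open>q\<close> exceeds \<open>2 * \<epsilon>\<close>. The absolute values of the reflected
        paths are the \<open>y j\<close>; they converge to those of the path, and \<open>Gc\<close>
        applies.\<close>
      have "\<forall>j. \<exists>y. (\<forall>k\<le>K. \<bar>y k - \<bar>grid u \<omega> k\<bar>\<bar> \<le> 2 * \<epsilon> (j + J)) \<and> \<bar>R (j + J) \<omega>\<bar> \<le> \<bar>g \<omega> - G y\<bar>"
        by (intro allI R4 J) simp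
      from choice[OF this] obtain y where y: "\<And>j k. k \<le> K \<Longrightarrow> \<bar>y j k - \<bar>grid u \<omega> k\<bar>\<bar> \<le> 2 * \<epsilon> (j + J)" "\<And>j. \<bar>R (j + J) \<omega>\<bar> \<le> \<bar>g \<omega> - G (y j)\<bar>"
        by blast
      have e2: "(\<lambda>j. 2 * \<epsilon> (j + J)) \<longlonglongrightarrow> 0"
        using LIMSEQ_ignore_initial_segment[OF \<open>(\<lambda>j. 2 * \<epsilon> j) \<longlonglongrightarrow> 2 * 0\<close>, of J] by simp
      have "(\<lambda>j. y j k) \<longlonglongrightarrow> \<bar>grid u \<omega> k\<bar>" if "k \<le> K" for k
        by (rule LIM_zero_cancel, rule Lim_null_comparison[OF _ e2]) (use y(1)[OF that] in auto)
      then have "(\<lambda>j. G (y j)) \<longlonglongrightarrow> g \<omega>" unfolding g_def by (intro Gc) auto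
      then have "(\<lambda>j. \<bar>g \<omega> - G (y j)\<bar>) \<longlonglongrightarrow> \<bar>g \<omega> - g \<omega>\<bar>" by (intro tendsto_intros)
      then have z: "(\<lambda>j. \<bar>g \<omega> - G (y j)\<bar>) \<longlonglongrightarrow> 0" by simp
      have "\<forall>\<^sub>F j in sequentially. norm (R (j + J) \<omega>) \<le> \<bar>g \<omega> - G (y j)\<bar>"
        unfolding real_norm_def by (intro always_eventually allI y(2))
      then have "(\<lambda>j. R (j + J) \<omega>) \<longlonglongrightarrow> 0" by (rule Lim_null_comparison[OF _ z])
      then show ?case by (rule LIMSEQ_offset)
    qed
  qed (use R in auto)
  then have "(\<lambda>j. expectation (R j) / 2) \<longlonglongrightarrow> 0 / 2" by (intro tendsto_intros) auto
  then have l1: "(\<lambda>j. expectation (\<lambda>\<omega>. if H j \<omega> then A \<omega> else 0)) \<longlonglongrightarrow> 0" unfolding R(3) by simp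
  have l2: "(\<lambda>j. expectation (\<lambda>\<omega>. A \<omega> * of_bool (?nz \<omega> \<and> \<not> H j \<omega>))) \<longlonglongrightarrow> expectation (\<lambda>\<omega>. g \<omega> * of_bool (?nz \<omega>))"
  proof (rule integral_dominated_convergence[where w="\<lambda>_. B"])
    show "AE \<omega> in M. (\<lambda>j. A \<omega> * of_bool (?nz \<omega> \<and> \<not> H j \<omega>)) \<longlonglongrightarrow> g \<omega> * of_bool (?nz \<omega>)"
    proof (intro AE_I2)
      fix \<omega>
      show "(\<lambda>j. A \<omega> * of_bool (?nz \<omega> \<and> \<not> H j \<omega>)) \<longlonglongrightarrow> g \<omega> * of_bool (?nz \<omega>)"
      proof (cases "?nz \<omega>")
        case True
        from no_zero_not_hit[OF u pq(1) True] obtain e where e: "0 < e" "\<And>m d. 0 < m \<Longrightarrow> d < e \<Longrightarrow> \<not> hit u p q m d \<omega>" by blast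
        have "eventually (\<lambda>j. \<epsilon> j < e) sequentially" using \<epsilon>0 e(1) by (intro order_tendstoD)
        then have "eventually (\<lambda>j. A \<omega> * of_bool (?nz \<omega> \<and> \<not> H j \<omega>) = g \<omega> * of_bool (?nz \<omega>)) sequentially"
        proof eventually_elim
          case (elim j)
          then show ?case using e(2)[OF m(1), of "\<epsilon> j" j] True A_nz[OF True] by (simp add: H_def)
        qed
        then show ?thesis by (rule tendsto_eventually)
      qed simp
    qed
  qed (use Ab B0 in \<open>auto simp: of_bool_def\<close>)
  have l3: "(\<lambda>j. expectation (\<lambda>\<omega>. A \<omega> * of_bool (\<not> ?nz \<omega> \<and> \<not> H j \<omega>))) \<longlonglongrightarrow> 0"
  proof (rule Lim_null_comparison)
    show "(\<lambda>j. B * \<epsilon> j) \<longlonglongrightarrow> 0" using tendsto_mult_right_zero[OF \<epsilon>0] .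
    show "\<forall>\<^sub>F j in sequentially. norm (expectation (\<lambda>\<omega>. A \<omega> * of_bool (\<not> ?nz \<omega> \<and> \<not> H j \<omega>))) \<le> B * \<epsilon> j"
    proof (intro always_eventually allI)
      fix j
      have "norm (expectation (\<lambda>\<omega>. A \<omega> * of_bool (\<not> ?nz \<omega> \<and> \<not> H j \<omega>))) \<le> expectation (\<lambda>\<omega>. norm (A \<omega> * of_bool (\<not> ?nz \<omega> \<and> \<not> H j \<omega>)))"
        by (rule integral_norm_bound)
      also have "\<dots> \<le> expectation (\<lambda>\<omega>. B * of_bool (\<not> ?nz \<omega> \<and> \<not> H j \<omega>))"
        using Ab B0 by (intro integral_mono integrable_const_bound[where B=B]) (auto simp: of_bool_def)
      also have "\<dots> \<le> B * \<epsilon> j" using m(2)[of j] B0 by (simp add: H_def mult_left_mono)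
      finally show "norm (expectation (\<lambda>\<omega>. A \<omega> * of_bool (\<not> ?nz \<omega> \<and> \<not> H j \<omega>))) \<le> B * \<epsilon> j" .
    qed
  qed
  have split: "expectation A = expectation (\<lambda>\<omega>. if H j \<omega> then A \<omega> else 0) + expectation (\<lambda>\<omega>. A \<omega> * of_bool (?nz \<omega> \<and> \<not> H j \<omega>))
      + expectation (\<lambda>\<omega>. A \<omega> * of_bool (\<not> ?nz \<omega> \<and> \<not> H j \<omega>))" for j
  proof -
    have i: "integrable M (\<lambda>\<omega>. if H j \<omega> then A \<omega> else 0)" "integrable M (\<lambda>\<omega>. A \<omega> * of_bool (?nz \<omega> \<and> \<not> H j \<omega>))"
        "integrable M (\<lambda>\<omega>. A \<omega> * of_bool (\<not> ?nz \<omega> \<and> \<not> H j \<omega>))"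
      using Ab B0 by (auto intro!: integrable_const_bound[where B=B] simp: of_bool_def)
    have "expectation A = expectation (\<lambda>\<omega>. (if H j \<omega> then A \<omega> else 0) + A \<omega> * of_bool (?nz \<omega> \<and> \<not> H j \<omega>) + A \<omega> * of_bool (\<not> ?nz \<omega> \<and> \<not> H j \<omega>))"
      by (intro Bochner_Integration.integral_cong) auto
    then show ?thesis using i by simp
  qed
  have "(\<lambda>j::nat. expectation A) \<longlonglongrightarrow> 0 + expectation (\<lambda>\<omega>. g \<omega> * of_bool (?nz \<omega>)) + 0"
    using tendsto_add[OF tendsto_add[OF l1 l2] l3] unfolding split[symmetric] .
  then have "expectation A = 0 + expectation (\<lambda>\<omega>. g \<omega> * of_bool (?nz \<omega>)) + 0"
    by (simp only: LIMSEQ_const_iff)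
  then show ?thesis unfolding A_def[abs_def] g_def by simp
qed

text \<open>By symmetry the Gaussian mean of \<open>sgn y\<close> is 0 and may be subtracted. The
  difference \<open>sgn (x + y) - sgn y\<close> is at most 2 and lives on
  \<open>\<bar>y\<bar> \<le> \<bar>x\<bar>\<close>, where the density is at most
  \<open>1 / sqrt (2 * pi * h)\<close>.\<close>

lemma heat_sgn_bound:
  assumes h: "0 < h"
  shows "\<bar>heat h sgn x\<bar> \<le> 4 * \<bar>x\<bar> / sqrt (2 * pi * h)"
proof -
  let ?n = "normal_density 0 (sqrt h)"
  have n1: "integrable lborel ?n" using h by simp
  have ib: "integrable lborel (\<lambda>y. ?n y * f y)" if [measurable]: "f \<in> borel_measurable borel" and "\<And>y. \<bar>f y\<bar> \<le> 2" for f
    by (rule Bochner_Integration.integrable_bound[OF integrable_mult_left[OF n1, of 2]])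
       (use that in \<open>auto simp: abs_mult intro!: mult_left_mono\<close>)
  have "heat h sgn x = (LINT y|lborel. ?n y * sgn (x + y))"
    unfolding heat_def by (subst lborel_integral_real_affine[where c=1 and t=x]) auto
  moreover have "(LINT y|lborel. ?n y * sgn y) = 0"
  proof -
    have "(LINT y|lborel. ?n y * sgn y) = (LINT y|lborel. ?n (- y) * sgn (- y))"
      by (subst lborel_integral_real_affine[where c="-1" and t=0]) auto
    also have "\<dots> = - (LINT y|lborel. ?n y * sgn y)" by (simp add: normal_density_def)
    finally show ?thesis by simp
  qed
  ultimately have "heat h sgn x = (LINT y|lborel. ?n y * sgn (x + y)) - (LINT y|lborel. ?n y * sgn y)" by simp
  also have "\<dots> = (LINT y|lborel. ?n y * sgn (x + y) - ?n y * sgn y)"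
    by (intro Bochner_Integration.integral_diff[symmetric] ib) (auto simp: sgn_if)
  finally have eq: "heat h sgn x = (LINT y|lborel. ?n y * (sgn (x + y) - sgn y))" by (simp add: right_diff_distrib)
  have c: "0 < sqrt (2 * pi * h)" using h by simp
  have "\<bar>heat h sgn x\<bar> \<le> (LINT y|lborel. \<bar>?n y * (sgn (x + y) - sgn y)\<bar>)"
    unfolding eq by (rule integral_abs_bound)
  also have "\<dots> \<le> (LINT y|lborel. indicator {- \<bar>x\<bar>..\<bar>x\<bar>} y * (2 / sqrt (2 * pi * h)))"
  proof (rule integral_mono')
    show "integrable lborel (\<lambda>y. indicator {- \<bar>x\<bar>..\<bar>x\<bar>} y * (2 / sqrt (2 * pi * h)))"
      by (intro integrable_mult_left integrable_real_indicator) auto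
    fix y
    have n: "?n y \<le> 1 / sqrt (2 * pi * h)"
      using h c by (simp add: normal_density_def divide_right_mono)
    show "\<bar>?n y * (sgn (x + y) - sgn y)\<bar> \<le> indicator {- \<bar>x\<bar>..\<bar>x\<bar>} y * (2 / sqrt (2 * pi * h))"
    proof (cases "y \<in> {- \<bar>x\<bar>..\<bar>x\<bar>}")
      case True
      have "\<bar>?n y * (sgn (x + y) - sgn y)\<bar> \<le> 1 / sqrt (2 * pi * h) * 2"
        unfolding abs_mult using n h by (intro mult_mono) (auto simp: sgn_if)
      then show ?thesis using True by simp
    next
      case False
      then have "sgn (x + y) = sgn y" by (auto simp: sgn_if)
      then show ?thesis using False by simp
    qed
  qed (use h in auto)
  also have "\<dots> = 4 * \<bar>x\<bar> / sqrt (2 * pi * h)" by simp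
  finally show ?thesis .
qed

text \<open>Reflection expresses the probability of having no zero between 1 and
  \<open>1 + n\<close> as the mean of \<open>sgn x * heat n sgn x\<close>, where \<open>x\<close> is
  the position at time 1; for each position this is of order \<open>1 / sqrt n\<close>.\<close>

lemma zero_after_1_AE: "AE \<omega> in M. \<exists>t\<ge>1. X t \<omega> = 0"
proof -
  have e: "expectation (\<lambda>\<omega>. of_bool (no_zero 1 (real (1 + n)) \<omega>) :: real) = expectation (\<lambda>\<omega>. sgn (grid 1 \<omega> 1) * heat (real n) sgn (grid 1 \<omega> 1))" if n: "1 \<le> n" for n
  proof -
    have "expectation (\<lambda>\<omega>. of_bool (no_zero 1 (real (1 + n)) \<omega>) :: real) = expectation (\<lambda>\<omega>. sgn (grid 1 \<omega> 1) * sgn (grid 1 \<omega> (1 + n)))"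
      using no_zero_reflection[of 1 1 "1 + n" "1 + n" "\<lambda>_. 1" 1] by simp
    also have "\<dots> = expectation (\<lambda>\<omega>. sgn (grid 1 \<omega> 1) * heat (real n * 1) sgn (grid 1 \<omega> 1))"
      by (rule chain_heat[where b=1 and c=1]) (use n in \<open>auto simp: depends_upto_def sgn_if\<close>)
    finally show ?thesis by simp
  qed
  have sb: "\<bar>sgn x :: real\<bar> \<le> 1" for x :: real by (simp add: sgn_if)
  have hb: "\<bar>heat h sgn x\<bar> \<le> 1" if "0 < h" for h x
    by (rule heat_bound[OF that _ sb]) auto
  have [measurable]: "(\<lambda>\<omega>. grid 1 \<omega> k) \<in> borel_measurable M" for k by (rule borel_measurable_grid) simp
  have "(\<lambda>n. expectation (\<lambda>\<omega>. sgn (grid 1 \<omega> 1) * heat (real (Suc n)) sgn (grid 1 \<omega> 1))) \<longlonglongrightarrow> expectation (\<lambda>\<omega>. 0 :: real)"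
  proof (rule integral_dominated_convergence[where w="\<lambda>_. 1"])
    show "AE \<omega> in M. norm (sgn (grid 1 \<omega> 1) * heat (real (Suc n)) sgn (grid 1 \<omega> 1)) \<le> 1" for n
      using mult_mono[OF sb hb[of "real (Suc n)"]] by (auto simp: abs_mult simp del: of_nat_Suc)
    show "AE \<omega> in M. (\<lambda>n. sgn (grid 1 \<omega> 1) * heat (real (Suc n)) sgn (grid 1 \<omega> 1)) \<longlonglongrightarrow> 0"
    proof (intro AE_I2)
      fix \<omega>
      let ?x = "grid 1 \<omega> 1"
      show "(\<lambda>n. sgn ?x * heat (real (Suc n)) sgn ?x) \<longlonglongrightarrow> 0"
      proof (rule tendsto_mult_right_zero, rule Lim_null_comparison)
        show "\<forall>\<^sub>F n in sequentially. norm (heat (real (Suc n)) sgn ?x) \<le> 4 * \<bar>?x\<bar> / sqrt (2 * pi * real (Suc n))"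
          using heat_sgn_bound[of "real (Suc n)" ?x for n] by (auto simp del: of_nat_Suc)
        have "(\<lambda>n. 4 * c / sqrt (2 * pi * real (Suc n))) \<longlonglongrightarrow> 0" for c by real_asymp
        then show "(\<lambda>n. 4 * \<bar>?x\<bar> / sqrt (2 * pi * real (Suc n))) \<longlonglongrightarrow> 0" .
      qed
    qed
  qed auto
  then have lim: "(\<lambda>n. expectation (\<lambda>\<omega>. of_bool (no_zero 1 (real (1 + Suc n)) \<omega>) :: real)) \<longlonglongrightarrow> 0"
  proof -
    have "expectation (\<lambda>\<omega>. of_bool (no_zero 1 (real (1 + Suc n)) \<omega>) :: real) = expectation (\<lambda>\<omega>. sgn (grid 1 \<omega> 1) * heat (real (Suc n)) sgn (grid 1 \<omega> 1))" for n
      by (rule e) simp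
    then show "(\<lambda>n. expectation (\<lambda>\<omega>. sgn (grid 1 \<omega> 1) * heat (real (Suc n)) sgn (grid 1 \<omega> 1))) \<longlonglongrightarrow> expectation (\<lambda>\<omega>. 0 :: real) \<Longrightarrow> ?thesis"
      by simp
  qed
  have nm[measurable]: "Measurable.pred M (no_zero 1 (real (1 + n)))" for n
    using measurable_no_zero[of 1 1 "1 + n"] by simp
  let ?N = "\<lambda>\<omega>. \<forall>n. no_zero 1 (real (1 + Suc n)) \<omega>"
  have int: "integrable M (\<lambda>\<omega>. of_bool (P \<omega>) :: real)" if [measurable]: "Measurable.pred M P" for P
    by (rule integrable_const_bound[where B=1]) auto
  have "expectation (\<lambda>\<omega>. of_bool (?N \<omega>) :: real) \<le> expectation (\<lambda>\<omega>. of_bool (no_zero 1 (real (1 + Suc n)) \<omega>) :: real)" for n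
  proof (rule integral_mono)
    show "integrable M (\<lambda>\<omega>. of_bool (no_zero 1 (real (1 + Suc n)) \<omega>) :: real)" by (rule int[OF nm])
    have "Measurable.pred M ?N" using nm by (intro pred_intros_countable)
    then show "integrable M (\<lambda>\<omega>. of_bool (?N \<omega>) :: real)" by (rule int)
  qed auto
  then have "expectation (\<lambda>\<omega>. of_bool (?N \<omega>) :: real) \<le> 0" using lim by (intro LIMSEQ_le_const) auto
  moreover have "0 \<le> expectation (\<lambda>\<omega>. of_bool (?N \<omega>) :: real)" by simp
  ultimately have "expectation (\<lambda>\<omega>. of_bool (?N \<omega>) :: real) = 0" by linarith
  moreover have "integrable M (\<lambda>\<omega>. of_bool (?N \<omega>) :: real)" using nm by (intro int pred_intros_countable)
  ultimately have "AE \<omega> in M. of_bool (?N \<omega>) = (0::real)"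
    using integral_nonneg_eq_0_iff_AE[of M "\<lambda>\<omega>. of_bool (?N \<omega>)"] by auto
  then show ?thesis
    by eventually_elim (auto simp: no_zero_def)
qed

end

section \<open>Discretization of the Sturm-Liouville problem\<close>

context sturm_liouville
begin

context
  fixes s :: real
  assumes s: "0 < s"
begin

abbreviation "u \<equiv> sl_sol p s"
abbreviation "u1 \<equiv> sl_sol' p s"

lemma DERIV_u_within: "t \<in> {0..1} \<Longrightarrow> (u has_real_derivative u1 t) (at t within {0..1})"
  using sl_sol_deriv[of t s] by (simp add: has_real_derivative_iff_has_vector_derivative)

lemma DERIV_u1_within: "t \<in> {0..1} \<Longrightarrow> (u1 has_real_derivative p t * s * u t) (at t within {0..1})"
  using sl_sol'_deriv[of t s] by (simp add: has_real_derivative_iff_has_vector_derivative)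

lemma DERIV_u: "0 < t \<Longrightarrow> t < 1 \<Longrightarrow> (u has_real_derivative u1 t) (at t)"
  using DERIV_u_within[of t] by (simp add: at_within_Icc_at)

lemma DERIV_u1: "0 < t \<Longrightarrow> t < 1 \<Longrightarrow> (u1 has_real_derivative p t * s * u t) (at t)"
  using DERIV_u1_within[of t] by (simp add: at_within_Icc_at)

lemma cont_u: "continuous_on {0..1} u" and cont_u1: "continuous_on {0..1} u1"
  using DERIV_continuous_on[OF DERIV_u_within] DERIV_continuous_on[OF DERIV_u1_within] by blast+

lemma u_ge: "t \<in> {0..1} \<Longrightarrow> t \<le> u t" and u_le: "t \<in> {0..1} \<Longrightarrow> u t \<le> t * exp (s * C * t\<^sup>2)"
  using sl_sol_ge[of t s] s by auto

lemma u_nonneg: "t \<in> {0..1} \<Longrightarrow> 0 \<le> u t" using u_ge[of t] by auto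

lemma u_pos: "0 < t \<Longrightarrow> t \<le> 1 \<Longrightarrow> 0 < u t" using u_ge[of t] by auto

lemma sub_cont_u: "0 \<le> a \<Longrightarrow> b \<le> 1 \<Longrightarrow> continuous_on {a..b} u"
  and sub_cont_u1: "0 \<le> a \<Longrightarrow> b \<le> 1 \<Longrightarrow> continuous_on {a..b} u1"
  by (auto intro: continuous_on_subset[OF cont_u] continuous_on_subset[OF cont_u1])

lemma u1_mono: assumes "0 \<le> a" "a \<le> b" "b \<le> 1" shows "u1 a \<le> u1 b"
proof (rule DERIV_nonneg_imp_increasing_open[OF assms(2)])
  fix x assume x: "a < x" "x < b"
  show "\<exists>y. DERIV u1 x :> y \<and> 0 \<le> y"
    using DERIV_u1[of x] x assms p_nonneg[of x] u_nonneg[of x] s by (intro exI[of _ "p x * s * u x"]) auto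
qed (use sub_cont_u1 assms in auto)

lemma u1_ge_1: "t \<in> {0..1} \<Longrightarrow> 1 \<le> u1 t"
  using u1_mono[of 0 t] by simp

lemma u_mono: assumes "0 \<le> a" "a \<le> b" "b \<le> 1" shows "u a \<le> u b"
proof (rule DERIV_nonneg_imp_increasing_open[OF assms(2)])
  fix x assume x: "a < x" "x < b"
  show "\<exists>y. DERIV u x :> y \<and> 0 \<le> y"
    using DERIV_u[of x] x assms u1_ge_1[of x] by (intro exI[of _ "u1 x"]) auto
qed (use sub_cont_u assms in auto)

lemma u_MVT: assumes "0 \<le> a" "a < b" "b \<le> 1"
  obtains x where "a < x" "x < b" "u b - u a = (b - a) * u1 x"
proof -
  have "\<exists>l z. a < z \<and> z < b \<and> DERIV u z :> l \<and> u b - u a = (b - a) * l"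
  proof (rule MVT[OF assms(2) sub_cont_u[OF assms(1,3)]])
    fix x assume "a < x" "x < b"
    then show "u differentiable at x" using DERIV_u[of x] assms unfolding real_differentiable_def by auto
  qed
  then obtain l z where z: "a < z" "z < b" "DERIV u z :> l" "u b - u a = (b - a) * l" by blast
  moreover have "l = u1 z" using DERIV_unique[OF z(3) DERIV_u[of z]] z assms by auto
  ultimately show ?thesis using that by blast
qed

lemma u_le_u1: assumes "0 < t" "t \<le> 1" shows "u t \<le> t * u1 t"
proof -
  obtain x where x: "0 < x" "x < t" "u t - u 0 = (t - 0) * u1 x" using u_MVT[of 0 t] assms by auto
  have "u1 x \<le> u1 t" using x assms by (intro u1_mono) auto
  then have "t * u1 x \<le> t * u1 t" using assms by (intro mult_left_mono) auto
  then show ?thesis using x(3) by simp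
qed

text \<open>Convexity of \<open>u\<close> together with \<open>u 0 = 0\<close>. It makes the
  discrete profile dominate the linear one that belongs to Brownian motion without weights.\<close>

lemma ratio_mono: assumes "0 < a" "a \<le> b" "b \<le> 1" shows "u a / a \<le> u b / b"
proof (rule DERIV_nonneg_imp_increasing_open[OF assms(2), where f="\<lambda>t. u t / t"])
  fix x assume x: "a < x" "x < b"
  have "((\<lambda>t. u t / t) has_real_derivative (u1 x * x - u x * 1) / (x * x)) (at x)"
    using x assms by (intro DERIV_divide DERIV_u DERIV_ident) auto
  moreover have "0 \<le> (u1 x * x - u x * 1) / (x * x)"
    using u_le_u1[of x] x assms by (intro divide_nonneg_nonneg) (auto simp: mult.commute)
  ultimately show "\<exists>y. DERIV (\<lambda>t. u t / t) x :> y \<and> 0 \<le> y" by blast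
qed (use assms in \<open>auto intro!: continuous_intros sub_cont_u\<close>)

text \<open>The mean value theorem twice: for the increment of \<open>u\<close> over
  \<open>h\<close>, and then for \<open>u1\<close>, whose derivative is given by the
  equation.\<close>

lemma second_difference:
  assumes "0 < h" "h \<le> t" "t + h \<le> 1"
  obtains \<xi> where "t - h \<le> \<xi>" "\<xi> \<le> t + h" "u (t + h) - 2 * u t + u (t - h) = h\<^sup>2 * (p \<xi> * s * u \<xi>)"
proof -
  have d: "((\<lambda>x. u (x + h) - u x) has_real_derivative u1 (x + h) - u1 x) (at x)" if "t - h < x" "x < t" for x
  proof -
    have "((\<lambda>x. u (x + h)) has_real_derivative u1 (x + h)) (at x)"
      using that assms by (subst DERIV_shift[symmetric], intro DERIV_u) auto
    then show ?thesis using that assms by (intro DERIV_diff DERIV_u) auto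
  qed
  have "\<exists>l z. t - h < z \<and> z < t \<and> DERIV (\<lambda>x. u (x + h) - u x) z :> l \<and>
     (u (t + h) - u t) - (u (t - h + h) - u (t - h)) = (t - (t - h)) * l"
  proof (rule MVT)
    show "continuous_on {t - h..t} (\<lambda>x. u (x + h) - u x)"
      using assms by (intro continuous_intros continuous_on_compose2[OF cont_u] sub_cont_u) (auto intro!: continuous_intros)
    show "\<And>x. t - h < x \<Longrightarrow> x < t \<Longrightarrow> (\<lambda>x. u (x + h) - u x) differentiable at x"
      using d by (auto simp: real_differentiable_def)
  qed (use assms in auto)
  then obtain l z where z: "t - h < z" "z < t" "DERIV (\<lambda>x. u (x + h) - u x) z :> l"
     "(u (t + h) - u t) - (u (t - h + h) - u (t - h)) = (t - (t - h)) * l" by blast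
  have l: "l = u1 (z + h) - u1 z" using DERIV_unique[OF z(3) d[OF z(1,2)]] .
  have "\<exists>l \<xi>. z < \<xi> \<and> \<xi> < z + h \<and> DERIV u1 \<xi> :> l \<and> u1 (z + h) - u1 z = (z + h - z) * l"
  proof (rule MVT)
    show "continuous_on {z..z + h} u1" using assms z by (intro sub_cont_u1) auto
    fix x assume "z < x" "x < z + h"
    then show "u1 differentiable at x" using DERIV_u1[of x] assms z unfolding real_differentiable_def by auto
  qed (use assms in auto)
  then obtain l' \<xi> where x: "z < \<xi>" "\<xi> < z + h" "DERIV u1 \<xi> :> l'" "u1 (z + h) - u1 z = h * l'" by auto
  have "l' = p \<xi> * s * u \<xi>" using DERIV_unique[OF x(3) DERIV_u1[of \<xi>]] x z assms by auto
  then have "u (t + h) - 2 * u t + u (t - h) = h\<^sup>2 * (p \<xi> * s * u \<xi>)"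
    using z(4) l x(4) by (simp add: power2_eq_square)
  then show ?thesis using that[of \<xi>] x z by auto
qed

text \<open>Chosen so that multiples of \<open>u\<close> on the grid solve the recursion of the Gaussian chain exactly and not
  only up to a discretization error.\<close>

definition weight :: "nat \<Rightarrow> nat \<Rightarrow> real" where
  "weight N k = real N * (u (real (Suc k) / real N) - 2 * u (real k / real N) + u (real (k - 1) / real N)) / (2 * u (real k / real N))"

text \<open>The second difference is \<open>u''\<close> at an intermediate point. Numerator and
  denominator of \<open>u \<xi> / u (k / N)\<close> may both be close to 0; as
  \<open>\<xi> \<le> (k + 1) / N \<le> 2 * k / N\<close> and \<open>u\<close> lies between two
  linear bounds, the quotient stays bounded even for the first few \<open>k\<close>.\<close>

lemma weight_eq:
  assumes k: "1 \<le> k" "k < N"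
  obtains \<xi> where "\<bar>\<xi> - real k / real N\<bar> \<le> 1 / real N" "0 \<le> \<xi>" "\<xi> \<le> 1" "u \<xi> \<le> 2 * exp (s * C) * u (real k / real N)"
    "real N * weight N k = s / 2 * (p \<xi> * (u \<xi> / u (real k / real N)))"
proof -
  let ?h = "1 / real N" let ?t = "real k / real N"
  have N: "0 < real N" using k by simp
  have h: "0 < ?h" "?h \<le> ?t" "?t + ?h \<le> 1"
    using k N by (auto simp: divide_right_mono field_simps simp flip: add_divide_distrib of_nat_Suc)
  have e: "?t + ?h = real (Suc k) / real N" "?t - ?h = real (k - 1) / real N"
    using k by (simp_all add: add_divide_distrib diff_divide_distrib of_nat_diff)
  obtain \<xi> where x: "?t - ?h \<le> \<xi>" "\<xi> \<le> ?t + ?h" "u (?t + ?h) - 2 * u ?t + u (?t - ?h) = ?h\<^sup>2 * (p \<xi> * s * u \<xi>)"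
    using second_difference[OF h] .
  have x01: "0 \<le> \<xi>" "\<xi> \<le> 1" using x h by linarith+
  have t: "0 < ?t" "?t \<le> 1" using h by linarith+
  show ?thesis
  proof (rule that[OF _ x01])
    show "\<bar>\<xi> - ?t\<bar> \<le> 1 / real N" using x by linarith
    have "u \<xi> \<le> u (?t + ?h)" using x x01 h by (intro u_mono) auto
    also have "\<dots> \<le> (?t + ?h) * exp (s * C * (?t + ?h)\<^sup>2)" using h t by (intro u_le) auto
    also have "\<dots> \<le> (2 * ?t) * exp (s * C * 1)"
    proof (rule mult_mono)
      have "(?t + ?h)\<^sup>2 \<le> 1" using h t by (intro power_le_one) auto
      then show "exp (s * C * (?t + ?h)\<^sup>2) \<le> exp (s * C * 1)"
        unfolding exp_le_cancel_iff using s C_nonneg by (intro mult_left_mono) auto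
    qed (use h t in auto)
    also have "\<dots> = 2 * exp (s * C) * ?t" by simp
    also have "\<dots> \<le> 2 * exp (s * C) * u ?t" using t by (intro mult_left_mono u_ge) auto
    finally show "u \<xi> \<le> 2 * exp (s * C) * u ?t" .
    show "real N * weight N k = s / 2 * (p \<xi> * (u \<xi> / u ?t))"
      unfolding weight_def e[symmetric] x(3) using N by (simp add: power2_eq_square)
  qed
qed

lemma weight_nonneg: assumes "1 \<le> k" "k < N" shows "0 \<le> weight N k"
proof -
  obtain \<xi> where x: "0 \<le> \<xi>" "\<xi> \<le> 1" "real N * weight N k = s / 2 * (p \<xi> * (u \<xi> / u (real k / real N)))"
    using weight_eq[OF assms] by metis
  have "0 < u (real k / real N)" using assms by (intro u_pos) auto
  then have "0 \<le> real N * weight N k" unfolding x(3) using x p_nonneg[of \<xi>] u_nonneg[of \<xi>] s by auto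
  then show ?thesis using assms by (simp add: zero_le_mult_iff)
qed

text \<open>The weights are the Riemann weights \<open>s / 2 * p / N\<close> only up to the quotient
  \<open>u \<xi> / u (k / N)\<close>, which tends to 1 at every fixed position but is merely bounded
  near 0. So the sum is written as the integral of a step function that is bounded and converges
  pointwise on the open unit interval.\<close>

lemma weight_sum_tendsto:
  fixes Y :: "real \<Rightarrow> real"
  assumes Y: "continuous_on {0..1} Y"
  shows "(\<lambda>N. \<Sum>k=1..<N. weight N k * Y (real k / real N)) \<longlonglongrightarrow> s * (LINT t:{0..1}|lborel. p t / 2 * Y t)"
proof -
  \<comment> \<open>The factor \<open>N\<close> compensates the cell length
    \<open>1 / N\<close>.\<close>
  define F where "F N x = (\<Sum>k=1..<N. real N * weight N k * Y (real k / real N) * indicator {real (k - 1) / real N<..real k / real N} x)" for N x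
  have "\<exists>x\<in>{0..1}. \<forall>y\<in>{0..1}. \<bar>Y y\<bar> \<le> \<bar>Y x\<bar>"
    by (intro continuous_attains_sup continuous_intros Y) auto
  then obtain L where L: "\<And>t. t \<in> {0..1} \<Longrightarrow> \<bar>Y t\<bar> \<le> L" by blast
  have L0: "0 \<le> L" using order_trans[OF abs_ge_zero L[of 0]] by simp
  define D where "D = s * C * exp (s * C) * L"
  have D0: "0 \<le> D" using s C_nonneg L0 by (simp add: D_def)
  have trm: "\<bar>real N * weight N k * Y (real k / real N)\<bar> \<le> D" if k: "1 \<le> k" "k < N" for N k
  proof -
    obtain \<xi> where x: "0 \<le> \<xi>" "\<xi> \<le> 1" "u \<xi> \<le> 2 * exp (s * C) * u (real k / real N)"
      "real N * weight N k = s / 2 * (p \<xi> * (u \<xi> / u (real k / real N)))"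
      using weight_eq[OF k] by metis
    have up: "0 < u (real k / real N)" using k by (intro u_pos) auto
    have "p \<xi> * (u \<xi> / u (real k / real N)) \<le> C * (2 * exp (s * C))"
      using x up p_le[of \<xi>] p_nonneg[of \<xi>] u_nonneg[of \<xi>] by (intro mult_mono) (auto simp: pos_divide_le_eq)
    then have 1: "real N * weight N k \<le> s / 2 * (C * (2 * exp (s * C)))"
      unfolding x(4) using s by (intro mult_left_mono) auto
    have "\<bar>real N * weight N k * Y (real k / real N)\<bar> = (real N * weight N k) * \<bar>Y (real k / real N)\<bar>"
      using weight_nonneg[OF k] by (simp add: abs_mult)
    also have "\<dots> \<le> (s / 2 * (C * (2 * exp (s * C)))) * L"
    proof (rule mult_mono[OF 1 L])
      show "real k / real N \<in> {0..1}" using k by auto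
    qed (use s C_nonneg in auto)
    finally show ?thesis by (simp add: D_def)
  qed
  have uniq: "k = j" if "x \<in> {real (k - 1) / real N<..real k / real N}" "x \<in> {real (j - 1) / real N<..real j / real N}" "1 \<le> k" "1 \<le> j" "0 < N" for x k j N
  proof (rule ccontr)
    assume "k \<noteq> j"
    then consider "k \<le> j - 1" | "j \<le> k - 1" using that by linarith
    then show False
    proof cases
      case 1
      then have "real k / real N \<le> real (j - 1) / real N" by (intro divide_right_mono) auto
      then show False using that by auto
    next
      case 2
      then have "real j / real N \<le> real (k - 1) / real N" by (intro divide_right_mono) auto
      then show False using that by auto
    qed
  qed
  have F_at: "F N x = real N * weight N k * Y (real k / real N)"
    if k: "1 \<le> k" "k < N" and x: "x \<in> {real (k - 1) / real N<..real k / real N}" for N k x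
  proof -
    have "F N x = (\<Sum>j=1..<N. if j = k then real N * weight N k * Y (real k / real N) else 0)"
      unfolding F_def
    proof (intro sum.cong refl)
      fix j assume j: "j \<in> {1..<N}"
      show "real N * weight N j * Y (real j / real N) * indicator {real (j - 1) / real N<..real j / real N} x = (if j = k then real N * weight N k * Y (real k / real N) else 0)"
        using uniq[OF x, of j] j k x by (cases "j = k") (auto simp: indicator_def)
    qed
    then show ?thesis using k by simp
  qed
  have Fb: "\<bar>F N x\<bar> \<le> D * indicator {0..1} x" for N x
  proof (cases "\<exists>k. 1 \<le> k \<and> k < N \<and> x \<in> {real (k - 1) / real N<..real k / real N}")
    case True
    then obtain k where k: "1 \<le> k" "k < N" "x \<in> {real (k - 1) / real N<..real k / real N}" by blast
    have "0 \<le> real (k - 1) / real N" "real k / real N \<le> 1" using k by auto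
    then have "x \<in> {0..1}" using k(3) unfolding atLeastAtMost_iff greaterThanAtMost_iff by linarith
    then show ?thesis using F_at[OF k] trm[OF k(1,2)] by simp
  next
    case False
    then have "F N x = 0" unfolding F_def by (intro sum.neutral) (auto simp: indicator_def)
    then show ?thesis using D0 by (simp add: indicator_def)
  qed
  have int: "(LINT x|lborel. F N x) = (\<Sum>k=1..<N. weight N k * Y (real k / real N))" for N
  proof -
    have i: "integrable lborel (indicat_real {real (k - 1) / real N<..real k / real N})" for k
      by (intro integrable_real_indicator) (auto simp: divide_right_mono)
    have "(LINT x|lborel. F N x) = (\<Sum>k=1..<N. real N * weight N k * Y (real k / real N) * measure lborel {real (k - 1) / real N<..real k / real N})"
    proof -
      have "(LINT x|lborel. F N x) = (\<Sum>k=1..<N. LINT x|lborel. real N * weight N k * Y (real k / real N) * indicator {real (k - 1) / real N<..real k / real N} x)"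
        unfolding F_def by (rule Bochner_Integration.integral_sum) (intro integrable_mult_right i)
      then show ?thesis by simp
    qed
    also have "\<dots> = (\<Sum>k=1..<N. weight N k * Y (real k / real N))"
    proof (intro sum.cong refl)
      fix k assume k: "k \<in> {1..<N}"
      have "measure lborel {real (k - 1) / real N<..real k / real N} = 1 / real N"
        using k by (subst measure_lborel_Ioc) (auto simp: divide_right_mono of_nat_diff simp flip: diff_divide_distrib)
      then show "real N * weight N k * Y (real k / real N) * measure lborel {real (k - 1) / real N<..real k / real N} = weight N k * Y (real k / real N)"
        using k by simp
    qed
    finally show ?thesis .
  qed
  have lim: "(\<lambda>N. F N x) \<longlonglongrightarrow> s / 2 * (p x * Y x)" if x: "0 < x" "x < 1" for x
  proof -
    \<comment> \<open>Rounding up matches the half-open cells: \<open>x\<close> lies in the cell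
      with right end \<open>k N / N\<close>.\<close>
    define k where "k N = nat \<lceil>x * real N\<rceil>" for N
    have rk: "real (k N) = of_int \<lceil>x * real N\<rceil>" for N
      unfolding k_def using x by (intro of_nat_nat) (auto simp: le_ceiling_iff intro: less_le_trans[of _ 0])
    have kb: "x * real N \<le> real (k N)" "real (k N) < x * real N + 1" for N
      unfolding rk using ceiling_correct[of "x * real N"] by linarith+
    have "eventually (\<lambda>N. 1 / (1 - x) < real N) sequentially"
      using filterlim_real_sequentially unfolding filterlim_at_top_dense by blast
    then obtain N0 where N0: "\<And>N. N0 \<le> N \<Longrightarrow> 1 / (1 - x) < real N" by (auto simp: eventually_sequentially)
    have good: "1 \<le> k N \<and> k N < N \<and> x \<in> {real (k N - 1) / real N<..real (k N) / real N}" if "N0 \<le> N" for N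
    proof -
      have "1 < real N * (1 - x)" using N0[OF that] x by (simp add: pos_divide_less_eq)
      then have a: "x * real N + 1 < real N" by (simp add: algebra_simps)
      have N: "0 < real N" using a x by (cases "N = 0") auto
      have "0 < x * real N" using x N by simp
      then have k1: "1 \<le> k N" using kb(1)[of N] by (cases "k N = 0") auto
      have "k N < N" using kb(2)[of N] a by linarith
      moreover have "x \<le> real (k N) / real N" using kb(1)[of N] N by (simp add: pos_le_divide_eq)
      moreover have "real (k N - 1) / real N < x" using kb(2)[of N] N k1 by (simp add: pos_divide_less_eq of_nat_diff)
      ultimately show ?thesis using k1 by auto
    qed
    have "\<exists>\<xi>. \<bar>\<xi> - real (k N) / real N\<bar> \<le> 1 / real N \<and> 0 \<le> \<xi> \<and> \<xi> \<le> 1 \<and>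
      real N * weight N (k N) = s / 2 * (p \<xi> * (u \<xi> / u (real (k N) / real N)))" if "N0 \<le> N" for N
      using weight_eq[of "k N" N] good[OF that] by metis
    then obtain \<xi> where xi: "\<And>N. N0 \<le> N \<Longrightarrow> \<bar>\<xi> N - real (k N) / real N\<bar> \<le> 1 / real N"
      "\<And>N. N0 \<le> N \<Longrightarrow> 0 \<le> \<xi> N" "\<And>N. N0 \<le> N \<Longrightarrow> \<xi> N \<le> 1"
      "\<And>N. N0 \<le> N \<Longrightarrow> real N * weight N (k N) = s / 2 * (p (\<xi> N) * (u (\<xi> N) / u (real (k N) / real N)))"
      by metis
    have l1: "(\<lambda>N. real (k N) / real N) \<longlonglongrightarrow> x"
    proof (rule LIM_zero_cancel, rule Lim_null_comparison)
      show "\<forall>\<^sub>F N in sequentially. norm (real (k N) / real N - x) \<le> 1 / real N"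
        using eventually_gt_at_top[of 0]
      proof eventually_elim
        case (elim N)
        have "real (k N) / real N - x = (real (k N) - x * real N) / real N" using elim by (simp add: diff_divide_distrib)
        also have "norm \<dots> \<le> 1 / real N"
          unfolding real_norm_def abs_divide abs_of_nat using kb[of N] by (intro divide_right_mono) auto
        finally show ?case .
      qed
      show "(\<lambda>N. 1 / real N) \<longlonglongrightarrow> 0" by real_asymp
    qed
    have l2: "\<xi> \<longlonglongrightarrow> x"
    proof -
      have "(\<lambda>N. \<xi> N - real (k N) / real N) \<longlonglongrightarrow> 0"
      proof (rule Lim_null_comparison)
        show "\<forall>\<^sub>F N in sequentially. norm (\<xi> N - real (k N) / real N) \<le> 1 / real N"
          using xi(1) by (auto simp: eventually_sequentially)
        show "(\<lambda>N. 1 / real N) \<longlonglongrightarrow> 0" by real_asymp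
      qed
      from tendsto_add[OF this l1] show ?thesis by simp
    qed
    have evx: "\<forall>\<^sub>F N in sequentially. \<xi> N \<in> {0..1}" using xi(2,3) by (auto simp: eventually_sequentially)
    have evk: "\<forall>\<^sub>F N in sequentially. real (k N) / real N \<in> {0..1}"
      unfolding eventually_sequentially
    proof (intro exI[of _ N0] allI impI)
      fix N assume "N0 \<le> N"
      from good[OF this] show "real (k N) / real N \<in> {0..1}" by simp
    qed
    have x01: "x \<in> {0..1}" using x by auto
    have lp: "(\<lambda>N. p (\<xi> N)) \<longlonglongrightarrow> p x" and lu: "(\<lambda>N. u (\<xi> N)) \<longlonglongrightarrow> u x"
      using continuous_on_tendsto_compose[OF cont_p l2 x01 evx] continuous_on_tendsto_compose[OF cont_u l2 x01 evx] by auto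
    have lk: "(\<lambda>N. u (real (k N) / real N)) \<longlonglongrightarrow> u x" and lY: "(\<lambda>N. Y (real (k N) / real N)) \<longlonglongrightarrow> Y x"
      using continuous_on_tendsto_compose[OF cont_u l1 x01 evk] continuous_on_tendsto_compose[OF Y l1 x01 evk] by auto
    have ux: "u x \<noteq> 0" using u_pos[of x] x by auto
    have "(\<lambda>N. s / 2 * (p (\<xi> N) * (u (\<xi> N) / u (real (k N) / real N))) * Y (real (k N) / real N)) \<longlonglongrightarrow> s / 2 * (p x * (u x / u x)) * Y x"
      by (intro tendsto_intros lp lu lk lY ux)
    moreover have "\<forall>\<^sub>F N in sequentially. s / 2 * (p (\<xi> N) * (u (\<xi> N) / u (real (k N) / real N))) * Y (real (k N) / real N) = F N x"
      unfolding eventually_sequentially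
    proof (intro exI[of _ N0] allI impI)
      fix N assume N: "N0 \<le> N"
      note g = good[OF N]
      show "s / 2 * (p (\<xi> N) * (u (\<xi> N) / u (real (k N) / real N))) * Y (real (k N) / real N) = F N x"
        unfolding F_at[OF g[THEN conjunct1] g[THEN conjunct2, THEN conjunct1] g[THEN conjunct2, THEN conjunct2]] xi(4)[OF N] ..
    qed
    ultimately have "(\<lambda>N. F N x) \<longlonglongrightarrow> s / 2 * (p x * (u x / u x)) * Y x" by (rule Lim_transform_eventually)
    then show ?thesis using ux by (simp add: mult.assoc)
  qed
  have "(\<lambda>N. LINT x|lborel. F N x) \<longlonglongrightarrow> (LINT x|lborel. s * (indicator {0..1} x * (p x / 2 * Y x)))"
  proof (rule integral_dominated_convergence[where w="\<lambda>x. D * indicator {0..1} x"])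
    have "set_borel_measurable borel {0..1} (\<lambda>x. p x / 2 * Y x)"
      by (intro set_measurable_continuous_on continuous_intros cont_p Y) auto
    then have "(\<lambda>x. indicator {0..1} x * (p x / 2 * Y x)) \<in> borel_measurable lborel"
      unfolding set_borel_measurable_def real_scaleR_def by (simp only: measurable_lborel1 measurable_lborel2)
    then show "(\<lambda>x. s * (indicator {0..1} x * (p x / 2 * Y x))) \<in> borel_measurable lborel"
      by (rule borel_measurable_times[OF borel_measurable_const])
    show "F N \<in> borel_measurable lborel" for N unfolding F_def by measurable
    show "integrable lborel (\<lambda>x. D * indicator {0..1::real} x)" by (intro integrable_mult_right integrable_real_indicator) auto
    show "AE x in lborel. norm (F N x) \<le> D * indicator {0..1} x" for N using Fb by simp
    show "AE x in lborel. (\<lambda>N. F N x) \<longlonglongrightarrow> s * (indicator {0..1} x * (p x / 2 * Y x))"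
      using AE_lborel_singleton[of 0] AE_lborel_singleton[of 1]
    proof eventually_elim
      case (elim x)
      show ?case
      proof (cases "0 < x \<and> x < 1")
        case True
        then show ?thesis using lim[of x] by (simp add: field_simps)
      next
        case False
        then have x: "x \<notin> {0..1}" using elim by auto
        then have "F N x = 0" for N using Fb[of N x] by simp
        then show ?thesis using x by simp
      qed
    qed
  qed
  then show ?thesis unfolding int by (simp add: set_lebesgue_integral_def)
qed

text \<open>\<open>U\<close> is \<open>u\<close> on the grid, scaled to \<open>U 1 = T / N\<close>
  as the chain requires; hence \<open>U N / T\<close> is \<open>u 1\<close> divided by
  \<open>N * u (1 / N)\<close>. The last four claims keep both diagonal coefficients between
  \<open>1 / T\<close> and a multiple of \<open>1 / T\<close>, so that at distances of order
  \<open>\<eta> * sqrt T\<close> from 0 they affect the kernel only through an exponent of order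
  \<open>\<eta>\<^sup>2\<close>.\<close>

lemma discrete_profile:
  fixes N :: nat and T :: real
  assumes N: "1 \<le> N" and T: "0 < T"
  defines "U \<equiv> (\<lambda>k. T / (real N * u (1 / real N)) * u (real k / real N))"
  shows "U 0 = 0" "U 1 = T / real N" "\<And>k. 1 \<le> k \<Longrightarrow> k \<le> N \<Longrightarrow> 0 < U k" "\<And>k. 1 \<le> k \<Longrightarrow> k \<le> N \<Longrightarrow> U (k - 1) < U k"
    "\<And>k. 1 \<le> k \<Longrightarrow> k < N \<Longrightarrow> weight N k / T = (U (Suc k) - 2 * U k + U (k - 1)) / (2 * (T / real N) * U k)"
    "T \<le> U N" "T / U N = real N * u (1 / real N) / u 1"
    "1 / T \<le> 1 / (T / real N) - (\<Sum>k=1..<N. (T / real N) / (U k * U (Suc k)))"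
    "1 / (T / real N) - (\<Sum>k=1..<N. (T / real N) / (U k * U (Suc k))) \<le> (1 + 4 * s * C) / T"
    "1 / T \<le> (1 - U (N - 1) / U N) / (T / real N)" "(1 - U (N - 1) / U N) / (T / real N) \<le> u1 1 / T"
proof -
  \<comment> \<open>The ratio of \<open>u\<close> to the linear profile. For constant
    \<open>v\<close> the diagonal coefficient telescopes to its free value \<open>1 / T\<close>; the
    estimates below measure the deviation from this case.\<close>
  define v where "v k = u (real k / real N) / (real k / real N)" for k
  have N0: "0 < real N" using N by simp
  have u1N: "0 < u (1 / real N)" using N by (intro u_pos) auto
  have up: "0 < u (real k / real N)" if "1 \<le> k" "k \<le> N" for k using that by (intro u_pos) auto
  define c where "c = T / (real N * u (1 / real N))"
  have c0: "0 < c" using T N0 u1N by (simp add: c_def)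
  have U: "U k = c * u (real k / real N)" for k by (simp add: U_def c_def)
  show "U 0 = 0" by (simp add: U)
  show "U 1 = T / real N" using u1N by (simp add: U c_def)
  show Upos: "0 < U k" if "1 \<le> k" "k \<le> N" for k using c0 up[OF that] by (simp add: U)
  have vmono: "v j \<le> v k" if "1 \<le> j" "j \<le> k" "k \<le> N" for j k
    unfolding v_def using that N0 by (intro ratio_mono) (auto intro!: divide_right_mono)
  have v1: "v 1 = real N * u (1 / real N)" using N0 by (simp add: v_def mult.commute)
  have v1pos: "0 < v 1" unfolding v1 using N0 u1N by simp
  have cT: "c = T / v 1" unfolding c_def v1 ..
  have vb: "1 \<le> v k" "v k \<le> exp (s * C * (real k / real N)\<^sup>2)" if "1 \<le> k" "k \<le> N" for k
  proof -
    have t: "real k / real N \<in> {0..1}" "0 < real k / real N" using that by auto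
    show "1 \<le> v k" unfolding v_def using u_ge[OF t(1)] t(2) by (simp only: le_divide_eq_1_pos)
    show "v k \<le> exp (s * C * (real k / real N)\<^sup>2)"
      unfolding v_def using u_le[OF t(1)] t(2) by (simp only: pos_divide_le_eq mult.commute)
  qed
  have Uv: "U k = T * (real k / real N) * (v k / v 1)" if "1 \<le> k" for k
    using that N0 by (simp add: U cT v_def)
  show "T \<le> U N"
    using vmono[of 1 N] N N0 v1pos T by (simp add: Uv[OF N] pos_le_divide_eq)
  show "T / U N = real N * u (1 / real N) / u 1"
    using T N0 by (simp add: U c_def)
  show "U (k - 1) < U k" if k: "1 \<le> k" "k \<le> N" for k
  proof -
    have ab: "0 \<le> real (k - 1) / real N" "real (k - 1) / real N < real k / real N" "real k / real N \<le> 1"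
      using k N0 by (auto intro!: divide_strict_right_mono)
    obtain x where x: "real (k - 1) / real N < x" "x < real k / real N"
      "u (real k / real N) - u (real (k - 1) / real N) = (real k / real N - real (k - 1) / real N) * u1 x"
      using u_MVT[OF ab] .
    have "0 < u1 x" using u1_ge_1[of x] x ab by auto
    then have "0 < u (real k / real N) - u (real (k - 1) / real N)" unfolding x(3) using ab by simp
    then show ?thesis using c0 by (simp add: U)
  qed
  show "weight N k / T = (U (Suc k) - 2 * U k + U (k - 1)) / (2 * (T / real N) * U k)" if "1 \<le> k" "k < N" for k
  proof -
    have e1: "(U (Suc k) - 2 * U k + U (k - 1)) = c * (u (real (Suc k) / real N) - 2 * u (real k / real N) + u (real (k - 1) / real N))"
      unfolding U by (simp only: distrib_left right_diff_distrib mult_ac)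
    have e2: "2 * (T / real N) * U k = c * (2 * u (real k / real N) * T / real N)" unfolding U by simp
    show ?thesis unfolding e1 e2 weight_def
    proof -
      have gen: "n * z / w / T = c * z / (c * (w * T / n))" for n z w using c0 by simp
      show "real N * (u (real (Suc k) / real N) - 2 * u (real k / real N) + u (real (k - 1) / real N)) / (2 * u (real k / real N)) / T =
        c * (u (real (Suc k) / real N) - 2 * u (real k / real N) + u (real (k - 1) / real N)) / (c * (2 * u (real k / real N) * T / real N))"
        by (rule gen)
    qed
  qed
  define q where "q k = real N / (real k * real (Suc k))" for k
  have tele: "(\<Sum>k=1..<n. real N / (real k * real (Suc k))) = real N - real N / real n" if "1 \<le> n" for n
    using that
  proof (induction n rule: nat_induct_at_least)
    case (Suc m)
    have "real N / (a * (a + 1)) = real N / a - real N / (a + 1)" if "0 < a" for a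
      using that by (simp add: field_simps)
    from this[of "real m"] Suc show ?case by (simp add: add.commute)
  qed simp
  have trm: "(T / real N) / (U k * U (Suc k)) = q k / T * ((v 1)\<^sup>2 / (v k * v (Suc k)))" if "1 \<le> k" "k < N" for k
    using that N0 T v1pos by (simp add: Uv q_def power2_eq_square mult_ac)
  have q0: "0 \<le> q k" for k by (simp add: q_def)
  have A: "1 / (T / real N) - (\<Sum>k=1..<N. (T / real N) / (U k * U (Suc k))) =
     1 / T + (\<Sum>k=1..<N. q k / T * (1 - (v 1)\<^sup>2 / (v k * v (Suc k))))"
  proof -
    have "(\<Sum>k=1..<N. (T / real N) / (U k * U (Suc k))) = (\<Sum>k=1..<N. q k / T * ((v 1)\<^sup>2 / (v k * v (Suc k))))"
      by (intro sum.cong refl trm) auto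
    moreover have "(\<Sum>k=1..<N. q k / T) = (real N - 1) / T"
      unfolding sum_divide_distrib[symmetric] q_def tele[OF N] using N0 by simp
    ultimately show ?thesis by (simp add: right_diff_distrib sum_subtractf diff_divide_distrib)
  qed
  have bnd: "0 \<le> 1 - (v 1)\<^sup>2 / (v k * v (Suc k))" "q k * (1 - (v 1)\<^sup>2 / (v k * v (Suc k))) \<le> 4 * s * C / real N"
    if k: "1 \<le> k" "k < N" for k
  proof -
    have vv: "0 < v k * v (Suc k)" using vb(1)[of k] vb(1)[of "Suc k"] k by (intro mult_pos_pos) auto
    have "(v 1)\<^sup>2 \<le> v k * v (Suc k)"
      unfolding power2_eq_square using vmono[of 1 k] vmono[of 1 "Suc k"] k v1pos by (intro mult_mono) auto
    then show "0 \<le> 1 - (v 1)\<^sup>2 / (v k * v (Suc k))" using vv by (simp add: pos_divide_le_eq)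
    \<comment> \<open>The defect is bounded through \<open>1 - exp (- e) \<le> e\<close>. The square
      in \<open>e\<close> cancels the two linear factors in the denominator of \<open>q k\<close>,
      so each summand is of order \<open>1 / N\<close>.\<close>
    define e where "e = 2 * s * C * (real (Suc k) / real N)\<^sup>2"
    have "v k * v (Suc k) \<le> exp (s * C * (real (Suc k) / real N)\<^sup>2) * exp (s * C * (real (Suc k) / real N)\<^sup>2)"
    proof (rule mult_mono)
      have "v k \<le> v (Suc k)" using k by (intro vmono) auto
      also have "\<dots> \<le> exp (s * C * (real (Suc k) / real N)\<^sup>2)" using k by (intro vb) auto
      finally show "v k \<le> exp (s * C * (real (Suc k) / real N)\<^sup>2)" .
      show "v (Suc k) \<le> exp (s * C * (real (Suc k) / real N)\<^sup>2)" using k by (intro vb) auto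
    qed (use vb(1)[of "Suc k"] k in auto)
    also have "\<dots> = exp e" by (simp add: e_def flip: exp_add)
    finally have ve: "v k * v (Suc k) \<le> exp e" .
    have "1 - e \<le> exp (- e)" using exp_ge_add_one_self[of "-e"] by simp
    also have "\<dots> \<le> 1 / (v k * v (Suc k))" unfolding exp_minus inverse_eq_divide using ve vv by (intro divide_left_mono) auto
    also have "\<dots> \<le> (v 1)\<^sup>2 / (v k * v (Suc k))"
      using vb(1)[of 1] N vv by (intro divide_right_mono) auto
    finally have "1 - (v 1)\<^sup>2 / (v k * v (Suc k)) \<le> e" by simp
    then have "q k * (1 - (v 1)\<^sup>2 / (v k * v (Suc k))) \<le> q k * e" using q0 by (intro mult_left_mono)
    also have "\<dots> = 2 * s * C * (real (Suc k) / real k) / real N"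
      using k N0 by (simp add: q_def e_def power2_eq_square)
    also have "\<dots> \<le> 2 * s * C * 2 / real N"
      using k N0 s C_nonneg by (intro divide_right_mono mult_left_mono) (auto simp: divide_le_eq)
    finally show "q k * (1 - (v 1)\<^sup>2 / (v k * v (Suc k))) \<le> 4 * s * C / real N" by simp
  qed
  have "0 \<le> (\<Sum>k=1..<N. q k / T * (1 - (v 1)\<^sup>2 / (v k * v (Suc k))))"
    using bnd(1) q0 T by (intro sum_nonneg mult_nonneg_nonneg divide_nonneg_nonneg) auto
  then show "1 / T \<le> 1 / (T / real N) - (\<Sum>k=1..<N. (T / real N) / (U k * U (Suc k)))" unfolding A by simp
  have "(\<Sum>k=1..<N. q k / T * (1 - (v 1)\<^sup>2 / (v k * v (Suc k)))) \<le> (\<Sum>k=1..<N. 4 * s * C / real N / T)"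
  proof (rule sum_mono)
    fix k assume "k \<in> {1..<N}"
    then have "q k * (1 - (v 1)\<^sup>2 / (v k * v (Suc k))) / T \<le> 4 * s * C / real N / T"
      using T by (intro divide_right_mono bnd(2)) auto
    then show "q k / T * (1 - (v 1)\<^sup>2 / (v k * v (Suc k))) \<le> 4 * s * C / real N / T" by simp
  qed
  also have "\<dots> = (real N - 1) * (4 * s * C / real N / T)" using N by (simp add: of_nat_diff)
  also have "\<dots> \<le> real N * (4 * s * C / real N / T)" using s C_nonneg T N0 by (intro mult_right_mono) auto
  also have "\<dots> = 4 * s * C / T" using N0 by simp
  finally show "1 / (T / real N) - (\<Sum>k=1..<N. (T / real N) / (U k * U (Suc k))) \<le> (1 + 4 * s * C) / T"
    unfolding A by (simp add: add_divide_distrib)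
  have B: "(1 - U (N - 1) / U N) / (T / real N) = real N * (u 1 - u (real (N - 1) / real N)) / (u 1 * T)"
    using c0 u_pos[of 1] N0 T by (simp add: U field_simps)
  have uu: "0 < u 1" by (rule u_pos) auto
  have "u (real (N - 1) / real N) \<le> (real (N - 1) / real N) * u 1"
  proof (cases "N = 1")
    case False
    then have r: "0 < real (N - 1) / real N" using N by simp
    then have "u (real (N - 1) / real N) / (real (N - 1) / real N) \<le> u 1 / 1" using N by (intro ratio_mono) auto
    then have "u (real (N - 1) / real N) \<le> u 1 / 1 * (real (N - 1) / real N)" using r by (simp only: pos_divide_le_eq)
    then show ?thesis by (simp only: div_by_1 mult.commute)
  qed simp
  then have "u 1 \<le> real N * (u 1 - u (real (N - 1) / real N))"
    using N0 N by (simp add: of_nat_diff field_simps)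
  then show "1 / T \<le> (1 - U (N - 1) / U N) / (T / real N)"
    unfolding B using uu T by (simp add: pos_le_divide_eq)
  have ab: "0 \<le> real (N - 1) / real N" "real (N - 1) / real N < 1" "(1::real) \<le> 1" using N by auto
  obtain x where x: "real (N - 1) / real N < x" "x < 1" "u 1 - u (real (N - 1) / real N) = (1 - real (N - 1) / real N) * u1 x"
    using u_MVT[OF ab] .
  have "real N * (u 1 - u (real (N - 1) / real N)) = u1 x"
    unfolding x(3) using N0 N by (simp add: of_nat_diff diff_divide_distrib)
  also have "\<dots> \<le> u1 1" using order_trans[OF ab(1) less_imp_le[OF x(1)]] x(2) by (intro u1_mono) auto
  also have "\<dots> \<le> u1 1 * u 1" using u1_ge_1[of 1] u_ge[of 1] by simp
  finally show "(1 - U (N - 1) / U N) / (T / real N) \<le> u1 1 / T"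
    unfolding B using uu T by (simp add: divide_simps mult.commute)
qed

text \<open>A difference quotient of \<open>u\<close> at 0, where the slope is 1. It makes
  \<open>T / U N\<close> tend to \<open>1 / u 1\<close>.\<close>

lemma profile_limit: "(\<lambda>N. real N * u (1 / real N)) \<longlonglongrightarrow> 1"
proof -
  have "(u has_real_derivative 1) (at 0 within {0..1})" using DERIV_u_within[of 0] by simp
  then have "((\<lambda>y. (u y - u 0) / (y - 0)) \<longlongrightarrow> 1) (at 0 within {0..1})"
    unfolding has_field_derivative_iff .
  moreover have "filterlim (\<lambda>N. 1 / real (Suc N)) (at 0 within {0..1}) sequentially"
  proof -
    have "(\<lambda>N. 1 / real (Suc N)) \<longlonglongrightarrow> 0" by real_asymp
    then show ?thesis unfolding filterlim_at by (auto intro!: always_eventually simp del: of_nat_Suc)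
  qed
  ultimately have "(\<lambda>N. (u (1 / real (Suc N)) - u 0) / (1 / real (Suc N) - 0)) \<longlonglongrightarrow> 1"
    by (rule filterlim_compose)
  then have "(\<lambda>N. real (Suc N) * u (1 / real (Suc N))) \<longlonglongrightarrow> 1" by (simp add: mult.commute del: of_nat_Suc)
  then show ?thesis by (rule LIMSEQ_imp_Suc)
qed

end

end

section \<open>The excursion straddling 1\<close>

text \<open>A continuous bump rather than an indicator, since the reflection argument passes to the limit in
  functionals that are continuous in the path.\<close>

definition cutoff :: "real \<Rightarrow> real \<Rightarrow> real" where
  "cutoff \<rho> x = max 0 (1 - \<bar>x\<bar> / \<rho>)"

lemma cutoff_bounds: "0 < \<rho> \<Longrightarrow> 0 \<le> cutoff \<rho> x" "0 < \<rho> \<Longrightarrow> cutoff \<rho> x \<le> 1"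
  by (simp_all add: cutoff_def)

lemma cutoff_eq_0: "0 < \<rho> \<Longrightarrow> \<rho> < \<bar>x\<bar> \<Longrightarrow> cutoff \<rho> x = 0"
  by (simp add: cutoff_def)

lemma cutoff_minus [simp]: "cutoff \<rho> (- x) = cutoff \<rho> x"
  and cutoff_abs [simp]: "cutoff \<rho> \<bar>x\<bar> = cutoff \<rho> x"
  by (simp_all add: cutoff_def)

lemma cutoff_measurable [measurable]: "cutoff \<rho> \<in> borel_measurable borel"
  unfolding cutoff_def[abs_def] by measurable

lemma tendsto_cutoff: "(f \<longlongrightarrow> l) F \<Longrightarrow> ((\<lambda>x. cutoff \<rho> (f x)) \<longlongrightarrow> cutoff \<rho> l) F"
  unfolding cutoff_def divide_inverse by (intro tendsto_intros)

lemma heat_sgn_minus: "heat h sgn (- x) = - heat h sgn x"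
proof -
  have "heat h sgn (- x) = (LINT z|lborel. normal_density 0 (sqrt h) (- z - - x) * sgn (- z))"
    unfolding heat_def by (subst lborel_integral_real_affine[where c="-1" and t=0]) auto
  also have "\<dots> = (LINT z|lborel. - (normal_density 0 (sqrt h) (z - x) * sgn z))"
  proof (intro Bochner_Integration.integral_cong refl)
    fix z :: real
    have "- z - - x = - (z - x)" by simp
    then show "normal_density 0 (sqrt h) (- z - - x) * sgn (- z) = - (normal_density 0 (sqrt h) (z - x) * sgn z)"
      by (simp only: normal_density_def diff_0_right power2_minus sgn_minus mult_minus_right)
  qed
  finally show ?thesis by (simp add: heat_def)
qed

lemma heat_sgn_le_1: "0 < h \<Longrightarrow> \<bar>heat h sgn x\<bar> \<le> 1"
  by (rule heat_bound) (auto simp: sgn_if)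

context continuous_brownian_motion
begin

text \<open>If 1 lies between \<open>Suc i * \<delta>\<close> and \<open>j * \<delta>\<close>, this
  places the last zero before 1 in the cell \<open>i\<close> and the first zero after 1 in the cell
  \<open>j\<close>, using only \<open>no_zero\<close> between grid times.\<close>

definition straddle :: "real \<Rightarrow> nat \<Rightarrow> nat \<Rightarrow> 'a \<Rightarrow> bool" where
  "straddle \<delta> i j \<omega> \<longleftrightarrow> no_zero (real (Suc i) * \<delta>) (real j * \<delta>) \<omega> \<and>
     \<not> no_zero (real i * \<delta>) (real (Suc i) * \<delta>) \<omega> \<and> \<not> no_zero (real j * \<delta>) (real (Suc j) * \<delta>) \<omega>"

lemma no_zero_split: "a \<le> b \<Longrightarrow> b \<le> c \<Longrightarrow> no_zero a c \<omega> \<longleftrightarrow> no_zero a b \<omega> \<and> no_zero b c \<omega>"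
  unfolding no_zero_def by (metis atLeastAtMost_iff linear order_trans)

text \<open>Inclusion-exclusion turns the event into a combination of no-zero events, each of which reflection
  turns into a product of two signs.\<close>

lemma of_bool_straddle:
  assumes "0 < \<delta>" "Suc i \<le> j"
  shows "of_bool (straddle \<delta> i j \<omega>) = (of_bool (no_zero (real (Suc i) * \<delta>) (real j * \<delta>) \<omega>)
     - of_bool (no_zero (real i * \<delta>) (real j * \<delta>) \<omega>) - of_bool (no_zero (real (Suc i) * \<delta>) (real (Suc j) * \<delta>) \<omega>)
     + of_bool (no_zero (real i * \<delta>) (real (Suc j) * \<delta>) \<omega>) :: real)"
proof -
  have o: "real i * \<delta> \<le> real (Suc i) * \<delta>" "real (Suc i) * \<delta> \<le> real j * \<delta>" "real j * \<delta> \<le> real (Suc j) * \<delta>"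
    using assms by (intro mult_right_mono; simp)+
  have "no_zero (real i * \<delta>) (real j * \<delta>) \<omega> \<longleftrightarrow> no_zero (real i * \<delta>) (real (Suc i) * \<delta>) \<omega> \<and> no_zero (real (Suc i) * \<delta>) (real j * \<delta>) \<omega>"
    by (rule no_zero_split[OF o(1,2)])
  moreover have "no_zero (real (Suc i) * \<delta>) (real (Suc j) * \<delta>) \<omega> \<longleftrightarrow> no_zero (real (Suc i) * \<delta>) (real j * \<delta>) \<omega> \<and> no_zero (real j * \<delta>) (real (Suc j) * \<delta>) \<omega>"
    by (rule no_zero_split[OF o(2,3)])
  moreover have "no_zero (real i * \<delta>) (real (Suc j) * \<delta>) \<omega> \<longleftrightarrow> no_zero (real i * \<delta>) (real j * \<delta>) \<omega> \<and> no_zero (real j * \<delta>) (real (Suc j) * \<delta>) \<omega>"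
    by (rule no_zero_split) (use o in linarith)+
  ultimately show ?thesis
    unfolding straddle_def
    by (cases "no_zero (real (Suc i) * \<delta>) (real j * \<delta>) \<omega>"; cases "no_zero (real i * \<delta>) (real (Suc i) * \<delta>) \<omega>";
        cases "no_zero (real j * \<delta>) (real (Suc j) * \<delta>) \<omega>") simp_all
qed

lemma measurable_straddle:
  assumes "0 < \<delta>" "Suc i \<le> j"
  shows "Measurable.pred M (straddle \<delta> i j)"
proof -
  have [measurable]: "Measurable.pred M (no_zero (real (Suc i) * \<delta>) (real j * \<delta>))"
    "Measurable.pred M (no_zero (real i * \<delta>) (real (Suc i) * \<delta>))" "Measurable.pred M (no_zero (real j * \<delta>) (real (Suc j) * \<delta>))"
    using assms by (auto intro!: measurable_no_zero simp del: of_nat_Suc)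
  show ?thesis unfolding straddle_def[abs_def] by measurable
qed

text \<open>The four sign products of the inclusion-exclusion formula factor into a difference of
  signs across the left cell and one across the right cell. Integrating out the last sign leaves a
  functional \<open>Y\<close> of the past and an odd function \<open>\<beta>\<close> at the right
  inner end. The weighted and the unweighted expectation then differ only in the kernel between
  them, and \<open>integral_odd_kernel_bounds\<close> compares the two. The radius
  \<open>\<eta> * sqrt T\<close> follows Brownian scaling, so the error does not depend on
  \<open>T\<close>.\<close>

lemma straddle_chain_bounds:
  fixes p :: "real \<Rightarrow> real" and C s :: real
  assumes SL: "sturm_liouville p C" and s: "0 < s"
    and \<delta>: "0 < \<delta>" and ij: "Suc i < j" and m: "1 \<le> m" and \<eta>: "0 < \<eta>"
  defines "T \<equiv> real (j - Suc i) * \<delta>" and "N \<equiv> (j - Suc i) * m"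
  defines "\<rho> \<equiv> \<eta> * sqrt T"
  defines "\<zeta> \<equiv> (\<lambda>\<omega>. cutoff \<rho> (X (real (Suc i) * \<delta>) \<omega>) * cutoff \<rho> (X (real j * \<delta>) \<omega>) * of_bool (straddle \<delta> i j \<omega>))"
  defines "\<Xi> \<equiv> (\<lambda>\<omega>. \<Prod>k=1..<N. exp (- (sturm_liouville.weight p s N k / T) * (X (real (Suc i) * \<delta> + real k / real N * T) \<omega>)\<^sup>2))"
  defines "c \<equiv> (real N * sl_sol p s (1 / real N) / sl_sol p s 1) powr (3/2)"
  shows "exp (- (2 * s * C + sl_sol' p s 1 + 1) * \<eta>\<^sup>2) * (c * expectation \<zeta>) \<le> expectation (\<lambda>\<omega>. \<zeta> \<omega> * \<Xi> \<omega>)"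
    and "expectation (\<lambda>\<omega>. \<zeta> \<omega> * \<Xi> \<omega>) \<le> c * expectation \<zeta>"
proof -
  interpret sturm_liouville p C by (rule SL)
  define d where "d = j - Suc i"
  have d: "1 \<le> d" "j = Suc i + d" using ij by (auto simp: d_def)
  have T: "T = real d * \<delta>" "0 < T" using d(1) \<delta> by (simp_all add: T_def d_def[symmetric])
  have N: "N = d * m" "1 \<le> N" using d(1) m by (simp_all add: N_def d_def[symmetric])
  define h where "h = \<delta> / real m"
  have h: "0 < h" using \<delta> m by (simp add: h_def)
  have hT: "h = T / real N" using m d(1) by (simp add: h_def T(1) N(1))
  have \<rho>: "0 < \<rho>" "\<rho>\<^sup>2 = \<eta>\<^sup>2 * T" using \<eta> T(2) by (auto simp: \<rho>_def power_mult_distrib)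
  \<comment> \<open>Indices on the grid of mesh \<open>h\<close>: \<open>a\<close> and
    \<open>a + N\<close> are the inner ends of the two cells, \<open>i * m\<close> and
    \<open>K\<close> the outer ones.\<close>
  define a where "a = Suc i * m"
  define K where "K = Suc j * m"
  have aN: "a + N = j * m" "a + N + m = K" by (simp_all add: a_def N(1) d(2) K_def algebra_simps)
  have im: "i * m \<le> a" by (simp add: a_def)
  have gX: "grid h \<omega> (k * m) = X (real k * \<delta>) \<omega>" for k \<omega> using m by (simp add: grid_def h_def)
  have gk: "grid h \<omega> (a + k) = X (real (Suc i) * \<delta> + real k / real N * T) \<omega>" for k \<omega>
  proof -
    have "real (a + k) * h = real (Suc i) * \<delta> + real k * h" using m by (simp add: a_def h_def algebra_simps add_divide_distrib)
    also have "real k * h = real k / real N * T" by (simp add: hT)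
    finally show ?thesis by (simp add: grid_def)
  qed
  define U where "U k = T / (real N * sl_sol p s (1 / real N)) * sl_sol p s (real k / real N)" for k
  note prof = discrete_profile[OF s N(2) T(2), folded U_def, folded hT]
  define A where "A = 1 / h - (\<Sum>k=1..<N. h / (U k * U (Suc k)))"
  define B where "B = (1 - U (N - 1) / U N) / h"
  \<comment> \<open>The sign at the right inner end minus the conditional mean of the sign one cell
    later. It is odd, and nonnegative on the positive axis because that mean is at most 1.\<close>
  define \<beta> where "\<beta> y = cutoff \<rho> y * (sgn y - heat \<delta> sgn y)" for y
  have sgn1: "\<bar>sgn x :: real\<bar> \<le> 1" for x :: real by (simp add: sgn_if)
  have \<beta>m[measurable]: "\<beta> \<in> borel_measurable borel" unfolding \<beta>_def[abs_def] by measurable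
  have \<beta>odd: "\<beta> (- y) = - \<beta> y" for y by (simp add: \<beta>_def heat_sgn_minus algebra_simps)
  have \<beta>pos: "0 \<le> \<beta> y" if "0 \<le> y" for y
  proof (cases "y = 0")
    case True
    then show ?thesis using heat_sgn_minus[of \<delta> 0] by (simp add: \<beta>_def)
  next
    case False
    then have "heat \<delta> sgn y \<le> sgn y" using that heat_sgn_le_1[OF \<delta>, of y] by simp
    then show ?thesis using cutoff_bounds[OF \<rho>(1), of y] by (simp add: \<beta>_def)
  qed
  have \<beta>b: "\<bar>\<beta> y\<bar> \<le> 2" for y
  proof -
    have "\<bar>sgn y - heat \<delta> sgn y\<bar> \<le> 2" using sgn1[of y] heat_sgn_le_1[OF \<delta>, of y] by linarith
    then have "cutoff \<rho> y * \<bar>sgn y - heat \<delta> sgn y\<bar> \<le> 1 * 2"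
      using cutoff_bounds[OF \<rho>(1), of y] by (intro mult_mono) auto
    then show ?thesis using cutoff_bounds[OF \<rho>(1), of y] by (simp add: \<beta>_def abs_mult)
  qed
  have \<beta>0: "\<beta> y = 0" if "\<rho> < \<bar>y\<bar>" for y using cutoff_eq_0[OF \<rho>(1) that] by (simp add: \<beta>_def)
  define Y where "Y x = cutoff \<rho> (x a) * (sgn (x a) - sgn (x (i * m)))" for x :: "nat \<Rightarrow> real"
  have Ym[measurable]: "Y \<in> borel_measurable path_space" unfolding Y_def by measurable
  have Ydep: "depends_upto a Y" using im by (auto simp: depends_upto_def Y_def)
  have Yb: "\<bar>Y x\<bar> \<le> 2" for x
  proof -
    have "\<bar>sgn (x a) - sgn (x (i * m))\<bar> \<le> 2" using sgn1[of "x a"] sgn1[of "x (i * m)"] by linarith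
    then have "cutoff \<rho> (x a) * \<bar>sgn (x a) - sgn (x (i * m))\<bar> \<le> 1 * 2"
      using cutoff_bounds[OF \<rho>(1), of "x a"] by (intro mult_mono) auto
    then show ?thesis using cutoff_bounds[OF \<rho>(1), of "x a"] by (simp add: Y_def abs_mult)
  qed
  have mg: "(\<lambda>\<omega>. grid h \<omega> k) \<in> borel_measurable M" for k by (rule borel_measurable_grid[OF h])
  have mgp: "grid h \<in> measurable M path_space" by (rule measurable_grid[OF h])
  have sign_formula: "expectation (\<lambda>\<omega>. \<zeta> \<omega> * (\<Prod>k=1..<N. exp (- r k * (grid h \<omega> (a + k))\<^sup>2)))
     = expectation (\<lambda>\<omega>. Y (grid h \<omega>) * (\<Prod>k=1..<N. exp (- r k * (grid h \<omega> (a + k))\<^sup>2)) * \<beta> (grid h \<omega> (a + N)))"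
    if r: "\<And>k. 1 \<le> k \<Longrightarrow> k < N \<Longrightarrow> 0 \<le> r k" for r
  proof -
    define P where "P x = (\<Prod>k=1..<N. exp (- r k * (x (a + k))\<^sup>2))" for x :: "nat \<Rightarrow> real"
    define G where "G x = cutoff \<rho> (x a) * cutoff \<rho> (x (a + N)) * P x" for x
    have [measurable]: "P \<in> borel_measurable path_space" unfolding P_def by measurable
    have [measurable]: "G \<in> borel_measurable path_space" unfolding G_def by measurable
    have P01: "0 \<le> P x" "P x \<le> 1" for x
      unfolding P_def using r by (auto intro!: prod_nonneg prod_le_1)
    have P_abs: "P (\<lambda>k. \<bar>x k\<bar>) = P x" for x by (simp add: P_def)
    have G01: "0 \<le> G x" "G x \<le> 1" for x
    proof -
      show "0 \<le> G x" unfolding G_def using cutoff_bounds[OF \<rho>(1)] P01 by (intro mult_nonneg_nonneg) auto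
      have "G x \<le> 1 * 1 * 1" unfolding G_def using cutoff_bounds[OF \<rho>(1)] P01 by (intro mult_mono mult_nonneg_nonneg) auto
      then show "G x \<le> 1" by simp
    qed
    have G_abs: "G (\<lambda>k. \<bar>x k\<bar>) = G x" for x by (simp add: G_def P_abs)
    have Gc: "(\<lambda>n. G (y n)) \<longlonglongrightarrow> G x" if "\<And>k. k \<le> K \<Longrightarrow> (\<lambda>n. y n k) \<longlonglongrightarrow> x k" for y x
      unfolding G_def P_def using aN
      by (intro tendsto_intros tendsto_cutoff that) auto
    have sgn_eq: "expectation (\<lambda>\<omega>. G (grid h \<omega>) * (sgn (grid h \<omega> (i' * m)) * sgn (grid h \<omega> (j' * m)))) =
        expectation (\<lambda>\<omega>. G (grid h \<omega>) * of_bool (no_zero (real i' * \<delta>) (real j' * \<delta>) \<omega>))"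
      if "i' \<le> j'" "j' \<le> Suc j" for i' j'
    proof -
      have "i' * m \<le> j' * m" "j' * m \<le> K" unfolding K_def using that by (intro mult_right_mono; simp)+
      note q = this
      have "expectation (\<lambda>\<omega>. G (\<lambda>k. \<bar>grid h \<omega> k\<bar>) * (sgn (grid h \<omega> (i' * m)) * sgn (grid h \<omega> (j' * m)))) =
        expectation (\<lambda>\<omega>. G (\<lambda>k. \<bar>grid h \<omega> k\<bar>) * of_bool (no_zero (real (i' * m) * h) (real (j' * m) * h) \<omega>))"
      proof (rule no_zero_reflection[where B=1, OF h q])
        show "\<bar>G x\<bar> \<le> 1" for x using G01[of x] by simp
      qed (use Gc in auto)
      then have "expectation (\<lambda>\<omega>. G (grid h \<omega>) * (sgn (grid h \<omega> (i' * m)) * sgn (grid h \<omega> (j' * m)))) =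
        expectation (\<lambda>\<omega>. G (grid h \<omega>) * of_bool (no_zero (real (i' * m) * h) (real (j' * m) * h) \<omega>))"
        by (simp only: G_abs)
      moreover have "real (k * m) * h = real k * \<delta>" for k using m by (simp add: h_def)
      ultimately show ?thesis by (simp only:)
    qed
    have intG: "integrable M (\<lambda>\<omega>. G (grid h \<omega>) * F \<omega>)" if "F \<in> borel_measurable M" "\<And>\<omega>. \<bar>F \<omega>\<bar> \<le> 1" for F
    proof (rule integrable_const_bound[where B=1])
      have "\<bar>G (grid h \<omega>) * F \<omega>\<bar> \<le> 1 * 1" for \<omega>
        unfolding abs_mult using G01[of "grid h \<omega>"] that(2)[of \<omega>] by (intro mult_mono) auto
      then show "AE \<omega> in M. norm (G (grid h \<omega>) * F \<omega>) \<le> 1" by simp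
      show "(\<lambda>\<omega>. G (grid h \<omega>) * F \<omega>) \<in> borel_measurable M"
        using mgp that(1) by measurable
    qed
    have nzm: "(\<lambda>\<omega>. of_bool (no_zero (real i' * \<delta>) (real j' * \<delta>) \<omega>) :: real) \<in> borel_measurable M" if "i' \<le> j'" for i' j'
      using measurable_no_zero[OF \<delta> that] by measurable
    have ssm: "(\<lambda>\<omega>. sgn (grid h \<omega> k) * sgn (grid h \<omega> l) :: real) \<in> borel_measurable M" for k l
      using mg[of k] mg[of l] by measurable
    have ssb: "\<bar>sgn x * sgn y :: real\<bar> \<le> 1" for x y :: real by (simp add: sgn_if abs_mult)
    note i1 = intG[OF nzm] note i2 = intG[OF ssm ssb]
    have ijs: "Suc i \<le> j" "i \<le> j" "Suc i \<le> Suc j" "i \<le> Suc j" using ij by auto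
    have "expectation (\<lambda>\<omega>. \<zeta> \<omega> * P (grid h \<omega>)) = expectation (\<lambda>\<omega>. G (grid h \<omega>) * of_bool (straddle \<delta> i j \<omega>))"
      unfolding \<zeta>_def G_def aN(1) gX gX[of _ "Suc i", folded a_def] by (simp add: mult_ac)
    also have "\<dots> = expectation (\<lambda>\<omega>. G (grid h \<omega>) * of_bool (no_zero (real (Suc i) * \<delta>) (real j * \<delta>) \<omega>)
        - G (grid h \<omega>) * of_bool (no_zero (real i * \<delta>) (real j * \<delta>) \<omega>)
        - G (grid h \<omega>) * of_bool (no_zero (real (Suc i) * \<delta>) (real (Suc j) * \<delta>) \<omega>)
        + G (grid h \<omega>) * of_bool (no_zero (real i * \<delta>) (real (Suc j) * \<delta>) \<omega>))"
      unfolding of_bool_straddle[OF \<delta> ijs(1)] by (simp only: distrib_left right_diff_distrib)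
    also have "\<dots> = expectation (\<lambda>\<omega>. G (grid h \<omega>) * of_bool (no_zero (real (Suc i) * \<delta>) (real j * \<delta>) \<omega>))
        - expectation (\<lambda>\<omega>. G (grid h \<omega>) * of_bool (no_zero (real i * \<delta>) (real j * \<delta>) \<omega>))
        - expectation (\<lambda>\<omega>. G (grid h \<omega>) * of_bool (no_zero (real (Suc i) * \<delta>) (real (Suc j) * \<delta>) \<omega>))
        + expectation (\<lambda>\<omega>. G (grid h \<omega>) * of_bool (no_zero (real i * \<delta>) (real (Suc j) * \<delta>) \<omega>))"
      using i1[OF ijs(1)] i1[OF ijs(2)] i1[OF ijs(3)] i1[OF ijs(4)]
      by (simp add: Bochner_Integration.integral_add Bochner_Integration.integral_diff Bochner_Integration.integrable_diff del: of_nat_Suc)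
    also have "\<dots> = expectation (\<lambda>\<omega>. G (grid h \<omega>) * (sgn (grid h \<omega> (Suc i * m)) * sgn (grid h \<omega> (j * m))))
        - expectation (\<lambda>\<omega>. G (grid h \<omega>) * (sgn (grid h \<omega> (i * m)) * sgn (grid h \<omega> (j * m))))
        - expectation (\<lambda>\<omega>. G (grid h \<omega>) * (sgn (grid h \<omega> (Suc i * m)) * sgn (grid h \<omega> (Suc j * m))))
        + expectation (\<lambda>\<omega>. G (grid h \<omega>) * (sgn (grid h \<omega> (i * m)) * sgn (grid h \<omega> (Suc j * m))))"
      using ijs by (subst (1 2 3 4) sgn_eq) auto
    also have "\<dots> = expectation (\<lambda>\<omega>. G (grid h \<omega>) * (sgn (grid h \<omega> (Suc i * m)) * sgn (grid h \<omega> (j * m)))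
        - G (grid h \<omega>) * (sgn (grid h \<omega> (i * m)) * sgn (grid h \<omega> (j * m)))
        - G (grid h \<omega>) * (sgn (grid h \<omega> (Suc i * m)) * sgn (grid h \<omega> (Suc j * m)))
        + G (grid h \<omega>) * (sgn (grid h \<omega> (i * m)) * sgn (grid h \<omega> (Suc j * m))))"
      using i2 by (simp add: Bochner_Integration.integral_add Bochner_Integration.integral_diff Bochner_Integration.integrable_diff del: mult_Suc)
    \<comment> \<open>Here the four products factor; the time \<open>a + N + m\<close> occurs in the
      second term only, which prepares it for the Markov property.\<close>
    also have "\<dots> = expectation (\<lambda>\<omega>. Y (grid h \<omega>) * P (grid h \<omega>) * (cutoff \<rho> (grid h \<omega> (a + N)) * sgn (grid h \<omega> (a + N)))
        - (Y (grid h \<omega>) * P (grid h \<omega>) * cutoff \<rho> (grid h \<omega> (a + N))) * sgn (grid h \<omega> (a + N + m)))"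
      unfolding aN(2) K_def[symmetric] a_def[symmetric] unfolding G_def Y_def aN(1)
      by (intro Bochner_Integration.integral_cong refl) (simp add: algebra_simps)
    also have "\<dots> = expectation (\<lambda>\<omega>. Y (grid h \<omega>) * P (grid h \<omega>) * (cutoff \<rho> (grid h \<omega> (a + N)) * sgn (grid h \<omega> (a + N))))
        - expectation (\<lambda>\<omega>. (Y (grid h \<omega>) * P (grid h \<omega>) * cutoff \<rho> (grid h \<omega> (a + N))) * sgn (grid h \<omega> (a + N + m)))"
    proof (intro Bochner_Integration.integral_diff)
      have b: "\<bar>Y x * P x * (cutoff \<rho> y * sgn z)\<bar> \<le> 2 * 1 * (1 * 1)" for x y z
        unfolding abs_mult using Yb[of x] P01[of x] cutoff_bounds[OF \<rho>(1), of y] sgn1[of z] by (intro mult_mono) auto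
      show "integrable M (\<lambda>\<omega>. Y (grid h \<omega>) * P (grid h \<omega>) * (cutoff \<rho> (grid h \<omega> (a + N)) * sgn (grid h \<omega> (a + N))))"
        using mgp mg b by (intro integrable_const_bound[where B=2]) (simp_all add: AE_I2, measurable)
      show "integrable M (\<lambda>\<omega>. (Y (grid h \<omega>) * P (grid h \<omega>) * cutoff \<rho> (grid h \<omega> (a + N))) * sgn (grid h \<omega> (a + N + m)))"
        using mgp mg b by (intro integrable_const_bound[where B=2]) (simp_all add: AE_I2 mult.assoc, measurable)
    qed
    also have "expectation (\<lambda>\<omega>. (Y (grid h \<omega>) * P (grid h \<omega>) * cutoff \<rho> (grid h \<omega> (a + N))) * sgn (grid h \<omega> (a + N + m)))
      = expectation (\<lambda>\<omega>. (Y (grid h \<omega>) * P (grid h \<omega>) * cutoff \<rho> (grid h \<omega> (a + N))) * heat (real m * h) sgn (grid h \<omega> (a + N)))"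
    proof (rule chain_heat[OF h _ _ _ m, where G="\<lambda>x. Y x * P x * cutoff \<rho> (x (a + N))" and b=2 and c=1])
      show "depends_upto (a + N) (\<lambda>x. Y x * P x * cutoff \<rho> (x (a + N)))"
        using im unfolding depends_upto_def Y_def P_def by (auto intro!: arg_cong2[where f="(*)"] prod.cong)
      have "\<bar>Y x * P x * cutoff \<rho> (x (a + N))\<bar> \<le> 2 * 1 * 1" for x
        unfolding abs_mult using Yb[of x] P01[of x] cutoff_bounds[OF \<rho>(1), of "x (a + N)"] by (intro mult_mono) auto
      then show "\<bar>Y x * P x * cutoff \<rho> (x (a + N))\<bar> \<le> 2" for x by simp
    qed (use sgn1 in auto)
    also have "real m * h = \<delta>" using m by (simp add: h_def)
    also have "expectation (\<lambda>\<omega>. Y (grid h \<omega>) * P (grid h \<omega>) * (cutoff \<rho> (grid h \<omega> (a + N)) * sgn (grid h \<omega> (a + N)))) -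
       expectation (\<lambda>\<omega>. (Y (grid h \<omega>) * P (grid h \<omega>) * cutoff \<rho> (grid h \<omega> (a + N))) * heat \<delta> sgn (grid h \<omega> (a + N))) =
       expectation (\<lambda>\<omega>. Y (grid h \<omega>) * P (grid h \<omega>) * (cutoff \<rho> (grid h \<omega> (a + N)) * sgn (grid h \<omega> (a + N)))
         - (Y (grid h \<omega>) * P (grid h \<omega>) * cutoff \<rho> (grid h \<omega> (a + N))) * heat \<delta> sgn (grid h \<omega> (a + N)))"
    proof (intro Bochner_Integration.integral_diff[symmetric])
      have b: "\<bar>Y x * P x * (cutoff \<rho> y * z)\<bar> \<le> 2 * 1 * (1 * 1)" if "\<bar>z\<bar> \<le> 1" for x y z
        unfolding abs_mult using Yb[of x] P01[of x] cutoff_bounds[OF \<rho>(1), of y] that by (intro mult_mono) auto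
      show "integrable M (\<lambda>\<omega>. Y (grid h \<omega>) * P (grid h \<omega>) * (cutoff \<rho> (grid h \<omega> (a + N)) * sgn (grid h \<omega> (a + N))))"
        using mgp mg b[OF sgn1] by (intro integrable_const_bound[where B=2]) (simp_all add: AE_I2, measurable)
      show "integrable M (\<lambda>\<omega>. (Y (grid h \<omega>) * P (grid h \<omega>) * cutoff \<rho> (grid h \<omega> (a + N))) * heat \<delta> sgn (grid h \<omega> (a + N)))"
        using mgp mg b[OF heat_sgn_le_1[OF \<delta>]] by (intro integrable_const_bound[where B=2]) (simp_all add: AE_I2 mult.assoc, measurable)
    qed
    finally show ?thesis
      unfolding P_def \<beta>_def by (simp add: algebra_simps)
  qed
  have chi_Pi: "expectation (\<lambda>\<omega>. \<zeta> \<omega> * \<Xi> \<omega>) = expectation (\<lambda>\<omega>. Y (grid h \<omega>) * (LINT z|lborel. gauss_kernel (U N) A B (grid h \<omega> a) z * \<beta> z))"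
  proof -
    have "expectation (\<lambda>\<omega>. \<zeta> \<omega> * \<Xi> \<omega>) = expectation (\<lambda>\<omega>. \<zeta> \<omega> * (\<Prod>k=1..<N. exp (- (weight s N k / T) * (grid h \<omega> (a + k))\<^sup>2)))"
      unfolding \<Xi>_def gk ..
    also have "\<dots> = expectation (\<lambda>\<omega>. Y (grid h \<omega>) * (\<Prod>k=1..<N. exp (- (weight s N k / T) * (grid h \<omega> (a + k))\<^sup>2)) * \<beta> (grid h \<omega> (a + N)))"
      using weight_nonneg[OF s] T(2) by (intro sign_formula) auto
    also have "\<dots> = expectation (\<lambda>\<omega>. Y (grid h \<omega>) * (LINT z|lborel. gauss_kernel (U N) A B (grid h \<omega> a) z * \<beta> z))"
      unfolding A_def B_def
      by (rule chain_kernel[OF h prof(1,2) prof(3) prof(5) _ prof(4) Ym Ydep Yb N(2) \<beta>m \<beta>b])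
         (use weight_nonneg[OF s] T(2) in auto)
    finally show ?thesis .
  qed
  have chi: "expectation \<zeta> = expectation (\<lambda>\<omega>. Y (grid h \<omega>) * (LINT z|lborel. gauss_kernel T (1 / T) (1 / T) (grid h \<omega> a) z * \<beta> z))"
  proof -
    have "expectation \<zeta> = expectation (\<lambda>\<omega>. Y (grid h \<omega>) * \<beta> (grid h \<omega> (a + N)))"
      using sign_formula[of "\<lambda>_. 0"] by simp
    also have "\<dots> = expectation (\<lambda>\<omega>. Y (grid h \<omega>) * heat (real N * h) \<beta> (grid h \<omega> a))"
      by (rule chain_heat[OF h Ym Ydep Yb N(2) \<beta>m \<beta>b])
    also have "real N * h = T" using N(2) by (simp add: hT)
    finally show ?thesis unfolding heat_def normal_density_eq_gauss_kernel[OF T(2)] .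
  qed
  \<comment> \<open>In units of \<open>1 / T\<close> the diagonal coefficients exceed their free
    value by at most \<open>4 * s * C\<close> and \<open>sl_sol' p s 1\<close>, and both excesses
    are halved in the exponent; the summand 1 belongs to \<open>sinh\<close>. Leaving
    \<open>sl_sol' p s 1\<close> unhalved only weakens the bound.\<close>
  define e where "e = (2 * s * C + sl_sol' p s 1 + 1) * \<eta>\<^sup>2"
  have kern: "sgn x * (LINT z|lborel. gauss_kernel (U N) A B x z * \<beta> z) \<le> c * (sgn x * (LINT z|lborel. gauss_kernel T (1 / T) (1 / T) x z * \<beta> z))"
     "exp (- e) * (c * (sgn x * (LINT z|lborel. gauss_kernel T (1 / T) (1 / T) x z * \<beta> z))) \<le> sgn x * (LINT z|lborel. gauss_kernel (U N) A B x z * \<beta> z)"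
    if x: "\<bar>x\<bar> \<le> \<rho>" for x
  proof -
    have "(A - 1 / T) * \<rho>\<^sup>2 / 2 + (B - 1 / T) * \<rho>\<^sup>2 / 2 + \<rho>\<^sup>2 / T \<le> (4 * s * C / T) * \<rho>\<^sup>2 / 2 + (sl_sol' p s 1 / T) * \<rho>\<^sup>2 / 2 + \<rho>\<^sup>2 / T"
    proof -
      have "A - 1 / T \<le> 4 * s * C / T" using prof(9) by (simp add: A_def add_divide_distrib)
      moreover have "B - 1 / T \<le> sl_sol' p s 1 / T" using prof(11) T(2) by (simp add: B_def) (smt (verit) divide_nonneg_pos)
      ultimately show ?thesis using T(2) by (intro add_mono divide_right_mono mult_right_mono) auto
    qed
    also have "\<dots> = \<eta>\<^sup>2 * (2 * s * C + sl_sol' p s 1 / 2 + 1)" using T(2) unfolding \<rho>(2) by (simp add: field_simps)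
    also have "\<dots> \<le> \<eta>\<^sup>2 * (2 * s * C + sl_sol' p s 1 + 1)" using u1_ge_1[OF s, of 1] by (intro mult_left_mono) auto
    also have "\<dots> = e" by (simp add: e_def mult.commute)
    finally have ee: "(A - 1 / T) * \<rho>\<^sup>2 / 2 + (B - 1 / T) * \<rho>\<^sup>2 / 2 + \<rho>\<^sup>2 / T \<le> e" .
    have \<beta>b': "\<beta> y \<le> 2" for y using \<beta>b[of y] by linarith
    note kb = integral_odd_kernel_bounds[OF T(2) prof(6) _ _ \<beta>m \<beta>odd \<beta>pos \<beta>b' \<beta>0 x ee]
    have cc: "c = (T / U N) powr (3/2)" unfolding c_def prof(7) ..
    show "sgn x * (LINT z|lborel. gauss_kernel (U N) A B x z * \<beta> z) \<le> c * (sgn x * (LINT z|lborel. gauss_kernel T (1 / T) (1 / T) x z * \<beta> z))"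
     "exp (- e) * (c * (sgn x * (LINT z|lborel. gauss_kernel T (1 / T) (1 / T) x z * \<beta> z))) \<le> sgn x * (LINT z|lborel. gauss_kernel (U N) A B x z * \<beta> z)"
      unfolding cc using kb(1,2) prof(8) prof(10) by (auto simp: A_def B_def)
  qed
  define I where "I x = (LINT z|lborel. gauss_kernel (U N) A B x z * \<beta> z)" for x
  define I0 where "I0 x = (LINT z|lborel. gauss_kernel T (1 / T) (1 / T) x z * \<beta> z)" for x
  have pt: "Y (grid h \<omega>) * I (grid h \<omega> a) \<le> c * (Y (grid h \<omega>) * I0 (grid h \<omega> a))"
     "exp (- e) * (c * (Y (grid h \<omega>) * I0 (grid h \<omega> a))) \<le> Y (grid h \<omega>) * I (grid h \<omega> a)"
    if ne: "grid h \<omega> a \<noteq> 0" for \<omega>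
  proof -
    let ?x = "grid h \<omega> a" and ?x' = "grid h \<omega> (i * m)"
    have "Y (grid h \<omega>) * I ?x \<le> c * (Y (grid h \<omega>) * I0 ?x) \<and> exp (- e) * (c * (Y (grid h \<omega>) * I0 ?x)) \<le> Y (grid h \<omega>) * I ?x"
    proof (cases "\<bar>?x\<bar> \<le> \<rho>")
      case True
      \<comment> \<open>Where the path does not vanish, \<open>Y\<close> is a nonnegative multiple
        of the sign at the left inner end, so the inequalities for \<open>sgn x * I x\<close> may be
        multiplied by that factor.\<close>
      define w where "w = cutoff \<rho> ?x * (1 - sgn ?x * sgn ?x')"
      have w: "0 \<le> w" unfolding w_def using cutoff_bounds[OF \<rho>(1), of ?x] by (intro mult_nonneg_nonneg) (auto simp: sgn_if)
      have "sgn ?x * sgn ?x = 1" using ne by (simp add: sgn_if)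
      then have Yw: "Y (grid h \<omega>) = w * sgn ?x" unfolding Y_def w_def by algebra
      show ?thesis
        using mult_left_mono[OF kern(1)[OF True] w] mult_left_mono[OF kern(2)[OF True] w]
        unfolding Yw I_def I0_def by (simp add: mult_ac)
    next
      case False
      then have "Y (grid h \<omega>) = 0" using cutoff_eq_0[OF \<rho>(1), of ?x] by (simp add: Y_def)
      then show ?thesis by simp
    qed
    then show "Y (grid h \<omega>) * I ?x \<le> c * (Y (grid h \<omega>) * I0 ?x)" "exp (- e) * (c * (Y (grid h \<omega>) * I0 ?x)) \<le> Y (grid h \<omega>) * I ?x" by auto
  qed
  have "0 < a" using m by (simp add: a_def)
  then have ne: "AE \<omega> in M. grid h \<omega> a \<noteq> 0"
    unfolding grid_def using h by (intro X_nonzero_AE mult_pos_pos) simp_all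
  have Im[measurable]: "I \<in> borel_measurable borel" "I0 \<in> borel_measurable borel" unfolding I_def I0_def by measurable
  have I0b: "\<bar>I0 x\<bar> \<le> 2" for x
    using heat_bound[OF T(2) \<beta>m \<beta>b, of x] by (simp add: I0_def heat_def normal_density_eq_gauss_kernel[OF T(2)])
  have c0: "0 \<le> c" by (simp add: c_def)
  have int0: "integrable M (\<lambda>\<omega>. Y (grid h \<omega>) * I0 (grid h \<omega> a))"
  proof (rule integrable_const_bound[where B="2 * 2"])
    show "AE \<omega> in M. norm (Y (grid h \<omega>) * I0 (grid h \<omega> a)) \<le> 2 * 2"
      unfolding real_norm_def abs_mult using Yb I0b by (intro AE_I2 mult_mono) auto
    show "(\<lambda>\<omega>. Y (grid h \<omega>) * I0 (grid h \<omega> a)) \<in> borel_measurable M" using mgp mg by measurable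
  qed
  have int: "integrable M (\<lambda>\<omega>. Y (grid h \<omega>) * I (grid h \<omega> a))"
  proof (rule Bochner_Integration.integrable_bound[OF Bochner_Integration.integrable_add[OF integrable_abs[OF integrable_mult_right[OF int0, of c]] integrable_abs[OF integrable_mult_right[OF int0, of "exp (- e) * c"]]]])
    show "(\<lambda>\<omega>. Y (grid h \<omega>) * I (grid h \<omega> a)) \<in> borel_measurable M" using mgp mg by measurable
    show "AE \<omega> in M. norm (Y (grid h \<omega>) * I (grid h \<omega> a)) \<le> norm (\<bar>c * (Y (grid h \<omega>) * I0 (grid h \<omega> a))\<bar> + \<bar>exp (- e) * c * (Y (grid h \<omega>) * I0 (grid h \<omega> a))\<bar>)"
      using ne
    proof eventually_elim
      case (elim \<omega>)
      from pt[OF elim] show ?case by (simp add: mult.assoc)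
    qed
  qed
  show "expectation (\<lambda>\<omega>. \<zeta> \<omega> * \<Xi> \<omega>) \<le> c * expectation \<zeta>"
  proof -
    have "expectation (\<lambda>\<omega>. Y (grid h \<omega>) * I (grid h \<omega> a)) \<le> expectation (\<lambda>\<omega>. c * (Y (grid h \<omega>) * I0 (grid h \<omega> a)))"
      using ne by (intro integral_mono_AE int integrable_mult_right int0) (auto elim!: eventually_mono intro: pt)
    then show ?thesis unfolding chi_Pi chi I_def I0_def by simp
  qed
  show "exp (- (2 * s * C + sl_sol' p s 1 + 1) * \<eta>\<^sup>2) * (c * expectation \<zeta>) \<le> expectation (\<lambda>\<omega>. \<zeta> \<omega> * \<Xi> \<omega>)"
  proof -
    have "expectation (\<lambda>\<omega>. exp (- e) * (c * (Y (grid h \<omega>) * I0 (grid h \<omega> a)))) \<le> expectation (\<lambda>\<omega>. Y (grid h \<omega>) * I (grid h \<omega> a))"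
      using ne by (intro integral_mono_AE int integrable_mult_right int0) (auto elim!: eventually_mono intro: pt)
    then have "exp (- e) * (c * expectation \<zeta>) \<le> expectation (\<lambda>\<omega>. \<zeta> \<omega> * \<Xi> \<omega>)"
      unfolding chi_Pi chi I_def I0_def by simp
    then show ?thesis by (simp only: e_def mult_minus_left)
  qed
qed

end

section \<open>Dyadic approximation of the excursion interval\<close>

lemma tendsto_path_integral:
  fixes w r :: "real \<Rightarrow> real"
  assumes w: "continuous_on {0..} w" and r: "continuous_on {0..1} r"
    and a: "a \<longlonglongrightarrow> a0" "\<And>n. 0 \<le> a n" and T: "T \<longlonglongrightarrow> T0" "\<And>n. 0 \<le> T n"
  shows "(\<lambda>n. LINT t:{0..1}|lborel. r t * (w (a n + t * T n))\<^sup>2) \<longlonglongrightarrow> (LINT t:{0..1}|lborel. r t * (w (a0 + t * T0))\<^sup>2)"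
proof -
  have a0: "0 \<le> a0" "0 \<le> T0" using LIMSEQ_le_const[OF a(1)] a(2) LIMSEQ_le_const[OF T(1)] T(2) by auto
  have "Bseq (\<lambda>n. a n + T n)" using tendsto_add[OF a(1) T(1)] by (intro convergent_imp_Bseq convergentI)
  then obtain B where B: "0 < B" "\<And>n. norm (a n + T n) \<le> B" by (auto elim!: BseqE)
  have "\<exists>x\<in>{0..B}. \<forall>y\<in>{0..B}. (w y)\<^sup>2 \<le> (w x)\<^sup>2"
    using B(1) by (intro continuous_attains_sup continuous_intros continuous_on_subset[OF w]) auto
  then obtain L where L: "\<And>y. y \<in> {0..B} \<Longrightarrow> (w y)\<^sup>2 \<le> L" by blast
  have "\<exists>x\<in>{0..1}. \<forall>y\<in>{0..1}. \<bar>r y\<bar> \<le> \<bar>r x\<bar>"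
    by (intro continuous_attains_sup continuous_intros r) auto
  then obtain R where R: "\<And>y. y \<in> {0..1} \<Longrightarrow> \<bar>r y\<bar> \<le> R" by blast
  have cont: "continuous_on {0..1} (\<lambda>t. r t * (w (b + t * S))\<^sup>2)" if "0 \<le> b" "0 \<le> S" for b S
    using that by (intro continuous_intros r continuous_on_compose2[OF w]) auto
  show ?thesis
    unfolding set_lebesgue_integral_def
  proof (rule integral_dominated_convergence[where w="\<lambda>t. indicator {0..1::real} t * (R * L)"])
    show "(\<lambda>t. indicator {0..1::real} t *\<^sub>R (r t * (w (a0 + t * T0))\<^sup>2)) \<in> borel_measurable lborel"
      using borel_measurable_continuous_on_indicator[OF _ cont[OF a0]] by simp
    show "(\<lambda>t. indicator {0..1::real} t *\<^sub>R (r t * (w (a n + t * T n))\<^sup>2)) \<in> borel_measurable lborel" for n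
      using borel_measurable_continuous_on_indicator[OF _ cont[OF a(2) T(2), of n n]] by simp
    show "integrable lborel (\<lambda>t. indicator {0..1::real} t * (R * L))" by simp
    show "AE t in lborel. (\<lambda>n. indicator {0..1::real} t *\<^sub>R (r t * (w (a n + t * T n))\<^sup>2)) \<longlonglongrightarrow>
      indicator {0..1} t *\<^sub>R (r t * (w (a0 + t * T0))\<^sup>2)"
    proof (intro AE_I2)
      fix t :: real
      show "(\<lambda>n. indicator {0..1::real} t *\<^sub>R (r t * (w (a n + t * T n))\<^sup>2)) \<longlonglongrightarrow> indicator {0..1} t *\<^sub>R (r t * (w (a0 + t * T0))\<^sup>2)"
      proof (cases "t \<in> {0..1}")
        case True
        have "(\<lambda>n. w (a n + t * T n)) \<longlonglongrightarrow> w (a0 + t * T0)"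
          by (rule continuous_on_tendsto_compose[OF w]) (use True a T a0 in \<open>auto intro!: tendsto_intros\<close>)
        then show ?thesis by (intro tendsto_intros)
      qed simp
    qed
    show "AE t in lborel. norm (indicator {0..1::real} t *\<^sub>R (r t * (w (a n + t * T n))\<^sup>2)) \<le> indicator {0..1} t * (R * L)" for n
    proof (intro AE_I2)
      fix t :: real
      show "norm (indicator {0..1::real} t *\<^sub>R (r t * (w (a n + t * T n))\<^sup>2)) \<le> indicator {0..1} t * (R * L)"
      proof (cases "t \<in> {0..1}")
        case True
        then have "t * T n \<le> T n" "0 \<le> t * T n" using T(2)[of n] mult_right_mono[of t 1 "T n"] by simp_all
        then have "a n + t * T n \<in> {0..B}" using a(2)[of n] B(2)[of n] by auto
        then have "\<bar>r t\<bar> * (w (a n + t * T n))\<^sup>2 \<le> R * L"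
          using R[OF True] L by (intro mult_mono) (auto intro: order_trans[OF abs_ge_zero])
        then show ?thesis using True by (simp add: abs_mult)
      qed simp
    qed
  qed
qed

text \<open>Pathwise properties that hold almost surely. Avoiding 0 at positive dyadic times gives
  \<open>g < 1 < d\<close> and puts \<open>d\<close> into the interior of its dyadic cell at every
  level.\<close>

locale excursion_path =
  fixes w :: "real \<Rightarrow> real"
  assumes cont: "continuous_on {0..} w" and zero_0: "w 0 = 0"
    and nonzero_dyadic: "\<And>k n. 0 < k \<Longrightarrow> w (real k / 2 ^ n) \<noteq> 0"
    and zero_after_1: "\<exists>t\<ge>1. w t = 0"
begin

definition "g = last_zero_before_1 w"
definition "d = first_zero_after_1 w"

lemma zeros_closed: "0 \<le> a \<Longrightarrow> closed {t \<in> {a..}. w t = 0}"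
  by (intro continuous_closed_preimage_constant continuous_on_subset[OF cont]) auto

lemma w_1: "w 1 \<noteq> 0" using nonzero_dyadic[of 1 0] by simp

lemma g: "0 \<le> g" "g < 1" "w g = 0" "\<And>t. g < t \<Longrightarrow> t \<le> 1 \<Longrightarrow> w t \<noteq> 0"
proof -
  let ?S = "{t. 0 \<le> t \<and> t \<le> 1 \<and> w t = 0}"
  have eq: "?S = {t \<in> {0..}. w t = 0} \<inter> {..1}" by auto
  have S: "?S \<noteq> {}" "bdd_above ?S" "closed ?S"
    using zero_0 zeros_closed[of 0] unfolding eq by (auto intro!: bdd_aboveI[of _ 1] closed_Int)
  from closed_contains_Sup[OF S] have m: "g \<in> ?S" by (simp add: g_def last_zero_before_1_def)
  then show g0: "0 \<le> g" "w g = 0" by auto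
  show "g < 1" using m w_1 by (cases "g = 1") auto
  show "w t \<noteq> 0" if "g < t" "t \<le> 1" for t
    using cSup_upper[OF _ S(2), of t] that g0 by (auto simp: g_def last_zero_before_1_def)
qed

lemma d: "1 < d" "w d = 0" "\<And>t. 1 \<le> t \<Longrightarrow> t < d \<Longrightarrow> w t \<noteq> 0"
proof -
  let ?S = "{t. 1 \<le> t \<and> w t = 0}"
  have eq: "?S = {t \<in> {1..}. w t = 0}" by auto
  have S: "?S \<noteq> {}" "bdd_below ?S" "closed ?S"
    using zero_after_1 zeros_closed[of 1] unfolding eq by (auto intro!: bdd_belowI[of _ 1])
  from closed_contains_Inf[OF S] have m: "d \<in> ?S" by (simp add: d_def first_zero_after_1_def)
  then show "w d = 0" by auto
  show "1 < d" using m w_1 by (cases "d = 1") auto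
  show "w t \<noteq> 0" if "1 \<le> t" "t < d" for t
    using cInf_lower[OF _ S(2), of t] that by (auto simp: d_def first_zero_after_1_def)
qed

definition "left n = nat \<lfloor>g * 2 ^ n\<rfloor>"
definition "right n = nat \<lfloor>d * 2 ^ n\<rfloor>"

lemma left: "real (left n) / 2 ^ n \<le> g" "g < real (Suc (left n)) / 2 ^ n"
proof -
  have "real (left n) = of_int \<lfloor>g * 2 ^ n\<rfloor>" using g(1) by (simp add: left_def)
  then have "real (left n) \<le> g * 2 ^ n" "g * 2 ^ n < real (Suc (left n))" by linarith+
  then show "real (left n) / 2 ^ n \<le> g" "g < real (Suc (left n)) / 2 ^ n" by (auto simp: field_simps)
qed

lemma right: "real (right n) / 2 ^ n < d" "d < real (Suc (right n)) / 2 ^ n"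
proof -
  have "real (right n) = of_int \<lfloor>d * 2 ^ n\<rfloor>" using d(1) by (simp add: right_def)
  then have "real (right n) \<le> d * 2 ^ n" "d * 2 ^ n < real (Suc (right n))" by linarith+
  then have *: "real (right n) / 2 ^ n \<le> d" "d < real (Suc (right n)) / 2 ^ n" by (auto simp: field_simps)
  moreover have "real (right n) / 2 ^ n \<noteq> d"
  proof
    assume e: "real (right n) / 2 ^ n = d"
    then have "0 < right n" using d(1) by (cases "right n") auto
    then show False using nonzero_dyadic[of "right n" n] d(2) e by simp
  qed
  ultimately show "real (right n) / 2 ^ n < d" "d < real (Suc (right n)) / 2 ^ n" by auto
qed

lemma left_less: "Suc (left n) \<le> 2 ^ n" and right_ge: "2 ^ n \<le> right n"
proof -
  have "real (left n) / 2 ^ n < 1" using left(1)[of n] g(2) by linarith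
  then have "real (left n) < real (2 ^ n)" by simp
  then show "Suc (left n) \<le> 2 ^ n" unfolding of_nat_less_iff by simp
  have "1 < real (Suc (right n)) / 2 ^ n" using right(2)[of n] d(1) by linarith
  then have "real (2 ^ n) < real (Suc (right n))" by (simp add: field_simps)
  then show "2 ^ n \<le> right n" unfolding of_nat_less_iff by simp
qed

definition straddles :: "nat \<Rightarrow> nat \<Rightarrow> nat \<Rightarrow> bool" where
  "straddles n i j \<longleftrightarrow> (\<forall>t\<in>{real (Suc i) / 2 ^ n..real j / 2 ^ n}. w t \<noteq> 0) \<and>
     \<not> (\<forall>t\<in>{real i / 2 ^ n..real (Suc i) / 2 ^ n}. w t \<noteq> 0) \<and> \<not> (\<forall>t\<in>{real j / 2 ^ n..real (Suc j) / 2 ^ n}. w t \<noteq> 0)"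

text \<open>Since 1 lies between the inner ends, a zero in the left cell and none from there up to 1
  pin down the cell of \<open>g\<close>; the same holds for \<open>d\<close> on the other side. Sums
  over pairs of cells therefore have at most one nonzero term.\<close>

lemma straddles_iff:
  assumes "Suc i \<le> 2 ^ n" "2 ^ n \<le> j"
  shows "straddles n i j \<longleftrightarrow> i = left n \<and> j = right n"
proof
  assume "i = left n \<and> j = right n"
  then have e: "i = left n" "j = right n" by auto
  have nz: "w t \<noteq> 0" if t: "real (Suc (left n)) / 2 ^ n \<le> t" "t \<le> real (right n) / 2 ^ n" for t
    using g(4)[of t] d(3)[of t] t left(2)[of n] right(1)[of n] by (cases "t \<le> 1") auto
  have gd: "g \<in> {real (left n) / 2 ^ n..real (Suc (left n)) / 2 ^ n}" "d \<in> {real (right n) / 2 ^ n..real (Suc (right n)) / 2 ^ n}"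
    using left[of n] right[of n] unfolding atLeastAtMost_iff by linarith+
  show "straddles n i j" unfolding straddles_def e
  proof (intro conjI ballI notI)
    fix t assume "t \<in> {real (Suc (left n)) / 2 ^ n..real (right n) / 2 ^ n}" "w t = 0"
    then show False using nz[of t] unfolding atLeastAtMost_iff by blast
  next
    assume "\<forall>t\<in>{real (left n) / 2 ^ n..real (Suc (left n)) / 2 ^ n}. w t \<noteq> 0"
    then show False using gd(1) g(3) by blast
  next
    assume "\<forall>t\<in>{real (right n) / 2 ^ n..real (Suc (right n)) / 2 ^ n}. w t \<noteq> 0"
    then show False using gd(2) d(2) by blast
  qed
next
  assume "straddles n i j"
  then have all: "\<forall>t\<in>{real (Suc i) / 2 ^ n..real j / 2 ^ n}. w t \<noteq> 0"
    and ex: "\<exists>a\<in>{real i / 2 ^ n..real (Suc i) / 2 ^ n}. w a = 0" "\<exists>b\<in>{real j / 2 ^ n..real (Suc j) / 2 ^ n}. w b = 0"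
    unfolding straddles_def by blast+
  obtain a where a: "real i / 2 ^ n \<le> a" "a \<le> real (Suc i) / 2 ^ n" "w a = 0"
    using ex(1) unfolding Bex_def atLeastAtMost_iff by blast
  obtain b where b: "real j / 2 ^ n \<le> b" "b \<le> real (Suc j) / 2 ^ n" "w b = 0"
    using ex(2) unfolding Bex_def atLeastAtMost_iff by blast
  have nz: "\<not> (real (Suc i) / 2 ^ n \<le> t \<and> t \<le> real j / 2 ^ n)" if "w t = 0" for t
    using all that unfolding Ball_def atLeastAtMost_iff by blast
  have "real (Suc i) \<le> real (2 ^ n)" "real (2 ^ n) \<le> real j" using assms by (simp_all only: of_nat_le_iff)
  then have ij: "real (Suc i) / 2 ^ n \<le> 1" "1 \<le> real j / 2 ^ n" by (simp_all add: field_simps)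
  have "a \<le> g" using g(4)[of a] a(3) order_trans[OF a(2) ij(1)] by linarith
  moreover have "g < real (Suc i) / 2 ^ n" using nz[OF g(3)] g(2) ij by linarith
  ultimately have "real i / 2 ^ n \<le> g" "g < real (Suc i) / 2 ^ n" using a by auto
  then have "real i / 2 ^ n < real (Suc (left n)) / 2 ^ n" "real (left n) / 2 ^ n < real (Suc i) / 2 ^ n"
    using left[of n] by linarith+
  then have "i < Suc (left n)" "left n < Suc i" by (simp_all add: divide_less_cancel)
  moreover have "d \<le> b" using d(3)[of b] b(3) order_trans[OF ij(2) b(1)] by linarith
  moreover have "real j / 2 ^ n < d" using nz[OF d(2)] d(1) ij by linarith
  ultimately have "real j / 2 ^ n < real (Suc (right n)) / 2 ^ n" "real (right n) / 2 ^ n < real (Suc j) / 2 ^ n"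
    using b right[of n] by linarith+
  then have "j < Suc (right n)" "right n < Suc j" by (simp_all add: divide_less_cancel)
  then show "i = left n \<and> j = right n" using \<open>i < Suc (left n)\<close> \<open>left n < Suc i\<close> by simp
qed

lemma left_tendsto: "(\<lambda>n. real (Suc (left n)) / 2 ^ n) \<longlonglongrightarrow> g"
proof (rule tendsto_sandwich[OF _ _ tendsto_const])
  show "(\<lambda>n. g + (1 / 2) ^ n) \<longlonglongrightarrow> g" by (auto intro!: tendsto_eq_intros LIMSEQ_power_zero)
  show "\<forall>\<^sub>F n in sequentially. real (Suc (left n)) / 2 ^ n \<le> g + (1 / 2) ^ n"
    using left(1) by (intro always_eventually allI) (simp add: add_divide_distrib power_one_over)
qed (use left(2) in \<open>auto intro!: always_eventually less_imp_le simp del: of_nat_Suc\<close>)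

lemma right_tendsto: "(\<lambda>n. real (right n) / 2 ^ n) \<longlonglongrightarrow> d"
proof (rule tendsto_sandwich[OF _ _ _ tendsto_const])
  show "(\<lambda>n. d - (1 / 2) ^ n) \<longlonglongrightarrow> d" by (auto intro!: tendsto_eq_intros LIMSEQ_power_zero)
  show "\<forall>\<^sub>F n in sequentially. d - (1 / 2) ^ n \<le> real (right n) / 2 ^ n"
  proof (intro always_eventually allI)
    fix n show "d - (1 / 2) ^ n \<le> real (right n) / 2 ^ n"
      using right(2)[of n] by (simp add: add_divide_distrib power_one_over)
  qed
qed (use right(1) in \<open>auto intro!: always_eventually less_imp_le\<close>)

end

text \<open>The bound \<open>n * 2 ^ n\<close> makes the set finite and is respected by the cell of
  \<open>d\<close> for all large \<open>n\<close>. \<open>Suc i < j\<close> leaves a stretch of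
  positive length between the cells.\<close>

definition dyadic_pairs :: "nat \<Rightarrow> (nat \<times> nat) set" where
  "dyadic_pairs n = {(i, j). Suc i \<le> 2 ^ n \<and> 2 ^ n \<le> j \<and> j \<le> n * 2 ^ n \<and> Suc i < j}"

lemma finite_dyadic_pairs [simp]: "finite (dyadic_pairs n)"
  by (rule finite_subset[of _ "{..2 ^ n} \<times> {..n * 2 ^ n}"]) (auto simp: dyadic_pairs_def)

context excursion_path
begin

lemma sum_straddles:
  "(\<Sum>(i, j)\<in>dyadic_pairs n. of_bool (straddles n i j) * F i j) =
     (if (left n, right n) \<in> dyadic_pairs n then F (left n) (right n) else (0::real))"
proof -
  have "(\<Sum>(i, j)\<in>dyadic_pairs n. of_bool (straddles n i j) * F i j) =
     (\<Sum>x\<in>dyadic_pairs n. if x = (left n, right n) then F (left n) (right n) else 0)"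
  proof (rule sum.cong[OF refl])
    fix x assume "x \<in> dyadic_pairs n"
    then show "(case x of (i, j) \<Rightarrow> of_bool (straddles n i j) * F i j) = (if x = (left n, right n) then F (left n) (right n) else 0)"
      by (cases x) (auto simp: dyadic_pairs_def straddles_iff)
  qed
  then show ?thesis by simp
qed

lemma eventually_dyadic_pair: "\<forall>\<^sub>F n in sequentially. (left n, right n) \<in> dyadic_pairs n"
proof -
  have gd: "g < d" using g d by linarith
  have "(\<lambda>n. real (right n) / 2 ^ n - real (Suc (left n)) / 2 ^ n) \<longlonglongrightarrow> d - g"
    by (intro tendsto_diff right_tendsto left_tendsto)
  then have "\<forall>\<^sub>F n in sequentially. 0 < real (right n) / 2 ^ n - real (Suc (left n)) / 2 ^ n"
    using gd by (intro order_tendstoD) auto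
  moreover have "\<forall>\<^sub>F n in sequentially. d \<le> real n" using eventually_ge_at_top[of "nat \<lceil>d\<rceil>"] by eventually_elim linarith
  ultimately show ?thesis
  proof eventually_elim
    case (elim n)
    have "real (Suc (left n)) < real (right n)" using elim(1) by (simp add: divide_less_cancel del: of_nat_Suc)
    moreover have "real (right n) / 2 ^ n \<le> real n" using right(1)[of n] elim(2) by linarith
    then have "real (right n) \<le> real (n * 2 ^ n)" by (simp add: field_simps)
    ultimately show ?case unfolding dyadic_pairs_def of_nat_less_iff of_nat_le_iff using left_less[of n] right_ge[of n] by simp
  qed
qed

end

section \<open>Measurability and Laplace transform of the excursion energy\<close>

context continuous_brownian_motion
begin

text \<open>The weighted grid sums, taken with \<open>s = 1\<close>, converge to this integral along
  every path, and they are measurable term by term.\<close>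

lemma measurable_path_integral:
  assumes SL: "sturm_liouville p C" and b: "0 \<le> b" and T: "0 \<le> T"
  shows "(\<lambda>\<omega>. LINT t:{0..1}|lborel. p t / 2 * (X (b + t * T) \<omega>)\<^sup>2) \<in> borel_measurable M"
proof -
  interpret sturm_liouville p C by (rule SL)
  have "(\<lambda>\<omega>. 1 * (LINT t:{0..1}|lborel. p t / 2 * (X (b + t * T) \<omega>)\<^sup>2)) \<in> borel_measurable M"
  proof (rule borel_measurable_LIMSEQ_real)
    show "(\<lambda>N. \<Sum>k=1..<N. weight 1 N k * (X (b + real k / real N * T) \<omega>)\<^sup>2) \<longlonglongrightarrow> 1 * (LINT t:{0..1}|lborel. p t / 2 * (X (b + t * T) \<omega>)\<^sup>2)" for \<omega>
      using b T by (intro weight_sum_tendsto continuous_intros continuous_on_compose2[OF X_continuous]) auto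
    show "(\<lambda>\<omega>. \<Sum>k=1..<N. weight 1 N k * (X (b + real k / real N * T) \<omega>)\<^sup>2) \<in> borel_measurable M" for N
      using b T by (intro borel_measurable_sum borel_measurable_times borel_measurable_power X_measurable borel_measurable_const) auto
  qed
  then show ?thesis by simp
qed

text \<open>The limit of finer and finer chains: the number of grid steps runs through multiples of
  the cell distance, the product of exponentials tends to the exponential of the path integral, and
  the prefactor tends to \<open>sl_sol p s 1 powr (-3/2)\<close>.\<close>

lemma straddle_bounds:
  fixes p :: "real \<Rightarrow> real" and C s :: real
  assumes SL: "sturm_liouville p C" and s: "0 < s"
    and \<delta>: "0 < \<delta>" and ij: "Suc i < j" and \<eta>: "0 < \<eta>"
  defines "T \<equiv> real (j - Suc i) * \<delta>"
  defines "\<rho> \<equiv> \<eta> * sqrt T"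
  defines "\<zeta> \<equiv> (\<lambda>\<omega>. cutoff \<rho> (X (real (Suc i) * \<delta>) \<omega>) * cutoff \<rho> (X (real j * \<delta>) \<omega>) * of_bool (straddle \<delta> i j \<omega>))"
  defines "\<Phi> \<equiv> (\<lambda>\<omega>. exp (- (s * (LINT t:{0..1}|lborel. p t / 2 * (X (real (Suc i) * \<delta> + t * T) \<omega>)\<^sup>2) / T)))"
  shows "exp (- (2 * s * C + sl_sol' p s 1 + 1) * \<eta>\<^sup>2) * (sl_sol p s 1 powr (-3/2) * expectation \<zeta>) \<le> expectation (\<lambda>\<omega>. \<zeta> \<omega> * \<Phi> \<omega>)"
    and "expectation (\<lambda>\<omega>. \<zeta> \<omega> * \<Phi> \<omega>) \<le> sl_sol p s 1 powr (-3/2) * expectation \<zeta>"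
    and "integrable M \<zeta>" and "integrable M (\<lambda>\<omega>. \<zeta> \<omega> * \<Phi> \<omega>)"
proof -
  interpret sturm_liouville p C by (rule SL)
  have T: "0 < T" using \<delta> ij by (simp add: T_def)
  have \<rho>: "0 < \<rho>" using \<eta> T by (simp add: \<rho>_def)
  define N where "N m = (j - Suc i) * m" for m
  define \<Xi> where "\<Xi> m \<omega> = (\<Prod>k=1..<N m. exp (- (weight s (N m) k / T) * (X (real (Suc i) * \<delta> + real k / real (N m) * T) \<omega>)\<^sup>2))" for m \<omega>
  have N: "filterlim N sequentially sequentially"
    unfolding N_def using ij by (intro filterlim_subseq) (auto simp: strict_mono_def)
  have pm: "0 \<le> real (Suc i) * \<delta>" "0 \<le> real j * \<delta>" using \<delta> by auto
  have xm[measurable]: "(\<lambda>\<omega>. X (real (Suc i) * \<delta> + t * T) \<omega>) \<in> borel_measurable M" if "0 \<le> t" for t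
    using T \<delta> that by (intro X_measurable) auto
  have \<zeta>m[measurable]: "\<zeta> \<in> borel_measurable M"
    using X_measurable[OF pm(1)] X_measurable[OF pm(2)] measurable_straddle[OF \<delta> less_imp_le[OF ij]]
    unfolding \<zeta>_def by measurable
  have \<zeta>01: "0 \<le> \<zeta> \<omega>" "\<zeta> \<omega> \<le> 1" for \<omega>
  proof -
    show "0 \<le> \<zeta> \<omega>" unfolding \<zeta>_def using cutoff_bounds[OF \<rho>] by (intro mult_nonneg_nonneg) auto
    have "\<zeta> \<omega> \<le> 1 * 1 * 1" unfolding \<zeta>_def using cutoff_bounds[OF \<rho>] by (intro mult_mono mult_nonneg_nonneg) auto
    then show "\<zeta> \<omega> \<le> 1" by simp
  qed
  have \<Phi>m[measurable]: "\<Phi> \<in> borel_measurable M"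
    using measurable_path_integral[OF SL pm(1) less_imp_le[OF T]] unfolding \<Phi>_def by measurable
  have \<Xi>m[measurable]: "\<Xi> m \<in> borel_measurable M" for m
    unfolding \<Xi>_def by (intro borel_measurable_prod borel_measurable_exp measurable_compose[OF _ borel_measurable_exp] borel_measurable_times borel_measurable_power borel_measurable_const xm) auto
  have \<Xi>01: "0 \<le> \<Xi> m \<omega>" "\<Xi> m \<omega> \<le> 1" for m \<omega>
    unfolding \<Xi>_def using weight_nonneg[OF s] T by (auto intro!: prod_nonneg prod_le_1)
  have lim: "(\<lambda>m. \<Xi> m \<omega>) \<longlonglongrightarrow> \<Phi> \<omega>" for \<omega>
  proof -
    define y where "y t = (X (real (Suc i) * \<delta> + t * T) \<omega>)\<^sup>2" for t
    have "continuous_on {0..1} y"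
      unfolding y_def using pm(1) T by (intro continuous_intros continuous_on_compose2[OF X_continuous]) auto
    from filterlim_compose[OF weight_sum_tendsto[OF s this] N]
    have "(\<lambda>m. exp (- ((\<Sum>k=1..<N m. weight s (N m) k * y (real k / real (N m))) / T))) \<longlonglongrightarrow> exp (- (s * (LINT t:{0..1}|lborel. p t / 2 * y t) / T))"
      using T by (intro tendsto_intros) auto
    moreover have "\<Xi> m \<omega> = exp (- ((\<Sum>k=1..<N m. weight s (N m) k * y (real k / real (N m))) / T))" for m
      unfolding \<Xi>_def y_def by (simp add: exp_sum[symmetric] sum_negf[symmetric] sum_divide_distrib)
    ultimately show ?thesis by (simp add: \<Phi>_def y_def)
  qed
  have \<Phi>01: "0 \<le> \<Phi> \<omega>" "\<Phi> \<omega> \<le> 1" for \<omega>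
    using \<Xi>01 by (auto intro!: LIMSEQ_le_const[OF lim] LIMSEQ_le_const2[OF lim])
  show "integrable M \<zeta>" using \<zeta>01 by (intro integrable_const_bound[where B=1]) auto
  have zb: "\<bar>\<zeta> \<omega> * x\<bar> \<le> 1" if "0 \<le> x" "x \<le> 1" for \<omega> x
    using that \<zeta>01[of \<omega>] mult_mono[of "\<zeta> \<omega>" 1 x 1] by auto
  show "integrable M (\<lambda>\<omega>. \<zeta> \<omega> * \<Phi> \<omega>)" using zb[OF \<Phi>01] by (intro integrable_const_bound[where B=1]) auto
  have E: "(\<lambda>m. expectation (\<lambda>\<omega>. \<zeta> \<omega> * \<Xi> m \<omega>)) \<longlonglongrightarrow> expectation (\<lambda>\<omega>. \<zeta> \<omega> * \<Phi> \<omega>)"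
    by (rule integral_dominated_convergence[where w="\<lambda>_. 1"]) (use zb[OF \<Xi>01] in \<open>auto intro!: tendsto_intros lim\<close>)
  define c where "c m = (real (N m) * sl_sol p s (1 / real (N m)) / sl_sol p s 1) powr (3/2)" for m
  have u: "0 < sl_sol p s 1" using u_pos[OF s, of 1] by simp
  have "c \<longlonglongrightarrow> (1 / sl_sol p s 1) powr (3/2)"
    unfolding c_def by (intro tendsto_intros filterlim_compose[OF profile_limit[OF s] N]) (use u in auto)
  also have "(1 / sl_sol p s 1) powr (3/2) = sl_sol p s 1 powr (-3/2)"
    using u by (simp add: powr_divide powr_minus_divide)
  finally have c: "c \<longlonglongrightarrow> sl_sol p s 1 powr (-3/2)" .
  have bd: "exp (- (2 * s * C + sl_sol' p s 1 + 1) * \<eta>\<^sup>2) * (c m * expectation \<zeta>) \<le> expectation (\<lambda>\<omega>. \<zeta> \<omega> * \<Xi> m \<omega>)"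
    "expectation (\<lambda>\<omega>. \<zeta> \<omega> * \<Xi> m \<omega>) \<le> c m * expectation \<zeta>" if "1 \<le> m" for m
    unfolding c_def \<zeta>_def \<Xi>_def N_def \<rho>_def T_def
    by (rule straddle_chain_bounds[OF SL s \<delta> ij that \<eta>])+
  show "exp (- (2 * s * C + sl_sol' p s 1 + 1) * \<eta>\<^sup>2) * (sl_sol p s 1 powr (-3/2) * expectation \<zeta>) \<le> expectation (\<lambda>\<omega>. \<zeta> \<omega> * \<Phi> \<omega>)"
    by (rule LIMSEQ_le[OF tendsto_mult_left[OF tendsto_mult_right[OF c]] E]) (use bd(1) in blast)
  show "expectation (\<lambda>\<omega>. \<zeta> \<omega> * \<Phi> \<omega>) \<le> sl_sol p s 1 powr (-3/2) * expectation \<zeta>"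
    by (rule LIMSEQ_le[OF E tendsto_mult_right[OF c]]) (use bd(2) in blast)
qed

end

context excursion_path
begin

definition "gap n = real (right n - Suc (left n)) * (1 / 2 ^ n)"

lemma gap_nonneg: "0 \<le> gap n" by (simp add: gap_def)

lemma gap_tendsto: "gap \<longlonglongrightarrow> d - g"
proof (rule Lim_transform_eventually)
  show "(\<lambda>n. real (right n) / 2 ^ n - real (Suc (left n)) / 2 ^ n) \<longlonglongrightarrow> d - g"
    by (intro tendsto_diff right_tendsto left_tendsto)
  show "\<forall>\<^sub>F n in sequentially. real (right n) / 2 ^ n - real (Suc (left n)) / 2 ^ n = gap n"
    using eventually_dyadic_pair
    by eventually_elim (auto simp: dyadic_pairs_def gap_def of_nat_diff diff_divide_distrib simp del: of_nat_Suc)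
qed

lemma d_minus_g: "0 < d - g" using g d by linarith

lemma left_tendsto': "(\<lambda>n. real (Suc (left n)) * (1 / 2 ^ n)) \<longlonglongrightarrow> g"
  using left_tendsto by simp

lemma right_tendsto': "(\<lambda>n. real (right n) * (1 / 2 ^ n)) \<longlonglongrightarrow> d"
  using right_tendsto by simp

lemma normalized_integral_tendsto:
  assumes r: "continuous_on {0..1} r"
  shows "(\<lambda>n. (LINT t:{0..1}|lborel. r t * (w (real (Suc (left n)) * (1 / 2 ^ n) + t * gap n))\<^sup>2) / gap n)
    \<longlonglongrightarrow> (LINT t:{0..1}|lborel. r t * (\<bar>w (g + t * (d - g))\<bar> / sqrt (d - g))\<^sup>2)"
proof -
  have "(\<lambda>n. (LINT t:{0..1}|lborel. r t * (w (real (Suc (left n)) * (1 / 2 ^ n) + t * gap n))\<^sup>2) / gap n)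
    \<longlonglongrightarrow> (LINT t:{0..1}|lborel. r t * (w (g + t * (d - g)))\<^sup>2) / (d - g)"
    using d_minus_g
    by (intro tendsto_divide tendsto_path_integral cont r left_tendsto' gap_tendsto gap_nonneg) auto
  also have "(LINT t:{0..1}|lborel. r t * (w (g + t * (d - g)))\<^sup>2) / (d - g) = (LINT t:{0..1}|lborel. r t * (\<bar>w (g + t * (d - g))\<bar> / sqrt (d - g))\<^sup>2)"
    using d_minus_g by (simp add: power_divide flip: set_integral_divide_zero)
  finally show ?thesis .
qed

lemma cutoff_tendsto_1:
  assumes \<eta>: "0 < \<eta>" and a: "a \<longlonglongrightarrow> a0" "\<And>n. 0 \<le> a n" "w a0 = 0"
  shows "(\<lambda>n. cutoff (\<eta> * sqrt (gap n)) (w (a n))) \<longlonglongrightarrow> 1"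
proof -
  have "0 \<le> a0" using LIMSEQ_le_const[OF a(1)] a(2) by auto
  then have "(\<lambda>n. w (a n)) \<longlonglongrightarrow> w a0"
    by (intro continuous_on_tendsto_compose[OF cont a(1)]) (use a in auto)
  then have "(\<lambda>n. cutoff (\<eta> * sqrt (gap n)) (w (a n))) \<longlonglongrightarrow> max 0 (1 - \<bar>w a0\<bar> / (\<eta> * sqrt (d - g)))"
    unfolding cutoff_def using \<eta> d_minus_g by (intro tendsto_intros gap_tendsto) auto
  then show ?thesis by (simp add: a)
qed

end

context continuous_brownian_motion
begin

lemma AE_excursion_path: "AE \<omega> in M. excursion_path (\<lambda>t. X t \<omega>)"
proof -
  have "AE \<omega> in M. \<forall>n k. 0 < k \<longrightarrow> X (real k / 2 ^ n) \<omega> \<noteq> 0"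
    unfolding AE_all_countable by (intro allI AE_impI X_nonzero_AE) auto
  with zero_after_1_AE show ?thesis
    by eventually_elim (auto simp: excursion_path_def X_continuous)
qed

lemma straddle_iff_straddles:
  assumes "excursion_path (\<lambda>t. X t \<omega>)"
  shows "straddle (1 / 2 ^ n) i j \<omega> \<longleftrightarrow> excursion_path.straddles (\<lambda>t. X t \<omega>) n i j"
  unfolding straddle_def no_zero_def excursion_path.straddles_def[OF assms] by simp

text \<open>The energy of the path between the inner ends of the cells after Brownian rescaling to
  unit length. In the application \<open>p = 2 * \<psi>\<close>, so \<open>p t / 2\<close> is the
  weight of the norm.\<close>

definition segment_energy :: "(real \<Rightarrow> real) \<Rightarrow> nat \<Rightarrow> nat \<Rightarrow> nat \<Rightarrow> 'a \<Rightarrow> real" where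
  "segment_energy p n i j \<omega> = (LINT t:{0..1}|lborel. p t / 2 *
     (X (real (Suc i) * (1 / 2 ^ n) + t * (real (j - Suc i) * (1 / 2 ^ n))) \<omega>)\<^sup>2) / (real (j - Suc i) * (1 / 2 ^ n))"

definition end_cutoff :: "real \<Rightarrow> nat \<Rightarrow> nat \<Rightarrow> nat \<Rightarrow> 'a \<Rightarrow> real" where
  "end_cutoff \<eta> n i j \<omega> = cutoff (\<eta> * sqrt (real (j - Suc i) * (1 / 2 ^ n))) (X (real (Suc i) * (1 / 2 ^ n)) \<omega>) *
     cutoff (\<eta> * sqrt (real (j - Suc i) * (1 / 2 ^ n))) (X (real j * (1 / 2 ^ n)) \<omega>)"

definition excursion_energy :: "(real \<Rightarrow> real) \<Rightarrow> 'a \<Rightarrow> real" where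
  "excursion_energy p \<omega> = (LINT t:{0..1}|lborel. p t / 2 * (normalized_excursion X t \<omega>)\<^sup>2)"

definition dyadic_energy :: "(real \<Rightarrow> real) \<Rightarrow> nat \<Rightarrow> 'a \<Rightarrow> real" where
  "dyadic_energy p n \<omega> = (\<Sum>(i, j)\<in>dyadic_pairs n. of_bool (straddle (1 / 2 ^ n) i j \<omega>) * segment_energy p n i j \<omega>)"

lemma segment_energy_tendsto:
  assumes E: "excursion_path (\<lambda>t. X t \<omega>)" and p: "continuous_on {0..1} p"
  shows "(\<lambda>n. segment_energy p n (excursion_path.left (\<lambda>t. X t \<omega>) n) (excursion_path.right (\<lambda>t. X t \<omega>) n) \<omega>) \<longlonglongrightarrow> excursion_energy p \<omega>"
proof -
  interpret E: excursion_path "\<lambda>t. X t \<omega>" by (rule E)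
  have "continuous_on {0..1} (\<lambda>t. p t / 2)" by (intro continuous_intros p) auto
  from E.normalized_integral_tendsto[OF this] show ?thesis
    unfolding segment_energy_def excursion_energy_def normalized_excursion_def Let_def E.g_def[symmetric] E.d_def[symmetric] E.gap_def .
qed

lemma sum_straddle:
  assumes E: "excursion_path (\<lambda>t. X t \<omega>)"
  defines "l \<equiv> excursion_path.left (\<lambda>t. X t \<omega>)" and "r \<equiv> excursion_path.right (\<lambda>t. X t \<omega>)"
  shows "(\<Sum>(i, j)\<in>dyadic_pairs n. of_bool (straddle (1 / 2 ^ n) i j \<omega>) * F i j) =
     (if (l n, r n) \<in> dyadic_pairs n then F (l n) (r n) else (0::real))"
  unfolding straddle_iff_straddles[OF E] l_def r_def by (rule excursion_path.sum_straddles[OF E])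

lemma eventually_sum_straddle:
  assumes E: "excursion_path (\<lambda>t. X t \<omega>)"
  defines "l \<equiv> excursion_path.left (\<lambda>t. X t \<omega>)" and "r \<equiv> excursion_path.right (\<lambda>t. X t \<omega>)"
  assumes lim: "(\<lambda>n. F n (l n) (r n)) \<longlonglongrightarrow> (x::real)"
  shows "(\<lambda>n. \<Sum>(i, j)\<in>dyadic_pairs n. of_bool (straddle (1 / 2 ^ n) i j \<omega>) * F n i j) \<longlonglongrightarrow> x"
proof (rule Lim_transform_eventually[OF lim])
  show "\<forall>\<^sub>F n in sequentially. F n (l n) (r n) = (\<Sum>(i, j)\<in>dyadic_pairs n. of_bool (straddle (1 / 2 ^ n) i j \<omega>) * F n i j)"
    using excursion_path.eventually_dyadic_pair[OF E]
    by eventually_elim (simp add: sum_straddle[OF E] l_def r_def)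
qed

lemma dyadic_energy_tendsto:
  "excursion_path (\<lambda>t. X t \<omega>) \<Longrightarrow> continuous_on {0..1} p \<Longrightarrow> (\<lambda>n. dyadic_energy p n \<omega>) \<longlonglongrightarrow> excursion_energy p \<omega>"
  unfolding dyadic_energy_def by (intro eventually_sum_straddle segment_energy_tendsto)

lemma end_cutoff_tendsto:
  assumes E: "excursion_path (\<lambda>t. X t \<omega>)" and \<eta>: "0 < \<eta>"
  shows "(\<lambda>n. end_cutoff \<eta> n (excursion_path.left (\<lambda>t. X t \<omega>) n) (excursion_path.right (\<lambda>t. X t \<omega>) n) \<omega>) \<longlonglongrightarrow> 1"
proof -
  interpret E: excursion_path "\<lambda>t. X t \<omega>" by (rule E)
  have "(\<lambda>n. cutoff (\<eta> * sqrt (E.gap n)) (X (real (Suc (E.left n)) * (1 / 2 ^ n)) \<omega>) *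
      cutoff (\<eta> * sqrt (E.gap n)) (X (real (E.right n) * (1 / 2 ^ n)) \<omega>)) \<longlonglongrightarrow> 1 * 1"
    by (intro tendsto_mult E.cutoff_tendsto_1[OF \<eta> E.left_tendsto'] E.cutoff_tendsto_1[OF \<eta> E.right_tendsto'] E.g E.d) auto
  then show ?thesis unfolding end_cutoff_def E.gap_def by simp
qed

lemma measurable_dyadic_energy:
  assumes SL: "sturm_liouville p C"
  shows "dyadic_energy p n \<in> borel_measurable M"
  unfolding dyadic_energy_def
proof (intro borel_measurable_sum)
  fix x assume "x \<in> dyadic_pairs n"
  moreover obtain i j where x: "x = (i, j)" by fastforce
  ultimately have ij: "Suc i \<le> j" by (auto simp: dyadic_pairs_def)
  have [measurable]: "segment_energy p n i j \<in> borel_measurable M"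
    unfolding segment_energy_def by (intro borel_measurable_divide measurable_path_integral[OF SL] borel_measurable_const) auto
  have [measurable]: "Measurable.pred M (straddle (1 / 2 ^ n) i j)"
    by (rule measurable_straddle[OF _ ij]) simp
  show "(\<lambda>\<omega>. case x of (i, j) \<Rightarrow> of_bool (straddle (1 / 2 ^ n) i j \<omega>) * segment_energy p n i j \<omega>) \<in> borel_measurable M"
    unfolding x by simp
qed

text \<open>Measurable by construction. The measurability of \<open>excursion_energy\<close> is not
  evident because its time interval is random, so it is identified with this limit almost
  surely.\<close>

definition limit_energy :: "(real \<Rightarrow> real) \<Rightarrow> 'a \<Rightarrow> real" where
  "limit_energy p \<omega> = lim (\<lambda>n. dyadic_energy p n \<omega>)"

lemma measurable_limit_energy: "sturm_liouville p C \<Longrightarrow> limit_energy p \<in> borel_measurable M"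
  unfolding limit_energy_def[abs_def] by (intro borel_measurable_lim_metric measurable_dyadic_energy)

lemma limit_energy_AE:
  assumes "sturm_liouville p C"
  shows "AE \<omega> in M. limit_energy p \<omega> = excursion_energy p \<omega>"
  using AE_excursion_path
  by eventually_elim (simp add: limit_energy_def limI dyadic_energy_tendsto sturm_liouville.cont_p[OF assms])

lemma segment_energy_nonneg: "sturm_liouville p C \<Longrightarrow> 0 \<le> segment_energy p n i j \<omega>"
  unfolding segment_energy_def set_lebesgue_integral_def
  by (intro divide_nonneg_nonneg Bochner_Integration.integral_nonneg) (auto simp: indicator_def sturm_liouville.p_nonneg)

text \<open>The prefactor in \<open>straddle_bounds\<close> is the same for all pairs, so the bounds
  survive summation over the cells. As \<open>n\<close> grows, the unweighted sum tends to 1 and the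
  weighted one to the Laplace transform: for fixed \<open>\<eta>\<close> the cutoffs tend to 1
  because the path vanishes at both ends of the excursion. Only afterwards does
  \<open>\<eta>\<close> tend to 0.\<close>

theorem laplace_limit_energy:
  assumes SL: "sturm_liouville p C" and s: "0 < s"
  shows "expectation (\<lambda>\<omega>. exp (- s * limit_energy p \<omega>)) = sl_sol p s 1 powr (-3/2)"
proof -
  have bounds: "exp (- (2 * s * C + sl_sol' p s 1 + 1) * \<eta>\<^sup>2) * sl_sol p s 1 powr (-3/2) \<le> expectation (\<lambda>\<omega>. exp (- s * limit_energy p \<omega>))"
    "expectation (\<lambda>\<omega>. exp (- s * limit_energy p \<omega>)) \<le> sl_sol p s 1 powr (-3/2)" if \<eta>: "0 < \<eta>" for \<eta>
  proof -
    define \<zeta> where "\<zeta> n i j \<omega> = end_cutoff \<eta> n i j \<omega> * of_bool (straddle (1 / 2 ^ n) i j \<omega>)" for n i j \<omega>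
    define \<Phi> where "\<Phi> n i j \<omega> = exp (- (s * segment_energy p n i j \<omega>))" for n i j \<omega>
    let ?K = "exp (- (2 * s * C + sl_sol' p s 1 + 1) * \<eta>\<^sup>2)" and ?c = "sl_sol p s 1 powr (-3/2)"
    have b: "?K * (?c * expectation (\<zeta> n i j)) \<le> expectation (\<lambda>\<omega>. \<zeta> n i j \<omega> * \<Phi> n i j \<omega>)"
      "expectation (\<lambda>\<omega>. \<zeta> n i j \<omega> * \<Phi> n i j \<omega>) \<le> ?c * expectation (\<zeta> n i j)"
      "integrable M (\<zeta> n i j)" "integrable M (\<lambda>\<omega>. \<zeta> n i j \<omega> * \<Phi> n i j \<omega>)" if "(i, j) \<in> dyadic_pairs n" for n i j
    proof -
      have ij: "Suc i < j" using that by (auto simp: dyadic_pairs_def)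
      have "0 < 1 / (2::real) ^ n" by simp
      note * = straddle_bounds[OF SL s this ij \<eta>]
      show "?K * (?c * expectation (\<zeta> n i j)) \<le> expectation (\<lambda>\<omega>. \<zeta> n i j \<omega> * \<Phi> n i j \<omega>)"
        "expectation (\<lambda>\<omega>. \<zeta> n i j \<omega> * \<Phi> n i j \<omega>) \<le> ?c * expectation (\<zeta> n i j)"
        "integrable M (\<zeta> n i j)" "integrable M (\<lambda>\<omega>. \<zeta> n i j \<omega> * \<Phi> n i j \<omega>)"
        unfolding \<zeta>_def[abs_def] \<Phi>_def end_cutoff_def segment_energy_def times_divide_eq_right[of s] by (rule *)+
    qed
    define S1 where "S1 n \<omega> = (\<Sum>(i, j)\<in>dyadic_pairs n. \<zeta> n i j \<omega>)" for n \<omega>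
    define S where "S n \<omega> = (\<Sum>(i, j)\<in>dyadic_pairs n. \<zeta> n i j \<omega> * \<Phi> n i j \<omega>)" for n \<omega>
    have S1_int: "integrable M (S1 n)" "expectation (S1 n) = (\<Sum>(i, j)\<in>dyadic_pairs n. expectation (\<zeta> n i j))" for n
      unfolding S1_def[abs_def] case_prod_beta
      by (auto intro!: Bochner_Integration.integrable_sum Bochner_Integration.integral_sum b)
    have S_int: "integrable M (S n)" "expectation (S n) = (\<Sum>(i, j)\<in>dyadic_pairs n. expectation (\<lambda>\<omega>. \<zeta> n i j \<omega> * \<Phi> n i j \<omega>))" for n
      unfolding S_def[abs_def] case_prod_beta
      by (auto intro!: Bochner_Integration.integrable_sum Bochner_Integration.integral_sum b)
    have le: "?K * (?c * expectation (S1 n)) \<le> expectation (S n)" "expectation (S n) \<le> ?c * expectation (S1 n)" for n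
      unfolding S1_int S_int sum_distrib_left case_prod_beta by (intro sum_mono b; simp)+
    have S1_eq: "S1 n \<omega> = (\<Sum>(i, j)\<in>dyadic_pairs n. of_bool (straddle (1 / 2 ^ n) i j \<omega>) * end_cutoff \<eta> n i j \<omega>)" for n \<omega>
      by (simp add: S1_def \<zeta>_def mult_ac)
    have S_eq: "S n \<omega> = (\<Sum>(i, j)\<in>dyadic_pairs n. of_bool (straddle (1 / 2 ^ n) i j \<omega>) * (end_cutoff \<eta> n i j \<omega> * \<Phi> n i j \<omega>))" for n \<omega>
      by (simp add: S_def \<zeta>_def mult_ac)
    have c01: "0 \<le> end_cutoff \<eta> n i j \<omega>" "end_cutoff \<eta> n i j \<omega> \<le> 1" if "(i, j) \<in> dyadic_pairs n" for n i j \<omega>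
    proof -
      have *: "0 < \<eta> * sqrt (real (j - Suc i) * (1 / 2 ^ n))" using \<eta> that by (auto simp: dyadic_pairs_def)
      show "0 \<le> end_cutoff \<eta> n i j \<omega>" "end_cutoff \<eta> n i j \<omega> \<le> 1"
        unfolding end_cutoff_def using cutoff_bounds[OF *] by (auto intro!: mult_nonneg_nonneg mult_le_one)
    qed
    have \<Phi>01: "0 \<le> \<Phi> n i j \<omega>" "\<Phi> n i j \<omega> \<le> 1" for n i j \<omega>
      unfolding \<Phi>_def using segment_energy_nonneg[OF SL, of n i j \<omega>] s by auto
    have lim: "AE \<omega> in M. (\<lambda>n. S n \<omega>) \<longlonglongrightarrow> exp (- s * limit_energy p \<omega>)" "AE \<omega> in M. (\<lambda>n. S1 n \<omega>) \<longlonglongrightarrow> 1"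
      and bnd: "AE \<omega> in M. norm (S n \<omega>) \<le> 1" "AE \<omega> in M. norm (S1 n \<omega>) \<le> 1" for n
    proof -
      show "AE \<omega> in M. (\<lambda>n. S1 n \<omega>) \<longlonglongrightarrow> 1"
        using AE_excursion_path unfolding S1_eq
        by eventually_elim (intro eventually_sum_straddle end_cutoff_tendsto \<eta>)
      show "AE \<omega> in M. (\<lambda>n. S n \<omega>) \<longlonglongrightarrow> exp (- s * limit_energy p \<omega>)"
        using AE_excursion_path limit_energy_AE[OF SL] unfolding S_eq
      proof eventually_elim
        case (elim \<omega>)
        have "(\<lambda>n. end_cutoff \<eta> n (excursion_path.left (\<lambda>t. X t \<omega>) n) (excursion_path.right (\<lambda>t. X t \<omega>) n) \<omega> *
           \<Phi> n (excursion_path.left (\<lambda>t. X t \<omega>) n) (excursion_path.right (\<lambda>t. X t \<omega>) n) \<omega>) \<longlonglongrightarrow> 1 * exp (- (s * excursion_energy p \<omega>))"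
          unfolding \<Phi>_def
          by (intro tendsto_intros end_cutoff_tendsto segment_energy_tendsto elim(1) \<eta> sturm_liouville.cont_p[OF SL])
        from eventually_sum_straddle[where F="\<lambda>n i j. end_cutoff \<eta> n i j \<omega> * \<Phi> n i j \<omega>", OF elim(1) this] show ?case by (simp add: elim(2))
      qed
      show "AE \<omega> in M. norm (S n \<omega>) \<le> 1"
        using AE_excursion_path unfolding S_eq
        by eventually_elim (simp add: sum_straddle abs_mult c01 \<Phi>01 mult_le_one)
      show "AE \<omega> in M. norm (S1 n \<omega>) \<le> 1"
        using AE_excursion_path unfolding S1_eq
        by eventually_elim (simp add: sum_straddle abs_mult c01)
    qed
    have ES: "(\<lambda>n. expectation (S n)) \<longlonglongrightarrow> expectation (\<lambda>\<omega>. exp (- s * limit_energy p \<omega>))"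
      by (rule integral_dominated_convergence[where w="\<lambda>_. 1"])
         (use lim bnd S_int measurable_limit_energy[OF SL] in auto)
    have "(\<lambda>n. expectation (S1 n)) \<longlonglongrightarrow> expectation (\<lambda>\<omega>. 1)"
      by (rule integral_dominated_convergence[where w="\<lambda>_. 1"]) (use lim bnd S1_int in auto)
    then have ES1: "(\<lambda>n. expectation (S1 n)) \<longlonglongrightarrow> 1" by (simp add: prob_space)
    show "?K * ?c \<le> expectation (\<lambda>\<omega>. exp (- s * limit_energy p \<omega>))"
      using LIMSEQ_le[OF tendsto_mult_left[OF tendsto_mult_left[OF ES1]] ES, of ?K ?c] le(1) by simp
    show "expectation (\<lambda>\<omega>. exp (- s * limit_energy p \<omega>)) \<le> ?c"
      using LIMSEQ_le[OF ES tendsto_mult_left[OF ES1, of ?c]] le(2) by simp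
  qed
  have "((\<lambda>\<eta>. exp (- (2 * s * C + sl_sol' p s 1 + 1) * \<eta>\<^sup>2) * sl_sol p s 1 powr (-3/2)) \<longlongrightarrow>
      exp (- (2 * s * C + sl_sol' p s 1 + 1) * 0\<^sup>2) * sl_sol p s 1 powr (-3/2)) (at_right 0)"
    by (intro tendsto_intros)
  then have "exp (- (2 * s * C + sl_sol' p s 1 + 1) * 0\<^sup>2) * sl_sol p s 1 powr (-3/2) \<le> expectation (\<lambda>\<omega>. exp (- s * limit_energy p \<omega>))"
    by (rule tendsto_upperbound) (use bounds(1) in \<open>auto simp: eventually_at_right_less intro: eventually_mono[OF eventually_at_right_less]\<close>)
  then show ?thesis using bounds(2)[of 1] by simp
qed

end

section \<open>Small deviations of the excursion\<close>

context standard_brownian_motion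
begin

text \<open>Paths in a measurable null set that contains all bad ones are replaced by the zero path;
  the joint law of the increments is unaffected, and independence turns it into a product of
  Gaussian measures.\<close>

lemma continuous_version:
  obtains X where "continuous_brownian_motion M X" "AE \<omega> in M. \<forall>t. X t \<omega> = W t \<omega>"
proof -
  have "AE \<omega> in M. W 0 \<omega> = 0 \<and> continuous_on {0..} (\<lambda>t. W t \<omega>)"
    using start_zero continuous_paths by eventually_elim simp
  from AE_E[OF this] obtain N where
    N: "{\<omega> \<in> space M. \<not> (W 0 \<omega> = 0 \<and> continuous_on {0..} (\<lambda>t. W t \<omega>))} \<subseteq> N" "emeasure M N = 0" "N \<in> sets M" .
  define X where "X t \<omega> = (if \<omega> \<in> space M - N then W t \<omega> else 0)" for t \<omega>
  have "AE \<omega> in M. \<omega> \<in> space M - N" using N by (intro AE_I[of _ _ N]) auto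
  then have XW: "AE \<omega> in M. \<forall>t. X t \<omega> = W t \<omega>" by eventually_elim (simp add: X_def)
  have Xm: "X t \<in> borel_measurable M" if "0 \<le> t" for t
    unfolding X_def using rv[OF that] N(3) by (intro measurable_If_set) auto
  have "continuous_brownian_motion M X"
  proof unfold_locales
    show "X t \<in> borel_measurable M" if "0 \<le> t" for t by (rule Xm[OF that])
    show "X 0 \<omega> = 0" for \<omega> using N(1) by (auto simp: X_def)
    show "continuous_on {0..} (\<lambda>t. X t \<omega>)" for \<omega>
      using N(1) by (cases "\<omega> \<in> space M - N") (auto simp: X_def)
    show "distr M (PiM {..<K} (\<lambda>_. borel)) (\<lambda>\<omega>. \<lambda>l\<in>{..<K}. X (real (Suc l) * u) \<omega> - X (real l * u) \<omega>) = PiM {..<K} (\<lambda>_. gaussian u)"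
      if u: "0 < u" and K: "0 < K" for u :: real and K :: nat
    proof -
      let ?D = "\<lambda>l \<omega>. W (real (Suc l) * u) \<omega> - W (real l * u) \<omega>"
      have Dm: "?D l \<in> borel_measurable M" for l
        using u by (intro borel_measurable_diff rv) auto
      have XDm: "(\<lambda>\<omega>. X (real (Suc l) * u) \<omega> - X (real l * u) \<omega>) \<in> borel_measurable M" for l
        using u by (intro borel_measurable_diff Xm) auto
      have "distr M (PiM {..<K} (\<lambda>_. borel)) (\<lambda>\<omega>. \<lambda>l\<in>{..<K}. X (real (Suc l) * u) \<omega> - X (real l * u) \<omega>)
          = distr M (PiM {..<K} (\<lambda>_. borel)) (\<lambda>\<omega>. \<lambda>l\<in>{..<K}. ?D l \<omega>)"
      proof (rule distr_cong_AE[OF refl refl])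
        show "AE \<omega> in M. (\<lambda>l\<in>{..<K}. X (real (Suc l) * u) \<omega> - X (real l * u) \<omega>) = (\<lambda>l\<in>{..<K}. ?D l \<omega>)"
          using XW by eventually_elim simp
      qed (intro measurable_restrict XDm Dm)+
      also have "\<dots> = PiM {..<K} (\<lambda>l. distr M borel (?D l))"
      proof -
        have "indep_vars (\<lambda>_. borel) ?D {..<K}"
          by (rule indep_increments[where t="\<lambda>i. real i * u"]) (use u in auto)
        then show ?thesis
          using K by (subst (asm) indep_vars_iff_distr_eq_PiM'[OF _ Dm]) auto
      qed
      also have "\<dots> = PiM {..<K} (\<lambda>_. gaussian u)"
      proof (rule PiM_cong[OF refl])
        fix l
        have "distributed M lborel (?D l) (normal_density 0 (sqrt (real (Suc l) * u - real l * u)))"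
          using u by (intro normal_increments) (auto intro!: mult_strict_right_mono)
        moreover have "real (Suc l) * u - real l * u = u" by (simp add: algebra_simps)
        ultimately have D: "distributed M lborel (?D l) (normal_density 0 (sqrt u))" by simp
        have "distr M borel (?D l) = distr M lborel (?D l)" by (rule distr_cong) auto
        also have "\<dots> = gaussian u" unfolding gaussian_def by (rule distributed_distr_eq_density[OF D])
        finally show "distr M borel (?D l) = gaussian u" .
      qed
      finally show ?thesis .
    qed
  qed
  then show ?thesis using XW by (rule that)
qed

end

theorem theorem7:
  fixes M :: "'a measure" and W :: "real \<Rightarrow> 'a \<Rightarrow> real"
    and \<psi> :: "real \<Rightarrow> real" and \<theta> :: real
  assumes "standard_brownian_motion M W"
    and "\<forall>t\<in>{0..1}. \<psi> t > 0"
    and "twice_continuously_differentiable_on \<psi> {0..1}"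
    and "\<theta> = (LINT t:{0..1}|lborel. sqrt (\<psi> t))"
  shows "(\<lambda>\<epsilon>. measure (completion M)
            {\<omega> \<in> space M. weighted_norm \<psi> (\<lambda>t. normalized_excursion W t \<omega>) \<le> \<epsilon>})
         \<sim>[at_right 0]
         (\<lambda>\<epsilon>. 2 * sqrt (6 * \<theta>) * \<psi> 0 powr (3/8) * \<psi> 1 powr (3/8) / sqrt pi
              * \<epsilon> powi (-2) * exp (- (9 * \<theta>\<^sup>2 / 8) * \<epsilon> powi (-2)))"
proof -
  interpret W: standard_brownian_motion M W by (rule assms)
  have pos: "\<And>t. t \<in> {0..1} \<Longrightarrow> 0 < \<psi> t" using assms(2) by blast
  have cont: "continuous_on {0..1} \<psi>"
    using assms(3) unfolding twice_continuously_differentiable_on_def by (blast intro: DERIV_continuous_on)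
  have scont: "continuous_on {0..1} (\<lambda>t. sqrt (\<psi> t))" by (intro continuous_intros cont)
  have \<theta>: "\<theta> = integral {0..1} (\<lambda>t. sqrt (\<psi> t))"
    unfolding assms(4) by (intro set_borel_integral_eq_integral borel_integrable_atLeastAtMost' scont)
  have "\<exists>x\<in>{0..1}. \<forall>y\<in>{0..1}. sqrt (\<psi> x) \<le> sqrt (\<psi> y)"
    by (intro continuous_attains_inf scont) auto
  then obtain x where x: "x \<in> {0..1}" "\<And>y. y \<in> {0..1} \<Longrightarrow> sqrt (\<psi> x) \<le> sqrt (\<psi> y)" by blast
  have "integral {0..1} (\<lambda>t::real. sqrt (\<psi> x)) \<le> \<theta>"
    unfolding \<theta> by (intro Henstock_Kurzweil_Integration.integral_le integrable_continuous_interval scont x) auto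
  then have \<theta>_pos: "0 < \<theta>" using pos[OF x(1)] by simp (smt (verit) real_sqrt_gt_zero)
  have "\<exists>x\<in>{0..1}. \<forall>y\<in>{0..1}. 2 * \<psi> y \<le> 2 * \<psi> x"
    by (intro continuous_attains_sup continuous_intros cont) auto
  then obtain C where C: "\<And>y. y \<in> {0..1} \<Longrightarrow> 2 * \<psi> y \<le> C" by blast
  have SL: "sturm_liouville (\<lambda>t. 2 * \<psi> t) C"
    by unfold_locales (use C in \<open>auto intro!: continuous_intros cont less_imp_le pos\<close>)
  obtain X where X: "continuous_brownian_motion M X" "AE \<omega> in M. \<forall>t. X t \<omega> = W t \<omega>"
    by (rule W.continuous_version)
  interpret X: continuous_brownian_motion M X by (rule X)
  define Z where "Z = X.limit_energy (\<lambda>t. 2 * \<psi> t)"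
  have Zm[measurable]: "Z \<in> borel_measurable M" unfolding Z_def by (rule X.measurable_limit_energy[OF SL])
  have Z_eq: "AE \<omega> in M. 0 \<le> Z \<omega> \<and> weighted_norm \<psi> (\<lambda>t. normalized_excursion W t \<omega>) = sqrt (Z \<omega>)"
    using X(2) X.limit_energy_AE[OF SL]
  proof eventually_elim
    case (elim \<omega>)
    have "normalized_excursion X t \<omega> = normalized_excursion W t \<omega>" for t
      unfolding normalized_excursion_def using elim(1) by simp
    then have Z: "Z \<omega> = (LINT t:{0..1}|lborel. (normalized_excursion W t \<omega>)\<^sup>2 * \<psi> t)"
      using elim(2) by (simp add: Z_def X.excursion_energy_def mult.commute)
    have "0 \<le> Z \<omega>"
      unfolding Z set_lebesgue_integral_def
      by (intro Bochner_Integration.integral_nonneg) (auto simp: indicator_def less_imp_le pos)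
    then show ?case by (simp add: weighted_norm_def Z)
  qed
  \<comment> \<open>The event is known to agree with a measurable one only up to a null set; the
    completion measures it and gives both the same probability.\<close>
  have prob_eq: "measure (completion M) {\<omega> \<in> space M. weighted_norm \<psi> (\<lambda>t. normalized_excursion W t \<omega>) \<le> \<epsilon>}
      = measure M {\<omega> \<in> space M. Z \<omega> \<le> \<epsilon>\<^sup>2}" if \<epsilon>: "0 < \<epsilon>" for \<epsilon>
  proof -
    let ?A = "\<lambda>\<omega>. weighted_norm \<psi> (\<lambda>t. normalized_excursion W t \<omega>) \<le> \<epsilon>" and ?B = "\<lambda>\<omega>. Z \<omega> \<le> \<epsilon>\<^sup>2"
    have AB: "AE \<omega> in M. ?A \<omega> \<longleftrightarrow> ?B \<omega>"
      using Z_eq by eventually_elim (use \<epsilon> in \<open>auto intro: real_le_lsqrt dest: sqrt_le_D\<close>)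
    \<comment> \<open>The event is recovered as the symmetric difference of the measurable event and
      a null set.\<close>
    have "Measurable.pred (completion M) (\<lambda>\<omega>. \<not> (?A \<omega> \<longleftrightarrow> ?B \<omega>))"
      using AB by (intro sets_completion_AE) simp
    moreover have "Measurable.pred (completion M) ?B" by (rule measurable_completion) measurable
    ultimately have "Measurable.pred (completion M) (\<lambda>\<omega>. (\<not> (?A \<omega> \<longleftrightarrow> ?B \<omega>)) \<noteq> ?B \<omega>)" by measurable
    moreover have "(\<lambda>\<omega>. (\<not> (?A \<omega> \<longleftrightarrow> ?B \<omega>)) \<noteq> ?B \<omega>) = ?A" by auto
    ultimately have "Measurable.pred (completion M) ?A" by (simp only:)
    then have "{\<omega> \<in> space M. ?A \<omega>} \<in> sets (completion M)" by (simp add: pred_def)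
    then have "measure (completion M) {\<omega> \<in> space M. ?A \<omega>} = measure (completion M) {\<omega> \<in> space M. ?B \<omega>}"
      using AE_completion[OF AB] by (intro measure_eq_AE) auto
    then show ?thesis by simp
  qed
  interpret D: prob_space "distr M borel Z" by (rule W.prob_space_distr) measurable
  interpret D: real_distribution "distr M borel Z" by unfold_locales auto
  have cdf_eq: "cdf (distr M borel Z) r = measure M {\<omega> \<in> space M. Z \<omega> \<le> r}" for r
    unfolding cdf_def by (subst measure_distr) (auto intro!: arg_cong[where f="measure M"])
  define c where "c = 2 * sqrt (6 * \<theta>) * \<psi> 0 powr (3/8) * \<psi> 1 powr (3/8) / sqrt pi"
  define f where "f r = cdf (distr M borel Z) r / (c / r * exp (- (9 * \<theta>\<^sup>2 / 8) / r))" for r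
  have "(f \<longlongrightarrow> 1) (at_right 0)"
    unfolding f_def c_def
  proof (rule D.cdf_asymptotics_of_sl_laplace[OF _ pos assms(3) \<theta> \<theta>_pos])
    show "AE x in distr M borel Z. 0 \<le> x"
      by (subst AE_distr_iff) (use Z_eq in \<open>auto elim!: eventually_mono\<close>)
    show "(LINT x|distr M borel Z. exp (- s * x)) = sl_sol (\<lambda>t. 2 * \<psi> t) s 1 powr (-3/2)" if "0 < s" for s
      by (subst integral_distr) (auto simp only: Z_def intro!: X.laplace_limit_energy[OF SL that] borel_measurable_exp Zm[unfolded Z_def], measurable)
  qed
  \<comment> \<open>The norm is the square root of \<open>Z\<close>, so the distribution function of
    \<open>Z\<close> is taken at the square of the radius.\<close>
  moreover have "filterlim (\<lambda>\<epsilon>::real. \<epsilon>\<^sup>2) (at_right 0) (at_right 0)" by real_asymp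
  ultimately have lim: "((\<lambda>\<epsilon>. f (\<epsilon>\<^sup>2)) \<longlongrightarrow> 1) (at_right 0)" by (rule filterlim_compose)
  show ?thesis
  proof (rule asymp_equivI', rule Lim_transform_eventually[OF lim])
    show "\<forall>\<^sub>F \<epsilon> in at_right 0. f (\<epsilon>\<^sup>2) = measure (completion M)
            {\<omega> \<in> space M. weighted_norm \<psi> (\<lambda>t. normalized_excursion W t \<omega>) \<le> \<epsilon>} /
         (2 * sqrt (6 * \<theta>) * \<psi> 0 powr (3/8) * \<psi> 1 powr (3/8) / sqrt pi
              * \<epsilon> powi (-2) * exp (- (9 * \<theta>\<^sup>2 / 8) * \<epsilon> powi (-2)))"
      using eventually_at_right_less[of 0]
    proof eventually_elim
      case (elim \<epsilon>)
      have e: "\<epsilon> powi (-2) = 1 / \<epsilon>\<^sup>2" by (simp add: power_int_minus inverse_eq_divide)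
      show ?case unfolding f_def cdf_eq prob_eq[OF elim] e c_def by (simp only: times_divide_eq_right mult_1_right)
    qed
  qed
qed

end
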